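(* Let $\tau$ be a cancellative commutative monoid and let $C$ be a cubical set having a unique vertex. Then $$H^1_{\mathrm{sing}}(\|C\|;\tau)=\mathbf{Cat}(\mathrm{T}_1C,\tau),$$ the commutative monoid of all functors (monoid homomorphisms) $\mathrm{T}_1C\to\tau$.
   Context: Cubical sets. $[1]=\{0<1\}$; posets and monoids are regarded as categories. $\square$ is the subcategory of the category $\mathbf{Cat}$ of small categories with objects the product posets $[1]^n$ ($n\geq 0$) and morphisms all composites of cofaces $[1]^{n-1}\to[1]^n$ (inserting a constant $0$ or $1$ in one coordinate), codegeneracies $[1]^{n+1}\to[1]^n$ (projections omitting one coordinate) and coordinate permutations. Cubical sets are presheaves of sets on $\square$, forming $\hat\square$; $\square[1]^n$ is the presheaf represented by $[1]^n$; the vertices of $C$ are the elements of $C_0=C([1]^0)$; $\otimes$ is the Day convolution product with $\square[1]^m\otimes\square[1]^n=\square[1]^{m+n}$. The fundamental category functor $\mathrm{T}_1:\hat\square\to\mathbf{Cat}$ is the cocontinuous functor with $\mathrm{T}_1\square[1]^n=[1]^n$; when $C$ has a unique vertex, $\mathrm{T}_1C$ has one object, i.e. is a monoid. The cubical nerve $\mathrm{ner}\,\tau$ has $(\mathrm{ner}\,\tau)_n=\mathbf{Cat}([1]^n,\tau)$. A monoid is cancellative if $x_1yx_2=x_1zx_2$ implies $y=z$. Streams. A circulation on a space $X$ assigns to each open $U\subset X$ a preorder $\leqslant_U$ on $U$ such that, for each collection $\mathcal{O}$ of open subsets, the preorder on $\bigcup\mathcal{O}$ is the one with smallest graph containing the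 graphs of all $\leqslant_U$, $U\in\mathcal{O}$. A stream is a space with a circulation; a stream map $f:X\to Y$ is a continuous function with $f(x)\leqslant_U f(y)$ whenever $U\subset Y$ is open and $x\leqslant_{f^{-1}U}y$. $\mathbf{DiTop}$ is the category of weak Hausdorff k-streams (k-stream: colimit of compact Hausdorff streams in all streams; weak Hausdorff: the underlying space is). $\vec{\mathbb{I}}^n$ is $[0,1]^n$ with the unique circulation whose value on the whole cube is the coordinatewise order. Directed realization $\|-\|:\hat\square\to\mathbf{DiTop}$ is the cocontinuous functor with $\|\square[1]^n\|=\vec{\mathbb{I}}^n$ (with the evident action on cofaces, codegeneracies, permutations); its right adjoint is $\mathrm{sing}$, $(\mathrm{sing}\,X)_n=\mathbf{DiTop}(\|\square[1]^n\|,X)$. Cohomology. For a cubical set $A$, $H^1(A;\tau)$ is the set of cubical functions $A\to\mathrm{ner}\,\tau$ modulo the equivalence relation generated by $\alpha\sim\beta$ whenever there is a cubical function $A\otimes\square[1]\to\mathrm{ner}\,\tau$ restricting to $\alpha$ and $\beta$ at the vertices $0$ and $1$ of $\square[1]$; it is a commutative monoid under the operation induced by $\tau$. For a stream $X$, $H^1_{\mathrm{sing}}(X;\tau)=H^1(\mathrm{sing}\,X;\tau)$. The monoid structure on $\mathbf{Cat}(\mathrm{T}_1C,\tau)$ is pointwise, and the equality means a natural identification of commutative monoids. *)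

theory Defs
  imports "HOL-Analysis.Analysis" "HOL-Algebra.Group"
begin

section \<open>Generated relations\<close>

definition equiv_gen :: "'a set \<Rightarrow> 'a rel \<Rightarrow> 'a rel" where
  "equiv_gen S r = \<Inter>{E. equiv S E \<and> r \<subseteq> E}"

definition preorder_gen :: "'a set \<Rightarrow> 'a rel \<Rightarrow> 'a rel" where
  "preorder_gen S r = \<Inter>{p. preorder_on S p \<and> r \<subseteq> p}"

lemma equiv_gen_equiv:
  assumes "r \<subseteq> S \<times> S" shows "equiv S (equiv_gen S r)"
proof (rule equivI)
  have "equiv S (S \<times> S)" by (auto simp: equiv_def refl_on_def sym_def trans_def)
  then show "equiv_gen S r \<subseteq> S \<times> S" using assms unfolding equiv_gen_def by blast
  show "refl_on S (equiv_gen S r)" unfolding equiv_gen_def equiv_def refl_on_def by blast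
  show "sym (equiv_gen S r)" unfolding equiv_gen_def equiv_def sym_def by blast
  show "trans (equiv_gen S r)" unfolding equiv_gen_def equiv_def trans_def by blast
qed

lemma equiv_gen_incl: "r \<subseteq> equiv_gen S r"
  by (auto simp: equiv_gen_def)

lemma equiv_gen_least: "equiv S E \<Longrightarrow> r \<subseteq> E \<Longrightarrow> equiv_gen S r \<subseteq> E"
  by (auto simp: equiv_gen_def)

lemma preorder_gen_preorder:
  assumes "r \<subseteq> S \<times> S" shows "preorder_on S (preorder_gen S r)"
proof -
  have "preorder_on S (S \<times> S)" by (auto simp: preorder_on_def refl_on_def trans_def)
  then have "preorder_gen S r \<subseteq> S \<times> S" using assms unfolding preorder_gen_def by blast
  moreover have "refl_on S (preorder_gen S r)" unfolding preorder_gen_def preorder_on_def refl_on_def by blast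
  moreover have "trans (preorder_gen S r)" unfolding preorder_gen_def preorder_on_def trans_def by blast
  ultimately show ?thesis by (simp add: preorder_on_def)
qed

lemma preorder_gen_incl: "r \<subseteq> preorder_gen S r"
  by (auto simp: preorder_gen_def)

lemma preorder_gen_least: "preorder_on S p \<Longrightarrow> r \<subseteq> p \<Longrightarrow> preorder_gen S r \<subseteq> p"
  by (auto simp: preorder_gen_def)

lemma preorder_onD:
  assumes "preorder_on S p"
  shows "p \<subseteq> S \<times> S" "x \<in> S \<Longrightarrow> (x, x) \<in> p" "(x, y) \<in> p \<Longrightarrow> (y, z) \<in> p \<Longrightarrow> (x, z) \<in> p"
  using assms by (auto simp: preorder_on_def refl_on_def dest: transD)


section \<open>The category of cubes\<close>

text \<open>
  The poset \<open>[1]^n\<close> is the set of extensional functions from \<open>{..<n}\<close> to \<^typ>\<open>bool\<close>, ordered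
  coordinatewise; the topological cube \<open>[0,1]^n\<close> consists of extensional functions from \<open>{..<n}\<close>
  to \<open>{0..1}\<close>.  The structure maps are polymorphic in the coordinates, so that the same
  formulas give the cofaces, codegeneracies and permutations of both kinds of cubes.
\<close>

definition cube :: "'x set \<Rightarrow> nat \<Rightarrow> (nat \<Rightarrow> 'x) set" where
  "cube S n = (\<Pi>\<^sub>E i\<in>{..<n}. S)"

abbreviation bcube :: "nat \<Rightarrow> (nat \<Rightarrow> bool) set" where
  "bcube \<equiv> cube UNIV"

abbreviation icube :: "nat \<Rightarrow> (nat \<Rightarrow> real) set" where
  "icube \<equiv> cube {0..1}"

definition coface :: "'x set \<Rightarrow> nat \<Rightarrow> nat \<Rightarrow> 'x \<Rightarrow> (nat \<Rightarrow> 'x) \<Rightarrow> (nat \<Rightarrow> 'x)" where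
  "coface S n i e = (\<lambda>x\<in>cube S n. \<lambda>j\<in>{..<Suc n}. if j < i then x j else if j = i then e else x (j - 1))"

definition codegen :: "'x set \<Rightarrow> nat \<Rightarrow> nat \<Rightarrow> (nat \<Rightarrow> 'x) \<Rightarrow> (nat \<Rightarrow> 'x)" where
  "codegen S n i = (\<lambda>x\<in>cube S (Suc n). \<lambda>j\<in>{..<n}. if j < i then x j else x (Suc j))"

definition coperm :: "'x set \<Rightarrow> nat \<Rightarrow> (nat \<Rightarrow> nat) \<Rightarrow> (nat \<Rightarrow> 'x) \<Rightarrow> (nat \<Rightarrow> 'x)" where
  "coperm S n \<pi> = (\<lambda>x\<in>cube S n. \<lambda>j\<in>{..<n}. x (\<pi> j))"

type_synonym boxmap = "(nat \<Rightarrow> bool) \<Rightarrow> (nat \<Rightarrow> bool)"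

text \<open>\<open>box m n \<phi>\<close>: the monotone function \<open>\<phi> : [1]^m \<rightarrow> [1]^n\<close> is a morphism of \<open>\<box>\<close>.
  Identities are obtained from identity permutations.\<close>

inductive box :: "nat \<Rightarrow> nat \<Rightarrow> boxmap \<Rightarrow> bool" where
  coface: "i \<le> n \<Longrightarrow> box n (Suc n) (coface UNIV n i b)"
| codegen: "i \<le> n \<Longrightarrow> box (Suc n) n (codegen UNIV n i)"
| coperm: "\<pi> permutes {..<n} \<Longrightarrow> box n n (coperm UNIV n \<pi>)"
| comp: "box l m \<phi> \<Longrightarrow> box m n \<psi> \<Longrightarrow> box l n (compose (bcube l) \<psi> \<phi>)"

text \<open>\<open>box_real m n \<phi> f\<close>: the continuous function \<open>f : [0,1]^m \<rightarrow> [0,1]^n\<close> is the value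
  on \<open>\<phi>\<close> of the functor extending the evident action on generators.\<close>

inductive box_real :: "nat \<Rightarrow> nat \<Rightarrow> boxmap \<Rightarrow> ((nat \<Rightarrow> real) \<Rightarrow> (nat \<Rightarrow> real)) \<Rightarrow> bool" where
  coface: "i \<le> n \<Longrightarrow> box_real n (Suc n) (coface UNIV n i b) (coface {0..1} n i (of_bool b))"
| codegen: "i \<le> n \<Longrightarrow> box_real (Suc n) n (codegen UNIV n i) (codegen {0..1} n i)"
| coperm: "\<pi> permutes {..<n} \<Longrightarrow> box_real n n (coperm UNIV n \<pi>) (coperm {0..1} n \<pi>)"
| comp: "box_real l m \<phi> f \<Longrightarrow> box_real m n \<psi> g \<Longrightarrow>
    box_real l n (compose (bcube l) \<psi> \<phi>) (compose (icube l) g f)"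

definition geom :: "nat \<Rightarrow> nat \<Rightarrow> boxmap \<Rightarrow> (nat \<Rightarrow> real) \<Rightarrow> (nat \<Rightarrow> real)" where
  "geom m n \<phi> = (THE f. box_real m n \<phi> f)"

text \<open>A morphism of \<open>\<box>\<close> is a template listing, for each output coordinate, a constant or
  the input coordinate copied there; the template is determined by the action on vertices, so
  \<open>box_real m n \<phi>\<close> has at most one solution.\<close>

definition box_template :: "nat \<Rightarrow> nat \<Rightarrow> (nat \<Rightarrow> bool + nat) \<Rightarrow> bool" where
  "box_template m n s \<longleftrightarrow> (\<forall>j<n. case s j of Inl b \<Rightarrow> True | Inr i \<Rightarrow> i < m)"

definition template_map :: "'x set \<Rightarrow> (bool \<Rightarrow> 'x) \<Rightarrow> nat \<Rightarrow> nat \<Rightarrow> (nat \<Rightarrow> bool + nat) \<Rightarrow> (nat \<Rightarrow> 'x) \<Rightarrow> (nat \<Rightarrow> 'x)" where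
  "template_map S e m n s = (\<lambda>x\<in>cube S m. \<lambda>j\<in>{..<n}. case s j of Inl b \<Rightarrow> e b | Inr i \<Rightarrow> x i)"

lemma template_map_in_cube:
  assumes "box_template m n s" "range e \<subseteq> S" "x \<in> cube S m"
  shows "template_map S e m n s x \<in> cube S n"
  using assms by (fastforce simp: template_map_def cube_def box_template_def PiE_iff split: sum.splits)

lemma template_map_compose:
  assumes "box_template l m s" "box_template m n r" "range e \<subseteq> S"
  defines "q \<equiv> \<lambda>j. case r j of Inl b \<Rightarrow> Inl b | Inr i \<Rightarrow> s i"
  shows "box_template l n q \<and> compose (cube S l) (template_map S e m n r) (template_map S e l m s) = template_map S e l n q"
proof
  show "box_template l n q" using assms(1,2) by (fastforce simp: box_template_def q_def split: sum.splits)
  show "compose (cube S l) (template_map S e m n r) (template_map S e l m s) = template_map S e l n q"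
  proof
    fix x
    show "compose (cube S l) (template_map S e m n r) (template_map S e l m s) x = template_map S e l n q x"
    proof (cases "x \<in> cube S l")
      case True
      have "template_map S e l m s x \<in> cube S m" using template_map_in_cube[OF assms(1,3) True] .
      moreover have "template_map S e l m s x i = (case s i of Inl b \<Rightarrow> e b | Inr i \<Rightarrow> x i)" if "i < m" for i
        using that True by (simp add: template_map_def)
      moreover have "i < m" if "j < n" "r j = Inr i" for i j
        using assms(2) that by (force simp: box_template_def)
      ultimately show ?thesis
        using True by (auto simp: compose_def template_map_def[of S e m n] template_map_def[of S e l n] q_def fun_eq_iff split: sum.splits)
    qed (simp add: compose_def template_map_def)
  qed
qed

definition "cofacet i b = (\<lambda>j. if j < i then Inr j else if j = i then Inl b else Inr (j - 1))"

lemma coface_template_map: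
  assumes "i \<le> n" shows "box_template n (Suc n) (cofacet i b)" "coface S n i (e b) = template_map S e n (Suc n) (cofacet i b)"
  using assms by (auto simp: box_template_def cofacet_def coface_def template_map_def restrict_def fun_eq_iff)

lemma codegen_template_map:
  assumes "i \<le> n" shows "box_template (Suc n) n (\<lambda>j. Inr (if j < i then j else Suc j))"
    "codegen S n i = template_map S e (Suc n) n (\<lambda>j. Inr (if j < i then j else Suc j))"
  using assms by (auto simp: box_template_def codegen_def template_map_def restrict_def fun_eq_iff)

lemma coperm_template_map:
  assumes "\<pi> permutes {..<n}" shows "box_template n n (\<lambda>j. Inr (\<pi> j))"
    "coperm S n \<pi> = template_map S e n n (\<lambda>j. Inr (\<pi> j))"
  using permutes_in_image[OF assms] by (auto simp: box_template_def coperm_def template_map_def restrict_def fun_eq_iff)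

lemma box_real_template_map:
  assumes "box_real m n \<phi> f"
  shows "\<exists>s. box_template m n s \<and> \<phi> = template_map UNIV id m n s \<and> f = template_map {0..1} of_bool m n s"
  using assms
proof induction
  case (coface i n b)
  then show ?case using coface_template_map(1)[OF coface, of b] coface_template_map(2)[OF coface, where b = b and S = UNIV and e = id]
      coface_template_map(2)[OF coface, where b = b and S = "{0..1}" and e = of_bool] by (metis id_apply)
next
  case (codegen i n)
  then show ?case using codegen_template_map(1)[OF codegen] codegen_template_map(2)[OF codegen, where S = UNIV and e = id]
      codegen_template_map(2)[OF codegen, where S = "{0..1}" and e = of_bool] by blast
next
  case (coperm \<pi> n)
  then show ?case using coperm_template_map(1)[OF coperm] coperm_template_map(2)[OF coperm, where S = UNIV and e = id]
      coperm_template_map(2)[OF coperm, where S = "{0..1}" and e = of_bool] by blast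
next
  case (comp l m \<phi> f n \<psi> g)
  then obtain s r where s: "box_template l m s" "\<phi> = template_map UNIV id l m s" "f = template_map {0..1} of_bool l m s"
    and r: "box_template m n r" "\<psi> = template_map UNIV id m n r" "g = template_map {0..1} of_bool m n r" by blast
  have "range (of_bool :: bool \<Rightarrow> real) \<subseteq> {0..1}" by auto
  then show ?case using template_map_compose[OF s(1) r(1), of id UNIV] template_map_compose[OF s(1) r(1), of of_bool "{0..1}"]
    unfolding s r by blast
qed

lemma template_map_inj:
  assumes "box_template m n s" "box_template m n r" "template_map UNIV id m n s = template_map UNIV id m n r" "j < n"
  shows "s j = r j"
proof -
  define w :: "bool \<Rightarrow> nat \<Rightarrow> nat \<Rightarrow> bool" where "w = (\<lambda>b k i. if i < m then (if i = k then b else (\<not> b)) else undefined)"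
  define v :: "bool \<Rightarrow> nat \<Rightarrow> bool" where "v = (\<lambda>b i. if i < m then b else undefined)"
  have c: "w b k \<in> bcube m" "v b \<in> bcube m" for b k by (auto simp: w_def v_def cube_def PiE_iff extensional_def)
  have E: "(case s j of Inl b \<Rightarrow> b | Inr i \<Rightarrow> x i) = (case r j of Inl b \<Rightarrow> b | Inr i \<Rightarrow> x i)" if "x \<in> bcube m" for x
    using fun_cong[OF fun_cong[OF assms(3), of x], of j] that assms(4) by (simp add: template_map_def id_def)
  have S: "s j = Inr i \<Longrightarrow> i < m" "r j = Inr i \<Longrightarrow> i < m" for i using assms by (force simp: box_template_def)+
  show ?thesis
    using E[OF c(2)[of True]] E[OF c(2)[of False]] E[OF c(1)[of True "projr (s j)"]] S
    by (cases "s j"; cases "r j") (auto simp: v_def w_def split: if_splits)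
qed

lemma box_real_unique:
  assumes "box_real m n \<phi> f" "box_real m n \<phi> g" shows "f = g"
proof -
  obtain s where s: "box_template m n s" "\<phi> = template_map UNIV id m n s" "f = template_map {0..1} of_bool m n s"
    using box_real_template_map[OF assms(1)] by blast
  obtain r where r: "box_template m n r" "\<phi> = template_map UNIV id m n r" "g = template_map {0..1} of_bool m n r"
    using box_real_template_map[OF assms(2)] by blast
  have "s j = r j" if "j < n" for j using template_map_inj[OF s(1) r(1) _ that] s r by simp
  then show ?thesis unfolding s r by (auto simp: template_map_def restrict_def fun_eq_iff)
qed

lemma box_real_ex: "box m n \<phi> \<Longrightarrow> \<exists>f. box_real m n \<phi> f"
  by (induction rule: box.induct) (blast intro: box_real.intros)+

lemma box_real_geom: "box m n \<phi> \<Longrightarrow> box_real m n \<phi> (geom m n \<phi>)"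
  unfolding geom_def by (metis box_real_ex box_real_unique theI)

text \<open>The monoidal product \<open>\<phi> \<otimes> \<psi> : [1]^(m+m') \<rightarrow> [1]^(n+n')\<close> of
  \<open>\<phi> : [1]^m \<rightarrow> [1]^n\<close> and \<open>\<psi> : [1]^m' \<rightarrow> [1]^n'\<close>.\<close>

definition box_tensor :: "nat \<Rightarrow> nat \<Rightarrow> nat \<Rightarrow> nat \<Rightarrow> boxmap \<Rightarrow> boxmap \<Rightarrow> boxmap" where
  "box_tensor m n m' n' \<phi> \<psi> = (\<lambda>x\<in>bcube (m + m'). \<lambda>j\<in>{..<n + n'}.
     if j < n then \<phi> (\<lambda>i\<in>{..<m}. x i) j else \<psi> (\<lambda>i\<in>{..<m'}. x (m + i)) (j - n))"


section \<open>Cubical sets\<close>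

text \<open>\<open>act C m n \<phi>\<close> is the function \<open>C\<^sub>n \<rightarrow> C\<^sub>m\<close> induced by \<open>\<phi> : [1]^m \<rightarrow> [1]^n\<close>.\<close>

record 'c cubical =
  cells :: "nat \<Rightarrow> 'c set"
  act :: "nat \<Rightarrow> nat \<Rightarrow> boxmap \<Rightarrow> 'c \<Rightarrow> 'c"

definition cubical_set :: "'c cubical \<Rightarrow> bool" where
  "cubical_set C \<longleftrightarrow>
     (\<forall>m n \<phi>. box m n \<phi> \<longrightarrow> act C m n \<phi> \<in> cells C n \<rightarrow> cells C m) \<and>
     (\<forall>n. \<forall>c\<in>cells C n. act C n n (\<lambda>x\<in>bcube n. x) c = c) \<and>
     (\<forall>l m n \<phi> \<psi>. box l m \<phi> \<longrightarrow> box m n \<psi> \<longrightarrow>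
        (\<forall>c\<in>cells C n. act C l n (compose (bcube l) \<psi> \<phi>) c = act C l m \<phi> (act C m n \<psi> c)))"

text \<open>Cubical functions are required to be extensional, so that equality of cubical functions
  is equality in HOL.\<close>

definition cub_hom :: "'a cubical \<Rightarrow> 'b cubical \<Rightarrow> (nat \<Rightarrow> 'a \<Rightarrow> 'b) set" where
  "cub_hom A B = {f. (\<forall>n. f n \<in> cells A n \<rightarrow>\<^sub>E cells B n) \<and>
     (\<forall>m n \<phi>. box m n \<phi> \<longrightarrow> (\<forall>a\<in>cells A n. f m (act A m n \<phi> a) = act B m n \<phi> (f n a)))}"

definition cub_comp ::
  "'a cubical \<Rightarrow> (nat \<Rightarrow> 'b \<Rightarrow> 'c) \<Rightarrow> (nat \<Rightarrow> 'a \<Rightarrow> 'b) \<Rightarrow> nat \<Rightarrow> 'a \<Rightarrow> 'c" where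
  "cub_comp A g f = (\<lambda>n. compose (cells A n) (g n) (f n))"

definition representable :: "nat \<Rightarrow> boxmap cubical" where
  "representable k = \<lparr>cells = (\<lambda>m. {\<psi>. box m k \<psi>}), act = (\<lambda>m n \<phi> \<psi>. compose (bcube m) \<psi> \<phi>)\<rparr>"

text \<open>Day convolution as a coend: \<open>(A \<otimes> B)\<^sub>n\<close> is the quotient of the set of all
  \<open>(p, q, \<phi> : [1]^n \<rightarrow> [1]^(p+q), a \<in> A\<^sub>p, b \<in> B\<^sub>q)\<close> by dinaturality.\<close>

definition tensor_pre ::
  "'a cubical \<Rightarrow> 'b cubical \<Rightarrow> nat \<Rightarrow> (nat \<times> nat \<times> boxmap \<times> 'a \<times> 'b) set" where
  "tensor_pre A B n = {(p, q, \<phi>, a, b). box n (p + q) \<phi> \<and> a \<in> cells A p \<and> b \<in> cells B q}"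

definition tensor_rel ::
  "'a cubical \<Rightarrow> 'b cubical \<Rightarrow> nat \<Rightarrow> (nat \<times> nat \<times> boxmap \<times> 'a \<times> 'b) rel" where
  "tensor_rel A B n = equiv_gen (tensor_pre A B n)
     {((p, q, compose (bcube n) (box_tensor p' p q' q \<alpha> \<beta>) \<psi>, a, b),
       (p', q', \<psi>, act A p' p \<alpha> a, act B q' q \<beta> b)) | p q p' q' \<alpha> \<beta> \<psi> a b.
        box n (p' + q') \<psi> \<and> box p' p \<alpha> \<and> box q' q \<beta> \<and> a \<in> cells A p \<and> b \<in> cells B q}"

definition tensor ::
  "'a cubical \<Rightarrow> 'b cubical \<Rightarrow> (nat \<times> nat \<times> boxmap \<times> 'a \<times> 'b) set cubical" where
  "tensor A B =
     \<lparr>cells = (\<lambda>n. tensor_pre A B n // tensor_rel A B n),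
      act = (\<lambda>m n \<phi> X. tensor_rel A B m ``
               {(p, q, compose (bcube m) \<psi> \<phi>, a, b) | p q \<psi> a b. (p, q, \<psi>, a, b) \<in> X})\<rparr>"

text \<open>The inclusion \<open>A \<cong> A \<otimes> \<box>[1]^0 \<rightarrow> A \<otimes> \<box>[1]\<close> at the vertex \<open>\<epsilon>\<close> of \<open>\<box>[1]\<close>.\<close>

definition cyl_incl ::
  "'a cubical \<Rightarrow> bool \<Rightarrow> nat \<Rightarrow> 'a \<Rightarrow> (nat \<times> nat \<times> boxmap \<times> 'a \<times> boxmap) set" where
  "cyl_incl A \<epsilon> = (\<lambda>n. \<lambda>a\<in>cells A n. tensor_rel A (representable 1) n ``
      {(n, 0, (\<lambda>x\<in>bcube n. x), a, coface UNIV 0 0 \<epsilon>)})"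


section \<open>Small categories and the cubical nerve\<close>

text \<open>Composition is in the usual order: \<open>Comp A g f\<close> is \<open>g\<close> after \<open>f\<close>.\<close>

record ('o, 'a) category =
  Ob :: "'o set"
  Ar :: "'a set"
  Dom :: "'a \<Rightarrow> 'o"
  Cod :: "'a \<Rightarrow> 'o"
  Ident :: "'o \<Rightarrow> 'a"
  Comp :: "'a \<Rightarrow> 'a \<Rightarrow> 'a"

type_synonym ('o, 'a, 'p, 'b) func = "('o \<Rightarrow> 'p) \<times> ('a \<Rightarrow> 'b)"

definition functors :: "('o, 'a) category \<Rightarrow> ('p, 'b) category \<Rightarrow> ('o, 'a, 'p, 'b) func set" where
  "functors A B = {(F, G). F \<in> Ob A \<rightarrow>\<^sub>E Ob B \<and> G \<in> Ar A \<rightarrow>\<^sub>E Ar B \<and>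
     (\<forall>f\<in>Ar A. Dom B (G f) = F (Dom A f) \<and> Cod B (G f) = F (Cod A f)) \<and>
     (\<forall>x\<in>Ob A. G (Ident A x) = Ident B (F x)) \<and>
     (\<forall>f\<in>Ar A. \<forall>g\<in>Ar A. Cod A f = Dom A g \<longrightarrow> G (Comp A g f) = Comp B (G g) (G f))}"

definition func_comp ::
  "('o, 'a) category \<Rightarrow> ('p, 'b, 'q, 'c) func \<Rightarrow> ('o, 'a, 'p, 'b) func \<Rightarrow> ('o, 'a, 'q, 'c) func" where
  "func_comp A G F = (compose (Ob A) (fst G) (fst F), compose (Ar A) (snd G) (snd F))"

text \<open>The poset \<open>[1]^n\<close> as a category; \<open>(v, w)\<close> is the unique morphism from \<open>v\<close> to \<open>w\<close>.\<close>

definition cube_cat :: "nat \<Rightarrow> (nat \<Rightarrow> bool, (nat \<Rightarrow> bool) \<times> (nat \<Rightarrow> bool)) category" where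
  "cube_cat n = \<lparr>Ob = bcube n,
     Ar = {(v, w). v \<in> bcube n \<and> w \<in> bcube n \<and> (\<forall>i<n. v i \<le> w i)},
     Dom = fst, Cod = snd, Ident = (\<lambda>v. (v, v)), Comp = (\<lambda>g f. (fst f, snd g))\<rparr>"

definition cube_functor ::
  "nat \<Rightarrow> boxmap \<Rightarrow> (nat \<Rightarrow> bool, (nat \<Rightarrow> bool) \<times> (nat \<Rightarrow> bool), nat \<Rightarrow> bool, (nat \<Rightarrow> bool) \<times> (nat \<Rightarrow> bool)) func" where
  "cube_functor m \<phi> = (\<lambda>v\<in>bcube m. \<phi> v, \<lambda>f\<in>Ar (cube_cat m). map_prod \<phi> \<phi> f)"

definition monoid_cat :: "('m, 'r) monoid_scheme \<Rightarrow> (unit, 'm) category" where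
  "monoid_cat \<tau> = \<lparr>Ob = {()}, Ar = carrier \<tau>, Dom = (\<lambda>_. ()), Cod = (\<lambda>_. ()),
     Ident = (\<lambda>_. \<one>\<^bsub>\<tau>\<^esub>), Comp = (\<lambda>g f. g \<otimes>\<^bsub>\<tau>\<^esub> f)\<rparr>"

definition nerve ::
  "('o, 'a) category \<Rightarrow> (nat \<Rightarrow> bool, (nat \<Rightarrow> bool) \<times> (nat \<Rightarrow> bool), 'o, 'a) func cubical" where
  "nerve A = \<lparr>cells = (\<lambda>n. functors (cube_cat n) A),
     act = (\<lambda>m n \<phi> F. func_comp (cube_cat m) F (cube_functor m \<phi>))\<rparr>"

definition nerve_map :: "('o, 'a) category \<Rightarrow> ('o, 'a, 'p, 'b) func \<Rightarrow>
    nat \<Rightarrow> (nat \<Rightarrow> bool, (nat \<Rightarrow> bool) \<times> (nat \<Rightarrow> bool), 'o, 'a) func \<Rightarrow>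
    (nat \<Rightarrow> bool, (nat \<Rightarrow> bool) \<times> (nat \<Rightarrow> bool), 'p, 'b) func" where
  "nerve_map A H = (\<lambda>n. \<lambda>F\<in>functors (cube_cat n) A. func_comp (cube_cat n) H F)"

text \<open>The set \<open>Cat(A, \<tau>)\<close> with the pointwise operation.\<close>

definition functor_monoid ::
  "('o, 'a) category \<Rightarrow> ('m, 'r) monoid_scheme \<Rightarrow> ('o, 'a, unit, 'm) func monoid" where
  "functor_monoid A \<tau> = \<lparr>carrier = functors A (monoid_cat \<tau>),
     mult = (\<lambda>F G. (\<lambda>x\<in>Ob A. (), \<lambda>f\<in>Ar A. snd F f \<otimes>\<^bsub>\<tau>\<^esub> snd G f)),
     one = (\<lambda>x\<in>Ob A. (), \<lambda>f\<in>Ar A. \<one>\<^bsub>\<tau>\<^esub>)\<rparr>"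

definition cancellative :: "('m, 'r) monoid_scheme \<Rightarrow> bool" where
  "cancellative \<tau> \<longleftrightarrow> (\<forall>x\<^sub>1\<in>carrier \<tau>. \<forall>x\<^sub>2\<in>carrier \<tau>. \<forall>y\<in>carrier \<tau>. \<forall>z\<in>carrier \<tau>.
     x\<^sub>1 \<otimes>\<^bsub>\<tau>\<^esub> y \<otimes>\<^bsub>\<tau>\<^esub> x\<^sub>2 = x\<^sub>1 \<otimes>\<^bsub>\<tau>\<^esub> z \<otimes>\<^bsub>\<tau>\<^esub> x\<^sub>2 \<longrightarrow> y = z)"


section \<open>The fundamental category\<close>

text \<open>
  \<open>T\<^sub>1 C\<close> is the colimit, in the category of small categories, of the posets \<open>[1]^n\<close> indexed by
  the category of elements \<open>(n, c \<in> C\<^sub>n)\<close> of \<open>C\<close>.  Its objects are classes of pairs \<open>((n, c), v)\<close>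
  with \<open>v \<in> [1]^n\<close>; its arrows are classes of composable words in letters \<open>((n, c), (v, w))\<close>, with
  \<open>(v, w)\<close> an arrow of \<open>[1]^n\<close>, modulo functoriality of the insertions \<open>[1]^n \<rightarrow> T\<^sub>1 C\<close> and their
  compatibility with the morphisms of the category of elements.  Words are written in
  diagrammatic order.
\<close>

type_synonym 'c t1_ob = "((nat \<times> 'c) \<times> (nat \<Rightarrow> bool)) set"
type_synonym 'c t1_letter = "(nat \<times> 'c) \<times> ((nat \<Rightarrow> bool) \<times> (nat \<Rightarrow> bool))"
type_synonym 'c t1_ar = "'c t1_ob \<times> 'c t1_letter list set \<times> 'c t1_ob"

definition t1_vertices :: "'c cubical \<Rightarrow> ((nat \<times> 'c) \<times> (nat \<Rightarrow> bool)) set" where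
  "t1_vertices C = {((n, c), v). c \<in> cells C n \<and> v \<in> bcube n}"

definition t1_ob_rel :: "'c cubical \<Rightarrow> ((nat \<times> 'c) \<times> (nat \<Rightarrow> bool)) rel" where
  "t1_ob_rel C = equiv_gen (t1_vertices C)
     {(((m, act C m n \<phi> c), v), ((n, c), \<phi> v)) | m n \<phi> c v.
        box m n \<phi> \<and> c \<in> cells C n \<and> v \<in> bcube m}"

definition t1_letters :: "'c cubical \<Rightarrow> 'c t1_letter set" where
  "t1_letters C = {((n, c), f). c \<in> cells C n \<and> f \<in> Ar (cube_cat n)}"

fun t1_path :: "'c cubical \<Rightarrow> 'c t1_ob \<Rightarrow> 'c t1_letter list \<Rightarrow> 'c t1_ob \<Rightarrow> bool" where
  "t1_path C x [] y \<longleftrightarrow> x \<in> t1_vertices C // t1_ob_rel C \<and> x = y"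
| "t1_path C x ((s, (v, w)) # ls) y \<longleftrightarrow> (s, (v, w)) \<in> t1_letters C \<and>
     x = t1_ob_rel C `` {(s, v)} \<and> t1_path C (t1_ob_rel C `` {(s, w)}) ls y"

inductive_set t1_basic :: "'c cubical \<Rightarrow> ('c t1_letter list) rel" for C where
  ident: "([(s, (v, v))], []) \<in> t1_basic C"
| comp: "([(s, (u, v)), (s, (v, w))], [(s, (u, w))]) \<in> t1_basic C"
| elem: "box m n \<phi> \<Longrightarrow> c \<in> cells C n \<Longrightarrow> (v, w) \<in> Ar (cube_cat m) \<Longrightarrow>
    ([((m, act C m n \<phi> c), (v, w))], [((n, c), (\<phi> v, \<phi> w))]) \<in> t1_basic C"

definition t1_words :: "'c cubical \<Rightarrow> 'c t1_ob \<Rightarrow> 'c t1_ob \<Rightarrow> 'c t1_letter list set" where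
  "t1_words C x y = {ls. t1_path C x ls y}"

definition t1_rel :: "'c cubical \<Rightarrow> 'c t1_ob \<Rightarrow> 'c t1_ob \<Rightarrow> ('c t1_letter list) rel" where
  "t1_rel C x y = equiv_gen (t1_words C x y)
     {(as @ l @ bs, as @ r @ bs) | as bs l r. (l, r) \<in> t1_basic C \<and>
        as @ l @ bs \<in> t1_words C x y \<and> as @ r @ bs \<in> t1_words C x y}"

definition T1 :: "'c cubical \<Rightarrow> ('c t1_ob, 'c t1_ar) category" where
  "T1 C = \<lparr>Ob = t1_vertices C // t1_ob_rel C,
     Ar = {(x, P, y). x \<in> t1_vertices C // t1_ob_rel C \<and> y \<in> t1_vertices C // t1_ob_rel C \<and>
             P \<in> t1_words C x y // t1_rel C x y},
     Dom = (\<lambda>(x, P, y). x),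
     Cod = (\<lambda>(x, P, y). y),
     Ident = (\<lambda>x. (x, t1_rel C x x `` {[]}, x)),
     Comp = (\<lambda>(y', Q, z) (x, P, y). (x, t1_rel C x z `` {p @ q | p q. p \<in> P \<and> q \<in> Q}, z))\<rparr>"

definition T1_map :: "'c cubical \<Rightarrow> 'd cubical \<Rightarrow> (nat \<Rightarrow> 'c \<Rightarrow> 'd) \<Rightarrow>
    ('c t1_ob, 'c t1_ar, 'd t1_ob, 'd t1_ar) func" where
  "T1_map C D f =
    (let F = (\<lambda>x. t1_ob_rel D `` {((n, f n c), v) | n c v. ((n, c), v) \<in> x})
     in (\<lambda>x\<in>Ob (T1 C). F x,
         \<lambda>(x, P, y)\<in>Ar (T1 C).
           (F x, t1_rel D (F x) (F y) `` (map (\<lambda>((n, c), e). ((n, f n c), e)) ` P), F y)))"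

text \<open>The unit \<open>C \<rightarrow> ner (T\<^sub>1 C)\<close> of the adjunction \<open>T\<^sub>1 \<stileturn> ner\<close>: the cell \<open>c \<in> C\<^sub>n\<close> is sent to
  the insertion \<open>[1]^n \<rightarrow> T\<^sub>1 C\<close> of the colimit at \<open>(n, c)\<close>.\<close>

definition T1_unit :: "'c cubical \<Rightarrow>
    nat \<Rightarrow> 'c \<Rightarrow> (nat \<Rightarrow> bool, (nat \<Rightarrow> bool) \<times> (nat \<Rightarrow> bool), 'c t1_ob, 'c t1_ar) func" where
  "T1_unit C = (\<lambda>n. \<lambda>c\<in>cells C n.
    (let F = (\<lambda>v. t1_ob_rel C `` {((n, c), v)})
     in (\<lambda>v\<in>bcube n. F v,
         \<lambda>(v, w)\<in>Ar (cube_cat n). (F v, t1_rel C (F v) (F w) `` {[((n, c), (v, w))]}, F w))))"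


section \<open>Streams\<close>

definition circulation :: "'a topology \<Rightarrow> ('a set \<Rightarrow> 'a rel) \<Rightarrow> bool" where
  "circulation T c \<longleftrightarrow> (\<forall>U. openin T U \<longrightarrow> preorder_on U (c U)) \<and>
     (\<forall>\<O>. (\<forall>U\<in>\<O>. openin T U) \<longrightarrow> c (\<Union>\<O>) = preorder_gen (\<Union>\<O>) (\<Union>U\<in>\<O>. c U))"

lemma circulation_mono:
  assumes c: "circulation T c" and U: "openin T U" "openin T V" "U \<subseteq> V"
  shows "c U \<subseteq> c V"
proof -
  have "c (\<Union>{U, V}) = preorder_gen (\<Union>{U, V}) (\<Union>W\<in>{U, V}. c W)"
    by (rule c[unfolded circulation_def, THEN conjunct2, rule_format]) (use U in auto)
  moreover have "\<Union>{U, V} = V" using U by auto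
  ultimately have "c V = preorder_gen V (\<Union>W\<in>{U, V}. c W)" by simp
  then show ?thesis using preorder_gen_incl[of "\<Union>W\<in>{U, V}. c W" V] by auto
qed

record 'a stream =
  top_of :: "'a topology"
  circ :: "'a set \<Rightarrow> 'a rel"

definition stream :: "'a stream \<Rightarrow> bool" where
  "stream X \<longleftrightarrow> circulation (top_of X) (circ X)"

definition stream_map :: "'a stream \<Rightarrow> 'b stream \<Rightarrow> ('a \<Rightarrow> 'b) \<Rightarrow> bool" where
  "stream_map X Y f \<longleftrightarrow> continuous_map (top_of X) (top_of Y) f \<and>
     (\<forall>U x y. openin (top_of Y) U \<longrightarrow> (x, y) \<in> circ X {z \<in> topspace (top_of X). f z \<in> U} \<longrightarrow>
        (f x, f y) \<in> circ Y U)"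

definition coproduct_stream :: "('i \<Rightarrow> 'a stream) \<Rightarrow> 'i set \<Rightarrow> ('i \<times> 'a) stream" where
  "coproduct_stream X I = \<lparr>top_of = sum_topology (\<lambda>i. top_of (X i)) I,
     circ = (\<lambda>U. {((i, x), (i, y)) | i x y. i \<in> I \<and> (x, y) \<in> circ (X i) {z. (i, z) \<in> U}})\<rparr>"

text \<open>The quotient of a stream by an equivalence relation \<open>E\<close>, i.e. the coequalizer of
  \<open>E \<rightrightarrows> X\<close> in streams.  A set \<open>U\<close> of classes has preimage \<open>\<Union>U\<close> under the
  quotient map.\<close>

definition quotient_topology :: "'a topology \<Rightarrow> 'a rel \<Rightarrow> 'a set topology" where
  "quotient_topology T E = topology (\<lambda>U. U \<subseteq> topspace T // E \<and> openin T (\<Union>U))"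

lemma openin_quotient_topology:
  assumes "equiv (topspace T) E"
  shows "openin (quotient_topology T E) U \<longleftrightarrow> U \<subseteq> topspace T // E \<and> openin T (\<Union>U)"
proof -
  have "\<Union>(U \<inter> V) = \<Union>U \<inter> \<Union>V" if "U \<subseteq> topspace T // E" "V \<subseteq> topspace T // E" for U V
    using that quotient_disj[OF assms] by blast
  moreover have "\<Union>(\<Union>K) = (\<Union>U\<in>K. \<Union>U)" for K :: "'a set set set" by blast
  ultimately have "istopology (\<lambda>U. U \<subseteq> topspace T // E \<and> openin T (\<Union>U))"
    unfolding istopology_def by (auto intro!: openin_Int)
  then show ?thesis by (simp add: quotient_topology_def)
qed

definition quotient_stream :: "'a stream \<Rightarrow> 'a rel \<Rightarrow> 'a set stream" where
  "quotient_stream X E = \<lparr>top_of = quotient_topology (top_of X) E,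
     circ = (\<lambda>U. preorder_gen U {(E `` {x}, E `` {y}) | x y. (x, y) \<in> circ X (\<Union>U)})\<rparr>"

text \<open>
  In a weak Hausdorff space, continuous images of compact Hausdorff spaces are closed.  It
  suffices to test spaces \<open>K\<close> carried by \<^typ>\<open>'a set set\<close>: if \<open>D \<subseteq> K\<close> contains one point of every
  nonempty fibre of \<open>f\<close>, then \<open>K\<close> and the closure of \<open>D\<close> have the same image, and the latter has
  at most \<open>2^(2^|D|)\<close> points by the Hausdorff property.
\<close>

definition weak_Hausdorff_space :: "'a topology \<Rightarrow> bool" where
  "weak_Hausdorff_space X \<longleftrightarrow> (\<forall>(K :: 'a set set topology) f.
     compact_space K \<longrightarrow> Hausdorff_space K \<longrightarrow> continuous_map K X f \<longrightarrow>
       closedin X (f ` topspace K))"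

definition icube_top :: "nat \<Rightarrow> (nat \<Rightarrow> real) topology" where
  "icube_top n = product_topology (\<lambda>_. top_of_set {0..1}) {..<n}"

definition icube_order :: "nat \<Rightarrow> (nat \<Rightarrow> real) rel" where
  "icube_order n = {(x, y). x \<in> icube n \<and> y \<in> icube n \<and> (\<forall>i<n. x i \<le> y i)}"

text \<open>The irrelevant values of the circulation on sets that are not open are normalized.\<close>

definition icube_circ :: "nat \<Rightarrow> (nat \<Rightarrow> real) set \<Rightarrow> (nat \<Rightarrow> real) rel" where
  "icube_circ n = (THE c. circulation (icube_top n) c \<and> c (icube n) = icube_order n \<and>
     (\<forall>U. \<not> openin (icube_top n) U \<longrightarrow> c U = {}))"

text \<open>Existence and uniqueness of the circulation on \<open>[0,1]^n\<close>: on an open set \<open>U\<close> it is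
  generated by the pairs \<open>x \<le> y\<close> with order interval \<open>icube_seg x y n\<close> inside \<open>U\<close>.\<close>

lemma topspace_icube_top [simp]: "topspace (icube_top n) = icube n"
  by (simp add: icube_top_def cube_def)

lemma icube_iff: "x \<in> icube n \<longleftrightarrow> x \<in> extensional {..<n} \<and> (\<forall>i<n. 0 \<le> x i \<and> x i \<le> 1)"
  by (auto simp: cube_def PiE_iff)

definition icube_seg :: "(nat \<Rightarrow> real) \<Rightarrow> (nat \<Rightarrow> real) \<Rightarrow> nat \<Rightarrow> (nat \<Rightarrow> real) set" where
  "icube_seg x y n = {z. (x, z) \<in> icube_order n \<and> (z, y) \<in> icube_order n}"

definition icube_loc :: "nat \<Rightarrow> (nat \<Rightarrow> real) set \<Rightarrow> (nat \<Rightarrow> real) rel" where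
  "icube_loc n U = {(x, y). (x, y) \<in> icube_order n \<and> icube_seg x y n \<subseteq> U}"

definition icube_expl :: "nat \<Rightarrow> (nat \<Rightarrow> real) set \<Rightarrow> (nat \<Rightarrow> real) rel" where
  "icube_expl n U = (if openin (icube_top n) U then preorder_gen U (icube_loc n U) else {})"

lemma icube_order_preorder: "preorder_on (icube n) (icube_order n)"
proof -
  have "trans (icube_order n)" by (rule transI) (unfold icube_order_def, use order_trans in blast)
  then show ?thesis by (auto simp: preorder_on_def icube_order_def refl_on_def)
qed

lemma icube_order_antisym: "(x, y) \<in> icube_order n \<Longrightarrow> (y, x) \<in> icube_order n \<Longrightarrow> x = y"
  unfolding icube_order_def cube_def
  by (intro PiE_ext[where k = "{..<n}" and s = "\<lambda>_. {0..1}"]) (auto intro: order_antisym)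

lemma icube_loc_sub: "icube_loc n U \<subseteq> U \<times> U"
proof (rule subrelI)
  fix x y assume xy: "(x, y) \<in> icube_loc n U"
  then have "x \<in> icube n" "y \<in> icube n" by (auto simp: icube_loc_def icube_order_def)
  then have "x \<in> icube_seg x y n" "y \<in> icube_seg x y n"
    using xy by (auto simp: icube_loc_def icube_order_def icube_seg_def)
  then show "(x, y) \<in> U \<times> U" using xy by (auto simp: icube_loc_def)
qed

lemma closedin_icube_seg:
  shows "closedin (icube_top n) (icube_seg x y n)"
proof (cases "x \<in> icube n \<and> y \<in> icube n")
  case True
  have "icube_seg x y n = (\<Pi>\<^sub>E i\<in>{..<n}. {x i..y i})"
  proof (rule Set.set_eqI)
    fix z
    have "z \<in> icube n" if "z \<in> extensional {..<n}" "\<forall>i<n. x i \<le> z i \<and> z i \<le> y i"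
      using True that unfolding icube_iff by (meson order_trans)
    then show "z \<in> icube_seg x y n \<longleftrightarrow> z \<in> (\<Pi>\<^sub>E i\<in>{..<n}. {x i..y i})"
      using True by (auto simp: icube_seg_def icube_order_def icube_iff PiE_iff)
  qed
  moreover have "closedin (top_of_set {0..1}) {x i..y i}" if "i < n" for i
  proof (rule closed_subset)
    show "{x i..y i} \<subseteq> {0..1}" using True that by (auto simp: icube_iff)
  qed simp
  ultimately show ?thesis by (simp add: icube_top_def closedin_product_topology)
next
  case False
  then have "icube_seg x y n = {}" by (auto simp: icube_seg_def icube_order_def)
  then show ?thesis by simp
qed

lemma icube_convex_nbhd:
  assumes "openin (icube_top n) U" "x \<in> U"
  obtains B where "openin (icube_top n) B" "x \<in> B" "B \<subseteq> U"
    "\<And>a b. a \<in> B \<Longrightarrow> b \<in> B \<Longrightarrow> icube_seg a b n \<subseteq> B"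
proof -
  have x: "x \<in> icube n" using assms openin_subset by fastforce
  obtain W where W: "\<And>i. i < n \<Longrightarrow> openin (top_of_set {0..1}) (W i)" "x \<in> Pi\<^sub>E {..<n} W" "Pi\<^sub>E {..<n} W \<subseteq> U"
    using assms unfolding icube_top_def openin_product_topology_alt by (auto; meson lessThan_iff)
  have "\<exists>e>0. {0..1} \<inter> {x i - e<..<x i + e} \<subseteq> W i" if "i < n" for i
  proof -
    have xi: "x i \<in> W i" using W(2) that by auto
    have Wi: "openin (top_of_set {0..1}) (W i)" using W(1) that by blast
    then have "\<exists>e>0. ball (x i) e \<inter> {0..1} \<subseteq> W i"
      using openin_contains_ball[THEN iffD1, OF Wi, THEN conjunct2, rule_format, OF xi] by simp
    then show ?thesis by (simp add: ball_eq_greaterThanLessThan Int_commute)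
  qed
  then obtain e where e: "\<And>i. i < n \<Longrightarrow> e i > 0 \<and> {0..1} \<inter> {x i - e i<..<x i + e i} \<subseteq> W i" by metis
  define B where "B = (\<Pi>\<^sub>E i\<in>{..<n}. {0..1} \<inter> {x i - e i<..<x i + e i})"
  show thesis
  proof
    show "openin (icube_top n) B"
      unfolding B_def icube_top_def openin_PiE_gen
      by (intro disjI2 conjI ballI openin_open_Int) auto
    show "x \<in> B" using x e by (auto simp: B_def cube_def PiE_iff)
    show "B \<subseteq> U" unfolding B_def by (rule subset_trans[OF PiE_mono W(3)]) (simp add: e)
    show "icube_seg a b n \<subseteq> B" if ab: "a \<in> B" "b \<in> B" for a b
    proof
      fix z assume "z \<in> icube_seg a b n"
      then have z: "z \<in> icube n" "\<And>i. i < n \<Longrightarrow> a i \<le> z i \<and> z i \<le> b i"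
        by (auto simp: icube_seg_def icube_order_def)
      have "x i - e i < z i \<and> z i < x i + e i" if "i < n" for i
      proof -
        have "x i - e i < a i" "b i < x i + e i" using ab that by (auto simp: B_def PiE_iff)
        then show ?thesis using z(2)[OF that] by linarith
      qed
      then show "z \<in> B" using z(1) by (simp add: B_def icube_iff PiE_iff)
    qed
  qed
qed

lemma icube_path:
  assumes xy: "(x, y) \<in> icube_loc n (\<Union>\<O>)" and O: "\<And>U. U \<in> \<O> \<Longrightarrow> openin (icube_top n) U"
    and p: "preorder_on (\<Union>\<O>) p" "\<And>U. U \<in> \<O> \<Longrightarrow> icube_loc n U \<subseteq> p"
  shows "(x, y) \<in> p"
proof -
  have xy': "x \<in> icube n" "y \<in> icube n" "\<And>i. i < n \<Longrightarrow> x i \<le> y i" "icube_seg x y n \<subseteq> \<Union>\<O>"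
    using xy by (auto simp: icube_loc_def icube_order_def)
  define g where "g t = (\<lambda>i\<in>{..<n}. x i + t * (y i - x i))" for t :: real
  have b: "0 \<le> x i" "y i \<le> 1" if "i < n" for i using xy'(1,2) that by (auto simp: cube_def PiE_iff)
  have g_ord: "(g s, g t) \<in> icube_order n" if "0 \<le> s" "s \<le> t" "t \<le> 1" for s t
  proof -
    have *: "0 \<le> x i + t * (y i - x i) \<and> x i + t * (y i - x i) \<le> 1" if "i < n" "0 \<le> t" "t \<le> 1" for i t
    proof -
      have "t * (y i - x i) \<le> y i - x i"
        using mult_right_mono[OF that(3), of "y i - x i"] xy'(3)[OF that(1)] by simp
      moreover have "0 \<le> t * (y i - x i)" using that xy'(3)[OF that(1)] by simp
      ultimately have "0 \<le> x i + t * (y i - x i)" "x i + t * (y i - x i) \<le> 1"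
        using b[OF that(1)] by linarith+
      then show ?thesis ..
    qed
    show ?thesis using that *[of _ s] *[of _ t] xy'(3)
      by (auto simp: icube_order_def g_def cube_def mult_right_mono)
  qed
  have g01: "g 0 = x" "g 1 = y" using xy'(1,2) by (auto simp: g_def cube_def PiE_iff extensional_def)
  have g_in: "g t \<in> \<Union>\<O>" if "0 \<le> t" "t \<le> 1" for t
    using g_ord[of 0 t] g_ord[of t 1] that g01 xy'(4) by (auto simp: icube_seg_def)
  have cont: "continuous_map (top_of_set {0..1}) (icube_top n) g"
    unfolding icube_top_def continuous_map_componentwise
    using g_ord[of _ 1] g_ord[of 0]
    by (auto simp: g_def icube_order_def cube_def continuous_map_in_subtopology PiE_iff intro!: continuous_intros)
  have "0 \<le> (0::real) \<and> 1 \<le> (1::real) \<longrightarrow> (g 0, g 1) \<in> p"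
  proof (rule Bolzano[where P = "\<lambda>s t. 0 \<le> s \<and> t \<le> 1 \<longrightarrow> (g s, g t) \<in> p"])
    show "0 \<le> a \<and> c \<le> 1 \<longrightarrow> (g a, g c) \<in> p"
      if "0 \<le> a \<and> b \<le> 1 \<longrightarrow> (g a, g b) \<in> p" "0 \<le> b \<and> c \<le> 1 \<longrightarrow> (g b, g c) \<in> p" "a \<le> b" "b \<le> c" for a b c
      using that preorder_onD(3)[OF p(1)] by (meson order_trans)
    fix t :: real assume t: "0 \<le> t" "t \<le> 1"
    obtain U where U: "U \<in> \<O>" "g t \<in> U" using g_in[OF t] by blast
    obtain B where B: "openin (icube_top n) B" "g t \<in> B" "B \<subseteq> U"
      "\<And>a b. a \<in> B \<Longrightarrow> b \<in> B \<Longrightarrow> icube_seg a b n \<subseteq> B"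
      using icube_convex_nbhd[OF O[OF U(1)] U(2)] by blast
    have "openin (top_of_set {0..1}) {s \<in> {0..1}. g s \<in> B}"
      using openin_continuous_map_preimage[OF cont B(1)] by simp
    then obtain d where d: "d > 0" "ball t d \<inter> {0..1} \<subseteq> {s \<in> {0..1}. g s \<in> B}"
      using t B(2) unfolding openin_contains_ball by auto
    show "\<exists>d>0. \<forall>a b. a \<le> t \<and> t \<le> b \<and> b - a < d \<longrightarrow> 0 \<le> a \<and> b \<le> 1 \<longrightarrow> (g a, g b) \<in> p"
    proof (intro exI conjI allI impI)
      fix a b assume h: "a \<le> t \<and> t \<le> b \<and> b - a < d" "0 \<le> a \<and> b \<le> 1"
      then have "a \<in> ball t d \<inter> {0..1}" "b \<in> ball t d \<inter> {0..1}" by (auto simp: dist_real_def)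
      then have "g a \<in> B" "g b \<in> B" using d(2) by blast+
      then have "icube_seg (g a) (g b) n \<subseteq> U" using B(3,4) by blast
      moreover have "(g a, g b) \<in> icube_order n" using g_ord h by auto
      ultimately show "(g a, g b) \<in> p" using p(2)[OF U(1)] by (auto simp: icube_loc_def)
    qed (use d in auto)
  qed auto
  then show ?thesis using g01 by simp
qed

lemma icube_expl_circulation:
  "circulation (icube_top n) (icube_expl n)"
  unfolding circulation_def
proof (intro conjI allI impI)
  fix U assume "openin (icube_top n) U"
  then show "preorder_on U (icube_expl n U)"
    using preorder_gen_preorder[OF icube_loc_sub] by (simp add: icube_expl_def)
next
  fix \<O> assume O: "\<forall>U\<in>\<O>. openin (icube_top n) U"
  then have op: "openin (icube_top n) (\<Union>\<O>)" by auto
  have e: "icube_expl n U = preorder_gen U (icube_loc n U)" if "U \<in> \<O>" for U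
    using O that by (simp add: icube_expl_def)
  have pre: "preorder_on (\<Union>\<O>) (preorder_gen (\<Union>\<O>) (icube_loc n (\<Union>\<O>)))"
    by (rule preorder_gen_preorder[OF icube_loc_sub])
  have sub: "icube_expl n U \<subseteq> U \<times> U" if "U \<in> \<O>" for U
    using e[OF that] preorder_onD(1)[OF preorder_gen_preorder[OF icube_loc_sub]] by metis
  let ?p = "preorder_gen (\<Union>\<O>) (\<Union>U\<in>\<O>. icube_expl n U)"
  have pp: "preorder_on (\<Union>\<O>) ?p" by (rule preorder_gen_preorder) (use sub in blast)
  show "icube_expl n (\<Union>\<O>) = ?p"
  proof
    have "icube_loc n U \<subseteq> ?p" if "U \<in> \<O>" for U
      using preorder_gen_incl[of "icube_loc n U" U] e[OF that] that
        preorder_gen_incl[of "\<Union>U\<in>\<O>. icube_expl n U" "\<Union>\<O>"] by blast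
    then have "icube_loc n (\<Union>\<O>) \<subseteq> ?p" using icube_path[OF _ _ pp] O by (metis subrelI)
    then show "icube_expl n (\<Union>\<O>) \<subseteq> ?p" using preorder_gen_least[OF pp] op by (simp add: icube_expl_def)
    have "icube_expl n U \<subseteq> icube_expl n (\<Union>\<O>)" if U: "U \<in> \<O>" for U
    proof -
      let ?q = "preorder_gen (\<Union>\<O>) (icube_loc n (\<Union>\<O>)) \<inter> U \<times> U"
      have "preorder_on U ?q"
        using preorder_onD[OF pre] U unfolding preorder_on_def refl_on_def trans_def by blast
      moreover have "icube_loc n U \<subseteq> icube_loc n (\<Union>\<O>)" using U by (auto simp: icube_loc_def)
      then have "icube_loc n U \<subseteq> ?q" using icube_loc_sub[of n U] preorder_gen_incl[of "icube_loc n (\<Union>\<O>)" "\<Union>\<O>"] by blast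
      ultimately show ?thesis using preorder_gen_least[of U ?q] e[OF U] op by (auto simp: icube_expl_def)
    qed
    then have "(\<Union>U\<in>\<O>. icube_expl n U) \<subseteq> icube_expl n (\<Union>\<O>)" by blast
    then show "?p \<subseteq> icube_expl n (\<Union>\<O>)"
      using op pre by (intro preorder_gen_least) (simp_all add: icube_expl_def)
  qed
qed

lemma icube_expl_top: "icube_expl n (icube n) = icube_order n"
proof -
  have "openin (icube_top n) (icube n)" by (metis openin_topspace topspace_icube_top)
  moreover have "icube_loc n (icube n) = icube_order n"
    using preorder_onD(1)[OF icube_order_preorder] by (auto simp: icube_loc_def icube_seg_def)
  moreover have "preorder_gen (icube n) (icube_order n) = icube_order n"
    using preorder_gen_least[OF icube_order_preorder order_refl] preorder_gen_incl by blast
  ultimately show ?thesis by (simp add: icube_expl_def)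
qed

lemma icube_circ_eq:
  assumes c: "circulation (icube_top n) c" and top: "c (icube n) = icube_order n"
    and U: "openin (icube_top n) U"
  shows "c U = preorder_gen U (icube_loc n U)"
proof
  have opt: "openin (icube_top n) (icube n)" by (metis openin_topspace topspace_icube_top)
  have pc: "preorder_on V (c V)" if "openin (icube_top n) V" for V using c that by (auto simp: circulation_def)
  have sub_ord: "c V \<subseteq> icube_order n" if "openin (icube_top n) V" for V
    using circulation_mono[OF c that opt] openin_subset[OF that] top by simp
  show "preorder_gen U (icube_loc n U) \<subseteq> c U"
  proof (rule preorder_gen_least[OF pc[OF U]], rule subrelI)
    fix x y assume xy: "(x, y) \<in> icube_loc n U"
    define V where "V = icube n - icube_seg x y n"
    have V: "openin (icube_top n) V" using openin_diff[OF opt closedin_icube_seg] by (simp add: V_def)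
    let ?S = "icube_seg x y n"
    have S: "?S \<subseteq> U" "x \<in> ?S" "y \<in> ?S" using xy preorder_onD[OF icube_order_preorder[of n]]
      by (auto simp: icube_loc_def icube_seg_def)
    have un: "\<Union>{U, V} = icube n" using S openin_subset[OF U] by (auto simp: V_def)
    have "c (\<Union>{U, V}) = preorder_gen (\<Union>{U, V}) (\<Union>W\<in>{U, V}. c W)"
      by (rule c[unfolded circulation_def, THEN conjunct2, rule_format]) (use U V in auto)
    then have gen: "icube_order n = preorder_gen (icube n) (c U \<union> c V)" unfolding un top by simp
    define q where "q = {(a, b) \<in> icube_order n. a \<in> ?S \<longrightarrow> b \<in> ?S \<longrightarrow> (a, b) \<in> c U}"
    have "preorder_on (icube n) q"
      unfolding preorder_on_def
    proof (intro conjI)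
      show "q \<subseteq> icube n \<times> icube n" using preorder_onD(1)[OF icube_order_preorder] by (auto simp: q_def)
      show "refl_on (icube n) q" using preorder_onD(2)[OF icube_order_preorder] preorder_onD(2)[OF pc[OF U]] S
        by (auto simp: q_def refl_on_def)
      show "trans q"
      proof (rule transI)
        fix a b d assume h: "(a, b) \<in> q" "(b, d) \<in> q"
        have "b \<in> ?S" if "a \<in> ?S" "d \<in> ?S"
          using h that preorder_onD(3)[OF icube_order_preorder[of n]] unfolding q_def icube_seg_def by blast
        then show "(a, d) \<in> q"
          using h preorder_onD(3)[OF icube_order_preorder[of n]] preorder_onD(3)[OF pc[OF U]] unfolding q_def by blast
      qed
    qed
    moreover have "c U \<union> c V \<subseteq> q"
      using sub_ord[OF U] sub_ord[OF V] preorder_onD(1)[OF pc[OF V]] by (auto simp: q_def V_def)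
    ultimately have "icube_order n \<subseteq> q" using preorder_gen_least gen by metis
    then show "(x, y) \<in> c U" using xy S by (auto simp: icube_loc_def q_def)
  qed
  define \<B> where "\<B> = {B. openin (icube_top n) B \<and> B \<subseteq> U \<and> (\<forall>a\<in>B. \<forall>b\<in>B. icube_seg a b n \<subseteq> B)}"
  have "\<Union>\<B> = U"
  proof (intro subset_antisym subsetI)
    fix x assume "x \<in> U"
    from icube_convex_nbhd[OF U this] obtain B where B: "openin (icube_top n) B" "x \<in> B" "B \<subseteq> U"
      "\<And>a b. a \<in> B \<Longrightarrow> b \<in> B \<Longrightarrow> icube_seg a b n \<subseteq> B" by metis
    then have "B \<in> \<B>" by (simp add: \<B>_def)
    then show "x \<in> \<Union>\<B>" using B(2) by blast
  next
    fix x assume "x \<in> \<Union>\<B>" then show "x \<in> U" by (auto simp: \<B>_def)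
  qed
  moreover have "c (\<Union>\<B>) = preorder_gen (\<Union>\<B>) (\<Union>B\<in>\<B>. c B)"
    by (rule c[unfolded circulation_def, THEN conjunct2, rule_format]) (simp add: \<B>_def)
  ultimately have "c U = preorder_gen U (\<Union>B\<in>\<B>. c B)" by simp
  moreover have "c B \<subseteq> icube_loc n U" if "B \<in> \<B>" for B
  proof (rule subrelI)
    fix x y assume xy: "(x, y) \<in> c B"
    have B: "openin (icube_top n) B" "B \<subseteq> U" "\<And>a b. a \<in> B \<Longrightarrow> b \<in> B \<Longrightarrow> icube_seg a b n \<subseteq> B"
      using that by (auto simp: \<B>_def)
    have "(x, y) \<in> icube_order n" using sub_ord[OF B(1)] xy by blast
    moreover have "x \<in> B" "y \<in> B" using preorder_onD(1)[OF pc[OF B(1)]] xy by auto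
    then have "icube_seg x y n \<subseteq> U" using B(2) B(3)[of x y] by simp
    ultimately show "(x, y) \<in> icube_loc n U" by (simp add: icube_loc_def)
  qed
  then have "(\<Union>B\<in>\<B>. c B) \<subseteq> preorder_gen U (icube_loc n U)"
    using preorder_gen_incl[of "icube_loc n U" U] by fast
  ultimately show "c U \<subseteq> preorder_gen U (icube_loc n U)"
    using preorder_gen_least[OF preorder_gen_preorder[OF icube_loc_sub]] by simp
qed

lemma icube_circ_ex1:
  "\<exists>!c. circulation (icube_top n) c \<and> c (icube n) = icube_order n \<and>
     (\<forall>U. \<not> openin (icube_top n) U \<longrightarrow> c U = {})"
proof (rule ex1I)
  show "circulation (icube_top n) (icube_expl n) \<and> icube_expl n (icube n) = icube_order n \<and>
     (\<forall>U. \<not> openin (icube_top n) U \<longrightarrow> icube_expl n U = {})"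
    apply (intro conjI allI impI icube_expl_circulation icube_expl_top)
    apply (simp add: icube_expl_def)
    done
  fix c assume c: "circulation (icube_top n) c \<and> c (icube n) = icube_order n \<and>
     (\<forall>U. \<not> openin (icube_top n) U \<longrightarrow> c U = {})"
  show "c = icube_expl n"
  proof
    fix U show "c U = icube_expl n U"
      using c icube_circ_eq[of n c U] by (cases "openin (icube_top n) U") (simp_all add: icube_expl_def)
  qed
qed

lemma icube_circ_props:
  "circulation (icube_top n) (icube_circ n) \<and> icube_circ n (icube n) = icube_order n \<and>
     (\<forall>U. \<not> openin (icube_top n) U \<longrightarrow> icube_circ n U = {})"
  unfolding icube_circ_def by (rule theI'[OF icube_circ_ex1])

definition dicube :: "nat \<Rightarrow> (nat \<Rightarrow> real) stream" where
  "dicube n = \<lparr>top_of = icube_top n, circ = icube_circ n\<rparr>"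


section \<open>Directed realization and singular cubical sets\<close>

text \<open>
  \<open>\<parallel>C\<parallel>\<close> is the colimit of directed cubes \<open>\<parallel>\<box>[1]^n\<parallel>\<close>, indexed by the
  category of elements \<open>(n, c \<in> C\<^sub>n)\<close> of \<open>C\<close>, in the category of weak Hausdorff k-streams.
  Colimits of streams, and in particular coproducts and quotients, preserve k-streams; the
  colimit in weak Hausdorff k-streams is therefore the largest weak Hausdorff quotient of the
  coproduct of the cubes in which the points related by \<open>real_gen\<close> are identified.
\<close>

type_synonym 'c real_pt = "(nat \<times> 'c) \<times> (nat \<Rightarrow> real)"

definition cubes_of :: "'c cubical \<Rightarrow> 'c real_pt stream" where
  "cubes_of C = coproduct_stream (\<lambda>(n, c). dicube n) {(n, c). c \<in> cells C n}"

definition real_gen :: "'c cubical \<Rightarrow> 'c real_pt rel" where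
  "real_gen C = {(((m, act C m n \<phi> c), t), ((n, c), geom m n \<phi> t)) | m n \<phi> c t.
     box m n \<phi> \<and> c \<in> cells C n \<and> t \<in> icube m}"

definition real_rel :: "'c cubical \<Rightarrow> 'c real_pt rel" where
  "real_rel C = \<Inter>{E. equiv (topspace (top_of (cubes_of C))) E \<and> real_gen C \<subseteq> E \<and>
     weak_Hausdorff_space (top_of (quotient_stream (cubes_of C) E))}"

definition realization :: "'c cubical \<Rightarrow> 'c real_pt set stream" where
  "realization C = quotient_stream (cubes_of C) (real_rel C)"

definition realization_map ::
  "'d cubical \<Rightarrow> (nat \<Rightarrow> 'c \<Rightarrow> 'd) \<Rightarrow> 'c real_pt set \<Rightarrow> 'd real_pt set" where
  "realization_map D f P = real_rel D `` {((n, f n c), t) | n c t. ((n, c), t) \<in> P}"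

definition sing :: "'a stream \<Rightarrow> ((nat \<Rightarrow> real) \<Rightarrow> 'a) cubical" where
  "sing X = \<lparr>cells = (\<lambda>n. {\<gamma>. stream_map (dicube n) X \<gamma> \<and> \<gamma> \<in> extensional (icube n)}),
     act = (\<lambda>m n \<phi> \<gamma>. compose (icube m) \<gamma> (geom m n \<phi>))\<rparr>"

definition sing_map ::
  "'a stream \<Rightarrow> ('a \<Rightarrow> 'b) \<Rightarrow> nat \<Rightarrow> ((nat \<Rightarrow> real) \<Rightarrow> 'a) \<Rightarrow> (nat \<Rightarrow> real) \<Rightarrow> 'b" where
  "sing_map X g = (\<lambda>n. \<lambda>\<gamma>\<in>cells (sing X) n. compose (icube n) g \<gamma>)"

text \<open>The unit \<open>C \<rightarrow> sing \<parallel>C\<parallel>\<close> of the adjunction between realization and \<open>sing\<close>.\<close>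

definition sing_unit :: "'c cubical \<Rightarrow> nat \<Rightarrow> 'c \<Rightarrow> (nat \<Rightarrow> real) \<Rightarrow> 'c real_pt set" where
  "sing_unit C = (\<lambda>n. \<lambda>c\<in>cells C n. \<lambda>t\<in>icube n. real_rel C `` {((n, c), t)})"


section \<open>Cohomology\<close>

abbreviation ner where "ner \<tau> \<equiv> nerve (monoid_cat \<tau>)"

definition H1_rel where
  "H1_rel A \<tau> = equiv_gen (cub_hom A (ner \<tau>))
     {(\<alpha>, \<beta>). \<alpha> \<in> cub_hom A (ner \<tau>) \<and> \<beta> \<in> cub_hom A (ner \<tau>) \<and>
        (\<exists>h\<in>cub_hom (tensor A (representable 1)) (ner \<tau>).
           cub_comp A h (cyl_incl A False) = \<alpha> \<and> cub_comp A h (cyl_incl A True) = \<beta>)}"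

definition H1 where
  "H1 A \<tau> = \<lparr>carrier = cub_hom A (ner \<tau>) // H1_rel A \<tau>,
     mult = (\<lambda>X Y. H1_rel A \<tau> ``
       {(\<lambda>n. \<lambda>a\<in>cells A n. \<alpha> n a \<otimes>\<^bsub>functor_monoid (cube_cat n) \<tau>\<^esub> \<beta> n a) | \<alpha> \<beta>. \<alpha> \<in> X \<and> \<beta> \<in> Y}),
     one = H1_rel A \<tau> `` {\<lambda>n. \<lambda>a\<in>cells A n. \<one>\<^bsub>functor_monoid (cube_cat n) \<tau>\<^esub>}\<rparr>"

definition H1_sing where
  "H1_sing X \<tau> = H1 (sing X) \<tau>"

text \<open>Functoriality of \<open>H\<^sup>1\<close> in the cubical set (contravariant) and in the monoid (covariant).\<close>

definition H1_pull where
  "H1_pull A \<tau> g X = H1_rel A \<tau> `` {cub_comp A \<alpha> g | \<alpha>. \<alpha> \<in> X}"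

definition H1_push where
  "H1_push A \<tau> \<tau>' k X = H1_rel A \<tau>' `` {cub_comp A (nerve_map (monoid_cat \<tau>) k) \<alpha> | \<alpha>. \<alpha> \<in> X}"

text \<open>
  The comparison \<open>H\<^sup>1\<^sub>s\<^sub>i\<^sub>n\<^sub>g(\<parallel>C\<parallel>; \<tau>) \<rightarrow> Cat(T\<^sub>1 C, \<tau>)\<close> sends the class of
  \<open>\<alpha> : sing \<parallel>C\<parallel> \<rightarrow> ner \<tau>\<close> to the functor adjunct to the composite of \<open>\<alpha>\<close> with the unit
  \<open>C \<rightarrow> sing \<parallel>C\<parallel>\<close>.
\<close>

definition comparison where
  "comparison C \<tau> X = (THE F. F \<in> functors (T1 C) (monoid_cat \<tau>) \<and>
     (\<forall>\<alpha>\<in>X. cub_comp C (nerve_map (T1 C) F) (T1_unit C) = cub_comp C \<alpha> (sing_unit C)))"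

end

theory Submission
  imports Defs
begin

text \<open>
  A cocycle \<open>\<alpha>\<close> on \<open>C\<close> is extended to singular cubes of \<open>\<parallel>C\<parallel>\<close> by pushing each point \<open>t\<close> of a cube down
  to the vertex \<open>{i. t i = 1}\<close> below it.  The tool is that every weakly increasing continuous
  \<open>\<phi>: [0,1] \<rightarrow> [0,1]\<close> fixing \<open>0\<close> and \<open>1\<close>, applied to all coordinates, acts naturally on \<open>\<parallel>C\<parallel>\<close>, and that one
  which is constant near \<open>0\<close>, \<open>1\<close> and each of the finitely many coordinates of a point collapses a
  neighbourhood of that point to it.  Hence the quotient of the disjoint union of cubes is already Hausdorff,
  and \<open>\<alpha>\<close> has local primitives with values in \<open>\<tau>\<close>; a Lebesgue number argument glues these along
  dipaths and over cubes.  Conversely, the natural homotopies from \<open>id\<close> and from \<open>\<phi>\<close> to \<open>max id \<phi>\<close> show that a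
  cocycle on the singular cubes is determined locally by its values on paths inside cubes of \<open>C\<close>, so that it
  is homotopic to the extension of its restriction to \<open>C\<close>.  Finally, if \<open>C\<close> has one vertex, a homotopy
  between two restrictions is an identity \<open>\<alpha> g = g \<beta>\<close> with a fixed \<open>g\<close>, and cancellation gives \<open>\<alpha> = \<beta>\<close>.
\<close>

section \<open>Cubes\<close>

text \<open>Three constraints shape the details. Nothing may be inverted in \<open>\<tau>\<close>,
  so quotients of primitives never appear: constancy of a ratio is stated as a cross-multiplied
  equation, whose transitivity is one use of cancellation, and an actual factor in
  \<open>\<tau>\<close> is produced only between points related by the circulation. A circulation is
  generated by arbitrarily small pieces, so a relation is verified on it by showing that it is a
  preorder and that it contains the coordinatewise order near each point of each cube; most global
  statements are obtained in this way, the preorder being the statement itself. Finally,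
  \<open>\<box>\<close> has neither diagonals nor connections: each coordinate of an image point is
  a constant \<open>0\<close> or \<open>1\<close>, or a coordinate copied nowhere else. Copies let
  maps and lines defined coordinatewise descend to the realization, the constants force such maps to
  fix \<open>0\<close> and \<open>1\<close>, and the absence of repetition allows a perturbation of
  an image point to be pulled back to the source, which gives saturated neighbourhoods in the
  quotient.\<close>

definition vert :: "nat \<Rightarrow> (nat \<Rightarrow> bool) \<Rightarrow> nat \<Rightarrow> real" where
  "vert n v = (\<lambda>j\<in>{..<n}. of_bool (v j))"

text \<open>The level \<open>u = 1\<close> is the vertex below \<open>t\<close> on which the
  extension is computed. Levels \<open>0 < u < 1\<close> are auxiliary thresholds in
  \<open>potential_exists\<close>; they can be chosen to avoid the coordinates of a given point,
  which \<open>1\<close> cannot.\<close>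

definition level :: "real \<Rightarrow> nat \<Rightarrow> (nat \<Rightarrow> real) \<Rightarrow> nat \<Rightarrow> bool" where
  "level u n t = (\<lambda>j\<in>{..<n}. u \<le> t j)"

definition coord :: "(real \<Rightarrow> real) \<Rightarrow> nat \<Rightarrow> (nat \<Rightarrow> real) \<Rightarrow> nat \<Rightarrow> real" where
  "coord \<phi> n t = (\<lambda>j\<in>{..<n}. \<phi> (t j))"

definition line :: "nat \<Rightarrow> (nat \<Rightarrow> real) \<Rightarrow> (nat \<Rightarrow> real) \<Rightarrow> real \<Rightarrow> nat \<Rightarrow> real" where
  "line n p q r = (\<lambda>j\<in>{..<n}. p j + r * (q j - p j))"

text \<open>The second conjunct excludes diagonals. It is what lets a prescribed change of the
  output coordinates be realised by changing the inputs, each of which feeds at most one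
  output.\<close>

definition linear_template :: "nat \<Rightarrow> nat \<Rightarrow> (nat \<Rightarrow> bool + nat) \<Rightarrow> bool" where
  "linear_template m n s \<longleftrightarrow> box_template m n s \<and>
     (\<forall>j<n. \<forall>k<n. \<forall>i. s j = Inr i \<longrightarrow> s k = Inr i \<longrightarrow> j = k)"

lemma template_map_cong:
  assumes "\<And>j. j < n \<Longrightarrow> s j = r j"
  shows "template_map S e m n s = template_map S e m n r"
  using assms by (auto simp: template_map_def restrict_def fun_eq_iff)

lemma linear_template_compose:
  assumes "linear_template l m s" "linear_template m n r"
  shows "linear_template l n (\<lambda>j. case r j of Inl b \<Rightarrow> Inl b | Inr i \<Rightarrow> s i)"
proof -
  have b: "box_template l n (\<lambda>j. case r j of Inl b \<Rightarrow> Inl b | Inr i \<Rightarrow> s i)"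
    using template_map_compose[of l m s n r id UNIV] assms by (auto simp: linear_template_def)
  have m: "i < m" if "j < n" "r j = Inr i" for i j
    using assms(2) that unfolding linear_template_def box_template_def by (metis old.sum.simps(6))
  have "j = k" if jk: "j < n" "k < n" "(case r j of Inl b \<Rightarrow> Inl b | Inr i \<Rightarrow> s i) = Inr i"
    "(case r k of Inl b \<Rightarrow> Inl b | Inr i \<Rightarrow> s i) = Inr i" for i j k
  proof -
    obtain a where a: "r j = Inr a" "s a = Inr i" using jk(3) by (cases "r j") auto
    obtain c where c: "r k = Inr c" "s c = Inr i" using jk(4) by (cases "r k") auto
    have "a = c" using assms(1) m[OF jk(1) a(1)] m[OF jk(2) c(1)] a(2) c(2)
      unfolding linear_template_def by blast
    then show ?thesis using assms(2) jk(1,2) a(1) c(1) unfolding linear_template_def by blast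
  qed
  then show ?thesis using b by (auto simp: linear_template_def)
qed

lemma box_real_linear_template:
  assumes "box_real m n \<phi> f"
  shows "\<exists>s. linear_template m n s \<and> \<phi> = template_map UNIV id m n s \<and> f = template_map {0..1} of_bool m n s"
  using assms
proof induction
  case (coface i n b)
  have "linear_template n (Suc n) (cofacet i b)"
    using coface_template_map(1)[OF coface, of b] coface
    by (auto simp: linear_template_def cofacet_def split: if_splits)
  then show ?case using coface_template_map(2)[OF coface, where b = b and S = UNIV and e = id]
      coface_template_map(2)[OF coface, where b = b and S = "{0..1}" and e = of_bool] by (metis id_apply)
next
  case (codegen i n)
  have "linear_template (Suc n) n (\<lambda>j. Inr (if j < i then j else Suc j))"
    using codegen_template_map(1)[OF codegen] by (auto simp: linear_template_def split: if_splits)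
  then show ?case using codegen_template_map(2)[OF codegen, where S = UNIV and e = id]
      codegen_template_map(2)[OF codegen, where S = "{0..1}" and e = of_bool] by blast
next
  case (coperm \<pi> n)
  have "linear_template n n (\<lambda>j. Inr (\<pi> j))"
    using coperm_template_map(1)[OF coperm] permutes_inj[OF coperm]
    by (auto simp: linear_template_def inj_def)
  then show ?case using coperm_template_map(2)[OF coperm, where S = UNIV and e = id]
      coperm_template_map(2)[OF coperm, where S = "{0..1}" and e = of_bool] by blast
next
  case (comp l m \<phi> f n \<psi> g)
  then obtain s r where s: "linear_template l m s" "\<phi> = template_map UNIV id l m s" "f = template_map {0..1} of_bool l m s"
    and r: "linear_template m n r" "\<psi> = template_map UNIV id m n r" "g = template_map {0..1} of_bool m n r" by blast
  have "range (of_bool :: bool \<Rightarrow> real) \<subseteq> {0..1}" by auto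
  moreover have "box_template l m s" "box_template m n r" using s r by (auto simp: linear_template_def)
  ultimately show ?case
    using template_map_compose(1)[of l m s n r id UNIV] template_map_compose(1)[of l m s n r of_bool "{0..1}"]
    unfolding s(2,3) r(2,3)
    by (intro exI[of _ "\<lambda>j. case r j of Inl b \<Rightarrow> Inl b | Inr i \<Rightarrow> s i"] conjI linear_template_compose[OF s(1) r(1)]) (simp_all add: id_def)
qed

lemma box_linear_template:
  assumes "box m n \<phi>"
  obtains s where "linear_template m n s" "\<phi> = template_map UNIV id m n s"
    "geom m n \<phi> = template_map {0..1} of_bool m n s"
  using box_real_linear_template[OF box_real_geom[OF assms]] by blast

lemma box_compose: "box l m \<phi> \<Longrightarrow> box m n \<psi> \<Longrightarrow> box l n (compose (bcube l) \<psi> \<phi>)"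
  by (rule box.comp)

text \<open>Induction on \<open>m + n\<close>. A constant output is split off as a coface and an
  unread input as a codegeneracy; when neither occurs, the template is a bijection of coordinates.
  The lemma supplies morphisms of \<open>\<box>\<close> from formulas: vertices, tensor products and
  single-coordinate edges.\<close>

lemma linear_template_box:
  assumes "linear_template m n s"
  shows "box m n (template_map UNIV id m n s)"
  using assms
proof (induction "m + n" arbitrary: m n s rule: less_induct)
  case less
  have lin: "box_template m n s" "\<And>j k i. j < n \<Longrightarrow> k < n \<Longrightarrow> s j = Inr i \<Longrightarrow> s k = Inr i \<Longrightarrow> j = k"
    using less.prems by (auto simp: linear_template_def)
  have lt: "i < m" if "j < n" "s j = Inr i" for i j
    using lin(1) that unfolding box_template_def by (metis old.sum.simps(6))
  consider (const) j b where "j < n" "s j = Inl b"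
    | (unused) i where "\<And>j. j < n \<Longrightarrow> \<exists>a. s j = Inr a" "i < m" "\<And>j. j < n \<Longrightarrow> s j \<noteq> Inr i"
    | (perm) "\<And>j. j < n \<Longrightarrow> \<exists>a. s j = Inr a" "\<And>i. i < m \<Longrightarrow> \<exists>j<n. s j = Inr i"
    by (metis sum.exhaust)
  then show ?case
  proof cases
    case const
    then obtain n' where n': "n = Suc n'" by (cases n) auto
    define s' where "s' = (\<lambda>k. s (if k < j then k else Suc k))"
    have "box_template m n' s'" using lin(1) const(1) by (auto simp: box_template_def s'_def n')
    moreover have "a = k" if "a < n'" "k < n'" "s' a = Inr i" "s' k = Inr i" for a k i
    proof -
      have "(if a < j then a else Suc a) = (if k < j then k else Suc k)"
        by (rule lin(2)[of _ _ i]) (use that in \<open>auto simp: n' s'_def\<close>)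
      then show ?thesis by (auto split: if_splits)
    qed
    ultimately have s': "linear_template m n' s'" by (auto simp: linear_template_def)
    have jn: "j \<le> n'" using const n' by simp
    have "box m (Suc n') (compose (bcube m) (coface UNIV n' j b) (template_map UNIV id m n' s'))"
      by (rule box.comp[OF less.hyps[OF _ s'] box.coface[OF jn]]) (simp add: n')
    moreover have "coface UNIV n' j b = template_map UNIV id n' n (cofacet j b)"
      using coface_template_map(2)[OF jn, where S = UNIV and e = id and b = b] by (simp add: n')
    moreover have "compose (bcube m) (template_map UNIV id n' n (cofacet j b)) (template_map UNIV id m n' s')
       = template_map UNIV id m n (\<lambda>k. case cofacet j b k of Inl b \<Rightarrow> Inl b | Inr i \<Rightarrow> s' i)"
      using template_map_compose[of m n' s' n "cofacet j b" id UNIV] s' coface_template_map(1)[OF jn, of b]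
      by (auto simp: n' linear_template_def)
    moreover have "template_map UNIV id m n (\<lambda>k. case cofacet j b k of Inl b \<Rightarrow> Inl b | Inr i \<Rightarrow> s' i)
       = template_map UNIV id m n s"
      by (rule template_map_cong) (use const in \<open>auto simp: cofacet_def s'_def\<close>)
    ultimately show ?thesis by (simp add: n')
  next
    case unused
    then obtain m' where m': "m = Suc m'" by (cases m) auto
    define h where "h = (\<lambda>a. if a < i then a else a - 1 :: nat)"
    define s' where "s' = (\<lambda>j. Inr (h (projr (s j))) :: bool + nat)"
    have h: "h a < m'" if "a < m" "a \<noteq> i" for a using that unused(2) by (auto simp: h_def m')
    have hinj: "a = b" if "h a = h b" "a \<noteq> i" "b \<noteq> i" for a b using that by (auto simp: h_def split: if_splits)
    have sj: "s j = Inr (projr (s j))" "projr (s j) < m" "projr (s j) \<noteq> i" if "j < n" for j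
      using unused(1)[OF that] unused(3)[OF that] lt[OF that] by auto
    have "box_template m' n s'" using h sj by (auto simp: box_template_def s'_def)
    moreover have "a = k" if "a < n" "k < n" "s' a = Inr b" "s' k = Inr b" for a k b
      using that hinj[of "projr (s a)" "projr (s k)"] sj lin(2) unfolding s'_def by (metis sum.inject(2))
    ultimately have s': "linear_template m' n s'" by (auto simp: linear_template_def)
    have im: "i \<le> m'" using unused m' by simp
    have "box (Suc m') n (compose (bcube (Suc m')) (template_map UNIV id m' n s') (codegen UNIV m' i))"
      by (rule box.comp[OF box.codegen[OF im] less.hyps[OF _ s']]) (simp add: m')
    moreover have "codegen UNIV m' i = template_map UNIV id m m' (\<lambda>j. Inr (if j < i then j else Suc j))"
      using codegen_template_map(2)[OF im, where S = UNIV and e = id] by (simp add: m')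
    moreover have "compose (bcube m) (template_map UNIV id m' n s') (template_map UNIV id m m' (\<lambda>j. Inr (if j < i then j else Suc j)))
       = template_map UNIV id m n (\<lambda>k. case s' k of Inl b \<Rightarrow> Inl b | Inr j \<Rightarrow> Inr (if j < i then j else Suc j))"
      using template_map_compose[of m m' "\<lambda>j. Inr (if j < i then j else Suc j)" n s' id UNIV] s' codegen_template_map(1)[OF im]
      by (auto simp: m' linear_template_def)
    moreover have "(case s' k of Inl b \<Rightarrow> Inl b | Inr j \<Rightarrow> Inr (if j < i then j else Suc j)) = s k" if "k < n" for k
    proof -
      have "(if h (projr (s k)) < i then h (projr (s k)) else Suc (h (projr (s k)))) = projr (s k)"
        using sj(3)[OF that] by (auto simp: h_def)
      then show ?thesis using sj(1)[OF that] by (simp add: s'_def)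
    qed
    then have "template_map UNIV id m n (\<lambda>k. case s' k of Inl b \<Rightarrow> Inl b | Inr j \<Rightarrow> Inr (if j < i then j else Suc j))
       = template_map UNIV id m n s"
      by (rule template_map_cong)
    ultimately show ?thesis by (simp add: m')
  next
    case perm
    define \<pi> where "\<pi> = (\<lambda>j. if j < n then projr (s j) else j)"
    have sj: "s j = Inr (\<pi> j)" "\<pi> j < m" if "j < n" for j
      using perm(1)[OF that] lt[OF that] that by (auto simp: \<pi>_def)
    have bij: "bij_betw \<pi> {..<n} {..<m}"
      unfolding bij_betw_def
    proof
      show "inj_on \<pi> {..<n}"
      proof (rule inj_onI)
        fix j k assume "j \<in> {..<n}" "k \<in> {..<n}" "\<pi> j = \<pi> k"
        then show "j = k" using lin(2)[of j k "\<pi> j"] sj(1)[of j] sj(1)[of k] by simp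
      qed
      have "i \<in> \<pi> ` {..<n}" if i: "i < m" for i
      proof -
        obtain j where "j < n" "s j = Inr i" using perm(2)[OF i] by blast
        then have "\<pi> j = i" "j \<in> {..<n}" using sj(1)[of j] by auto
        then show ?thesis by blast
      qed
      then show "\<pi> ` {..<n} = {..<m}" using sj(2) by auto
    qed
    then have nm: "m = n" using bij_betw_same_card by fastforce
    then have \<pi>: "\<pi> permutes {..<n}" using bij by (intro bij_imp_permutes) (auto simp: \<pi>_def)
    have "template_map UNIV id n n s = coperm UNIV n \<pi>"
      unfolding coperm_template_map(2)[OF \<pi>, where S = UNIV and e = id]
      by (rule template_map_cong) (use sj in auto)
    then show ?thesis using box.coperm[OF \<pi>] nm by simp
  qed
qed

lemma geom_template:
  assumes "linear_template m n s"
  shows "geom m n (template_map UNIV id m n s) = template_map {0..1} of_bool m n s"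
proof -
  obtain r where r: "linear_template m n r" "template_map UNIV id m n s = template_map UNIV id m n r"
    "geom m n (template_map UNIV id m n s) = template_map {0..1} of_bool m n r"
    using box_linear_template[OF linear_template_box[OF assms]] by metis
  show ?thesis unfolding r(3)
    by (rule template_map_cong) (use template_map_inj[of m n r s] r assms in \<open>auto simp: linear_template_def\<close>)
qed

lemma of_bool_unit: "range (of_bool :: bool \<Rightarrow> real) \<subseteq> {0..1}" by auto

lemma bcube_iff: "v \<in> bcube n \<longleftrightarrow> v \<in> extensional {..<n}"
  by (auto simp: cube_def PiE_iff)

lemma icube_eqI: "s \<in> icube n \<Longrightarrow> t \<in> icube n \<Longrightarrow> (\<And>i. i < n \<Longrightarrow> s i = t i) \<Longrightarrow> s = t"
  by (rule extensionalityI[of _ "{..<n}"]) (auto simp: icube_iff)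

lemma bcube_eqI: "s \<in> bcube n \<Longrightarrow> t \<in> bcube n \<Longrightarrow> (\<And>i. i < n \<Longrightarrow> s i = t i) \<Longrightarrow> s = t"
  by (rule extensionalityI[of _ "{..<n}"]) (auto simp: bcube_iff)

lemma box_in: "box m n \<psi> \<Longrightarrow> v \<in> bcube m \<Longrightarrow> \<psi> v \<in> bcube n"
  by (erule box_linear_template) (simp add: template_map_in_cube linear_template_def)

lemma geom_in: "box m n \<psi> \<Longrightarrow> t \<in> icube m \<Longrightarrow> geom m n \<psi> t \<in> icube n"
  by (erule box_linear_template) (simp add: template_map_in_cube linear_template_def of_bool_unit)

lemma box_extensional: "box m n \<psi> \<Longrightarrow> \<psi> \<in> extensional (bcube m)"
  by (erule box_linear_template) (simp add: template_map_def)

text \<open>One template describes \<open>\<psi>\<close> on vertices and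
  \<open>geom m n \<psi>\<close> on points, so that facts relating the two are checked coordinate by
  coordinate, constant or copy.\<close>

lemma box_coords:
  assumes "box m n \<psi>"
  obtains s where "\<And>j i. j < n \<Longrightarrow> s j = Inr i \<Longrightarrow> i < m"
    "\<And>j k i. j < n \<Longrightarrow> k < n \<Longrightarrow> s j = Inr i \<Longrightarrow> s k = Inr i \<Longrightarrow> j = k"
    "\<And>v j. v \<in> bcube m \<Longrightarrow> j < n \<Longrightarrow> \<psi> v j = (case s j of Inl b \<Rightarrow> b | Inr i \<Rightarrow> v i)"
    "\<And>t j. t \<in> icube m \<Longrightarrow> j < n \<Longrightarrow> geom m n \<psi> t j = (case s j of Inl b \<Rightarrow> of_bool b | Inr i \<Rightarrow> t i)"
proof (rule box_linear_template[OF assms])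
  fix s assume s: "linear_template m n s" "\<psi> = template_map UNIV id m n s" "geom m n \<psi> = template_map {0..1} of_bool m n s"
  show thesis
  proof (rule that[of s])
    show "i < m" if "j < n" "s j = Inr i" for i j
      using s(1) that unfolding linear_template_def box_template_def by (metis old.sum.simps(6))
    show "j = k" if "j < n" "k < n" "s j = Inr i" "s k = Inr i" for i j k
      using s(1) that by (auto simp: linear_template_def)
    show "\<psi> v j = (case s j of Inl b \<Rightarrow> b | Inr i \<Rightarrow> v i)" if "v \<in> bcube m" "j < n" for v j
      using that unfolding s(2) by (simp add: template_map_def id_def)
    show "geom m n \<psi> t j = (case s j of Inl b \<Rightarrow> of_bool b | Inr i \<Rightarrow> t i)" if "t \<in> icube m" "j < n" for t j
      using that unfolding s(3) by (simp add: template_map_def)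
  qed
qed

lemma box_mono:
  assumes "box m n \<psi>" "(v, w) \<in> Ar (cube_cat m)"
  shows "(\<psi> v, \<psi> w) \<in> Ar (cube_cat n)"
proof (rule box_coords[OF assms(1)])
  fix s
  assume s: "\<And>j i. j < n \<Longrightarrow> s j = Inr i \<Longrightarrow> i < m"
    "\<And>v j. v \<in> bcube m \<Longrightarrow> j < n \<Longrightarrow> \<psi> v j = (case s j of Inl b \<Rightarrow> b | Inr i \<Rightarrow> v i)"
  have vw: "v \<in> bcube m" "w \<in> bcube m" "\<And>i. i < m \<Longrightarrow> v i \<le> w i" using assms(2) by (auto simp: cube_cat_def)
  have "\<psi> v j \<le> \<psi> w j" if "j < n" for j
    unfolding s(2)[OF vw(1) that] s(2)[OF vw(2) that] using vw(3) s(1)[OF that] by (cases "s j") auto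
  then show ?thesis using vw(1,2) box_in[OF assms(1)] by (auto simp: cube_cat_def)
qed

lemma vert_in [simp]: "vert n v \<in> icube n"
  by (auto simp: vert_def icube_iff)

lemma level_in [simp]: "level u n t \<in> bcube n"
  by (auto simp: level_def bcube_iff)

lemma line_in:
  assumes "p \<in> icube n" "q \<in> icube n" "0 \<le> r" "r \<le> 1"
  shows "line n p q r \<in> icube n"
proof -
  have "0 \<le> p i + r * (q i - p i) \<and> p i + r * (q i - p i) \<le> 1" if "i < n" for i
  proof -
    have "0 \<le> p i" "p i \<le> 1" "0 \<le> q i" "q i \<le> 1" using assms that by (auto simp: icube_iff)
    moreover have "p i + r * (q i - p i) = (1 - r) * p i + r * q i" by (simp add: algebra_simps)
    moreover have "(1 - r) * p i + r * q i \<le> 1"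
      using assms(3,4) calculation by (intro convex_bound_le) auto
    ultimately show ?thesis using assms(3,4) by simp
  qed
  then show ?thesis by (auto simp: line_def icube_iff)
qed

lemma level_vert: "0 < u \<Longrightarrow> u \<le> 1 \<Longrightarrow> v \<in> bcube n \<Longrightarrow> level u n (vert n v) = v"
  by (rule bcube_eqI[OF level_in]) (auto simp: level_def vert_def)

lemma geom_vert:
  assumes "box m n \<psi>" "v \<in> bcube m" shows "geom m n \<psi> (vert m v) = vert n (\<psi> v)"
proof (rule box_coords[OF assms(1)], rule icube_eqI[OF geom_in[OF assms(1) vert_in] vert_in])
  fix s j
  assume j: "j < n" and s: "\<And>j i. j < n \<Longrightarrow> s j = Inr i \<Longrightarrow> i < m"
    "\<And>v j. v \<in> bcube m \<Longrightarrow> j < n \<Longrightarrow> \<psi> v j = (case s j of Inl b \<Rightarrow> b | Inr i \<Rightarrow> v i)"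
    "\<And>t j. t \<in> icube m \<Longrightarrow> j < n \<Longrightarrow> geom m n \<psi> t j = (case s j of Inl b \<Rightarrow> of_bool b | Inr i \<Rightarrow> t i)"
  show "geom m n \<psi> (vert m v) j = vert n (\<psi> v) j"
    unfolding s(3)[OF vert_in j] using j s(1)[OF j] s(2)[OF assms(2) j] by (cases "s j") (auto simp: vert_def)
qed

text \<open>The bounds on \<open>u\<close> make the threshold send the inserted constants
  \<open>0\<close> and \<open>1\<close> to \<open>False\<close> and \<open>True\<close>.\<close>

lemma geom_level:
  assumes "box m n \<psi>" "t \<in> icube m" "0 < u" "u \<le> 1"
  shows "level u n (geom m n \<psi> t) = \<psi> (level u m t)"
proof (rule box_coords[OF assms(1)], rule bcube_eqI[OF level_in box_in[OF assms(1) level_in]])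
  fix s j
  assume j: "j < n" and s: "\<And>j i. j < n \<Longrightarrow> s j = Inr i \<Longrightarrow> i < m"
    "\<And>v j. v \<in> bcube m \<Longrightarrow> j < n \<Longrightarrow> \<psi> v j = (case s j of Inl b \<Rightarrow> b | Inr i \<Rightarrow> v i)"
    "\<And>t j. t \<in> icube m \<Longrightarrow> j < n \<Longrightarrow> geom m n \<psi> t j = (case s j of Inl b \<Rightarrow> of_bool b | Inr i \<Rightarrow> t i)"
  show "level u n (geom m n \<psi> t) j = \<psi> (level u m t) j"
    unfolding s(2)[OF level_in j] using j s(1)[OF j] s(3)[OF assms(2) j] assms(3,4)
    by (cases "s j") (auto simp: level_def)
qed

lemma coord_in: "\<phi> \<in> {0..1} \<rightarrow> {0..1} \<Longrightarrow> t \<in> icube n \<Longrightarrow> coord \<phi> n t \<in> icube n"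
  by (auto simp: icube_iff coord_def Pi_iff)

text \<open>A copied coordinate commutes with any \<open>\<phi>\<close>; the fixed points
  \<open>0\<close> and \<open>1\<close> take care of the inserted ones.\<close>

lemma geom_coord:
  assumes "box m n \<psi>" "t \<in> icube m" "\<phi> 0 = 0" "\<phi> 1 = 1" "\<phi> \<in> {0..1} \<rightarrow> {0..1}"
  shows "coord \<phi> n (geom m n \<psi> t) = geom m n \<psi> (coord \<phi> m t)"
proof (rule box_coords[OF assms(1)], rule icube_eqI[OF coord_in[OF assms(5) geom_in[OF assms(1,2)]] geom_in[OF assms(1) coord_in[OF assms(5,2)]]])
  fix s j
  assume j: "j < n" and s: "\<And>j i. j < n \<Longrightarrow> s j = Inr i \<Longrightarrow> i < m"
    "\<And>t j. t \<in> icube m \<Longrightarrow> j < n \<Longrightarrow> geom m n \<psi> t j = (case s j of Inl b \<Rightarrow> of_bool b | Inr i \<Rightarrow> t i)"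
  show "coord \<phi> n (geom m n \<psi> t) j = geom m n \<psi> (coord \<phi> m t) j"
    unfolding s(2)[OF coord_in[OF assms(5,2)] j] using j s(1)[OF j] s(2)[OF assms(2) j] assms(3,4)
    by (cases "s j") (auto simp: coord_def)
qed

text \<open>Both ends have the same inserted constants, so these coordinates do not move along the
  line. Straight paths inside cubes are therefore compatible with the identifications in the
  realization.\<close>

lemma geom_line:
  assumes "box m n \<psi>" "p \<in> icube m" "q \<in> icube m" "0 \<le> r" "r \<le> 1"
  shows "geom m n \<psi> (line m p q r) = line n (geom m n \<psi> p) (geom m n \<psi> q) r"
proof (rule box_coords[OF assms(1)], rule icube_eqI[OF geom_in[OF assms(1) line_in[OF assms(2-)]]])
  show "line n (geom m n \<psi> p) (geom m n \<psi> q) r \<in> icube n"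
    using line_in geom_in[OF assms(1)] assms(2-) by simp
  fix s j
  assume j: "j < n" and s: "\<And>j i. j < n \<Longrightarrow> s j = Inr i \<Longrightarrow> i < m"
    "\<And>t j. t \<in> icube m \<Longrightarrow> j < n \<Longrightarrow> geom m n \<psi> t j = (case s j of Inl b \<Rightarrow> of_bool b | Inr i \<Rightarrow> t i)"
  show "geom m n \<psi> (line m p q r) j = line n (geom m n \<psi> p) (geom m n \<psi> q) r j"
    unfolding s(2)[OF line_in[OF assms(2-)] j] using j s(1)[OF j] s(2)[OF assms(2) j] s(2)[OF assms(3) j]
    by (cases "s j") (auto simp: line_def)
qed

lemma geom_compose:
  assumes "box l m \<phi>" "box m n \<psi>"
  shows "geom l n (compose (bcube l) \<psi> \<phi>) = compose (icube l) (geom m n \<psi>) (geom l m \<phi>)"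
  using box_real_unique box_real.comp[OF box_real_geom[OF assms(1)] box_real_geom[OF assms(2)]]
    box_real_geom[OF box_compose[OF assms]] by blast

lemma coperm_id: "coperm S n id = (\<lambda>x\<in>cube S n. x)"
  by (force simp: coperm_def cube_def restrict_def PiE_iff extensional_def fun_eq_iff)

lemma box_id: "box n n (\<lambda>x\<in>bcube n. x)"
  using box.coperm[of id n] by (simp add: coperm_id permutes_id)

lemma geom_id: "geom n n (\<lambda>x\<in>bcube n. x) = (\<lambda>x\<in>icube n. x)"
  using box_real_unique[OF box_real_geom[OF box_id] box_real.coperm[of id n, unfolded coperm_id]]
  by (simp add: permutes_id)

lemma geom_order:
  assumes "box m n \<psi>" "(p, q) \<in> icube_order m"
  shows "(geom m n \<psi> p, geom m n \<psi> q) \<in> icube_order n"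
proof (rule box_coords[OF assms(1)])
  fix s
  assume s: "\<And>j i. j < n \<Longrightarrow> s j = Inr i \<Longrightarrow> i < m"
    "\<And>t j. t \<in> icube m \<Longrightarrow> j < n \<Longrightarrow> geom m n \<psi> t j = (case s j of Inl b \<Rightarrow> of_bool b | Inr i \<Rightarrow> t i)"
  have pq: "p \<in> icube m" "q \<in> icube m" "\<And>i. i < m \<Longrightarrow> p i \<le> q i" using assms(2) by (auto simp: icube_order_def)
  have "geom m n \<psi> p j \<le> geom m n \<psi> q j" if "j < n" for j
    unfolding s(2)[OF pq(1) that] s(2)[OF pq(2) that] using s(1)[OF that] pq(3) by (cases "s j") auto
  then show ?thesis using pq geom_in[OF assms(1)] by (auto simp: icube_order_def)
qed

lemma continuous_map_into_icube:
  "continuous_map X (icube_top n) f \<longleftrightarrow> f ` topspace X \<subseteq> icube n \<and>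
     (\<forall>i<n. continuous_map X euclideanreal (\<lambda>x. f x i))"
  unfolding icube_top_def continuous_map_componentwise
  by (auto simp: continuous_map_in_subtopology icube_iff image_subset_iff extensional_def Pi_iff)

lemma continuous_map_icube_proj: "i < n \<Longrightarrow> continuous_map (icube_top n) euclideanreal (\<lambda>x. x i)"
  using continuous_map_into_icube[of "icube_top n" n id] by simp

lemma geom_continuous:
  assumes "box m n \<psi>" shows "continuous_map (icube_top m) (icube_top n) (geom m n \<psi>)"
  unfolding continuous_map_into_icube
proof (intro conjI allI impI)
  show "geom m n \<psi> ` topspace (icube_top m) \<subseteq> icube n" using geom_in[OF assms] by auto
  fix i assume i: "i < n"
  show "continuous_map (icube_top m) euclideanreal (\<lambda>x. geom m n \<psi> x i)"
  proof (rule box_coords[OF assms])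
    fix s
    assume s: "\<And>j i. j < n \<Longrightarrow> s j = Inr i \<Longrightarrow> i < m"
      "\<And>t j. t \<in> icube m \<Longrightarrow> j < n \<Longrightarrow> geom m n \<psi> t j = (case s j of Inl b \<Rightarrow> of_bool b | Inr i \<Rightarrow> t i)"
    have "continuous_map (icube_top m) euclideanreal (\<lambda>x. case s i of Inl b \<Rightarrow> of_bool b | Inr j \<Rightarrow> x j)"
      using s(1)[OF i] by (cases "s i") (auto intro: continuous_map_icube_proj)
    then show ?thesis by (rule continuous_map_eq) (use s(2) i in simp)
  qed
qed

section \<open>The identifications in the realization\<close>

text \<open>The kernel of \<open>J\<close> on \<open>S\<close> is an equivalence relation containing
  \<open>r\<close>. With a truth value for \<open>J\<close> this becomes induction over the
  generated relation, in both directions at once.\<close>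

lemma equiv_gen_invariant:
  assumes "r \<subseteq> S \<times> S" "\<And>x y. (x, y) \<in> r \<Longrightarrow> J x = J y" "(x, y) \<in> equiv_gen S r"
  shows "J x = J y"
proof -
  have "equiv S {(x, y). x \<in> S \<and> y \<in> S \<and> J x = J y}"
    by (auto simp: equiv_def refl_on_def sym_def trans_def)
  then have "equiv_gen S r \<subseteq> {(x, y). x \<in> S \<and> y \<in> S \<and> J x = J y}"
    by (rule equiv_gen_least) (use assms in auto)
  then show ?thesis using assms(3) by auto
qed

text \<open>Apply \<open>equiv_gen_invariant\<close> to the class of \<open>h x\<close> in
  \<open>E\<close>.\<close>

lemma equiv_gen_map:
  assumes r: "r \<subseteq> S \<times> S" and E: "equiv S' E" and h: "\<And>x. x \<in> S \<Longrightarrow> h x \<in> S'"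
    and rE: "\<And>x y. (x, y) \<in> r \<Longrightarrow> (h x, h y) \<in> E" and xy: "(x, y) \<in> equiv_gen S r"
  shows "(h x, h y) \<in> E"
proof -
  have "E `` {h x} = E `` {h y}"
    by (rule equiv_gen_invariant[OF r _ xy]) (rule equiv_class_eq[OF E rE])
  moreover have "y \<in> S" using equiv_gen_equiv[OF r] xy by (meson equiv_class_eq_iff)
  ultimately show ?thesis using eq_equiv_class[OF _ E h] by metis
qed

definition pts :: "'c cubical \<Rightarrow> 'c real_pt set" where
  "pts C = {((n, c), t). c \<in> cells C n \<and> t \<in> icube n}"

text \<open>The identifications forced by the colimit diagram alone, before any weak Hausdorff
  quotient; \<open>real_rel_naive\<close> shows that there are no others.\<close>

definition naive_rel :: "'c cubical \<Rightarrow> 'c real_pt rel" where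
  "naive_rel C = equiv_gen (pts C) (real_gen C)"

lemma top_cubes_of:
  "top_of (cubes_of C) = sum_topology (\<lambda>(n, c). icube_top n) {(n, c). c \<in> cells C n}"
  by (auto simp: cubes_of_def coproduct_stream_def dicube_def case_prod_unfold)

lemma topspace_cubes_of: "topspace (top_of (cubes_of C)) = pts C"
  by (auto simp: top_cubes_of pts_def)

lemma openin_cubes_of:
  "openin (top_of (cubes_of C)) U \<longleftrightarrow> U \<subseteq> pts C \<and>
     (\<forall>n. \<forall>c\<in>cells C n. openin (icube_top n) {t. ((n, c), t) \<in> U})"
  by (auto simp: top_cubes_of openin_sum_topology pts_def)

lemma act_in: "cubical_set C \<Longrightarrow> box m n \<psi> \<Longrightarrow> c \<in> cells C n \<Longrightarrow> act C m n \<psi> c \<in> cells C m"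
  by (auto simp: cubical_set_def)

lemma real_gen_sub: "cubical_set C \<Longrightarrow> real_gen C \<subseteq> pts C \<times> pts C"
  by (auto simp: real_gen_def pts_def act_in geom_in)

lemma naive_equiv: "cubical_set C \<Longrightarrow> equiv (pts C) (naive_rel C)"
  by (simp add: naive_rel_def equiv_gen_equiv real_gen_sub)

definition natural :: "(real \<Rightarrow> real) \<Rightarrow> bool" where
  "natural \<phi> \<longleftrightarrow> continuous_on {0..1} \<phi> \<and> mono_on {0..1} \<phi> \<and> \<phi> 0 = 0 \<and> \<phi> 1 = 1"

lemma natural_unit: "natural \<phi> \<Longrightarrow> \<phi> \<in> {0..1} \<rightarrow> {0..1}"
proof
  fix x :: real assume n: "natural \<phi>" and x: "x \<in> {0..1}"
  have "\<phi> 0 \<le> \<phi> x" "\<phi> x \<le> \<phi> 1" using n x unfolding natural_def by (meson atLeastAtMost_iff mono_onD order_refl zero_le_one)+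
  then show "\<phi> x \<in> {0..1}" using n by (simp add: natural_def)
qed

lemma natural_coord_in: "natural \<phi> \<Longrightarrow> t \<in> icube n \<Longrightarrow> coord \<phi> n t \<in> icube n"
  by (rule coord_in[OF natural_unit])

lemma natural_geom_coord:
  "natural \<phi> \<Longrightarrow> box m n \<psi> \<Longrightarrow> t \<in> icube m \<Longrightarrow> coord \<phi> n (geom m n \<psi> t) = geom m n \<psi> (coord \<phi> m t)"
  using geom_coord natural_unit by (metis natural_def)

text \<open>A coordinate that is not a coordinate of some representative of the point, nor \<open>0\<close> or \<open>1\<close>,
  belongs to a degenerate direction and may be changed.\<close>

lemma naive_irrelevant:
  assumes C: "cubical_set C" and T: "0 \<in> T" "1 \<in> T" "\<And>i. i < k \<Longrightarrow> t i \<in> T"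
    and zx: "(((k, d), t), ((n, c), s)) \<in> naive_rel C"
    and s': "s' \<in> icube n" "\<And>j. j < n \<Longrightarrow> s j \<in> T \<Longrightarrow> s' j = s j"
  shows "(((k, d), t), ((n, c), s')) \<in> naive_rel C"
proof -
  note eq = naive_equiv[OF C]
  define z where "z = ((k, d), t)"
  \<comment> \<open>The invariant contains the full freedom of changing coordinates outside
    \<open>T\<close>, so that it passes across a generating pair in either direction.\<close>
  define J where "J = (\<lambda>((n, c), s). (z, ((n, c), s)) \<in> naive_rel C \<and>
     (\<forall>s'\<in>icube n. (\<forall>j<n. s j \<in> T \<longrightarrow> s' j = s j) \<longrightarrow> (z, ((n, c), s')) \<in> naive_rel C))"
  have z: "z \<in> pts C" using zx eq by (metis equiv_class_eq_iff z_def)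
  have gen: "(((m, act C m n \<psi> c), t), ((n, c), geom m n \<psi> t)) \<in> naive_rel C"
    if "box m n \<psi>" "c \<in> cells C n" "t \<in> icube m" for m n \<psi> c t
    using that equiv_gen_incl[of "real_gen C" "pts C"] unfolding naive_rel_def real_gen_def by blast
  have tr: "(x, y) \<in> naive_rel C \<Longrightarrow> (y, w) \<in> naive_rel C \<Longrightarrow> (x, w) \<in> naive_rel C"
    and sy: "(x, y) \<in> naive_rel C \<Longrightarrow> (y, x) \<in> naive_rel C" for x y w
    using eq by (auto elim!: equivE dest: transD symD)
  have "J x = J y" if xy: "(x, y) \<in> real_gen C" for x y
  proof -
    obtain m n \<psi> c p where xy: "x = ((m, act C m n \<psi> c), p)" "y = ((n, c), geom m n \<psi> p)"
      and b: "box m n \<psi>" "c \<in> cells C n" "p \<in> icube m" using xy unfolding real_gen_def by blast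
    obtain s where s: "\<And>j i. j < n \<Longrightarrow> s j = Inr i \<Longrightarrow> i < m"
      "\<And>j k i. j < n \<Longrightarrow> k < n \<Longrightarrow> s j = Inr i \<Longrightarrow> s k = Inr i \<Longrightarrow> j = k"
      "\<And>t j. t \<in> icube m \<Longrightarrow> j < n \<Longrightarrow> geom m n \<psi> t j = (case s j of Inl b \<Rightarrow> of_bool b | Inr i \<Rightarrow> t i)"
      by (rule box_coords[OF b(1)]) (rule that; blast)
    have "J y" if "J x"
    proof -
      have "(z, ((n, c), q)) \<in> naive_rel C" if q: "q \<in> icube n" "\<forall>j<n. geom m n \<psi> p j \<in> T \<longrightarrow> q j = geom m n \<psi> p j" for q
      proof -
        \<comment> \<open>\<open>p'\<close> writes the changed outputs back into the inputs from
          which they are copied. Since \<open>s\<close> copies an input at most once,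
          \<open>THE\<close> is unambiguous; inputs forgotten by \<open>\<psi>\<close> keep the
          values of \<open>p\<close>.\<close>
        define p' where "p' = (\<lambda>i\<in>{..<m}. if \<exists>j<n. s j = Inr i then q (THE j. j < n \<and> s j = Inr i) else p i)"
        have the: "(THE j. j < n \<and> s j = Inr i) = j" if "j < n" "s j = Inr i" for i j
          using that s(2) by (intro the_equality) auto
        have p'j: "p' i = q j" if "j < n" "s j = Inr i" for i j
          using the[OF that] s(1)[OF that] that by (auto simp: p'_def)
        have p': "p' \<in> icube m"
          unfolding icube_iff
        proof (intro conjI allI impI)
          show "p' \<in> extensional {..<m}" by (simp add: p'_def)
          fix i assume i: "i < m"
          have "p' i \<in> {0..1}"
          proof (cases "\<exists>j<n. s j = Inr i")
            case True
            then obtain j where "j < n" "s j = Inr i" by blast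
            then show ?thesis using p'j q(1) by (auto simp: icube_iff)
          next
            case False
            then show ?thesis using i b(3) by (auto simp: p'_def icube_iff)
          qed
          then show "0 \<le> p' i" "p' i \<le> 1" by auto
        qed
        have "geom m n \<psi> p' = q"
        proof (rule icube_eqI[OF geom_in[OF b(1) p'] q(1)])
          fix j assume j: "j < n"
          show "geom m n \<psi> p' j = q j"
          proof (cases "s j")
            case (Inl e)
            then have "geom m n \<psi> p j = of_bool e" using s(3)[OF b(3) j] by simp
            \<comment> \<open>Inserted constants lie in \<open>T\<close>, hence are among the
              coordinates that \<open>q\<close> does not change.\<close>
            moreover have "of_bool e \<in> T" using T by (cases e) auto
            ultimately have "q j = of_bool e" using q(2) j by metis
            then show ?thesis using s(3)[OF p' j] Inl by simp
          next
            case (Inr i)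
            then show ?thesis using s(3)[OF p' j] p'j[OF j Inr] by simp
          qed
        qed
        moreover have "p' i = p i" if "i < m" "p i \<in> T" for i
        proof (cases "\<exists>j<n. s j = Inr i")
          case True
          then obtain j where j: "j < n" "s j = Inr i" by blast
          then show ?thesis using p'j[OF j] s(3)[OF b(3) j(1)] q(2) that by auto
        next
          case False
          then show ?thesis using that by (auto simp: p'_def)
        qed
        then have "(z, ((m, act C m n \<psi> c), p')) \<in> naive_rel C"
          using \<open>J x\<close> p' unfolding xy J_def by auto
        ultimately show ?thesis using tr gen[OF b(1,2) p'] by metis
      qed
      moreover have "(z, y) \<in> naive_rel C" using \<open>J x\<close> tr gen[OF b] unfolding xy J_def by blast
      ultimately show ?thesis unfolding J_def xy by auto
    qed
    \<comment> \<open>In this direction a change of inputs outside \<open>T\<close> changes only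
      outputs outside \<open>T\<close>, so it can be pushed forward directly.\<close>
    moreover have "J x" if "J y"
    proof -
      have "(z, ((m, act C m n \<psi> c), q)) \<in> naive_rel C" if q: "q \<in> icube m" "\<forall>j<m. p j \<in> T \<longrightarrow> q j = p j" for q
      proof -
        have "geom m n \<psi> q j = geom m n \<psi> p j" if "j < n" "geom m n \<psi> p j \<in> T" for j
          using s(1)[OF that(1)] s(3)[OF q(1) that(1)] s(3)[OF b(3) that(1)] that(2) q(2) by (cases "s j") auto
        then have "(z, ((n, c), geom m n \<psi> q)) \<in> naive_rel C"
          using \<open>J y\<close> geom_in[OF b(1) q(1)] unfolding J_def xy by auto
        then show ?thesis using tr sy gen[OF b(1,2) q(1)] by blast
      qed
      moreover have "(z, x) \<in> naive_rel C" using \<open>J y\<close> tr sy gen[OF b] unfolding xy J_def by blast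
      ultimately show ?thesis unfolding J_def xy by auto
    qed
    ultimately show ?thesis by blast
  qed
  from equiv_gen_invariant[OF real_gen_sub[OF C] this zx[unfolded naive_rel_def]]
  have "J z = J ((n, c), s)" by (simp add: z_def)
  \<comment> \<open>All coordinates of \<open>t\<close> lie in \<open>T\<close>, so nothing can be
    changed at \<open>z\<close> itself.\<close>
  moreover have "J z"
  proof -
    have "s' = t" if "s' \<in> icube k" "\<forall>j<k. t j \<in> T \<longrightarrow> s' j = t j" for s'
      using that z T(3) by (intro icube_eqI[of _ k]) (auto simp: z_def pts_def)
    moreover have "(z, z) \<in> naive_rel C" using equiv_class_self[OF eq z] by blast
    ultimately show ?thesis by (auto simp: J_def z_def)
  qed
  ultimately show ?thesis using s' by (auto simp: J_def z_def)
qed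

text \<open>Points of the open interval are only close to points of the open interval, so that
  the neighbourhoods below are saturated.\<close>

definition close :: "real \<Rightarrow> real \<Rightarrow> real \<Rightarrow> bool" where
  "close \<epsilon> a b \<longleftrightarrow> \<bar>b - a\<bar> < \<epsilon> \<and> (0 < a \<longrightarrow> 0 < b) \<and> (a < 1 \<longrightarrow> b < 1)"

text \<open>Nearness is measured inside one cell, against all representatives of \<open>Z\<close> in
  that cell; no metric on the quotient is involved.\<close>

definition nbhd :: "'c cubical \<Rightarrow> real \<Rightarrow> 'c real_pt set \<Rightarrow> 'c real_pt set" where
  "nbhd C \<epsilon> Z = {((n, c), s). c \<in> cells C n \<and> s \<in> icube n \<and>
     (\<exists>p\<in>icube n. ((n, c), p) \<in> Z \<and> (\<forall>j<n. close \<epsilon> (p j) (s j)))}"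

lemma openin_icube_coords:
  assumes "\<And>j. j < n \<Longrightarrow> open (A j)"
  shows "openin (icube_top n) {t \<in> icube n. \<forall>j<n. t j \<in> A j}"
proof -
  have "{t \<in> icube n. \<forall>j<n. t j \<in> A j} = (\<Pi>\<^sub>E i\<in>{..<n}. {0..1} \<inter> A i)"
    by (rule Set.set_eqI) (simp add: icube_iff PiE_iff Ball_def, blast)
  then show ?thesis
    unfolding icube_top_def openin_PiE_gen using assms by (auto intro!: openin_open_Int simp: openin_PiE_gen)
qed

lemma openin_nbhd:
  "openin (icube_top n) {s. ((n, c), s) \<in> nbhd C \<epsilon> Z}"
proof (cases "c \<in> cells C n")
  case True
  define A where "A = (\<lambda>a. {b. close \<epsilon> a b})"
  have "A a = {a - \<epsilon><..<a + \<epsilon>} \<inter> (if 0 < a then {0<..} else UNIV) \<inter> (if a < 1 then {..<1} else UNIV)" for a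
    by (auto simp: A_def close_def abs_less_iff)
  then have "open (A a)" for a by (auto intro!: open_Int)
  then have "openin (icube_top n) {s \<in> icube n. \<forall>j<n. s j \<in> A (p j)}" for p
    by (rule openin_icube_coords)
  moreover have "{s. ((n, c), s) \<in> nbhd C \<epsilon> Z} =
      \<Union>((\<lambda>p. {s \<in> icube n. \<forall>j<n. s j \<in> A (p j)}) ` {p \<in> icube n. ((n, c), p) \<in> Z})"
    using True by (auto simp: nbhd_def A_def)
  ultimately show ?thesis by (metis (mono_tags, lifting) imageE openin_Union)
next
  case False
  then show ?thesis by (simp add: nbhd_def)
qed

lemma nbhd_sub: "nbhd C \<epsilon> Z \<subseteq> pts C"
  by (auto simp: nbhd_def pts_def)

lemma nbhd_incl: "0 < \<epsilon> \<Longrightarrow> Z \<subseteq> pts C \<Longrightarrow> Z \<subseteq> nbhd C \<epsilon> Z"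
  by (force simp: nbhd_def pts_def close_def)

text \<open>Forwards, nearness of the inputs gives nearness of the copied outputs. Backwards, a
  point of \<open>Z\<close> near an image point is itself an image point, and is pulled back along
  the template as in \<open>naive_irrelevant\<close>.\<close>

lemma nbhd_saturated:
  assumes C: "cubical_set C" and \<epsilon>: "0 < \<epsilon>" and Z: "\<And>x y. (x, y) \<in> naive_rel C \<Longrightarrow> x \<in> Z \<longleftrightarrow> y \<in> Z"
    and xy: "(x, y) \<in> naive_rel C"
  shows "x \<in> nbhd C \<epsilon> Z \<longleftrightarrow> y \<in> nbhd C \<epsilon> Z"
proof (rule equiv_gen_invariant[OF real_gen_sub[OF C] _ xy[unfolded naive_rel_def]])
  fix x y assume "(x, y) \<in> real_gen C"
  then obtain m n \<psi> c t where xy: "x = ((m, act C m n \<psi> c), t)" "y = ((n, c), geom m n \<psi> t)"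
    and b: "box m n \<psi>" "c \<in> cells C n" "t \<in> icube m" unfolding real_gen_def by blast
  have gen: "((m, act C m n \<psi> c), p) \<in> Z \<longleftrightarrow> ((n, c), geom m n \<psi> p) \<in> Z" if "p \<in> icube m" for p
    by (rule Z) (use that b equiv_gen_incl[of "real_gen C" "pts C"] in \<open>unfold naive_rel_def real_gen_def, blast\<close>)
  obtain s where s: "\<And>j i. j < n \<Longrightarrow> s j = Inr i \<Longrightarrow> i < m"
    "\<And>j k i. j < n \<Longrightarrow> k < n \<Longrightarrow> s j = Inr i \<Longrightarrow> s k = Inr i \<Longrightarrow> j = k"
    "\<And>t j. t \<in> icube m \<Longrightarrow> j < n \<Longrightarrow> geom m n \<psi> t j = (case s j of Inl b \<Rightarrow> of_bool b | Inr i \<Rightarrow> t i)"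
    by (rule box_coords[OF b(1)]) (rule that; blast)
  show "(x \<in> nbhd C \<epsilon> Z) = (y \<in> nbhd C \<epsilon> Z)"
  proof
    assume "x \<in> nbhd C \<epsilon> Z"
    then obtain p where p: "p \<in> icube m" "((m, act C m n \<psi> c), p) \<in> Z" "\<forall>j<m. close \<epsilon> (p j) (t j)"
      by (auto simp: xy nbhd_def)
    have "close \<epsilon> (geom m n \<psi> p j) (geom m n \<psi> t j)" if "j < n" for j
      using s(1)[OF that] s(3)[OF p(1) that] s(3)[OF b(3) that] p(3) \<epsilon> by (cases "s j") (auto simp: close_def)
    then show "y \<in> nbhd C \<epsilon> Z" using p gen[OF p(1)] b geom_in[OF b(1)] by (auto simp: nbhd_def xy)
  next
    assume "y \<in> nbhd C \<epsilon> Z"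
    then obtain q where q: "q \<in> icube n" "((n, c), q) \<in> Z" "\<forall>j<n. close \<epsilon> (q j) (geom m n \<psi> t j)"
      by (auto simp: xy nbhd_def)
    define p where "p = (\<lambda>i\<in>{..<m}. if \<exists>j<n. s j = Inr i then q (THE j. j < n \<and> s j = Inr i) else t i)"
    have the: "(THE j. j < n \<and> s j = Inr i) = j" if "j < n" "s j = Inr i" for i j
      using that s(2) by (intro the_equality) auto
    have pj: "p i = q j" if "j < n" "s j = Inr i" for i j
      using the[OF that] s(1)[OF that] that by (auto simp: p_def)
    have p: "0 \<le> p i \<and> p i \<le> 1 \<and> close \<epsilon> (p i) (t i)" if "i < m" for i
    proof (cases "\<exists>j<n. s j = Inr i")
      case True
      then obtain j where j: "j < n" "s j = Inr i" by blast
      then show ?thesis using pj[OF j] q s(3)[OF b(3) j(1)] by (auto simp: icube_iff)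
    next
      case False
      then show ?thesis using that b(3) \<epsilon> by (auto simp: p_def icube_iff close_def)
    qed
    then have pc: "p \<in> icube m" by (auto simp: p_def icube_iff)
    have "geom m n \<psi> p = q"
    proof (rule icube_eqI[OF geom_in[OF b(1) pc] q(1)])
      fix j assume j: "j < n"
      show "geom m n \<psi> p j = q j"
      proof (cases "s j")
        case (Inl e)
        \<comment> \<open>In second position, \<open>0\<close> and \<open>1\<close> are
          \<open>close\<close> only to themselves within the unit interval, so \<open>q\<close> has
          the inserted constant as well.\<close>
        then have "close \<epsilon> (q j) (of_bool e)" using q(3) j s(3)[OF b(3) j] by auto
        moreover have "0 \<le> q j" "q j \<le> 1" using q(1) j by (auto simp: icube_iff)
        ultimately have "q j = of_bool e" by (cases e) (auto simp: close_def)
        then show ?thesis using s(3)[OF pc j] Inl by simp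
      next
        case (Inr i)
        then show ?thesis using s(3)[OF pc j] pj[OF j Inr] by simp
      qed
    qed
    then show "x \<in> nbhd C \<epsilon> Z" using p pc q(2) gen[OF pc] b act_in[OF C b(1,2)] by (auto simp: nbhd_def xy)
  qed
qed

section \<open>Monotone functions with prescribed plateaus\<close>

lemma collapse_interval:
  fixes v :: real assumes \<epsilon>: "0 < \<epsilon>"
  shows "\<exists>h. continuous_on UNIV h \<and> mono h \<and> (\<forall>x. \<bar>x - v\<bar> \<le> \<epsilon> \<longrightarrow> h x = v) \<and> (\<forall>x. \<bar>x - v\<bar> \<ge> 2 * \<epsilon> \<longrightarrow> h x = x)"
proof -
  \<comment> \<open>\<open>L\<close> raises the points just below \<open>v\<close>: it grows with
    slope \<open>2\<close> from \<open>v - 2 * \<epsilon>\<close> on and reaches \<open>v\<close> at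
    \<open>v - \<epsilon>\<close>. \<open>R\<close> is its mirror image above
    \<open>v\<close>.\<close>
  define L where "L = (\<lambda>x. max x (min v (2 * x - v + 2 * \<epsilon>)))"
  define R where "R = (\<lambda>x. min x (max v (2 * x - v - 2 * \<epsilon>)))"
  have "continuous_on UNIV (\<lambda>x. R (L x))" unfolding L_def R_def by (intro continuous_intros)
  moreover have "mono (\<lambda>x. R (L x))" unfolding L_def R_def by (rule monoI) (auto simp: max_def min_def)
  moreover have "R (L x) = v" if "\<bar>x - v\<bar> \<le> \<epsilon>" for x using that \<epsilon> unfolding L_def R_def by (auto simp: max_def min_def)
  moreover have "R (L x) = x" if "\<bar>x - v\<bar> \<ge> 2 * \<epsilon>" for x using that \<epsilon> unfolding L_def R_def by (auto simp: max_def min_def)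
  ultimately show ?thesis by (intro exI[of _ "\<lambda>x. R (L x)"]) auto
qed

text \<open>The induction needs points that are merely fixed, whence \<open>F\<close>: the function
  for \<open>T\<close> is asked to fix the new value \<open>v\<close>, and is then precomposed with
  a collapse around \<open>v\<close> so narrow that it moves no other value of \<open>T\<close> or
  \<open>F\<close>.\<close>

lemma plateau_function:
  fixes T F :: "real set" assumes "finite T" "finite F"
  shows "\<exists>\<phi> \<epsilon>. continuous_on UNIV \<phi> \<and> mono \<phi> \<and> (\<forall>v\<in>T \<union> F. \<phi> v = v) \<and> 0 < \<epsilon> \<and>
     (\<forall>v\<in>T. \<forall>x. \<bar>x - v\<bar> < \<epsilon> \<longrightarrow> \<phi> x = v)"
  using assms
proof (induction T arbitrary: F)
  case empty
  show ?case by (intro exI[of _ id] exI[of _ 1]) (auto simp: mono_def)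
next
  case (insert v T)
  from insert.IH[of "insert v F"] insert.prems obtain \<phi> \<epsilon> where \<phi>: "continuous_on UNIV \<phi>" "mono \<phi>"
    "\<forall>w\<in>T \<union> insert v F. \<phi> w = w" "0 < \<epsilon>" "\<forall>w\<in>T. \<forall>x. \<bar>x - w\<bar> < \<epsilon> \<longrightarrow> \<phi> x = w" by (metis finite.insertI)
  \<comment> \<open>The plateau radius is half the least distance to another value, because the
    collapse is the identity from \<open>2 * \<delta>\<close> on; the element \<open>1\<close> keeps
    \<open>D\<close> nonempty.\<close>
  define D where "D = insert 1 ((\<lambda>w. \<bar>w - v\<bar>) ` (T \<union> F - {v}))"
  have D: "finite D" "D \<noteq> {}" "\<forall>d\<in>D. 0 < d" using insert by (auto simp: D_def)
  define \<delta> where "\<delta> = Min D / 2"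
  have \<delta>: "0 < \<delta>" using D by (simp add: \<delta>_def)
  have far: "\<bar>w - v\<bar> \<ge> 2 * \<delta>" if "w \<in> T \<union> F" "w \<noteq> v" for w
    using D that Min_le[of D "\<bar>w - v\<bar>"] by (auto simp: \<delta>_def D_def)
  obtain h where h: "continuous_on UNIV h" "mono h" "\<forall>x. \<bar>x - v\<bar> \<le> \<delta> \<longrightarrow> h x = v"
    "\<forall>x. \<bar>x - v\<bar> \<ge> 2 * \<delta> \<longrightarrow> h x = x" using collapse_interval[OF \<delta>] by blast
  have hw: "h w = w" if "w \<in> insert v T \<union> F" for w using that far[of w] h(3,4) \<delta> by (cases "w = v") auto
  \<comment> \<open>Precomposition with \<open>h\<close> may shrink the old plateaus; continuity of
    \<open>h\<close> at its fixed point \<open>w\<close> keeps their width positive.\<close>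
  have "\<exists>\<eta>>0. \<forall>x. \<bar>x - w\<bar> < \<eta> \<longrightarrow> \<bar>h x - w\<bar> < \<epsilon>" if "w \<in> T" for w
  proof -
    have "isCont h w" using h(1) by (simp add: continuous_on_eq_continuous_at)
    then have "\<exists>\<eta>>0. \<forall>x. dist x w < \<eta> \<longrightarrow> dist (h x) (h w) < \<epsilon>" using \<phi>(4) unfolding continuous_at_eps_delta by blast
    then show ?thesis using hw[of w] that by (simp add: dist_real_def)
  qed
  then obtain \<eta> where \<eta>: "\<And>w. w \<in> T \<Longrightarrow> \<eta> w > 0 \<and> (\<forall>x. \<bar>x - w\<bar> < \<eta> w \<longrightarrow> \<bar>h x - w\<bar> < \<epsilon>)" by metis
  define e where "e = Min (insert \<delta> (\<eta> ` T))"
  have e: "0 < e" "e \<le> \<delta>" "\<And>w. w \<in> T \<Longrightarrow> e \<le> \<eta> w" using insert \<delta> \<eta> by (auto simp: e_def)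
  have "continuous_on UNIV (\<lambda>x. \<phi> (h x))" using \<phi>(1) h(1) continuous_on_compose2 by blast
  moreover have "mono (\<lambda>x. \<phi> (h x))" using \<phi>(2) h(2) by (simp add: mono_def)
  moreover have "\<phi> (h x) = w" if "w \<in> insert v T" "\<bar>x - w\<bar> < e" for w x
  proof (cases "w = v")
    case True
    then show ?thesis using that h(3) e(2) \<phi>(3) by auto
  next
    case False
    then show ?thesis using that \<eta>[of w] e(3)[of w] \<phi>(5) by fastforce
  qed
  moreover have "\<forall>w\<in>insert v T \<union> F. \<phi> (h w) = w" using hw \<phi>(3) by auto
  ultimately show ?case using e(1) by blast
qed

lemma natural_plateau:
  assumes "finite T" "0 \<in> T" "1 \<in> T"
  obtains \<phi> \<epsilon> where "natural \<phi>" "0 < \<epsilon>" "\<And>v x. v \<in> T \<Longrightarrow> \<bar>x - v\<bar> < \<epsilon> \<Longrightarrow> \<phi> x = v"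
proof -
  obtain \<phi> \<epsilon> where \<phi>: "continuous_on UNIV \<phi>" "mono \<phi>" "\<forall>v\<in>T \<union> {}. \<phi> v = v" "0 < \<epsilon>"
     "\<forall>v\<in>T. \<forall>x. \<bar>x - v\<bar> < \<epsilon> \<longrightarrow> \<phi> x = v" using plateau_function[OF assms(1), of "{}"] by blast
  then have "natural \<phi>" using assms
    by (auto simp: natural_def mono_def intro: continuous_on_subset mono_onI)
  then show thesis using that \<phi> by blast
qed

section \<open>The quotient by the generated relation is Hausdorff\<close>

lemma naive_collapse:
  assumes C: "cubical_set C" and T: "0 \<in> T" "1 \<in> T" "\<And>i. i < k \<Longrightarrow> t i \<in> T"
    and \<phi>: "natural \<phi>" "\<And>v x. v \<in> T \<Longrightarrow> \<bar>x - v\<bar> < \<epsilon> \<Longrightarrow> \<phi> x = v"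
    and x: "((n, c), s) \<in> nbhd C \<epsilon> (naive_rel C `` {((k, d), t)})"
  shows "(((k, d), t), ((n, c), coord \<phi> n s)) \<in> naive_rel C"
proof -
  obtain p where p: "p \<in> icube n" "(((k, d), t), ((n, c), p)) \<in> naive_rel C" "\<forall>j<n. close \<epsilon> (p j) (s j)" "s \<in> icube n"
    using x by (auto simp: nbhd_def)
  show ?thesis
  \<comment> \<open>The representative \<open>p\<close> near \<open>s\<close> has in
    \<open>T\<close> all coordinates that matter, and \<open>\<phi>\<close> moves those of
    \<open>s\<close> onto them exactly. What \<open>\<phi>\<close> does to the remaining coordinates
    is harmless.\<close>
  proof (rule naive_irrelevant[OF C T p(2) natural_coord_in[OF \<phi>(1) p(4)]])
    fix j assume j: "j < n" "p j \<in> T"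
    then have "\<bar>s j - p j\<bar> < \<epsilon>" using p(3) by (simp add: close_def)
    then show "coord \<phi> n s j = p j" using \<phi>(2)[OF j(2)] j(1) by (simp add: coord_def)
  qed simp_all
qed

lemma naive_image_open:
  assumes C: "cubical_set C" and S: "S \<subseteq> pts C" "\<And>x y. (x, y) \<in> naive_rel C \<Longrightarrow> x \<in> S \<longleftrightarrow> y \<in> S"
    and op: "\<And>n c. c \<in> cells C n \<Longrightarrow> openin (icube_top n) {t. ((n, c), t) \<in> S}"
  shows "openin (top_of (quotient_stream (cubes_of C) (naive_rel C))) {naive_rel C `` {x} | x. x \<in> S}"
proof -
  have "\<Union>{naive_rel C `` {x} | x. x \<in> S} = S"
  proof (intro subset_antisym subsetI)
    fix y assume "y \<in> S"
    then have "y \<in> naive_rel C `` {y}" using S(1) equiv_class_self[OF naive_equiv[OF C]] by blast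
    then show "y \<in> \<Union>{naive_rel C `` {x} | x. x \<in> S}" using \<open>y \<in> S\<close> by blast
  qed (use S(2) in blast)
  moreover have "{naive_rel C `` {x} | x. x \<in> S} \<subseteq> pts C // naive_rel C"
    using S(1) by (auto intro!: quotientI)
  ultimately show ?thesis
    using S(1) op naive_equiv[OF C]
    by (simp add: quotient_stream_def openin_quotient_topology topspace_cubes_of openin_cubes_of)
qed

lemma topspace_quotient:
  assumes "equiv (topspace (top_of X)) E"
  shows "topspace (top_of (quotient_stream X E)) = topspace (top_of X) // E"
proof -
  have "openin (top_of (quotient_stream X E)) U \<longleftrightarrow> U \<subseteq> topspace (top_of X) // E \<and> openin (top_of X) (\<Union>U)" for U
    using openin_quotient_topology[OF assms] by (simp add: quotient_stream_def)
  moreover have "\<Union>(topspace (top_of X) // E) = topspace (top_of X)" by (rule Union_quotient[OF assms])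
  ultimately show ?thesis
    by (intro subset_antisym) (metis openin_topspace, metis openin_subset openin_topspace order_refl)
qed

text \<open>One collapse is chosen for the coordinates of both points together. If their
  neighbourhoods met, a common point would be moved by it onto both of them.\<close>

lemma naive_Hausdorff:
  assumes C: "cubical_set C"
  shows "Hausdorff_space (top_of (quotient_stream (cubes_of C) (naive_rel C)))" (is "Hausdorff_space ?X")
  unfolding Hausdorff_space_def
proof (intro allI impI)
  note eq = naive_equiv[OF C]
  have tr: "(x, y) \<in> naive_rel C \<Longrightarrow> (y, w) \<in> naive_rel C \<Longrightarrow> (x, w) \<in> naive_rel C"
    and sy: "(x, y) \<in> naive_rel C \<Longrightarrow> (y, x) \<in> naive_rel C" for x y w
    using eq by (auto elim!: equivE dest: transD symD)
  fix P Q assume PQ: "P \<in> topspace ?X \<and> Q \<in> topspace ?X \<and> P \<noteq> Q"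
  then have "P \<in> pts C // naive_rel C" "Q \<in> pts C // naive_rel C"
    using topspace_quotient[of "cubes_of C" "naive_rel C"] eq by (simp_all add: topspace_cubes_of)
  then obtain k d t l e u where z: "((k, d), t) \<in> pts C" "P = naive_rel C `` {((k, d), t)}"
    "((l, e), u) \<in> pts C" "Q = naive_rel C `` {((l, e), u)}" by (elim quotientE) auto
  define T where "T = {0, 1} \<union> t ` {..<k} \<union> u ` {..<l}"
  have T: "finite T" "0 \<in> T" "1 \<in> T" "\<And>i. i < k \<Longrightarrow> t i \<in> T" "\<And>i. i < l \<Longrightarrow> u i \<in> T" by (auto simp: T_def)
  obtain \<phi> \<epsilon> where \<phi>: "natural \<phi>" "0 < \<epsilon>" "\<And>v x. v \<in> T \<Longrightarrow> \<bar>x - v\<bar> < \<epsilon> \<Longrightarrow> \<phi> x = v"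
    using natural_plateau[OF T(1-3)] by blast
  define O' where "O' = (\<lambda>Z. {naive_rel C `` {x} | x. x \<in> nbhd C \<epsilon> Z})"
  have sat: "x \<in> Z \<longleftrightarrow> y \<in> Z" if "(x, y) \<in> naive_rel C" "Z = naive_rel C `` {a}" for x y Z a
    using that tr sy by blast
  have nsat: "x \<in> nbhd C \<epsilon> Z \<longleftrightarrow> y \<in> nbhd C \<epsilon> Z" if "(x, y) \<in> naive_rel C" "Z = naive_rel C `` {a}" for x y Z a
    by (rule nbhd_saturated[OF C \<phi>(2) _ that(1)]) (use sat that(2) in blast)
  have op: "openin ?X (O' Z)" if "Z = naive_rel C `` {a}" for Z a
    unfolding O'_def by (rule naive_image_open[OF C nbhd_sub nsat[OF _ that] openin_nbhd])
  have self: "Z \<in> O' Z" if "Z = naive_rel C `` {a}" "a \<in> pts C" for Z a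
  proof -
    have "a \<in> Z" using that eq by (auto simp: equiv_def refl_on_def)
    moreover have "Z \<subseteq> pts C" using that eq by (auto simp: equiv_def)
    ultimately have "a \<in> nbhd C \<epsilon> Z" using nbhd_incl[OF \<phi>(2)] by blast
    then show ?thesis using that(1) unfolding O'_def by blast
  qed
  have "disjnt (O' P) (O' Q)"
  proof (rule ccontr)
    assume "\<not> disjnt (O' P) (O' Q)"
    then obtain x y where xy: "x \<in> nbhd C \<epsilon> P" "y \<in> nbhd C \<epsilon> Q" "naive_rel C `` {x} = naive_rel C `` {y}"
      by (auto simp: disjnt_iff O'_def)
    then have "(x, y) \<in> naive_rel C" using eq_equiv_class[OF xy(3) eq] nbhd_sub by blast
    then have "x \<in> nbhd C \<epsilon> Q" using nsat[OF _ z(4)] xy(2) by blast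
    moreover obtain n c s where x: "x = ((n, c), s)" by (metis prod.exhaust)
    ultimately have x': "((n, c), s) \<in> nbhd C \<epsilon> P" "((n, c), s) \<in> nbhd C \<epsilon> Q" using xy(1) by auto
    have "(((k, d), t), ((n, c), coord \<phi> n s)) \<in> naive_rel C"
      by (rule naive_collapse[where T = T and \<epsilon> = \<epsilon>]) (fact C T(2-4) \<phi>(1,3) x'(1)[unfolded z(2)])+
    moreover have "(((l, e), u), ((n, c), coord \<phi> n s)) \<in> naive_rel C"
      by (rule naive_collapse[where T = T and \<epsilon> = \<epsilon>]) (fact C T(2,3,5) \<phi>(1,3) x'(2)[unfolded z(4)])+
    ultimately have "(((k, d), t), ((l, e), u)) \<in> naive_rel C" using tr sy by blast
    then have "P = Q" unfolding z(2,4) by (rule equiv_class_eq[OF eq])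
    then show False using PQ by blast
  qed
  then show "\<exists>U V. openin ?X U \<and> openin ?X V \<and> P \<in> U \<and> Q \<in> V \<and> disjnt U V"
    using op[OF z(2)] op[OF z(4)] self[OF z(2,1)] self[OF z(4,3)] by blast
qed

lemma Hausdorff_imp_weak_Hausdorff: "Hausdorff_space X \<Longrightarrow> weak_Hausdorff_space X"
  unfolding weak_Hausdorff_space_def
  by (meson compact_space_def compactin_imp_closedin image_compactin)

text \<open>The generated relation lies in every relation intersected in \<open>real_rel\<close>;
  since its quotient is Hausdorff, it is one of them itself.\<close>

lemma real_rel_naive:
  assumes C: "cubical_set C" shows "real_rel C = naive_rel C"
proof
  show "real_rel C \<subseteq> naive_rel C"
    unfolding real_rel_def topspace_cubes_of
    using naive_equiv[OF C] Hausdorff_imp_weak_Hausdorff[OF naive_Hausdorff[OF C]] equiv_gen_incl[of "real_gen C" "pts C"]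
    unfolding naive_rel_def by blast
  show "naive_rel C \<subseteq> real_rel C"
    unfolding real_rel_def topspace_cubes_of naive_rel_def using equiv_gen_least by blast
qed

section \<open>Points and maps of the realization\<close>

definition cell_pt :: "'c cubical \<Rightarrow> nat \<Rightarrow> 'c \<Rightarrow> (nat \<Rightarrow> real) \<Rightarrow> 'c real_pt set" where
  "cell_pt C n c t = real_rel C `` {((n, c), t)}"

text \<open>Descent along the quotient by evaluation at a chosen representative. It is meaningful
  for families compatible with the generators, as \<open>desc_cell_pt\<close> asks.\<close>

definition desc :: "(nat \<Rightarrow> 'c \<Rightarrow> (nat \<Rightarrow> real) \<Rightarrow> 'b) \<Rightarrow> 'c real_pt set \<Rightarrow> 'b" where
  "desc J P = (case SOME x. x \<in> P of ((n, c), t) \<Rightarrow> J n c t)"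

abbreviation rtop :: "'c cubical \<Rightarrow> 'c real_pt set topology" where
  "rtop C \<equiv> top_of (realization C)"

lemma real_equiv: "cubical_set C \<Longrightarrow> equiv (pts C) (real_rel C)"
  by (simp add: real_rel_naive naive_equiv)

lemma topspace_realization: "cubical_set C \<Longrightarrow> topspace (rtop C) = pts C // real_rel C"
  using topspace_quotient[of "cubes_of C" "real_rel C"] real_equiv[of C] by (simp add: realization_def topspace_cubes_of)

lemma cell_pt_in:
  "cubical_set C \<Longrightarrow> c \<in> cells C n \<Longrightarrow> t \<in> icube n \<Longrightarrow> cell_pt C n c t \<in> topspace (rtop C)"
  by (simp add: topspace_realization cell_pt_def quotientI pts_def)

lemma cell_pt_cases:
  assumes "cubical_set C" "P \<in> topspace (rtop C)"
  obtains n c t where "c \<in> cells C n" "t \<in> icube n" "P = cell_pt C n c t"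
  using assms by (auto simp: topspace_realization cell_pt_def pts_def elim!: quotientE)

lemma cell_pt_eq_iff:
  assumes "cubical_set C" "c \<in> cells C n" "t \<in> icube n" "d \<in> cells C m" "s \<in> icube m"
  shows "cell_pt C n c t = cell_pt C m d s \<longleftrightarrow> (((n, c), t), ((m, d), s)) \<in> real_rel C"
  unfolding cell_pt_def
  by (rule eq_equiv_class_iff[OF real_equiv[OF assms(1)]]) (use assms in \<open>auto simp: pts_def\<close>)

lemma mem_Union_realization:
  assumes C: "cubical_set C" and U: "U \<subseteq> topspace (rtop C)" and ct: "c \<in> cells C n" "t \<in> icube n"
  shows "((n, c), t) \<in> \<Union>U \<longleftrightarrow> cell_pt C n c t \<in> U"
proof
  assume "((n, c), t) \<in> \<Union>U"
  then obtain P where P: "P \<in> U" "((n, c), t) \<in> P" by blast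
  then obtain m d s where "d \<in> cells C m" "s \<in> icube m" "P = cell_pt C m d s" using U cell_pt_cases[OF C] by blast
  then have "cell_pt C m d s = cell_pt C n c t" using P(2) ct C by (subst cell_pt_eq_iff) (auto simp: cell_pt_def)
  then show "cell_pt C n c t \<in> U" using P \<open>P = _\<close> by simp
next
  have "((n, c), t) \<in> cell_pt C n c t" unfolding cell_pt_def
    by (rule equiv_class_self[OF real_equiv[OF C]]) (use ct in \<open>simp add: pts_def\<close>)
  then show "cell_pt C n c t \<in> U \<Longrightarrow> ((n, c), t) \<in> \<Union>U" by blast
qed

lemma slice_realization:
  assumes C: "cubical_set C" and U: "U \<subseteq> topspace (rtop C)" and c: "c \<in> cells C n"
  shows "{t. ((n, c), t) \<in> \<Union>U} = {t \<in> icube n. cell_pt C n c t \<in> U}"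
proof -
  have "\<Union>U \<subseteq> pts C" using U Union_quotient[OF real_equiv[OF C]] by (auto simp: topspace_realization[OF C])
  then have "t \<in> icube n" if "((n, c), t) \<in> \<Union>U" for t using that by (auto simp: pts_def)
  then show ?thesis using mem_Union_realization[OF C U c] by blast
qed

lemma openin_realization:
  assumes C: "cubical_set C"
  shows "openin (rtop C) U \<longleftrightarrow> U \<subseteq> topspace (rtop C) \<and>
     (\<forall>n. \<forall>c\<in>cells C n. openin (icube_top n) {t \<in> icube n. cell_pt C n c t \<in> U})"
proof -
  have *: "openin (rtop C) U \<longleftrightarrow> U \<subseteq> topspace (rtop C) \<and> openin (top_of (cubes_of C)) (\<Union>U)"
    using openin_quotient_topology[of "top_of (cubes_of C)" "real_rel C" U] real_equiv[OF C]
    unfolding topspace_realization[OF C] by (simp add: realization_def quotient_stream_def topspace_cubes_of)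
  have "\<Union>U \<subseteq> pts C" if "U \<subseteq> topspace (rtop C)"
    using that Union_quotient[OF real_equiv[OF C]] by (auto simp: topspace_realization[OF C])
  then show ?thesis unfolding * openin_cubes_of using slice_realization[OF C, of U] by auto
qed

lemma cell_pt_act:
  assumes C: "cubical_set C" and b: "box m n \<psi>" "c \<in> cells C n" "t \<in> icube m"
  shows "cell_pt C m (act C m n \<psi> c) t = cell_pt C n c (geom m n \<psi> t)"
proof -
  have "(((m, act C m n \<psi> c), t), ((n, c), geom m n \<psi> t)) \<in> real_gen C" using b unfolding real_gen_def by blast
  then have "(((m, act C m n \<psi> c), t), ((n, c), geom m n \<psi> t)) \<in> real_rel C"
    unfolding real_rel_naive[OF C] naive_rel_def using equiv_gen_incl by blast
  then show ?thesis by (subst cell_pt_eq_iff) (use C b act_in geom_in in auto)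
qed

lemma desc_cell_pt:
  assumes C: "cubical_set C" and c: "c \<in> cells C n" "t \<in> icube n"
    and J: "\<And>m n \<psi> c t. box m n \<psi> \<Longrightarrow> c \<in> cells C n \<Longrightarrow> t \<in> icube m \<Longrightarrow> J m (act C m n \<psi> c) t = J n c (geom m n \<psi> t)"
  shows "desc J (cell_pt C n c t) = J n c t"
proof -
  define x where "x = (SOME x. x \<in> cell_pt C n c t)"
  have "((n, c), t) \<in> cell_pt C n c t" unfolding cell_pt_def
    by (rule equiv_class_self[OF real_equiv[OF C]]) (use c in \<open>simp add: pts_def\<close>)
  then have "x \<in> cell_pt C n c t" unfolding x_def by (rule someI)
  then have x: "(((n, c), t), x) \<in> equiv_gen (pts C) (real_gen C)"
    by (simp add: cell_pt_def real_rel_naive[OF C] naive_rel_def)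
  have "(case ((n, c), t) of ((n, c), t) \<Rightarrow> J n c t) = (case x of ((n, c), t) \<Rightarrow> J n c t)"
    by (rule equiv_gen_invariant[OF real_gen_sub[OF C] _ x]) (use J in \<open>auto simp: real_gen_def\<close>)
  then show ?thesis by (simp add: desc_def x_def)
qed

lemma natural_id: "natural (\<lambda>x. x)"
  by (auto simp: natural_def mono_on_def)

text \<open>The neighbourhood is that of \<open>naive_Hausdorff\<close> for a single point. One
  function \<open>\<phi>\<close> contracts all of it, in whichever cell a point is represented; this
  takes the place of contractible charts.\<close>

lemma realization_collapse:
  assumes C: "cubical_set C" and P: "P \<in> topspace (rtop C)"
  obtains U \<phi> where "openin (rtop C) U" "P \<in> U" "natural \<phi>"
    "\<And>n c t. c \<in> cells C n \<Longrightarrow> t \<in> icube n \<Longrightarrow> cell_pt C n c t \<in> U \<Longrightarrow> cell_pt C n c (coord \<phi> n t) = P"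
proof -
  note eq = naive_equiv[OF C]
  have tr: "(x, y) \<in> naive_rel C \<Longrightarrow> (y, w) \<in> naive_rel C \<Longrightarrow> (x, w) \<in> naive_rel C"
    and sy: "(x, y) \<in> naive_rel C \<Longrightarrow> (y, x) \<in> naive_rel C" for x y w
    using eq by (auto elim!: equivE dest: transD symD)
  obtain k d t where z: "d \<in> cells C k" "t \<in> icube k" "P = cell_pt C k d t" using cell_pt_cases[OF C P] by blast
  define T where "T = {0, 1} \<union> t ` {..<k}"
  have T: "finite T" "0 \<in> T" "1 \<in> T" "\<And>i. i < k \<Longrightarrow> t i \<in> T" by (auto simp: T_def)
  obtain \<phi> \<epsilon> where \<phi>: "natural \<phi>" "0 < \<epsilon>" "\<And>v x. v \<in> T \<Longrightarrow> \<bar>x - v\<bar> < \<epsilon> \<Longrightarrow> \<phi> x = v"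
    using natural_plateau[OF T(1-3)] by blast
  have Pn: "P = naive_rel C `` {((k, d), t)}" by (simp add: z cell_pt_def real_rel_naive[OF C])
  have sat: "x \<in> nbhd C \<epsilon> P \<longleftrightarrow> y \<in> nbhd C \<epsilon> P" if "(x, y) \<in> naive_rel C" for x y
    by (rule nbhd_saturated[OF C \<phi>(2) _ that]) (use Pn tr sy in blast)
  define U where "U = {naive_rel C `` {x} | x. x \<in> nbhd C \<epsilon> P}"
  have zz: "((k, d), t) \<in> P" unfolding Pn
    by (rule equiv_class_self[OF eq]) (use z in \<open>simp add: pts_def\<close>)
  show thesis
  proof
    show "openin (rtop C) U"
      unfolding U_def realization_def real_rel_naive[OF C]
      by (rule naive_image_open[OF C nbhd_sub sat openin_nbhd])
    have "P \<subseteq> pts C" using eq unfolding Pn by (auto simp: equiv_def)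
    then have "((k, d), t) \<in> nbhd C \<epsilon> P" using nbhd_incl[OF \<phi>(2)] zz by blast
    then show "P \<in> U" unfolding U_def using Pn by blast
    show "natural \<phi>" by fact
    show "cell_pt C n c (coord \<phi> n s) = P" if c: "c \<in> cells C n" "s \<in> icube n" "cell_pt C n c s \<in> U" for n c s
    proof -
      obtain x where x: "x \<in> nbhd C \<epsilon> P" "naive_rel C `` {((n, c), s)} = naive_rel C `` {x}"
        using c(3) by (auto simp: U_def cell_pt_def real_rel_naive[OF C])
      then have "(((n, c), s), x) \<in> naive_rel C" using eq_equiv_class[OF x(2) eq] nbhd_sub by blast
      then have s: "((n, c), s) \<in> nbhd C \<epsilon> P" using sat x(1) by blast
      have "(((k, d), t), ((n, c), coord \<phi> n s)) \<in> naive_rel C"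
        by (rule naive_collapse[where T = T and \<epsilon> = \<epsilon>]) (fact C T(2-4) \<phi>(1,3) s[unfolded Pn])+
      then show ?thesis unfolding z(3)
        by (subst eq_commute, subst cell_pt_eq_iff) (use C z c natural_coord_in[OF \<phi>(1)] in \<open>auto simp: real_rel_naive\<close>)
    qed
  qed
qed

section \<open>Circulations\<close>

lemma icube_circ_gen: "openin (icube_top n) V \<Longrightarrow> icube_circ n V = preorder_gen V (icube_loc n V)"
  using icube_circ_eq icube_circ_props by blast

lemma icube_circ_preorder: "openin (icube_top n) V \<Longrightarrow> preorder_on V (icube_circ n V)"
  by (simp add: icube_circ_gen preorder_gen_preorder icube_loc_sub)

lemma icube_circ_top: "icube_circ n (icube n) = icube_order n"
  using icube_circ_props by blast

lemma icube_circ_seg: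
  "openin (icube_top n) V \<Longrightarrow> (s, t) \<in> icube_order n \<Longrightarrow> icube_seg s t n \<subseteq> V \<Longrightarrow> (s, t) \<in> icube_circ n V"
  using preorder_gen_incl[of "icube_loc n V" V] by (auto simp: icube_circ_gen icube_loc_def)

lemma openin_icube: "openin (icube_top n) (icube n)"
  by (metis openin_topspace topspace_icube_top)

text \<open>The circulation on \<open>V\<close> is generated by the pairs whose order interval lies
  in \<open>V\<close>; by \<open>icube_path\<close> the segment joining such a pair breaks into
  steps small enough to be covered by the hypothesis.\<close>

lemma icube_circ_local:
  assumes V: "openin (icube_top n) V" and P: "preorder_on V P"
    and loc: "\<And>t. t \<in> V \<Longrightarrow> \<exists>B. openin (icube_top n) B \<and> t \<in> B \<and>
      (\<forall>s\<in>B \<inter> V. \<forall>s'\<in>B \<inter> V. (s, s') \<in> icube_order n \<longrightarrow> (s, s') \<in> P)"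
  shows "icube_circ n V \<subseteq> P"
  unfolding icube_circ_gen[OF V]
proof (rule preorder_gen_least[OF P], rule subrelI)
  fix x y assume xy: "(x, y) \<in> icube_loc n V"
  define \<O> where "\<O> = {B. openin (icube_top n) B \<and> B \<subseteq> V \<and> (\<forall>s\<in>B. \<forall>s'\<in>B. (s, s') \<in> icube_order n \<longrightarrow> (s, s') \<in> P)}"
  have U: "\<Union>\<O> = V"
  proof (intro subset_antisym subsetI)
    fix t assume t: "t \<in> V"
    then obtain B where B: "openin (icube_top n) B" "t \<in> B"
      "\<forall>s\<in>B \<inter> V. \<forall>s'\<in>B \<inter> V. (s, s') \<in> icube_order n \<longrightarrow> (s, s') \<in> P" using loc by blast
    then have "B \<inter> V \<in> \<O>" using V by (auto simp: \<O>_def)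
    then show "t \<in> \<Union>\<O>" using B(2) t by blast
  qed (auto simp: \<O>_def)
  show "(x, y) \<in> P"
  proof (rule icube_path[of x y n \<O> P])
    show "icube_loc n B \<subseteq> P" if B: "B \<in> \<O>" for B
    proof (rule subrelI)
      fix s s' assume ss: "(s, s') \<in> icube_loc n B"
      then have "s \<in> B" "s' \<in> B" using icube_loc_sub[of n B] by auto
      then show "(s, s') \<in> P" using ss B by (auto simp: \<O>_def icube_loc_def)
    qed
  qed (use xy U P in \<open>auto simp: \<O>_def\<close>)
qed

lemma icube_order_local:
  assumes P: "preorder_on (icube n) P"
    and loc: "\<And>t. t \<in> icube n \<Longrightarrow> \<exists>B. openin (icube_top n) B \<and> t \<in> B \<and>
      (\<forall>s\<in>B \<inter> icube n. \<forall>s'\<in>B \<inter> icube n. (s, s') \<in> icube_order n \<longrightarrow> (s, s') \<in> P)"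
  shows "icube_order n \<subseteq> P"
  using icube_circ_local[OF openin_icube P loc] by (simp add: icube_circ_top)

text \<open>The part of the stream axioms on a target that lets maps into it be checked on a
  generating set of pairs.\<close>

definition circ_preorder :: "'a stream \<Rightarrow> bool" where
  "circ_preorder X \<longleftrightarrow> (\<forall>U. openin (top_of X) U \<longrightarrow> preorder_on U (circ X U))"

lemma circ_preorder_dicube: "circ_preorder (dicube n)"
  by (simp add: circ_preorder_def dicube_def icube_circ_preorder)

lemma openin_preimage_cube:
  "continuous_map (icube_top n) Y f \<Longrightarrow> openin Y U \<Longrightarrow> openin (icube_top n) {z \<in> icube n. f z \<in> U}"
  using openin_continuous_map_preimage by fastforce

lemma preorder_on_pullback:
  assumes "preorder_on U R" "\<And>x. x \<in> V \<Longrightarrow> f x \<in> U"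
  shows "preorder_on V {(x, y). x \<in> V \<and> y \<in> V \<and> (f x, f y) \<in> R}"
  using assms unfolding preorder_on_def refl_on_def trans_def by blast

lemma stream_map_dicube_local:
  assumes f: "continuous_map (icube_top n) (top_of Y) f" and Y: "circ_preorder Y"
    and loc: "\<And>U t. openin (top_of Y) U \<Longrightarrow> t \<in> icube n \<Longrightarrow> f t \<in> U \<Longrightarrow>
      \<exists>B. openin (icube_top n) B \<and> t \<in> B \<and> (\<forall>s\<in>B \<inter> icube n. \<forall>s'\<in>B \<inter> icube n. f s \<in> U \<longrightarrow> f s' \<in> U \<longrightarrow>
        (s, s') \<in> icube_order n \<longrightarrow> (f s, f s') \<in> circ Y U)"
  shows "stream_map (dicube n) Y f"
proof -
  have "icube_circ n {z \<in> icube n. f z \<in> U} \<subseteq>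
      {(x, y). x \<in> {z \<in> icube n. f z \<in> U} \<and> y \<in> {z \<in> icube n. f z \<in> U} \<and> (f x, f y) \<in> circ Y U}"
    if U: "openin (top_of Y) U" for U
  proof (rule icube_circ_local[OF openin_preimage_cube[OF f U] preorder_on_pullback])
    show "preorder_on U (circ Y U)" using Y U by (simp add: circ_preorder_def)
    fix t assume "t \<in> {z \<in> icube n. f z \<in> U}"
    then obtain B where "openin (icube_top n) B" "t \<in> B" "\<forall>s\<in>B \<inter> icube n. \<forall>s'\<in>B \<inter> icube n. f s \<in> U \<longrightarrow> f s' \<in> U \<longrightarrow>
        (s, s') \<in> icube_order n \<longrightarrow> (f s, f s') \<in> circ Y U" using loc[OF U, of t] by auto
    then show "\<exists>B. openin (icube_top n) B \<and> t \<in> B \<and>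
      (\<forall>s\<in>B \<inter> {z \<in> icube n. f z \<in> U}. \<forall>s'\<in>B \<inter> {z \<in> icube n. f z \<in> U}. (s, s') \<in> icube_order n \<longrightarrow>
        (s, s') \<in> {(x, y). x \<in> {z \<in> icube n. f z \<in> U} \<and> y \<in> {z \<in> icube n. f z \<in> U} \<and> (f x, f y) \<in> circ Y U})"
      by (intro exI[of _ B]) auto
  qed auto
  then show ?thesis using f by (auto simp: stream_map_def dicube_def)
qed

lemma stream_map_dicubeD:
  assumes "stream_map (dicube n) Y f"
  shows "continuous_map (icube_top n) (top_of Y) f"
    "openin (top_of Y) U \<Longrightarrow> (x, y) \<in> icube_circ n {z \<in> icube n. f z \<in> U} \<Longrightarrow> (f x, f y) \<in> circ Y U"
  using assms by (auto simp: stream_map_def dicube_def)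

text \<open>A convex neighbourhood of \<open>f t\<close> inside \<open>U\<close> contains the whole
  order interval between two of its points, so ordered images in it are related in the circulation
  on \<open>U\<close>.\<close>

lemma stream_map_monotone:
  assumes f: "continuous_map (icube_top m) (icube_top n) f"
    and mono: "\<And>s t. (s, t) \<in> icube_order m \<Longrightarrow> (f s, f t) \<in> icube_order n"
  shows "stream_map (dicube m) (dicube n) f"
proof (rule stream_map_dicube_local[OF _ circ_preorder_dicube])
  show "continuous_map (icube_top m) (top_of (dicube n)) f" using f by (simp add: dicube_def)
  fix U t assume U: "openin (top_of (dicube n)) U" and t: "t \<in> icube m" "f t \<in> U"
  then have U': "openin (icube_top n) U" by (simp add: dicube_def)
  obtain B where B: "openin (icube_top n) B" "f t \<in> B" "B \<subseteq> U" "\<And>a b. a \<in> B \<Longrightarrow> b \<in> B \<Longrightarrow> icube_seg a b n \<subseteq> B"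
    using icube_convex_nbhd[OF U' t(2)] by blast
  have "(f s, f s') \<in> icube_circ n U" if "f s \<in> B" "f s' \<in> B" "(s, s') \<in> icube_order m" for s s'
    by (rule icube_circ_seg[OF U' mono[OF that(3)]]) (use B that in blast)
  then show "\<exists>B. openin (icube_top m) B \<and> t \<in> B \<and> (\<forall>s\<in>B \<inter> icube m. \<forall>s'\<in>B \<inter> icube m. f s \<in> U \<longrightarrow> f s' \<in> U \<longrightarrow>
        (s, s') \<in> icube_order m \<longrightarrow> (f s, f s') \<in> circ (dicube n) U)"
    using openin_preimage_cube[OF f B(1)] B(2) t(1)
    by (intro exI[of _ "{z \<in> icube m. f z \<in> B}"]) (auto simp: dicube_def)
qed

lemma stream_map_compose:
  assumes f: "stream_map X Y f" and g: "stream_map Y Z g"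
  shows "stream_map X Z (\<lambda>x. g (f x))"
proof -
  have c: "continuous_map (top_of X) (top_of Y) f" "continuous_map (top_of Y) (top_of Z) g"
    using f g by (auto simp: stream_map_def)
  have "(g (f x), g (f y)) \<in> circ Z U" if U: "openin (top_of Z) U" "(x, y) \<in> circ X {z \<in> topspace (top_of X). g (f z) \<in> U}" for U x y
  proof -
    let ?V = "{z \<in> topspace (top_of Y). g z \<in> U}"
    have "{z \<in> topspace (top_of X). g (f z) \<in> U} = {z \<in> topspace (top_of X). f z \<in> ?V}"
      using c(1) by (auto simp: continuous_map_def)
    moreover have "openin (top_of Y) ?V" using c(2) U(1) openin_continuous_map_preimage by blast
    ultimately have "(f x, f y) \<in> circ Y ?V" using f U(2) by (auto simp: stream_map_def)
    then show ?thesis using g U(1) by (auto simp: stream_map_def)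
  qed
  then show ?thesis using continuous_map_compose[OF c] by (auto simp: stream_map_def o_def)
qed

text \<open>Singular cubes are extensional functions while composites are not; this passes from one
  to the other.\<close>

lemma stream_map_dicube_cong:
  assumes f: "stream_map (dicube n) Y f" and fg: "\<And>t. t \<in> icube n \<Longrightarrow> f t = g t"
  shows "stream_map (dicube n) Y g"
proof -
  have c: "continuous_map (icube_top n) (top_of Y) g"
    using stream_map_dicubeD(1)[OF f] by (rule continuous_map_eq) (use fg in auto)
  have "(g x, g y) \<in> circ Y U" if U: "openin (top_of Y) U" "(x, y) \<in> icube_circ n {z \<in> icube n. g z \<in> U}" for U x y
  proof -
    have "{z \<in> icube n. f z \<in> U} = {z \<in> icube n. g z \<in> U}" using fg by auto
    then have "(f x, f y) \<in> circ Y U" using stream_map_dicubeD(2)[OF f U(1)] U(2) by auto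
    moreover have "x \<in> icube n" "y \<in> icube n"
      using U(2) preorder_onD(1)[OF icube_circ_preorder[OF openin_preimage_cube[OF c U(1)]]] by auto
    ultimately show ?thesis using fg by simp
  qed
  then show ?thesis using c by (auto simp: stream_map_def dicube_def)
qed

lemma circ_realization:
  assumes C: "cubical_set C" and U: "openin (rtop C) U"
  shows "circ (realization C) U = preorder_gen U {(cell_pt C n c s, cell_pt C n c t) | n c s t.
     c \<in> cells C n \<and> (s, t) \<in> icube_circ n {t \<in> icube n. cell_pt C n c t \<in> U}}"
proof -
  have sl: "{t. ((n, c), t) \<in> \<Union>U} = {t \<in> icube n. cell_pt C n c t \<in> U}" if "c \<in> cells C n" for n c
    using slice_realization[OF C openin_subset[OF U] that] .
  have "circ (cubes_of C) (\<Union>U) = {(((n, c), s), ((n, c), t)) | n c s t.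
     c \<in> cells C n \<and> (s, t) \<in> icube_circ n {t. ((n, c), t) \<in> \<Union>U}}"
    by (auto simp: cubes_of_def coproduct_stream_def dicube_def)
  also have "\<dots> = {(((n, c), s), ((n, c), t)) | n c s t.
     c \<in> cells C n \<and> (s, t) \<in> icube_circ n {t \<in> icube n. cell_pt C n c t \<in> U}}"
    by (intro Collect_cong ex_cong1) (simp add: sl del: Union_iff cong: conj_cong)
  finally have *: "circ (cubes_of C) (\<Union>U) = {(((n, c), s), ((n, c), t)) | n c s t.
     c \<in> cells C n \<and> (s, t) \<in> icube_circ n {t \<in> icube n. cell_pt C n c t \<in> U}}" .
  have "{(real_rel C `` {x}, real_rel C `` {y}) | x y. (x, y) \<in> circ (cubes_of C) (\<Union>U)} =
      {(cell_pt C n c s, cell_pt C n c t) | n c s t.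
     c \<in> cells C n \<and> (s, t) \<in> icube_circ n {t \<in> icube n. cell_pt C n c t \<in> U}}"
    unfolding * cell_pt_def by blast
  then show ?thesis by (simp add: realization_def quotient_stream_def)
qed

lemma openin_slice:
  "cubical_set C \<Longrightarrow> openin (rtop C) U \<Longrightarrow> c \<in> cells C n \<Longrightarrow> openin (icube_top n) {t \<in> icube n. cell_pt C n c t \<in> U}"
  using openin_realization by blast

lemma circ_realization_gen_sub:
  assumes C: "cubical_set C" and U: "openin (rtop C) U"
  shows "{(cell_pt C n c s, cell_pt C n c t) | n c s t.
     c \<in> cells C n \<and> (s, t) \<in> icube_circ n {t \<in> icube n. cell_pt C n c t \<in> U}} \<subseteq> U \<times> U"
proof -
  have "(s, t) \<in> {t \<in> icube n. cell_pt C n c t \<in> U} \<times> {t \<in> icube n. cell_pt C n c t \<in> U}"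
    if "c \<in> cells C n" "(s, t) \<in> icube_circ n {t \<in> icube n. cell_pt C n c t \<in> U}" for n c s t
    using preorder_onD(1)[OF icube_circ_preorder[OF openin_slice[OF C U that(1)]]] that(2) by blast
  then show ?thesis by auto
qed

lemma circ_preorder_realization: "cubical_set C \<Longrightarrow> circ_preorder (realization C)"
  by (simp add: circ_preorder_def circ_realization preorder_gen_preorder circ_realization_gen_sub)

text \<open>The analogue of \<open>icube_circ_local\<close> for the colimit, whose circulation is
  generated by those of the cubes: one cell and one point of it are considered at a time.\<close>

lemma circ_realization_local:
  assumes C: "cubical_set C" and U: "openin (rtop C) U" and P: "preorder_on U P"
    and loc: "\<And>n c t. c \<in> cells C n \<Longrightarrow> t \<in> icube n \<Longrightarrow> cell_pt C n c t \<in> U \<Longrightarrow>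
      \<exists>B. openin (icube_top n) B \<and> t \<in> B \<and> (\<forall>s\<in>B \<inter> icube n. \<forall>s'\<in>B \<inter> icube n.
        cell_pt C n c s \<in> U \<longrightarrow> cell_pt C n c s' \<in> U \<longrightarrow> (s, s') \<in> icube_order n \<longrightarrow>
        (cell_pt C n c s, cell_pt C n c s') \<in> P)"
  shows "circ (realization C) U \<subseteq> P"
  unfolding circ_realization[OF C U]
proof (rule preorder_gen_least[OF P], clarify)
  fix n c s t assume c: "c \<in> cells C n" and st: "(s, t) \<in> icube_circ n {t \<in> icube n. cell_pt C n c t \<in> U}"
  have "icube_circ n {t \<in> icube n. cell_pt C n c t \<in> U} \<subseteq> {(x, y). x \<in> {t \<in> icube n. cell_pt C n c t \<in> U} \<and>
     y \<in> {t \<in> icube n. cell_pt C n c t \<in> U} \<and> (cell_pt C n c x, cell_pt C n c y) \<in> P}"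
  proof (rule icube_circ_local[OF openin_slice[OF C U c] preorder_on_pullback[OF P]])
    fix t assume "t \<in> {t \<in> icube n. cell_pt C n c t \<in> U}"
    then obtain B where "openin (icube_top n) B" "t \<in> B" "\<forall>s\<in>B \<inter> icube n. \<forall>s'\<in>B \<inter> icube n.
        cell_pt C n c s \<in> U \<longrightarrow> cell_pt C n c s' \<in> U \<longrightarrow> (s, s') \<in> icube_order n \<longrightarrow>
        (cell_pt C n c s, cell_pt C n c s') \<in> P" using loc[OF c, of t] by auto
    then show "\<exists>B. openin (icube_top n) B \<and> t \<in> B \<and>
      (\<forall>s\<in>B \<inter> {t \<in> icube n. cell_pt C n c t \<in> U}. \<forall>s'\<in>B \<inter> {t \<in> icube n. cell_pt C n c t \<in> U}. (s, s') \<in> icube_order n \<longrightarrow>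
        (s, s') \<in> {(x, y). x \<in> {t \<in> icube n. cell_pt C n c t \<in> U} \<and>
          y \<in> {t \<in> icube n. cell_pt C n c t \<in> U} \<and> (cell_pt C n c x, cell_pt C n c y) \<in> P})"
      by (intro exI[of _ B]) auto
  qed auto
  then show "(cell_pt C n c s, cell_pt C n c t) \<in> P" using st by blast
qed

lemma stream_map_cell_pt:
  assumes C: "cubical_set C" and c: "c \<in> cells C n"
  shows "stream_map (dicube n) (realization C) (cell_pt C n c)"
proof -
  have "continuous_map (icube_top n) (rtop C) (cell_pt C n c)"
    unfolding continuous_map_def using openin_slice[OF C _ c] cell_pt_in[OF C c] by auto
  moreover have "(cell_pt C n c s, cell_pt C n c t) \<in> circ (realization C) U"
    if U: "openin (rtop C) U" "(s, t) \<in> icube_circ n {t \<in> icube n. cell_pt C n c t \<in> U}" for U s t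
    unfolding circ_realization[OF C U(1)]
    by (rule subsetD[OF preorder_gen_incl]) (use U(2) c in blast)
  ultimately show ?thesis by (auto simp: stream_map_def dicube_def)
qed

text \<open>The universal property of the colimit: continuity is tested by the quotient topology on
  each cube, and the circulation on its generators, which come from the cubes.\<close>

lemma stream_map_realization:
  assumes C: "cubical_set C" and Y: "circ_preorder Y"
    and F: "\<And>n c. c \<in> cells C n \<Longrightarrow> stream_map (dicube n) Y (\<lambda>t. F (cell_pt C n c t))"
  shows "stream_map (realization C) Y F"
proof -
  have cont: "continuous_map (rtop C) (top_of Y) F"
    unfolding continuous_map_def
  proof (intro conjI allI impI Pi_I)
    show "F P \<in> topspace (top_of Y)" if "P \<in> topspace (rtop C)" for P
      using cell_pt_cases[OF C that] stream_map_dicubeD(1)[OF F] continuous_map_image_subset_topspace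
      by (metis (no_types, lifting) image_subset_iff topspace_icube_top)
    show "openin (rtop C) {x \<in> topspace (rtop C). F x \<in> U}" if U: "openin (top_of Y) U" for U
      unfolding openin_realization[OF C]
    proof (intro conjI allI ballI)
      fix n c assume c: "c \<in> cells C n"
      have "{t \<in> icube n. cell_pt C n c t \<in> {x \<in> topspace (rtop C). F x \<in> U}} = {t \<in> icube n. F (cell_pt C n c t) \<in> U}"
        using cell_pt_in[OF C c] by auto
      then show "openin (icube_top n) {t \<in> icube n. cell_pt C n c t \<in> {x \<in> topspace (rtop C). F x \<in> U}}"
        using openin_preimage_cube[OF stream_map_dicubeD(1)[OF F[OF c]] U] by simp
    qed auto
  qed
  have "(F x, F y) \<in> circ Y U"
    if U: "openin (top_of Y) U" and xy: "(x, y) \<in> circ (realization C) {z \<in> topspace (rtop C). F z \<in> U}" for U x y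
  proof -
    let ?V = "{z \<in> topspace (rtop C). F z \<in> U}"
    have V: "openin (rtop C) ?V" using cont U openin_continuous_map_preimage by blast
    have "circ (realization C) ?V \<subseteq> {(x, y). x \<in> ?V \<and> y \<in> ?V \<and> (F x, F y) \<in> circ Y U}"
      unfolding circ_realization[OF C V]
    proof (rule preorder_gen_least)
      show "preorder_on ?V {(x, y). x \<in> ?V \<and> y \<in> ?V \<and> (F x, F y) \<in> circ Y U}"
        by (rule preorder_on_pullback) (use Y U in \<open>auto simp: circ_preorder_def\<close>)
      have "(F (cell_pt C n c s), F (cell_pt C n c t)) \<in> circ Y U"
        if c: "c \<in> cells C n" and st: "(s, t) \<in> icube_circ n {t \<in> icube n. cell_pt C n c t \<in> ?V}" for n c s t
      proof -
        have "{t \<in> icube n. cell_pt C n c t \<in> ?V} = {t \<in> icube n. F (cell_pt C n c t) \<in> U}"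
          using cell_pt_in[OF C c] by auto
        then show ?thesis using stream_map_dicubeD(2)[OF F[OF c] U] st by auto
      qed
      then show "{(cell_pt C n c s, cell_pt C n c t) | n c s t.
         c \<in> cells C n \<and> (s, t) \<in> icube_circ n {t \<in> icube n. cell_pt C n c t \<in> ?V}} \<subseteq>
         {(x, y). x \<in> ?V \<and> y \<in> ?V \<and> (F x, F y) \<in> circ Y U}"
        using circ_realization_gen_sub[OF C V] by blast
    qed
    then show ?thesis using xy by blast
  qed
  then show ?thesis using cont by (auto simp: stream_map_def)
qed

lemma natural_coord_order:
  assumes "natural \<phi>" "(s, t) \<in> icube_order n"
  shows "(coord \<phi> n s, coord \<phi> n t) \<in> icube_order n"
proof -
  have st: "s \<in> icube n" "t \<in> icube n" "\<And>i. i < n \<Longrightarrow> s i \<le> t i" using assms(2) by (auto simp: icube_order_def)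
  have "\<phi> (s i) \<le> \<phi> (t i)" if "i < n" for i
  proof -
    have "s i \<in> {0..1}" "t i \<in> {0..1}" using st(1,2) that by (auto simp: icube_iff)
    then show ?thesis using assms(1) st(3)[OF that] unfolding natural_def by (blast dest: mono_onD)
  qed
  then show ?thesis using st natural_coord_in[OF assms(1)] by (auto simp: icube_order_def coord_def)
qed

lemma natural_coord_stream_map:
  assumes "natural \<phi>" shows "stream_map (dicube n) (dicube n) (coord \<phi> n)"
proof (rule stream_map_monotone[OF _ natural_coord_order[OF assms]])
  show "continuous_map (icube_top n) (icube_top n) (coord \<phi> n)"
    unfolding continuous_map_into_icube
  proof (intro conjI allI impI)
    show "coord \<phi> n ` topspace (icube_top n) \<subseteq> icube n" using natural_coord_in[OF assms] by auto
    fix i assume i: "i < n"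
    have "continuous_map (icube_top n) (top_of_set {0..1}) (\<lambda>x. x i)"
      using continuous_map_icube_proj[OF i] i by (auto simp: continuous_map_in_subtopology icube_iff)
    moreover have "continuous_map (top_of_set {0..1}) euclideanreal \<phi>" using assms by (simp add: natural_def)
    ultimately have "continuous_map (icube_top n) euclideanreal (\<lambda>x. \<phi> (x i))"
      using continuous_map_compose[of _ _ "\<lambda>x. x i" _ \<phi>] by (simp add: o_def)
    then show "continuous_map (icube_top n) euclideanreal (\<lambda>x. coord \<phi> n x i)"
      using i by (simp add: coord_def)
  qed
qed

definition natural_map :: "'c cubical \<Rightarrow> (real \<Rightarrow> real) \<Rightarrow> 'c real_pt set \<Rightarrow> 'c real_pt set" where
  "natural_map C \<phi> = desc (\<lambda>n c t. cell_pt C n c (coord \<phi> n t))"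

lemma natural_map_cell_pt:
  assumes "cubical_set C" "natural \<phi>" "c \<in> cells C n" "t \<in> icube n"
  shows "natural_map C \<phi> (cell_pt C n c t) = cell_pt C n c (coord \<phi> n t)"
  unfolding natural_map_def
  by (rule desc_cell_pt) (use assms in \<open>auto simp: cell_pt_act natural_coord_in natural_geom_coord\<close>)

lemma natural_map_stream_map:
  assumes C: "cubical_set C" and \<phi>: "natural \<phi>"
  shows "stream_map (realization C) (realization C) (natural_map C \<phi>)"
proof (rule stream_map_realization[OF C circ_preorder_realization[OF C]])
  fix n c assume c: "c \<in> cells C n"
  show "stream_map (dicube n) (realization C) (\<lambda>t. natural_map C \<phi> (cell_pt C n c t))"
    by (rule stream_map_dicube_cong[OF stream_map_compose[OF natural_coord_stream_map[OF \<phi>] stream_map_cell_pt[OF C c]]])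
      (simp add: natural_map_cell_pt[OF C \<phi> c])
qed

lemma line_order:
  assumes "(p, q) \<in> icube_order n" "0 \<le> r" "r \<le> r'" "r' \<le> 1"
  shows "(line n p q r, line n p q r') \<in> icube_order n"
  using assms line_in[of p n q r] line_in[of p n q r']
  by (auto simp: icube_order_def line_def intro: mult_right_mono)

lemma line_stream_map:
  assumes "(p, q) \<in> icube_order n"
  shows "stream_map (dicube 1) (dicube n) (\<lambda>x. line n p q (x 0))"
proof (rule stream_map_monotone)
  show "continuous_map (icube_top 1) (icube_top n) (\<lambda>x. line n p q (x 0))"
    unfolding continuous_map_into_icube
  proof (intro conjI allI impI)
    have "line n p q (x 0) \<in> icube n" if "x \<in> icube 1" for x
      by (rule line_in) (use that assms in \<open>auto simp: icube_iff[of _ "Suc 0"] icube_order_def\<close>)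
    then show "(\<lambda>x. line n p q (x 0)) ` topspace (icube_top 1) \<subseteq> icube n" by auto
    show "continuous_map (icube_top 1) euclideanreal (\<lambda>x. line n p q (x 0) i)" if "i < n" for i
      using that by (simp add: line_def) (intro continuous_intros continuous_map_icube_proj; simp)
  qed
  show "(line n p q (s 0), line n p q (t 0)) \<in> icube_order n" if "(s, t) \<in> icube_order 1" for s t
    by (rule line_order[OF assms]) (use that in \<open>auto simp: icube_order_def icube_iff\<close>)
qed

lemma geom_stream_map: "box m n \<psi> \<Longrightarrow> stream_map (dicube m) (dicube n) (geom m n \<psi>)"
  by (rule stream_map_monotone[OF geom_continuous geom_order])

section \<open>Functors into a commutative monoid\<close>

locale canc_monoid = comm_monoid \<tau> for \<tau> :: "'m monoid" (structure) +
  assumes canc: "cancellative \<tau>"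
begin

lemma lcancel:
  assumes "x \<otimes> y = x \<otimes> z" "x \<in> carrier \<tau>" "y \<in> carrier \<tau>" "z \<in> carrier \<tau>" shows "y = z"
  using canc assms unfolding cancellative_def by (metis one_closed r_one m_closed)

lemma rcancel:
  assumes "y \<otimes> x = z \<otimes> x" "x \<in> carrier \<tau>" "y \<in> carrier \<tau>" "z \<in> carrier \<tau>" shows "y = z"
  using assms lcancel m_comm by metis

end

lemma cube_cat_simps [simp]:
  "Ob (cube_cat n) = bcube n" "Dom (cube_cat n) = fst" "Cod (cube_cat n) = snd"
  "Ident (cube_cat n) v = (v, v)" "Comp (cube_cat n) g f = (fst f, snd g)"
  by (simp_all add: cube_cat_def)

lemma cube_arr_iff: "(v, w) \<in> Ar (cube_cat n) \<longleftrightarrow> v \<in> bcube n \<and> w \<in> bcube n \<and> (\<forall>i<n. v i \<le> w i)"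
  by (simp add: cube_cat_def)

lemma cube_arr_refl: "v \<in> bcube n \<Longrightarrow> (v, v) \<in> Ar (cube_cat n)"
  by (simp add: cube_arr_iff)

lemma cube_arr_trans: "(u, v) \<in> Ar (cube_cat n) \<Longrightarrow> (v, w) \<in> Ar (cube_cat n) \<Longrightarrow> (u, w) \<in> Ar (cube_cat n)"
  by (auto simp: cube_arr_iff)

lemma cube_arr_ob: "(v, w) \<in> Ar (cube_cat n) \<Longrightarrow> v \<in> bcube n" "(v, w) \<in> Ar (cube_cat n) \<Longrightarrow> w \<in> bcube n"
  by (auto simp: cube_arr_iff)

lemma level_arr:
  "(s, t) \<in> icube_order n \<Longrightarrow> (level u n s, level u n t) \<in> Ar (cube_cat n)"
  by (auto simp: cube_arr_iff level_def icube_order_def bcube_iff intro: order_trans)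

lemma monoid_cat_simps [simp]:
  "Ob (monoid_cat \<tau>) = {()}" "Ar (monoid_cat \<tau>) = carrier \<tau>" "Ident (monoid_cat \<tau>) x = \<one>\<^bsub>\<tau>\<^esub>"
  "Comp (monoid_cat \<tau>) g f = g \<otimes>\<^bsub>\<tau>\<^esub> f" "Dom (monoid_cat \<tau>) g = ()" "Cod (monoid_cat \<tau>) g = ()"
  by (simp_all add: monoid_cat_def)

lemma functors_monoid_cat:
  "F \<in> functors A (monoid_cat \<tau>) \<longleftrightarrow> snd F \<in> Ar A \<rightarrow>\<^sub>E carrier \<tau> \<and>
     (\<forall>x\<in>Ob A. snd F (Ident A x) = \<one>\<^bsub>\<tau>\<^esub>) \<and>
     (\<forall>f\<in>Ar A. \<forall>g\<in>Ar A. Cod A f = Dom A g \<longrightarrow> snd F (Comp A g f) = snd F g \<otimes>\<^bsub>\<tau>\<^esub> snd F f)"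
  by (cases F) (auto simp: functors_def PiE_def extensional_def fun_eq_iff)

lemma functors_monoid_cat_eqI:
  fixes F G :: "('o, 'a, unit, 'm) func"
  assumes "F \<in> functors A (monoid_cat \<tau>)" "G \<in> functors A (monoid_cat \<tau>)"
    "\<And>f. f \<in> Ar A \<Longrightarrow> snd F f = snd G f"
  shows "F = G"
proof (rule prod_eqI)
  show "fst F = fst G" by (rule ext) simp
  show "snd F = snd G"
    by (rule extensionalityI[of _ "Ar A"]) (use assms in \<open>auto simp: functors_monoid_cat PiE_def\<close>)
qed

definition cube_fun :: "nat \<Rightarrow> ((nat \<Rightarrow> bool) \<Rightarrow> (nat \<Rightarrow> bool) \<Rightarrow> 'm) \<Rightarrow>
    (nat \<Rightarrow> bool, (nat \<Rightarrow> bool) \<times> (nat \<Rightarrow> bool), unit, 'm) func" where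
  "cube_fun n h = (\<lambda>_. (), \<lambda>f\<in>Ar (cube_cat n). h (fst f) (snd f))"

lemma snd_cube_fun [simp]: "(v, w) \<in> Ar (cube_cat n) \<Longrightarrow> snd (cube_fun n h) (v, w) = h v w"
  by (simp add: cube_fun_def)

lemma (in canc_monoid) cube_functorI:
  assumes "\<And>v w. (v, w) \<in> Ar (cube_cat n) \<Longrightarrow> h v w \<in> carrier \<tau>" "\<And>v. v \<in> bcube n \<Longrightarrow> h v v = \<one>"
    "\<And>u v w. (u, v) \<in> Ar (cube_cat n) \<Longrightarrow> (v, w) \<in> Ar (cube_cat n) \<Longrightarrow> h u w = h u v \<otimes> h v w"
  shows "cube_fun n h \<in> functors (cube_cat n) (monoid_cat \<tau>)"
  unfolding functors_monoid_cat
proof (intro conjI ballI impI)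
  show "snd (cube_fun n h) \<in> Ar (cube_cat n) \<rightarrow>\<^sub>E carrier \<tau>" using assms(1) by (auto simp: cube_fun_def)
  show "snd (cube_fun n h) (Ident (cube_cat n) x) = \<one>" if "x \<in> Ob (cube_cat n)" for x
    using assms(2) that by (simp add: cube_arr_refl)
  fix f g assume fg: "f \<in> Ar (cube_cat n)" "g \<in> Ar (cube_cat n)" "Cod (cube_cat n) f = Dom (cube_cat n) g"
  obtain u v w where f: "f = (u, v)" "g = (v, w)" using fg(3) by (metis cube_cat_simps(2,3) prod.collapse)
  have a: "(u, v) \<in> Ar (cube_cat n)" "(v, w) \<in> Ar (cube_cat n)" using fg f by auto
  then show "snd (cube_fun n h) (Comp (cube_cat n) g f) = snd (cube_fun n h) g \<otimes> snd (cube_fun n h) f"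
    using assms(3)[OF a] assms(1) cube_arr_trans[OF a] by (simp add: f m_comm)
qed

context canc_monoid
begin

lemma functor_closed: "F \<in> functors (cube_cat n) (monoid_cat \<tau>) \<Longrightarrow> (v, w) \<in> Ar (cube_cat n) \<Longrightarrow> snd F (v, w) \<in> carrier \<tau>"
  by (auto simp: functors_monoid_cat)

lemma functor_refl: "F \<in> functors (cube_cat n) (monoid_cat \<tau>) \<Longrightarrow> v \<in> bcube n \<Longrightarrow> snd F (v, v) = \<one>"
  by (auto simp: functors_monoid_cat)

text \<open>\<open>Comp\<close> puts the later arrow first; commutativity of \<open>\<tau>\<close>
  gives the diagrammatic order used from here on.\<close>

lemma functor_trans:
  assumes F: "F \<in> functors (cube_cat n) (monoid_cat \<tau>)"
    and a: "(u, v) \<in> Ar (cube_cat n)" "(v, w) \<in> Ar (cube_cat n)"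
  shows "snd F (u, w) = snd F (u, v) \<otimes> snd F (v, w)"
proof -
  have "snd F (Comp (cube_cat n) (v, w) (u, v)) = snd F (v, w) \<otimes> snd F (u, v)"
    using F a unfolding functors_monoid_cat by (metis cube_cat_simps(2,3) fst_conv snd_conv)
  then show ?thesis using functor_closed[OF F] a by (simp add: m_comm)
qed

end

lemma cube_functor_eqI:
  assumes "F \<in> functors (cube_cat n) (monoid_cat \<tau>)" "G \<in> functors (cube_cat n) (monoid_cat \<tau>)"
    "\<And>v w. (v, w) \<in> Ar (cube_cat n) \<Longrightarrow> snd F (v, w) = snd G (v, w)"
  shows "F = G"
  by (rule functors_monoid_cat_eqI[OF assms(1,2)]) (use assms(3) in auto)

lemma cells_ner: "cells (nerve A) n = functors (cube_cat n) A"
  by (simp add: nerve_def)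

lemma ner_act:
  assumes "(v, w) \<in> Ar (cube_cat m)"
  shows "snd (act (nerve A) m n \<psi> F) (v, w) = snd F (\<psi> v, \<psi> w)"
  using assms by (simp add: nerve_def func_comp_def cube_functor_def compose_def)

section \<open>Cubical functions\<close>

lemma cub_hom_in: "f \<in> cub_hom A B \<Longrightarrow> a \<in> cells A n \<Longrightarrow> f n a \<in> cells B n"
  by (auto simp: cub_hom_def)

lemma cub_hom_act: "f \<in> cub_hom A B \<Longrightarrow> box m n \<psi> \<Longrightarrow> a \<in> cells A n \<Longrightarrow> f m (act A m n \<psi> a) = act B m n \<psi> (f n a)"
  by (auto simp: cub_hom_def)

lemma cub_hom_eqI:
  assumes "f \<in> cub_hom A B" "g \<in> cub_hom A B" "\<And>n a. a \<in> cells A n \<Longrightarrow> f n a = g n a"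
  shows "f = g"
proof
  fix n show "f n = g n"
    by (rule extensionalityI[of _ "cells A n"]) (use assms in \<open>auto simp: cub_hom_def PiE_def\<close>)
qed

lemma cub_comp_apply: "a \<in> cells A n \<Longrightarrow> cub_comp A g f n a = g n (f n a)"
  by (simp add: cub_comp_def compose_def)

lemma cub_comp_hom:
  assumes "cubical_set A" "f \<in> cub_hom A B" "g \<in> cub_hom B D"
  shows "cub_comp A g f \<in> cub_hom A D"
  unfolding cub_hom_def
proof (intro CollectI conjI allI impI ballI)
  show "cub_comp A g f n \<in> cells A n \<rightarrow>\<^sub>E cells D n" for n
    using assms by (auto simp: cub_comp_def compose_def cub_hom_in)
  show "cub_comp A g f m (act A m n \<phi> a) = act D m n \<phi> (cub_comp A g f n a)"
    if "box m n \<phi>" "a \<in> cells A n" for m n \<phi> a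
    using assms that by (simp add: cub_comp_apply act_in cub_hom_act cub_hom_in)
qed

lemma cub_comp_assoc:
  assumes "f \<in> cub_hom A B"
  shows "cub_comp A (cub_comp B h g) f = cub_comp A h (cub_comp A g f)"
proof (intro ext)
  fix n a show "cub_comp A (cub_comp B h g) f n a = cub_comp A h (cub_comp A g f) n a"
    using cub_hom_in[OF assms] by (cases "a \<in> cells A n") (simp_all add: cub_comp_def compose_def)
qed

lemma cub_hom_ner_arr:
  assumes "f \<in> cub_hom A (ner \<tau>)" "box m n \<psi>" "a \<in> cells A n" "(v, w) \<in> Ar (cube_cat m)"
  shows "snd (f m (act A m n \<psi> a)) (v, w) = snd (f n a) (\<psi> v, \<psi> w)"
  using assms by (simp add: cub_hom_act ner_act)

lemma cub_hom_ner_in: "f \<in> cub_hom A (nerve B) \<Longrightarrow> a \<in> cells A n \<Longrightarrow> f n a \<in> functors (cube_cat n) B"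
  using cub_hom_in[of f A "nerve B"] by (simp add: cells_ner)

lemma ner_act_in:
  assumes "F \<in> functors (cube_cat n) (monoid_cat \<tau>)" "box m n \<psi>"
  shows "act (ner \<tau>) m n \<psi> F \<in> functors (cube_cat m) (monoid_cat \<tau>)"
proof -
  have F: "snd F \<in> Ar (cube_cat n) \<rightarrow> carrier \<tau>" "\<And>x. x \<in> bcube n \<Longrightarrow> snd F (x, x) = \<one>\<^bsub>\<tau>\<^esub>"
    using assms(1) unfolding functors_monoid_cat by (auto simp: PiE_def)
  have F3: "snd F (u, w) = snd F (v, w) \<otimes>\<^bsub>\<tau>\<^esub> snd F (u, v)"
    if "(u, v) \<in> Ar (cube_cat n)" "(v, w) \<in> Ar (cube_cat n)" for u v w
    using assms(1) that unfolding functors_monoid_cat by (metis cube_cat_simps(2,3,5) fst_conv snd_conv)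
  show ?thesis
    unfolding functors_monoid_cat
  proof (intro conjI ballI impI PiE_I)
    show "snd (act (ner \<tau>) m n \<psi> F) f \<in> carrier \<tau>" if "f \<in> Ar (cube_cat m)" for f
      using that F(1) box_mono[OF assms(2)] by (cases f) (auto simp: ner_act)
    show "snd (act (ner \<tau>) m n \<psi> F) f = undefined" if "f \<notin> Ar (cube_cat m)" for f
      using that by (simp add: nerve_def func_comp_def compose_def)
    show "snd (act (ner \<tau>) m n \<psi> F) (Ident (cube_cat m) x) = \<one>\<^bsub>\<tau>\<^esub>" if "x \<in> Ob (cube_cat m)" for x
      using that F(2) box_in[OF assms(2)] by (simp add: ner_act cube_arr_refl)
    fix f g assume fg: "f \<in> Ar (cube_cat m)" "g \<in> Ar (cube_cat m)" "Cod (cube_cat m) f = Dom (cube_cat m) g"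
    obtain u v w where f: "f = (u, v)" "g = (v, w)" using fg(3) by (metis cube_cat_simps(2,3) prod.collapse)
    show "snd (act (ner \<tau>) m n \<psi> F) (Comp (cube_cat m) g f) =
       snd (act (ner \<tau>) m n \<psi> F) g \<otimes>\<^bsub>\<tau>\<^esub> snd (act (ner \<tau>) m n \<psi> F) f"
      using fg F3 box_mono[OF assms(2)] cube_arr_trans[of u v m w] by (simp add: f ner_act)
  qed
qed

lemma cub_hom_nerI:
  assumes A: "cubical_set A"
    and h: "\<And>n a. a \<in> cells A n \<Longrightarrow> cube_fun n (h n a) \<in> functors (cube_cat n) (monoid_cat \<tau>)"
    and nat: "\<And>m n \<psi> a v w. box m n \<psi> \<Longrightarrow> a \<in> cells A n \<Longrightarrow> (v, w) \<in> Ar (cube_cat m) \<Longrightarrow>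
      h m (act A m n \<psi> a) v w = h n a (\<psi> v) (\<psi> w)"
  shows "(\<lambda>n. \<lambda>a\<in>cells A n. cube_fun n (h n a)) \<in> cub_hom A (ner \<tau>)"
  unfolding cub_hom_def
proof (intro CollectI conjI allI impI ballI)
  show "(\<lambda>a\<in>cells A n. cube_fun n (h n a)) \<in> cells A n \<rightarrow>\<^sub>E cells (ner \<tau>) n" for n
    using h by (auto simp: cells_ner)
  fix m n \<phi> a assume b: "box m n \<phi>" and a: "a \<in> cells A n"
  note a' = act_in[OF A b a]
  have "cube_fun m (h m (act A m n \<phi> a)) = act (ner \<tau>) m n \<phi> (cube_fun n (h n a))"
    by (rule cube_functor_eqI[OF h[OF a'] ner_act_in[OF h[OF a] b]])
      (simp add: ner_act nat[OF b a] box_mono[OF b])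
  then show "(\<lambda>a\<in>cells A m. cube_fun m (h m a)) (act A m n \<phi> a) = act (ner \<tau>) m n \<phi> ((\<lambda>a\<in>cells A n. cube_fun n (h n a)) a)"
    using a a' by simp
qed

section \<open>Vertices and the cylinder\<close>

definition pt :: "nat \<Rightarrow> (nat \<Rightarrow> bool) \<Rightarrow> boxmap" where
  "pt n v = (\<lambda>x\<in>bcube 0. v)"

lemma box_pt: assumes "v \<in> bcube n" shows "box 0 n (pt n v)"
proof -
  have "template_map UNIV id 0 n (\<lambda>j. Inl (v j)) = pt n v"
    using assms by (auto simp: template_map_def pt_def bcube_iff extensional_def fun_eq_iff restrict_def)
  moreover have "linear_template 0 n (\<lambda>j. Inl (v j))" by (auto simp: linear_template_def box_template_def)
  ultimately show ?thesis using linear_template_box by metis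
qed

definition vx :: "'a cubical \<Rightarrow> nat \<Rightarrow> 'a \<Rightarrow> (nat \<Rightarrow> bool) \<Rightarrow> 'a" where
  "vx A n a v = act A 0 n (pt n v) a"

lemma vx_in: "cubical_set A \<Longrightarrow> a \<in> cells A n \<Longrightarrow> v \<in> bcube n \<Longrightarrow> vx A n a v \<in> cells A 0"
  by (simp add: vx_def act_in box_pt)

lemma act_compose:
  "cubical_set A \<Longrightarrow> box l m \<phi> \<Longrightarrow> box m n \<psi> \<Longrightarrow> a \<in> cells A n \<Longrightarrow>
     act A l m \<phi> (act A m n \<psi> a) = act A l n (compose (bcube l) \<psi> \<phi>) a"
  by (simp add: cubical_set_def)

lemma act_id: "cubical_set A \<Longrightarrow> a \<in> cells A n \<Longrightarrow> act A n n (\<lambda>x\<in>bcube n. x) a = a"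
  by (simp add: cubical_set_def)

lemma vx_act:
  assumes "cubical_set A" "box m n \<psi>" "a \<in> cells A n" "v \<in> bcube m"
  shows "vx A m (act A m n \<psi> a) v = vx A n a (\<psi> v)"
proof -
  have "compose (bcube 0) \<psi> (pt m v) = pt n (\<psi> v)" by (auto simp: compose_def pt_def)
  then show ?thesis using assms by (simp add: vx_def act_compose box_pt)
qed

text \<open>The templates are put side by side, with the inputs of the second shifted by
  \<open>m\<close>; no input is copied twice because the two halves read disjoint ranges.\<close>

lemma box_tensor_box:
  assumes "box m n \<phi>" "box m' n' \<psi>" shows "box (m + m') (n + n') (box_tensor m n m' n' \<phi> \<psi>)"
proof -
  obtain s where s: "linear_template m n s" "\<phi> = template_map UNIV id m n s" using box_linear_template[OF assms(1)] by metis
  obtain s' where s': "linear_template m' n' s'" "\<psi> = template_map UNIV id m' n' s'" using box_linear_template[OF assms(2)] by metis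
  define r where "r = (\<lambda>j. if j < n then s j else case s' (j - n) of Inl b \<Rightarrow> Inl b | Inr i \<Rightarrow> Inr (m + i))"
  have sm: "i < m" if "j < n" "s j = Inr i" for i j
    using s(1) that unfolding linear_template_def box_template_def by (metis old.sum.simps(6))
  have sm': "i < m'" if "j < n'" "s' j = Inr i" for i j
    using s'(1) that unfolding linear_template_def box_template_def by (metis old.sum.simps(6))
  have r1: "r j = Inr i \<Longrightarrow> j < n \<Longrightarrow> s j = Inr i \<and> i < m" for i j by (auto simp: r_def dest: sm)
  have r2: "r j = Inr i \<Longrightarrow> \<not> j < n \<Longrightarrow> j < n + n' \<Longrightarrow> \<exists>k. i = m + k \<and> s' (j - n) = Inr k \<and> k < m'" for i j
    using sm'[of "j - n"] by (auto simp: r_def split: sum.splits)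
  have "box_template (m + m') (n + n') r"
    unfolding box_template_def
  proof (intro allI impI)
    fix j assume j: "j < n + n'"
    show "case r j of Inl b \<Rightarrow> True | Inr i \<Rightarrow> i < m + m'"
      using r1[of j] r2[of j] j by (cases "r j"; cases "j < n") fastforce+
  qed
  moreover have "j = k" if jk: "j < n + n'" "k < n + n'" "r j = Inr i" "r k = Inr i" for i j k
  proof (cases "j < n")
    case True
    then have j: "s j = Inr i" "i < m" using r1[OF jk(3)] by auto
    then have "k < n" using r2[OF jk(4)] jk(2) by fastforce
    then show ?thesis using r1[OF jk(4)] j True s(1) unfolding linear_template_def by blast
  next
    case False
    then obtain a where a: "i = m + a" "s' (j - n) = Inr a" using r2[OF jk(3)] jk(1) by blast
    then have k: "\<not> k < n" using r1[OF jk(4)] by auto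
    then obtain b where b: "i = m + b" "s' (k - n) = Inr b" using r2[OF jk(4)] jk(2) by blast
    have "j - n = k - n" using s'(1) a b jk False k unfolding linear_template_def by auto
    then show ?thesis using False k by simp
  qed
  ultimately have "linear_template (m + m') (n + n') r" unfolding linear_template_def by blast
  moreover have "template_map UNIV id (m + m') (n + n') r = box_tensor m n m' n' \<phi> \<psi>"
  proof (intro ext)
    fix x j
    show "template_map UNIV id (m + m') (n + n') r x j = box_tensor m n m' n' \<phi> \<psi> x j"
    proof (cases "x \<in> bcube (m + m') \<and> j < n + n'")
      case True
      have c: "(\<lambda>i\<in>{..<m}. x i) \<in> bcube m" "(\<lambda>i\<in>{..<m'}. x (m + i)) \<in> bcube m'" by (auto simp: bcube_iff)
      show ?thesis
      proof (cases "j < n")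
        case j: True
        then show ?thesis using True c sm[OF j] by (cases "s j") (auto simp: template_map_def box_tensor_def r_def s(2))
      next
        case j: False
        then have "j - n < n'" using True by auto
        then show ?thesis using True c j sm'[of "j - n"]
          by (cases "s' (j - n)") (auto simp: template_map_def box_tensor_def r_def s'(2))
      qed
    qed (auto simp: template_map_def box_tensor_def restrict_def)
  qed
  ultimately show ?thesis using linear_template_box by metis
qed

lemma representable_cubical_set: "cubical_set (representable k)"
  unfolding cubical_set_def representable_def
proof (simp, intro conjI allI impI)
  show "box m n \<phi> \<Longrightarrow> (\<lambda>\<psi>. compose (bcube m) \<psi> \<phi>) \<in> {\<psi>. box n k \<psi>} \<rightarrow> {\<psi>. box m k \<psi>}" for m n \<phi>
    by (auto intro: box_compose)
  show "box n k c \<Longrightarrow> compose (bcube n) c (\<lambda>x\<in>bcube n. x) = c" for n c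
    using box_extensional[of n k c] by (auto simp: compose_def extensional_def restrict_def fun_eq_iff)
  show "box l m \<phi> \<Longrightarrow> box m n \<psi> \<Longrightarrow> box n k c \<Longrightarrow>
    compose (bcube l) c (compose (bcube l) \<psi> \<phi>) = compose (bcube l) (compose (bcube m) c \<psi>) \<phi>" for l m n \<phi> \<psi> c
    using box_in[of l m \<phi>] by (auto simp: compose_def restrict_def fun_eq_iff)
qed

abbreviation tgen :: "'a cubical \<Rightarrow> 'b cubical \<Rightarrow> nat \<Rightarrow> (nat \<times> nat \<times> boxmap \<times> 'a \<times> 'b) rel" where
  "tgen A B n \<equiv> {((p, q, compose (bcube n) (box_tensor p' p q' q \<alpha> \<beta>) \<psi>, a, b),
       (p', q', \<psi>, act A p' p \<alpha> a, act B q' q \<beta> b)) | p q p' q' \<alpha> \<beta> \<psi> a b.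
        box n (p' + q') \<psi> \<and> box p' p \<alpha> \<and> box q' q \<beta> \<and> a \<in> cells A p \<and> b \<in> cells B q}"

lemma tgen_sub:
  assumes "cubical_set A" "cubical_set B"
  shows "tgen A B n \<subseteq> tensor_pre A B n \<times> tensor_pre A B n"
  using assms by (auto simp: tensor_pre_def act_in intro!: box_compose box_tensor_box)

lemma tensor_equiv: "cubical_set A \<Longrightarrow> cubical_set B \<Longrightarrow> equiv (tensor_pre A B n) (tensor_rel A B n)"
  unfolding tensor_rel_def by (rule equiv_gen_equiv[OF tgen_sub])

text \<open>Operations on quotients are defined here as the saturation of all images of
  representatives; for a map respecting the relations, one representative is enough.\<close>

lemma class_image:
  assumes "equiv S E" "equiv S' E'" "x \<in> S" "\<And>y. (x, y) \<in> E \<Longrightarrow> (h x, h y) \<in> E'"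
  shows "E' `` {h y | y. y \<in> E `` {x}} = E' `` {h x}"
proof (intro subset_antisym subsetI)
  fix z assume "z \<in> E' `` {h y | y. y \<in> E `` {x}}"
  then obtain y where "(x, y) \<in> E" "(h y, z) \<in> E'" by blast
  then show "z \<in> E' `` {h x}" using assms(4) assms(2) by (auto elim!: equivE dest: transD)
next
  fix z assume "z \<in> E' `` {h x}"
  then show "z \<in> E' `` {h y | y. y \<in> E `` {x}}" using equiv_class_self[OF assms(1,3)] by blast
qed

lemma compose_assoc_box:
  "box l m \<phi> \<Longrightarrow> compose (bcube l) c (compose (bcube l) \<psi> \<phi>) = compose (bcube l) (compose (bcube m) c \<psi>) \<phi>"
  using box_in[of l m \<phi>] by (auto simp: compose_def restrict_def fun_eq_iff)

lemma compose_id_right: "box m n \<psi> \<Longrightarrow> compose (bcube m) \<psi> (\<lambda>x\<in>bcube m. x) = \<psi>"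
  using box_extensional[of m n \<psi>] by (auto simp: compose_def extensional_def restrict_def fun_eq_iff)

lemma compose_id_left: "box m n \<psi> \<Longrightarrow> compose (bcube m) (\<lambda>x\<in>bcube n. x) \<psi> = \<psi>"
  using box_extensional[of m n \<psi>] box_in[of m n \<psi>] by (auto simp: compose_def extensional_def restrict_def fun_eq_iff)

lemma tensor_rel_compose:
  fixes A :: "'a cubical" and B :: "'b cubical"
  assumes A: "cubical_set A" and B: "cubical_set B" and \<phi>: "box m n \<phi>"
    and xy: "((p, q, \<psi>, a, b), (p', q', \<psi>', a', b')) \<in> tensor_rel A B n"
  shows "((p, q, compose (bcube m) \<psi> \<phi>, a, b), (p', q', compose (bcube m) \<psi>' \<phi>, a', b')) \<in> tensor_rel A B m"
proof -
  define h where "h = (\<lambda>(p :: nat, q :: nat, \<psi> :: boxmap, a :: 'a, b :: 'b). (p, q, compose (bcube m) \<psi> \<phi>, a, b))"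
  have "(h (p, q, \<psi>, a, b), h (p', q', \<psi>', a', b')) \<in> tensor_rel A B m"
  proof (rule equiv_gen_map[OF tgen_sub[OF A B] tensor_equiv[OF A B] _ _ xy[unfolded tensor_rel_def]])
    show "h x \<in> tensor_pre A B m" if "x \<in> tensor_pre A B n" for x
      using that box_compose[OF \<phi>] by (auto simp: h_def tensor_pre_def)
    fix x y assume "(x, y) \<in> tgen A B n"
    then obtain p q p' q' \<alpha> \<beta> \<psi> a b where g: "x = (p, q, compose (bcube n) (box_tensor p' p q' q \<alpha> \<beta>) \<psi>, a, b)"
      "y = (p', q', \<psi>, act A p' p \<alpha> a, act B q' q \<beta> b)" "box n (p' + q') \<psi>" "box p' p \<alpha>" "box q' q \<beta>"
      "a \<in> cells A p" "b \<in> cells B q" by blast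
    have "h x = (p, q, compose (bcube m) (box_tensor p' p q' q \<alpha> \<beta>) (compose (bcube m) \<psi> \<phi>), a, b)"
      unfolding g h_def by (simp add: compose_assoc_box[OF \<phi>])
    moreover have "h y = (p', q', compose (bcube m) \<psi> \<phi>, act A p' p \<alpha> a, act B q' q \<beta> b)" by (simp add: g h_def)
    ultimately have "(h x, h y) \<in> tgen A B m" using box_compose[OF \<phi> g(3)] g(4-) by blast
    then show "(h x, h y) \<in> tensor_rel A B m" unfolding tensor_rel_def by (rule subsetD[OF equiv_gen_incl])
  qed
  then show ?thesis by (simp add: h_def)
qed

lemma tensor_act_class:
  fixes A :: "'a cubical" and B :: "'b cubical"
  assumes A: "cubical_set A" and B: "cubical_set B" and \<phi>: "box m n \<phi>" and x: "(p, q, \<psi>, a, b) \<in> tensor_pre A B n"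
  shows "act (tensor A B) m n \<phi> (tensor_rel A B n `` {(p, q, \<psi>, a, b)}) =
     tensor_rel A B m `` {(p, q, compose (bcube m) \<psi> \<phi>, a, b)}"
proof -
  define h where "h = (\<lambda>(p :: nat, q :: nat, \<psi> :: boxmap, a :: 'a, b :: 'b). (p, q, compose (bcube m) \<psi> \<phi>, a, b))"
  let ?X = "tensor_rel A B n `` {(p, q, \<psi>, a, b)}"
  have "act (tensor A B) m n \<phi> ?X = tensor_rel A B m `` {h y | y. y \<in> ?X}"
    by (simp add: tensor_def h_def)
  also have "\<dots> = tensor_rel A B m `` {h (p, q, \<psi>, a, b)}"
    by (rule class_image[OF tensor_equiv[OF A B] tensor_equiv[OF A B] x])
      (use tensor_rel_compose[OF A B \<phi>] in \<open>auto simp: h_def\<close>)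
  finally show ?thesis by (simp add: h_def)
qed

lemma tensor_dinatural:
  assumes A: "cubical_set A" and B: "cubical_set B" and "box n (p' + q') \<psi>" "box p' p \<alpha>" "box q' q \<beta>" "a \<in> cells A p" "b \<in> cells B q"
  shows "tensor_rel A B n `` {(p, q, compose (bcube n) (box_tensor p' p q' q \<alpha> \<beta>) \<psi>, a, b)} =
    tensor_rel A B n `` {(p', q', \<psi>, act A p' p \<alpha> a, act B q' q \<beta> b)}"
proof (rule equiv_class_eq[OF tensor_equiv[OF A B]])
  have "((p, q, compose (bcube n) (box_tensor p' p q' q \<alpha> \<beta>) \<psi>, a, b), (p', q', \<psi>, act A p' p \<alpha> a, act B q' q \<beta> b)) \<in> tgen A B n"
    using assms(3-) by blast
  then show "((p, q, compose (bcube n) (box_tensor p' p q' q \<alpha> \<beta>) \<psi>, a, b), (p', q', \<psi>, act A p' p \<alpha> a, act B q' q \<beta> b)) \<in> tensor_rel A B n"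
    unfolding tensor_rel_def by (rule subsetD[OF equiv_gen_incl])
qed

lemma tensor_class_in: "x \<in> tensor_pre A B n \<Longrightarrow> tensor_rel A B n `` {x} \<in> cells (tensor A B) n"
  by (simp add: tensor_def quotientI)

lemma cells_representable: "b \<in> cells (representable k) q \<longleftrightarrow> box q k b"
  by (simp add: representable_def)

lemma act_representable: "act (representable k) m n \<phi> b = compose (bcube m) b \<phi>"
  by (simp add: representable_def)

section \<open>Homotopies and the first cohomology monoid\<close>

text \<open>A homotopy is determined by its values on the edges \<open>{x} \<otimes> \<box>[1]\<close>, i.e. by a cochain on the vertices.\<close>

definition (in canc_monoid) homotopic :: "'a cubical \<Rightarrow> (nat \<Rightarrow> 'a \<Rightarrow> (nat \<Rightarrow> bool, (nat \<Rightarrow> bool) \<times> (nat \<Rightarrow> bool), unit, 'm) func) \<Rightarrow>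
    (nat \<Rightarrow> 'a \<Rightarrow> (nat \<Rightarrow> bool, (nat \<Rightarrow> bool) \<times> (nat \<Rightarrow> bool), unit, 'm) func) \<Rightarrow> bool" where
  "homotopic A \<alpha> \<beta> \<longleftrightarrow> (\<exists>g\<in>cells A 0 \<rightarrow> carrier \<tau>. \<forall>n. \<forall>a\<in>cells A n. \<forall>v w. (v, w) \<in> Ar (cube_cat n) \<longrightarrow>
     snd (\<alpha> n a) (v, w) \<otimes> g (vx A n a w) = g (vx A n a v) \<otimes> snd (\<beta> n a) (v, w))"

abbreviation idb :: "nat \<Rightarrow> boxmap" where "idb n \<equiv> (\<lambda>x\<in>bcube n. x)"

text \<open>The cell \<open>a \<otimes> id\<close> of the cylinder, of dimension one more than
  \<open>a\<close>; its last coordinate is the time of the homotopy.\<close>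

abbreviation cyl_cell :: "'a cubical \<Rightarrow> nat \<Rightarrow> 'a \<Rightarrow> (nat \<times> nat \<times> boxmap \<times> 'a \<times> boxmap) set" where
  "cyl_cell A n a \<equiv> tensor_rel A (representable 1) (n + 1) `` {(n, 1, idb (n + 1), a, idb 1)}"

lemma cyl_pre: "a \<in> cells A n \<Longrightarrow> (n, 1, idb (n + 1), a, idb 1) \<in> tensor_pre A (representable 1) (n + 1)"
  using box_id by (simp add: tensor_pre_def cells_representable)

lemma cyl_cell_in: "a \<in> cells A n \<Longrightarrow> cyl_cell A n a \<in> cells (tensor A (representable 1)) (n + 1)"
  by (rule tensor_class_in[OF cyl_pre])

definition vert_edge :: "nat \<Rightarrow> (nat \<Rightarrow> bool) \<Rightarrow> boxmap" where
  "vert_edge n v = box_tensor 0 n 1 1 (pt n v) (idb 1)"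

lemma vert_edge_box: "v \<in> bcube n \<Longrightarrow> box 1 (n + 1) (vert_edge n v)"
  using box_tensor_box[OF box_pt box_id[of 1], of v n] by (simp add: vert_edge_def)

text \<open>Dinaturality moves the inclusion of the vertex from the morphism of cubes to the cell.
  The edge over \<open>v\<close> thus depends only on the vertex of \<open>a\<close> there, which is
  why a homotopy yields a cochain on vertices.\<close>

lemma cyl_cell_edge:
  assumes A: "cubical_set A" and a: "a \<in> cells A n" and v: "v \<in> bcube n"
  shows "act (tensor A (representable 1)) 1 (n + 1) (vert_edge n v) (cyl_cell A n a) = cyl_cell A 0 (vx A n a v)"
proof -
  let ?B = "representable 1"
  have "act (tensor A ?B) 1 (n + 1) (vert_edge n v) (cyl_cell A n a) =
      tensor_rel A ?B 1 `` {(n, 1, compose (bcube 1) (idb (n + 1)) (vert_edge n v), a, idb 1)}"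
    by (rule tensor_act_class[OF A representable_cubical_set vert_edge_box[OF v] cyl_pre[OF a]])
  also have "compose (bcube 1) (idb (n + 1)) (vert_edge n v) = compose (bcube 1) (vert_edge n v) (idb 1)"
    using compose_id_left[OF vert_edge_box[OF v]] compose_id_right[OF vert_edge_box[OF v]] by simp
  also have "tensor_rel A ?B 1 `` {(n, 1, compose (bcube 1) (vert_edge n v) (idb 1), a, idb 1)} =
      tensor_rel A ?B 1 `` {(0, 1, idb 1, act A 0 n (pt n v) a, act ?B 1 1 (idb 1) (idb 1))}"
    unfolding vert_edge_def
    by (rule tensor_dinatural[OF A representable_cubical_set])
      (use a v box_id[of 1] in \<open>simp_all add: box_pt cells_representable\<close>)
  also have "act ?B 1 1 (idb 1) (idb 1) = idb 1"
    using compose_id_left[OF box_id] by (simp add: act_representable)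
  finally show ?thesis by (simp only: vx_def add_0)
qed

lemma coface_last_box: "box n (n + 1) (coface UNIV n n e)"
  using box.coface[of n n e] by simp

text \<open>Here dinaturality moves the end \<open>e\<close> of the interval from the morphism of
  cubes to the factor \<open>representable 1\<close>.\<close>

lemma cyl_cell_end:
  assumes A: "cubical_set A" and a: "a \<in> cells A n"
  shows "act (tensor A (representable 1)) n (n + 1) (coface UNIV n n e) (cyl_cell A n a) = cyl_incl A e n a"
proof -
  let ?B = "representable 1"
  have t: "box_tensor n n 0 1 (idb n) (coface UNIV 0 0 e) = coface UNIV n n e"
  proof (intro ext)
    fix x j
    have c: "(\<lambda>i\<in>{..<n}. x i) \<in> bcube n" "(\<lambda>i\<in>{..<0::nat}. x (n + i)) \<in> bcube 0" by (auto simp: bcube_iff)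
    show "box_tensor n n 0 1 (idb n) (coface UNIV 0 0 e) x j = coface UNIV n n e x j"
      using c by (auto simp: box_tensor_def coface_def)
  qed
  have "act (tensor A ?B) n (n + 1) (coface UNIV n n e) (cyl_cell A n a) =
      tensor_rel A ?B n `` {(n, 1, compose (bcube n) (idb (n + 1)) (coface UNIV n n e), a, idb 1)}"
    by (rule tensor_act_class[OF A representable_cubical_set coface_last_box cyl_pre[OF a]])
  also have "compose (bcube n) (idb (n + 1)) (coface UNIV n n e) = compose (bcube n) (coface UNIV n n e) (idb n)"
    using compose_id_left[OF coface_last_box] compose_id_right[OF coface_last_box] by simp
  also have "\<dots> = compose (bcube n) (box_tensor n n 0 1 (idb n) (coface UNIV 0 0 e)) (idb n)" by (simp only: t)
  also have "tensor_rel A ?B n `` {(n, 1, compose (bcube n) (box_tensor n n 0 1 (idb n) (coface UNIV 0 0 e)) (idb n), a, idb 1)} =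
      tensor_rel A ?B n `` {(n, 0, idb n, act A n n (idb n) a, act ?B 0 1 (coface UNIV 0 0 e) (idb 1))}"
    by (rule tensor_dinatural[OF A representable_cubical_set])
      (use a box_id[of n] box_id[of 1] box.coface[of 0 0 e] in \<open>simp_all add: cells_representable\<close>)
  also have "act ?B 0 1 (coface UNIV 0 0 e) (idb 1) = coface UNIV 0 0 e"
    using compose_id_left[OF box.coface[of 0 0 e]] by (simp add: act_representable)
  also have "act A n n (idb n) a = a" by (rule act_id[OF A a])
  also have "tensor_rel A ?B n `` {(n, 0, idb n, a, coface UNIV 0 0 e)} = cyl_incl A e n a"
    using a by (simp add: cyl_incl_def)
  finally show ?thesis .
qed

lemma coface_last: "v \<in> bcube n \<Longrightarrow> coface UNIV n n e v = (\<lambda>j\<in>{..<Suc n}. if j < n then v j else e)"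
  by (auto simp: coface_def)

lemma vert_edge_apply: "x \<in> bcube 1 \<Longrightarrow> v \<in> bcube n \<Longrightarrow> vert_edge n v x = coface UNIV n n (x 0) v"
proof (intro ext)
  fix j assume x: "x \<in> bcube 1" and v: "v \<in> bcube n"
  have "(\<lambda>i\<in>{..<0::nat}. x i) \<in> bcube 0" "(\<lambda>i\<in>{..<1::nat}. x i) \<in> bcube 1" by (auto simp: bcube_iff)
  then show "vert_edge n v x j = coface UNIV n n (x 0) v j"
    using x v by (auto simp: vert_edge_def box_tensor_def coface_last pt_def)
qed

abbreviation b1 :: "bool \<Rightarrow> nat \<Rightarrow> bool" where "b1 e \<equiv> (\<lambda>i\<in>{..<1}. e)"

lemma b1_in [simp]: "b1 e \<in> bcube 1" by (simp add: bcube_iff)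

lemma b1_arr: "(b1 False, b1 True) \<in> Ar (cube_cat 1)"
  unfolding cube_arr_iff by (intro conjI b1_in) simp

context canc_monoid
begin

lemma ner_closed:
  "f \<in> cub_hom A (ner \<tau>) \<Longrightarrow> a \<in> cells A n \<Longrightarrow> (v, w) \<in> Ar (cube_cat n) \<Longrightarrow> snd (f n a) (v, w) \<in> carrier \<tau>"
  by (rule functor_closed[OF cub_hom_ner_in])

text \<open>The two sides of the equation are the two ways from \<open>(v, False)\<close> to
  \<open>(w, True)\<close> in the cube \<open>cyl_cell A n a\<close>.\<close>

lemma homotopy_imp_homotopic:
  assumes A: "cubical_set A" and h: "h \<in> cub_hom (tensor A (representable 1)) (ner \<tau>)"
  shows "homotopic A (cub_comp A h (cyl_incl A False)) (cub_comp A h (cyl_incl A True))"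
proof -
  let ?T = "tensor A (representable 1)"
  define g where "g = (\<lambda>x. snd (h 1 (cyl_cell A 0 x)) (b1 False, b1 True))"
  have X: "h (n + 1) (cyl_cell A n a) \<in> functors (cube_cat (n + 1)) (monoid_cat \<tau>)" if "a \<in> cells A n" for n a
    by (rule cub_hom_ner_in[OF h cyl_cell_in[OF that]])
  have "g \<in> cells A 0 \<rightarrow> carrier \<tau>"
    using functor_closed[OF X[of _ 0]] b1_arr by (auto simp: g_def)
  moreover have "snd (cub_comp A h (cyl_incl A False) n a) (v, w) \<otimes> g (vx A n a w) =
      g (vx A n a v) \<otimes> snd (cub_comp A h (cyl_incl A True) n a) (v, w)"
    if a: "a \<in> cells A n" and vw: "(v, w) \<in> Ar (cube_cat n)" for n a v w
  proof -
    let ?H = "h (n + 1) (cyl_cell A n a)"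
    let ?c = "\<lambda>e. coface UNIV n n e"
    note ob = cube_arr_ob[OF vw]
    have e: "snd (cub_comp A h (cyl_incl A e) n a) (v, w) = snd ?H (?c e v, ?c e w)" for e
      using cub_hom_ner_arr[OF h coface_last_box cyl_cell_in[OF a] vw, of e]
      unfolding cub_comp_apply[OF a] cyl_cell_end[OF A a] .
    have gx: "g (vx A n a x) = snd ?H (?c False x, ?c True x)" if x: "x \<in> bcube n" for x
      using cub_hom_ner_arr[OF h vert_edge_box[OF x] cyl_cell_in[OF a] b1_arr]
      unfolding g_def cyl_cell_edge[OF A a x] vert_edge_apply[OF b1_in x] by simp
    have ar: "(?c d x, ?c e y) \<in> Ar (cube_cat (n + 1))" if "(x, y) \<in> Ar (cube_cat n)" "d \<le> e" for x y d e
      using that cube_arr_ob[OF that(1)] box_in[OF coface_last_box]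
      by (auto simp: cube_arr_iff coface_last bcube_iff)
    have "snd ?H (?c False v, ?c True w) = snd ?H (?c False v, ?c False w) \<otimes> snd ?H (?c False w, ?c True w)"
      by (rule functor_trans[OF X[OF a]]) (use ar vw cube_arr_refl ob in auto)
    moreover have "snd ?H (?c False v, ?c True w) = snd ?H (?c False v, ?c True v) \<otimes> snd ?H (?c True v, ?c True w)"
      by (rule functor_trans[OF X[OF a]]) (use ar vw cube_arr_refl ob in auto)
    ultimately show ?thesis by (simp add: e gx[OF ob(1)] gx[OF ob(2)])
  qed
  ultimately show ?thesis unfolding homotopic_def by blast
qed

end

section \<open>From a cochain on vertices to a homotopy on the cylinder\<close>

definition fstp :: "nat \<Rightarrow> (nat \<Rightarrow> bool) \<Rightarrow> nat \<Rightarrow> bool" where "fstp p x = (\<lambda>i\<in>{..<p}. x i)"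
definition sndp :: "nat \<Rightarrow> nat \<Rightarrow> (nat \<Rightarrow> bool) \<Rightarrow> nat \<Rightarrow> bool" where "sndp p q x = (\<lambda>i\<in>{..<q}. x (p + i))"

lemma fstp_in [simp]: "fstp p x \<in> bcube p" by (simp add: fstp_def bcube_iff)
lemma sndp_in [simp]: "sndp p q x \<in> bcube q" by (simp add: sndp_def bcube_iff)

lemma fstp_arr: "(x, y) \<in> Ar (cube_cat (p + q)) \<Longrightarrow> (fstp p x, fstp p y) \<in> Ar (cube_cat p)"
  by (auto simp: cube_arr_iff fstp_def bcube_iff)

lemma sndp_arr: "(x, y) \<in> Ar (cube_cat (p + q)) \<Longrightarrow> (sndp p q x, sndp p q y) \<in> Ar (cube_cat q)"
  by (auto simp: cube_arr_iff sndp_def bcube_iff)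

lemma fstp_box_tensor:
  assumes "box p' p \<alpha>" "x \<in> bcube (p' + q')"
  shows "fstp p (box_tensor p' p q' q \<alpha> \<beta> x) = \<alpha> (fstp p' x)"
  by (rule bcube_eqI[OF fstp_in box_in[OF assms(1) fstp_in]]) (use assms in \<open>simp add: fstp_def box_tensor_def\<close>)

lemma sndp_box_tensor:
  assumes "box q' q \<beta>" "x \<in> bcube (p' + q')"
  shows "sndp p q (box_tensor p' p q' q \<alpha> \<beta> x) = \<beta> (sndp p' q' x)"
  by (rule bcube_eqI[OF sndp_in box_in[OF assms(1) sndp_in]]) (use assms in \<open>simp add: sndp_def box_tensor_def\<close>)

context canc_monoid
begin

lemma homotopic_imp_homotopy:
  assumes A: "cubical_set A" and \<alpha>: "\<alpha> \<in> cub_hom A (ner \<tau>)" and \<beta>: "\<beta> \<in> cub_hom A (ner \<tau>)"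
    and h: "homotopic A \<alpha> \<beta>"
  shows "\<exists>h\<in>cub_hom (tensor A (representable 1)) (ner \<tau>).
     cub_comp A h (cyl_incl A False) = \<alpha> \<and> cub_comp A h (cyl_incl A True) = \<beta>"
proof -
  let ?B = "representable 1"
  let ?T = "tensor A ?B"
  obtain g where g: "\<And>x. x \<in> cells A 0 \<Longrightarrow> g x \<in> carrier \<tau>"
    and ab: "\<And>n a v w. a \<in> cells A n \<Longrightarrow> (v, w) \<in> Ar (cube_cat n) \<Longrightarrow>
      snd (\<alpha> n a) (v, w) \<otimes> g (vx A n a w) = g (vx A n a v) \<otimes> snd (\<beta> n a) (v, w)"
    using h unfolding homotopic_def by blast
  \<comment> \<open>\<open>K p a v d w e\<close> is the value on the arrow from
    \<open>(v, d)\<close> to \<open>(w, e)\<close>. An arrow that changes the level runs along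
    \<open>\<alpha>\<close> first and crosses at \<open>w\<close>; by the equation for
    \<open>g\<close> it could as well cross at \<open>v\<close> and continue along
    \<open>\<beta>\<close>.\<close>
  define K where "K = (\<lambda>p a v (d :: bool) w e. if d = e then (if d then snd (\<beta> p a) (v, w) else snd (\<alpha> p a) (v, w))
     else snd (\<alpha> p a) (v, w) \<otimes> g (vx A p a w))"
  \<comment> \<open>A representative consists of a map \<open>\<psi>\<close> to a cube of dimension
    \<open>p + q\<close>, split by \<open>fstp\<close> and \<open>sndp\<close>; \<open>b\<close>
    maps the second part to \<open>[1]\<close>, and its coordinate \<open>0\<close> is the
    level.\<close>
  define val where "val = (\<lambda>(p, q, \<psi> :: boxmap, a, b :: boxmap) v w.
     K p a (fstp p (\<psi> v)) (b (sndp p q (\<psi> v)) 0) (fstp p (\<psi> w)) (b (sndp p q (\<psi> w)) 0))"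
  define H where "H = (\<lambda>X. val (SOME x. x \<in> X))"
  have A\<alpha>: "snd (\<alpha> p a) (v, w) \<in> carrier \<tau>" and A\<beta>: "snd (\<beta> p a) (v, w) \<in> carrier \<tau>"
    if "a \<in> cells A p" "(v, w) \<in> Ar (cube_cat p)" for p a v w
    using ner_closed[OF \<alpha> that] ner_closed[OF \<beta> that] by auto
  have gv: "g (vx A p a v) \<in> carrier \<tau>" if "a \<in> cells A p" "v \<in> bcube p" for p a v
    using g vx_in[OF A that] by blast
  have Kcl: "K p a v d w e \<in> carrier \<tau>" if "a \<in> cells A p" "(v, w) \<in> Ar (cube_cat p)" for p a v w d e
    using A\<alpha>[OF that] A\<beta>[OF that] gv[OF that(1) cube_arr_ob(2)[OF that(2)]] by (simp add: K_def)
  have Krefl: "K p a v d v d = \<one>" if "a \<in> cells A p" "v \<in> bcube p" for p a v d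
    using functor_refl[OF cub_hom_ner_in[OF \<alpha> that(1)] that(2)] functor_refl[OF cub_hom_ner_in[OF \<beta> that(1)] that(2)]
    by (simp add: K_def)
  have Ktrans: "K p a u c w e = K p a u c v d \<otimes> K p a v d w e"
    if a: "a \<in> cells A p" and uv: "(u, v) \<in> Ar (cube_cat p)" and vw: "(v, w) \<in> Ar (cube_cat p)"
      and le: "c \<le> d" "d \<le> e" for p a u v w c d e
  proof -
    have t: "snd (\<alpha> p a) (u, w) = snd (\<alpha> p a) (u, v) \<otimes> snd (\<alpha> p a) (v, w)"
      "snd (\<beta> p a) (u, w) = snd (\<beta> p a) (u, v) \<otimes> snd (\<beta> p a) (v, w)"
      using functor_trans[OF cub_hom_ner_in[OF \<alpha> a] uv vw] functor_trans[OF cub_hom_ner_in[OF \<beta> a] uv vw] by auto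
    note cl = A\<alpha>[OF a uv] A\<alpha>[OF a vw] A\<beta>[OF a uv] A\<beta>[OF a vw] gv[OF a cube_arr_ob(1)[OF vw]] gv[OF a cube_arr_ob(2)[OF vw]]
    show ?thesis using le cl
      by (cases c; cases d; cases e) (simp_all add: K_def t m_assoc ab[OF a vw])
  qed
  have Knat: "K m (act A m n \<psi> a) v d w e = K n a (\<psi> v) d (\<psi> w) e"
    if "box m n \<psi>" "a \<in> cells A n" "(v, w) \<in> Ar (cube_cat m)" for m n \<psi> a v w d e
    using that cub_hom_ner_arr[OF \<alpha> that] cub_hom_ner_arr[OF \<beta> that] vx_act[OF A that(1,2) cube_arr_ob(2)[OF that(3)]]
    by (simp add: K_def)
  \<comment> \<open>Invariance under dinaturality is naturality of \<open>K\<close> in the first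
    factor and composition of \<open>b\<close> with \<open>\<beta>'\<close> in the second.\<close>
  have val_rel: "val x v w = val y v w" if xy: "(x, y) \<in> tensor_rel A ?B n" and vw: "(v, w) \<in> Ar (cube_cat n)" for x y n v w
  proof (rule equiv_gen_invariant[OF tgen_sub[OF A representable_cubical_set] _ xy[unfolded tensor_rel_def]])
    fix x y assume "(x, y) \<in> tgen A ?B n"
    then obtain p q p' q' \<alpha>' \<beta>' \<psi> a b where x: "x = (p, q, compose (bcube n) (box_tensor p' p q' q \<alpha>' \<beta>') \<psi>, a, b)"
      "y = (p', q', \<psi>, act A p' p \<alpha>' a, act ?B q' q \<beta>' b)" and bx: "box n (p' + q') \<psi>" "box p' p \<alpha>'" "box q' q \<beta>'"
      and ab': "a \<in> cells A p" "b \<in> cells ?B q" by blast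
    have ar: "(fstp p' (\<psi> v), fstp p' (\<psi> w)) \<in> Ar (cube_cat p')" by (rule fstp_arr[OF box_mono[OF bx(1) vw]])
    show "val x v w = val y v w"
      using cube_arr_ob[OF vw] box_in[OF bx(1)] Knat[OF bx(2) ab'(1) ar] bx
      by (simp add: x val_def compose_def fstp_box_tensor sndp_box_tensor act_representable)
  qed
  have eqT: "equiv (tensor_pre A ?B n) (tensor_rel A ?B n)" for n
    by (rule tensor_equiv[OF A representable_cubical_set])
  have Hclass: "H (tensor_rel A ?B n `` {x}) v w = val x v w"
    if "x \<in> tensor_pre A ?B n" "(v, w) \<in> Ar (cube_cat n)" for x n v w
  proof -
    have "x \<in> tensor_rel A ?B n `` {x}" by (rule equiv_class_self[OF eqT that(1)])
    then have "(SOME y. y \<in> tensor_rel A ?B n `` {x}) \<in> tensor_rel A ?B n `` {x}" by (rule someI)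
    then show ?thesis unfolding H_def using val_rel[OF _ that(2)] by (metis Image_singleton_iff)
  qed
  have rep: "\<exists>x\<in>tensor_pre A ?B n. X = tensor_rel A ?B n `` {x}" if "X \<in> cells ?T n" for X n
    using that by (auto simp: tensor_def elim!: quotientE)
  define hh where "hh = (\<lambda>n. \<lambda>X\<in>cells ?T n. cube_fun n (H X))"
  \<comment> \<open>Required by \<open>cub_hom_nerI\<close>; each law is checked on a
    representative, where it is a law of composition of morphisms of \<open>\<box>\<close>.\<close>
  have T: "cubical_set ?T"
    unfolding cubical_set_def
  proof (intro conjI allI impI ballI Pi_I)
    fix m n \<phi> X assume b: "box m n \<phi>" and X: "X \<in> cells ?T n"
    obtain p q \<psi> a b where x: "(p, q, \<psi>, a, b) \<in> tensor_pre A ?B n" "X = tensor_rel A ?B n `` {(p, q, \<psi>, a, b)}" using rep[OF X] by auto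
    have "(p, q, compose (bcube m) \<psi> \<phi>, a, b) \<in> tensor_pre A ?B m" using x(1) box_compose[OF b] by (auto simp: tensor_pre_def)
    then show "act ?T m n \<phi> X \<in> cells ?T m"
      unfolding x(2) tensor_act_class[OF A representable_cubical_set b x(1)] by (rule tensor_class_in)
  next
    fix n X assume X: "X \<in> cells ?T n"
    obtain p q \<psi> a b where x: "(p, q, \<psi>, a, b) \<in> tensor_pre A ?B n" "X = tensor_rel A ?B n `` {(p, q, \<psi>, a, b)}" using rep[OF X] by auto
    then show "act ?T n n (idb n) X = X"
      unfolding x(2) tensor_act_class[OF A representable_cubical_set box_id x(1)]
      using compose_id_right by (auto simp: tensor_pre_def)
  next
    fix l m n \<phi> \<psi>' X assume b: "box l m \<phi>" "box m n \<psi>'" and X: "X \<in> cells ?T n"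
    obtain p q \<psi> a b where x: "(p, q, \<psi>, a, b) \<in> tensor_pre A ?B n" "X = tensor_rel A ?B n `` {(p, q, \<psi>, a, b)}" using rep[OF X] by auto
    have y: "(p, q, compose (bcube m) \<psi> \<psi>', a, b) \<in> tensor_pre A ?B m" using x(1) box_compose[OF b(2)] by (auto simp: tensor_pre_def)
    show "act ?T l n (compose (bcube l) \<psi>' \<phi>) X = act ?T l m \<phi> (act ?T m n \<psi>' X)"
      unfolding x(2) tensor_act_class[OF A representable_cubical_set box_compose[OF b] x(1)]
        tensor_act_class[OF A representable_cubical_set b(2) x(1)] tensor_act_class[OF A representable_cubical_set b(1) y]
      by (simp add: compose_assoc_box[OF b(1)])
  qed
  have hh: "hh \<in> cub_hom ?T (ner \<tau>)"
    unfolding hh_def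
  proof (rule cub_hom_nerI[OF T])
    fix n X assume X: "X \<in> cells ?T n"
    obtain p q \<psi> a b where x: "(p, q, \<psi>, a, b) \<in> tensor_pre A ?B n" "X = tensor_rel A ?B n `` {(p, q, \<psi>, a, b)}" using rep[OF X] by auto
    have bx: "box n (p + q) \<psi>" "a \<in> cells A p" "box q 1 b" using x(1) by (auto simp: tensor_pre_def cells_representable)
    have le: "b (sndp p q (\<psi> v)) 0 \<le> b (sndp p q (\<psi> w)) 0" if "(v, w) \<in> Ar (cube_cat n)" for v w
      using box_mono[OF bx(3) sndp_arr[OF box_mono[OF bx(1) that]]] by (auto simp: cube_arr_iff)
    have ar: "(fstp p (\<psi> v), fstp p (\<psi> w)) \<in> Ar (cube_cat p)" if "(v, w) \<in> Ar (cube_cat n)" for v w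
      by (rule fstp_arr[OF box_mono[OF bx(1) that]])
    show "cube_fun n (H X) \<in> functors (cube_cat n) (monoid_cat \<tau>)"
    proof (rule cube_functorI)
      show "H X v w \<in> carrier \<tau>" if "(v, w) \<in> Ar (cube_cat n)" for v w
        using Hclass[OF x(1) that] Kcl[OF bx(2) ar[OF that]] by (simp add: x(2) val_def)
      show "H X v v = \<one>" if "v \<in> bcube n" for v
        using Hclass[OF x(1) cube_arr_refl[OF that]] Krefl[OF bx(2)] by (simp add: x(2) val_def)
      show "H X u w = H X u v \<otimes> H X v w" if "(u, v) \<in> Ar (cube_cat n)" "(v, w) \<in> Ar (cube_cat n)" for u v w
        using Hclass[OF x(1) that(1)] Hclass[OF x(1) that(2)] Hclass[OF x(1) cube_arr_trans[OF that]]
          Ktrans[OF bx(2) ar[OF that(1)] ar[OF that(2)] le[OF that(1)] le[OF that(2)]]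
        by (simp add: x(2) val_def)
    qed
  next
    fix m n \<phi> X v w assume b: "box m n \<phi>" and X: "X \<in> cells ?T n" and vw: "(v, w) \<in> Ar (cube_cat m)"
    obtain p q \<psi> a b where x: "(p, q, \<psi>, a, b) \<in> tensor_pre A ?B n" "X = tensor_rel A ?B n `` {(p, q, \<psi>, a, b)}" using rep[OF X] by auto
    have y: "(p, q, compose (bcube m) \<psi> \<phi>, a, b) \<in> tensor_pre A ?B m" using x(1) box_compose[OF b] by (auto simp: tensor_pre_def)
    show "H (act ?T m n \<phi> X) v w = H X (\<phi> v) (\<phi> w)"
      unfolding x(2) tensor_act_class[OF A representable_cubical_set b x(1)]
        Hclass[OF y vw] Hclass[OF x(1) box_mono[OF b vw]]
      using cube_arr_ob[OF vw] by (simp add: val_def compose_def)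
  qed
  have e: "snd (cub_comp A hh (cyl_incl A e) n a) (v, w) = (if e then snd (\<beta> n a) (v, w) else snd (\<alpha> n a) (v, w))"
    if a: "a \<in> cells A n" and vw: "(v, w) \<in> Ar (cube_cat n)" for e n a v w
  proof -
    have x: "(n, 0, idb n, a, coface UNIV 0 0 e) \<in> tensor_pre A ?B n"
      using a box_id[of n] box.coface[of 0 0 e] by (simp add: tensor_pre_def cells_representable)
    have f: "fstp n y = y" if "y \<in> bcube n" for y
      by (rule bcube_eqI[OF fstp_in that]) (simp add: fstp_def)
    have c: "coface UNIV 0 0 e y 0 = e" if "y \<in> bcube 0" for y
      using that by (simp add: coface_def)
    show ?thesis
      using a vw Hclass[OF x vw] tensor_class_in[OF x] cube_arr_ob[OF vw]
      by (simp add: cub_comp_apply hh_def cyl_incl_def val_def K_def f c)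
  qed
  have cy: "cub_comp A hh (cyl_incl A e) n a \<in> functors (cube_cat n) (monoid_cat \<tau>)" if a: "a \<in> cells A n" for e n a
  proof -
    have "(n, 0, idb n, a, coface UNIV 0 0 e) \<in> tensor_pre A ?B n"
      using a box_id[of n] box.coface[of 0 0 e] by (simp add: tensor_pre_def cells_representable)
    then have "cyl_incl A e n a \<in> cells ?T n" using a tensor_class_in by (simp add: cyl_incl_def)
    then show ?thesis using cub_hom_ner_in[OF hh] by (simp add: cub_comp_apply[OF a])
  qed
  have ext: "cub_comp A hh (cyl_incl A e) = \<gamma>" if \<gamma>: "\<gamma> \<in> cub_hom A (ner \<tau>)"
    and eq: "\<And>n a v w. a \<in> cells A n \<Longrightarrow> (v, w) \<in> Ar (cube_cat n) \<Longrightarrow> snd (cub_comp A hh (cyl_incl A e) n a) (v, w) = snd (\<gamma> n a) (v, w)" for \<gamma> e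
  proof (intro ext)
    fix n a
    show "cub_comp A hh (cyl_incl A e) n a = \<gamma> n a"
    proof (cases "a \<in> cells A n")
      case True
      show ?thesis by (rule cube_functor_eqI[OF cy[OF True] cub_hom_ner_in[OF \<gamma> True] eq[OF True]])
    next
      case False
      then show ?thesis using \<gamma> by (auto simp: cub_comp_def compose_def cub_hom_def PiE_def extensional_def)
    qed
  qed
  show ?thesis
  proof (intro bexI[OF _ hh] conjI)
    show "cub_comp A hh (cyl_incl A False) = \<alpha>" by (rule ext[OF \<alpha>]) (simp add: e)
    show "cub_comp A hh (cyl_incl A True) = \<beta>" by (rule ext[OF \<beta>]) (simp add: e)
  qed
qed

definition hrel :: "'a cubical \<Rightarrow> (nat \<Rightarrow> 'a \<Rightarrow> (nat \<Rightarrow> bool, (nat \<Rightarrow> bool) \<times> (nat \<Rightarrow> bool), unit, 'm) func) rel" where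
  "hrel A = {(\<alpha>, \<beta>). \<alpha> \<in> cub_hom A (ner \<tau>) \<and> \<beta> \<in> cub_hom A (ner \<tau>) \<and> homotopic A \<alpha> \<beta>}"

lemma hrel_sub: "hrel A \<subseteq> cub_hom A (ner \<tau>) \<times> cub_hom A (ner \<tau>)"
  by (auto simp: hrel_def)

lemma H1_rel_eq:
  assumes A: "cubical_set A" shows "H1_rel A \<tau> = equiv_gen (cub_hom A (ner \<tau>)) (hrel A)"
proof -
  have "(\<exists>h\<in>cub_hom (tensor A (representable 1)) (ner \<tau>).
     cub_comp A h (cyl_incl A False) = \<alpha> \<and> cub_comp A h (cyl_incl A True) = \<beta>) \<longleftrightarrow> homotopic A \<alpha> \<beta>"
    if ab: "\<alpha> \<in> cub_hom A (ner \<tau>)" "\<beta> \<in> cub_hom A (ner \<tau>)" for \<alpha> \<beta>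
  proof (intro iffI homotopic_imp_homotopy[OF A ab])
    assume "\<exists>h\<in>cub_hom (tensor A (representable 1)) (ner \<tau>).
     cub_comp A h (cyl_incl A False) = \<alpha> \<and> cub_comp A h (cyl_incl A True) = \<beta>"
    then obtain h where h: "h \<in> cub_hom (tensor A (representable 1)) (ner \<tau>)"
      "cub_comp A h (cyl_incl A False) = \<alpha>" "cub_comp A h (cyl_incl A True) = \<beta>" by blast
    from homotopy_imp_homotopic[OF A h(1)] show "homotopic A \<alpha> \<beta>" unfolding h(2,3) .
  qed
  then have "{(\<alpha>, \<beta>). \<alpha> \<in> cub_hom A (ner \<tau>) \<and> \<beta> \<in> cub_hom A (ner \<tau>) \<and>
        (\<exists>h\<in>cub_hom (tensor A (representable 1)) (ner \<tau>).
           cub_comp A h (cyl_incl A False) = \<alpha> \<and> cub_comp A h (cyl_incl A True) = \<beta>)} = hrel A"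
    by (intro Set.set_eqI) (simp add: hrel_def split_beta cong: conj_cong)
  then show ?thesis unfolding H1_rel_def by (rule arg_cong)
qed

lemma H1_rel_equiv: "cubical_set A \<Longrightarrow> equiv (cub_hom A (ner \<tau>)) (H1_rel A \<tau>)"
  by (simp add: H1_rel_eq equiv_gen_equiv[OF hrel_sub])

lemma H1_relI:
  "cubical_set A \<Longrightarrow> \<alpha> \<in> cub_hom A (ner \<tau>) \<Longrightarrow> \<beta> \<in> cub_hom A (ner \<tau>) \<Longrightarrow> homotopic A \<alpha> \<beta> \<Longrightarrow> (\<alpha>, \<beta>) \<in> H1_rel A \<tau>"
  using equiv_gen_incl[of "hrel A" "cub_hom A (ner \<tau>)"] by (auto simp: H1_rel_eq hrel_def)

end

lemma cub_hom_ner_eqI: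
  assumes "\<alpha> \<in> cub_hom A (ner \<tau>)" "\<beta> \<in> cub_hom A (ner \<tau>)"
    "\<And>n a v w. a \<in> cells A n \<Longrightarrow> (v, w) \<in> Ar (cube_cat n) \<Longrightarrow> snd (\<alpha> n a) (v, w) = snd (\<beta> n a) (v, w)"
  shows "\<alpha> = \<beta>"
  by (rule cub_hom_eqI[OF assms(1,2)])
    (rule cube_functor_eqI[OF cub_hom_ner_in[OF assms(1)] cub_hom_ner_in[OF assms(2)] assms(3)])

section \<open>Pointwise products of functors, cocycles and cohomology classes\<close>

definition closed_cat :: "('o, 'a) category \<Rightarrow> bool" where
  "closed_cat A \<longleftrightarrow> (\<forall>x\<in>Ob A. Ident A x \<in> Ar A) \<and> (\<forall>f\<in>Ar A. Dom A f \<in> Ob A \<and> Cod A f \<in> Ob A) \<and>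
     (\<forall>f\<in>Ar A. \<forall>g\<in>Ar A. Cod A f = Dom A g \<longrightarrow> Comp A g f \<in> Ar A)"

lemma closed_cube_cat: "closed_cat (cube_cat n)"
  unfolding closed_cat_def
proof (intro conjI ballI impI)
  show "Ident (cube_cat n) x \<in> Ar (cube_cat n)" if "x \<in> Ob (cube_cat n)" for x
    using that by (simp add: cube_arr_refl)
  show "Dom (cube_cat n) f \<in> Ob (cube_cat n)" "Cod (cube_cat n) f \<in> Ob (cube_cat n)" if "f \<in> Ar (cube_cat n)" for f
    using cube_arr_ob[of "fst f" "snd f" n] that by simp_all
  show "Comp (cube_cat n) g f \<in> Ar (cube_cat n)"
    if "f \<in> Ar (cube_cat n)" "g \<in> Ar (cube_cat n)" "Cod (cube_cat n) f = Dom (cube_cat n) g" for f g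
    using that cube_arr_trans[of "fst f" "snd f" n "snd g"] by (simp add: prod_eq_iff) (metis prod.collapse)
qed

context canc_monoid
begin

lemma snd_functor_mult: "f \<in> Ar A \<Longrightarrow> snd (F \<otimes>\<^bsub>functor_monoid A \<tau>\<^esub> G) f = snd F f \<otimes> snd G f"
  by (simp add: functor_monoid_def)

lemma snd_functor_one: "f \<in> Ar A \<Longrightarrow> snd (\<one>\<^bsub>functor_monoid A \<tau>\<^esub>) f = \<one>"
  by (simp add: functor_monoid_def)

lemma functor_mult_closed:
  assumes A: "closed_cat A" and FG: "F \<in> functors A (monoid_cat \<tau>)" "G \<in> functors A (monoid_cat \<tau>)"
  shows "F \<otimes>\<^bsub>functor_monoid A \<tau>\<^esub> G \<in> functors A (monoid_cat \<tau>)"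
  unfolding functors_monoid_cat
proof (intro conjI ballI impI PiE_I)
  note FG' = FG[unfolded functors_monoid_cat]
  have cl: "snd F f \<in> carrier \<tau>" "snd G f \<in> carrier \<tau>" if "f \<in> Ar A" for f using FG' that by auto
  show "snd (F \<otimes>\<^bsub>functor_monoid A \<tau>\<^esub> G) f \<in> carrier \<tau>" if "f \<in> Ar A" for f
    using cl[OF that] by (simp add: snd_functor_mult[OF that])
  show "snd (F \<otimes>\<^bsub>functor_monoid A \<tau>\<^esub> G) f = undefined" if "f \<notin> Ar A" for f
    using that by (simp add: functor_monoid_def)
  show "snd (F \<otimes>\<^bsub>functor_monoid A \<tau>\<^esub> G) (Ident A x) = \<one>" if "x \<in> Ob A" for x
    using A that FG' by (simp add: closed_cat_def snd_functor_mult)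
  fix f g assume fg: "f \<in> Ar A" "g \<in> Ar A" "Cod A f = Dom A g"
  then have "Comp A g f \<in> Ar A" using A by (simp add: closed_cat_def)
  then show "snd (F \<otimes>\<^bsub>functor_monoid A \<tau>\<^esub> G) (Comp A g f) =
      snd (F \<otimes>\<^bsub>functor_monoid A \<tau>\<^esub> G) g \<otimes> snd (F \<otimes>\<^bsub>functor_monoid A \<tau>\<^esub> G) f"
    using fg FG' cl[OF fg(1)] cl[OF fg(2)] by (simp add: snd_functor_mult m_ac)
qed

lemma functor_one_closed:
  assumes A: "closed_cat A" shows "\<one>\<^bsub>functor_monoid A \<tau>\<^esub> \<in> functors A (monoid_cat \<tau>)"
  using A by (auto simp: functors_monoid_cat functor_monoid_def closed_cat_def)

lemma comm_monoid_functor_monoid: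
  assumes A: "closed_cat A" shows "comm_monoid (functor_monoid A \<tau>)"
proof (rule comm_monoidI)
  have c: "carrier (functor_monoid A \<tau>) = functors A (monoid_cat \<tau>)" by (simp add: functor_monoid_def)
  have cl: "snd F f \<in> carrier \<tau>" if "F \<in> functors A (monoid_cat \<tau>)" "f \<in> Ar A" for F f
    using that by (auto simp: functors_monoid_cat)
  note mc = functor_mult_closed[OF A] and oc = functor_one_closed[OF A]
  fix F G H assume "F \<in> carrier (functor_monoid A \<tau>)" "G \<in> carrier (functor_monoid A \<tau>)"
  then have FG: "F \<in> functors A (monoid_cat \<tau>)" "G \<in> functors A (monoid_cat \<tau>)" by (simp_all add: c)
  show "F \<otimes>\<^bsub>functor_monoid A \<tau>\<^esub> G \<in> carrier (functor_monoid A \<tau>)" using mc[OF FG] c by simp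
  show "F \<otimes>\<^bsub>functor_monoid A \<tau>\<^esub> G = G \<otimes>\<^bsub>functor_monoid A \<tau>\<^esub> F"
    by (rule functors_monoid_cat_eqI[OF mc[OF FG] mc[OF FG(2,1)]])
      (use cl[OF FG(1)] cl[OF FG(2)] in \<open>simp add: snd_functor_mult m_comm\<close>)
  show "\<one>\<^bsub>functor_monoid A \<tau>\<^esub> \<otimes>\<^bsub>functor_monoid A \<tau>\<^esub> F = F"
    by (rule functors_monoid_cat_eqI[OF mc[OF oc FG(1)] FG(1)])
      (use cl[OF FG(1)] in \<open>simp add: snd_functor_mult snd_functor_one\<close>)
  assume "H \<in> carrier (functor_monoid A \<tau>)"
  then have H: "H \<in> functors A (monoid_cat \<tau>)" by (simp add: c)
  show "F \<otimes>\<^bsub>functor_monoid A \<tau>\<^esub> G \<otimes>\<^bsub>functor_monoid A \<tau>\<^esub> H = F \<otimes>\<^bsub>functor_monoid A \<tau>\<^esub> (G \<otimes>\<^bsub>functor_monoid A \<tau>\<^esub> H)"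
    by (rule functors_monoid_cat_eqI[OF mc[OF mc[OF FG] H] mc[OF FG(1) mc[OF FG(2) H]]])
      (use cl[OF FG(1)] cl[OF FG(2)] cl[OF H] in \<open>simp add: snd_functor_mult m_assoc\<close>)
qed (use functor_one_closed[OF A] in \<open>simp add: functor_monoid_def\<close>)

definition pm where
  "pm A \<alpha> \<beta> = (\<lambda>n. \<lambda>a\<in>cells A n. \<alpha> n a \<otimes>\<^bsub>functor_monoid (cube_cat n) \<tau>\<^esub> \<beta> n a)"

definition pone where
  "pone A = (\<lambda>n. \<lambda>a\<in>cells A n. \<one>\<^bsub>functor_monoid (cube_cat n) \<tau>\<^esub>)"

lemma snd_pm: "a \<in> cells A n \<Longrightarrow> f \<in> Ar (cube_cat n) \<Longrightarrow> snd (pm A \<alpha> \<beta> n a) f = snd (\<alpha> n a) f \<otimes> snd (\<beta> n a) f"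
  by (simp add: pm_def snd_functor_mult)

lemma snd_pone: "a \<in> cells A n \<Longrightarrow> f \<in> Ar (cube_cat n) \<Longrightarrow> snd (pone A n a) f = \<one>"
  by (simp add: pone_def snd_functor_one)

lemma ner_homI:
  assumes A: "cubical_set A"
    and h: "\<And>n. h n \<in> extensional (cells A n)" "\<And>n a. a \<in> cells A n \<Longrightarrow> h n a \<in> functors (cube_cat n) (monoid_cat \<tau>)"
    and nat: "\<And>m n \<psi> a v w. box m n \<psi> \<Longrightarrow> a \<in> cells A n \<Longrightarrow> (v, w) \<in> Ar (cube_cat m) \<Longrightarrow>
      snd (h m (act A m n \<psi> a)) (v, w) = snd (h n a) (\<psi> v, \<psi> w)"
  shows "h \<in> cub_hom A (ner \<tau>)"
  unfolding cub_hom_def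
proof (intro CollectI conjI allI impI ballI PiE_I)
  show "h n a \<in> cells (ner \<tau>) n" if "a \<in> cells A n" for n a using h(2)[OF that] by (simp add: cells_ner)
  show "h n a = undefined" if "a \<notin> cells A n" for n a using h(1)[of n] that by (simp add: extensional_def)
  fix m n \<phi> a assume b: "box m n \<phi>" and a: "a \<in> cells A n"
  show "h m (act A m n \<phi> a) = act (ner \<tau>) m n \<phi> (h n a)"
    by (rule cube_functor_eqI[OF h(2)[OF act_in[OF A b a]] ner_act_in[OF h(2)[OF a] b]])
      (simp add: ner_act nat[OF b a])
qed

lemma pm_hom:
  assumes A: "cubical_set A" and ab: "\<alpha> \<in> cub_hom A (ner \<tau>)" "\<beta> \<in> cub_hom A (ner \<tau>)"
  shows "pm A \<alpha> \<beta> \<in> cub_hom A (ner \<tau>)"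
proof (rule ner_homI[OF A])
  show "pm A \<alpha> \<beta> n \<in> extensional (cells A n)" for n by (simp add: pm_def)
  show "pm A \<alpha> \<beta> n a \<in> functors (cube_cat n) (monoid_cat \<tau>)" if "a \<in> cells A n" for n a
    using functor_mult_closed[OF closed_cube_cat cub_hom_ner_in[OF ab(1) that] cub_hom_ner_in[OF ab(2) that]] that
    by (simp add: pm_def)
  show "snd (pm A \<alpha> \<beta> m (act A m n \<psi> a)) (v, w) = snd (pm A \<alpha> \<beta> n a) (\<psi> v, \<psi> w)"
    if "box m n \<psi>" "a \<in> cells A n" "(v, w) \<in> Ar (cube_cat m)" for m n \<psi> a v w
    using that by (simp add: snd_pm act_in[OF A] box_mono cub_hom_ner_arr[OF ab(1)] cub_hom_ner_arr[OF ab(2)])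
qed

lemma pone_hom:
  assumes A: "cubical_set A" shows "pone A \<in> cub_hom A (ner \<tau>)"
proof (rule ner_homI[OF A])
  show "pone A n \<in> extensional (cells A n)" for n by (simp add: pone_def)
  show "pone A n a \<in> functors (cube_cat n) (monoid_cat \<tau>)" if "a \<in> cells A n" for n a
    using functor_one_closed[OF closed_cube_cat] that by (simp add: pone_def)
  show "snd (pone A m (act A m n \<psi> a)) (v, w) = snd (pone A n a) (\<psi> v, \<psi> w)"
    if "box m n \<psi>" "a \<in> cells A n" "(v, w) \<in> Ar (cube_cat m)" for m n \<psi> a v w
    using that by (simp add: snd_pone act_in[OF A] box_mono)
qed

lemma pm_comm:
  assumes A: "cubical_set A" and ab: "\<alpha> \<in> cub_hom A (ner \<tau>)" "\<beta> \<in> cub_hom A (ner \<tau>)"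
  shows "pm A \<alpha> \<beta> = pm A \<beta> \<alpha>"
  by (rule cub_hom_ner_eqI[OF pm_hom[OF A ab] pm_hom[OF A ab(2,1)]])
    (use ner_closed[OF ab(1)] ner_closed[OF ab(2)] in \<open>simp add: snd_pm m_comm\<close>)

lemma pm_assoc:
  assumes A: "cubical_set A" and ab: "\<alpha> \<in> cub_hom A (ner \<tau>)" "\<beta> \<in> cub_hom A (ner \<tau>)" "\<gamma> \<in> cub_hom A (ner \<tau>)"
  shows "pm A (pm A \<alpha> \<beta>) \<gamma> = pm A \<alpha> (pm A \<beta> \<gamma>)"
  by (rule cub_hom_ner_eqI[OF pm_hom[OF A pm_hom[OF A ab(1,2)] ab(3)] pm_hom[OF A ab(1) pm_hom[OF A ab(2,3)]]])
    (use ner_closed[OF ab(1)] ner_closed[OF ab(2)] ner_closed[OF ab(3)] in \<open>simp add: snd_pm m_assoc\<close>)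

lemma pm_one:
  assumes A: "cubical_set A" and ab: "\<alpha> \<in> cub_hom A (ner \<tau>)"
  shows "pm A (pone A) \<alpha> = \<alpha>"
  by (rule cub_hom_ner_eqI[OF pm_hom[OF A pone_hom[OF A] ab] ab])
    (use ner_closed[OF ab] in \<open>simp add: snd_pm snd_pone\<close>)

text \<open>The cochain of a homotopy from \<open>\<alpha>\<close> to \<open>\<alpha>'\<close>
  serves unchanged after multiplication by \<open>\<beta>\<close>, by commutativity.\<close>

lemma pm_rel:
  assumes A: "cubical_set A" and ab: "(\<alpha>, \<alpha>') \<in> H1_rel A \<tau>" and \<beta>: "\<beta> \<in> cub_hom A (ner \<tau>)"
  shows "(pm A \<alpha> \<beta>, pm A \<alpha>' \<beta>) \<in> H1_rel A \<tau>"
proof (rule equiv_gen_map[OF hrel_sub H1_rel_equiv[OF A] pm_hom[OF A _ \<beta>] _ ab[unfolded H1_rel_eq[OF A]]])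
  fix \<alpha> \<alpha>' assume "(\<alpha>, \<alpha>') \<in> hrel A"
  then have hom: "\<alpha> \<in> cub_hom A (ner \<tau>)" "\<alpha>' \<in> cub_hom A (ner \<tau>)" and "homotopic A \<alpha> \<alpha>'" by (auto simp: hrel_def)
  then obtain g where g: "g \<in> cells A 0 \<rightarrow> carrier \<tau>"
    and eq: "\<And>n a v w. a \<in> cells A n \<Longrightarrow> (v, w) \<in> Ar (cube_cat n) \<Longrightarrow>
      snd (\<alpha> n a) (v, w) \<otimes> g (vx A n a w) = g (vx A n a v) \<otimes> snd (\<alpha>' n a) (v, w)"
    unfolding homotopic_def by blast
  have "homotopic A (pm A \<alpha> \<beta>) (pm A \<alpha>' \<beta>)"
    unfolding homotopic_def
  proof (intro bexI[OF _ g] allI ballI impI)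
    fix n a v w assume a: "a \<in> cells A n" and vw: "(v, w) \<in> Ar (cube_cat n)"
    have gc: "g (vx A n a v) \<in> carrier \<tau>" "g (vx A n a w) \<in> carrier \<tau>"
      using g vx_in[OF A a] cube_arr_ob[OF vw] by auto
    note cl = ner_closed[OF hom(1) a vw] ner_closed[OF hom(2) a vw] ner_closed[OF \<beta> a vw] gc
    have "snd (pm A \<alpha> \<beta> n a) (v, w) \<otimes> g (vx A n a w) = (snd (\<alpha> n a) (v, w) \<otimes> g (vx A n a w)) \<otimes> snd (\<beta> n a) (v, w)"
      using cl by (simp add: snd_pm[OF a vw] m_ac)
    also have "\<dots> = g (vx A n a v) \<otimes> snd (pm A \<alpha>' \<beta> n a) (v, w)"
      using cl by (simp add: eq[OF a vw] snd_pm[OF a vw] m_ac)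
    finally show "snd (pm A \<alpha> \<beta> n a) (v, w) \<otimes> g (vx A n a w) = g (vx A n a v) \<otimes> snd (pm A \<alpha>' \<beta> n a) (v, w)" .
  qed
  then show "(pm A \<alpha> \<beta>, pm A \<alpha>' \<beta>) \<in> H1_rel A \<tau>"
    by (rule H1_relI[OF A pm_hom[OF A hom(1) \<beta>] pm_hom[OF A hom(2) \<beta>]])
qed

lemma H1_rel_hom: "cubical_set A \<Longrightarrow> (\<alpha>, \<beta>) \<in> H1_rel A \<tau> \<Longrightarrow> \<alpha> \<in> cub_hom A (ner \<tau>) \<and> \<beta> \<in> cub_hom A (ner \<tau>)"
  using H1_rel_equiv[of A] by (meson equiv_class_eq_iff)

lemma H1_mult:
  assumes A: "cubical_set A" and ab: "\<alpha> \<in> cub_hom A (ner \<tau>)" "\<beta> \<in> cub_hom A (ner \<tau>)"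
  shows "H1_rel A \<tau> `` {\<alpha>} \<otimes>\<^bsub>H1 A \<tau>\<^esub> H1_rel A \<tau> `` {\<beta>} = H1_rel A \<tau> `` {pm A \<alpha> \<beta>}"
proof -
  note eq = H1_rel_equiv[OF A]
  have tr: "(x, y) \<in> H1_rel A \<tau> \<Longrightarrow> (y, w) \<in> H1_rel A \<tau> \<Longrightarrow> (x, w) \<in> H1_rel A \<tau>" for x y w
    using eq by (auto elim!: equivE dest: transD)
  have r: "(pm A \<alpha> \<beta>, pm A \<alpha>' \<beta>') \<in> H1_rel A \<tau>" if "(\<alpha>, \<alpha>') \<in> H1_rel A \<tau>" "(\<beta>, \<beta>') \<in> H1_rel A \<tau>" for \<alpha>' \<beta>'
  proof -
    have h: "\<alpha>' \<in> cub_hom A (ner \<tau>)" "\<beta>' \<in> cub_hom A (ner \<tau>)" using H1_rel_hom[OF A] that by auto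
    \<comment> \<open>\<open>pm_rel\<close> varies the first factor only; the second is reached by
      exchanging the two.\<close>
    have "(pm A \<alpha>' \<beta>, pm A \<alpha>' \<beta>') \<in> H1_rel A \<tau>"
      using pm_rel[OF A that(2) h(1)] pm_comm[OF A h(1) ab(2)] pm_comm[OF A h] by simp
    then show ?thesis using tr pm_rel[OF A that(1) ab(2)] by blast
  qed
  have s: "(\<alpha>, \<alpha>) \<in> H1_rel A \<tau>" "(\<beta>, \<beta>) \<in> H1_rel A \<tau>" using equiv_class_self[OF eq] ab by auto
  have "H1_rel A \<tau> `` {\<alpha>} \<otimes>\<^bsub>H1 A \<tau>\<^esub> H1_rel A \<tau> `` {\<beta>} =
     H1_rel A \<tau> `` {pm A \<alpha>' \<beta>' | \<alpha>' \<beta>'. \<alpha>' \<in> H1_rel A \<tau> `` {\<alpha>} \<and> \<beta>' \<in> H1_rel A \<tau> `` {\<beta>}}"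
    by (simp add: H1_def pm_def)
  also have "\<dots> = H1_rel A \<tau> `` {pm A \<alpha> \<beta>}"
  proof (intro subset_antisym subsetI)
    fix z assume "z \<in> H1_rel A \<tau> `` {pm A \<alpha>' \<beta>' | \<alpha>' \<beta>'. \<alpha>' \<in> H1_rel A \<tau> `` {\<alpha>} \<and> \<beta>' \<in> H1_rel A \<tau> `` {\<beta>}}"
    then obtain \<alpha>' \<beta>' where "(\<alpha>, \<alpha>') \<in> H1_rel A \<tau>" "(\<beta>, \<beta>') \<in> H1_rel A \<tau>" "(pm A \<alpha>' \<beta>', z) \<in> H1_rel A \<tau>" by auto
    then show "z \<in> H1_rel A \<tau> `` {pm A \<alpha> \<beta>}" using r tr by blast
  next
    fix z assume "z \<in> H1_rel A \<tau> `` {pm A \<alpha> \<beta>}"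
    then show "z \<in> H1_rel A \<tau> `` {pm A \<alpha>' \<beta>' | \<alpha>' \<beta>'. \<alpha>' \<in> H1_rel A \<tau> `` {\<alpha>} \<and> \<beta>' \<in> H1_rel A \<tau> `` {\<beta>}}"
      using s by blast
  qed
  finally show ?thesis .
qed

lemma carrier_H1: "carrier (H1 A \<tau>) = cub_hom A (ner \<tau>) // H1_rel A \<tau>"
  by (simp add: H1_def)

lemma one_H1: "\<one>\<^bsub>H1 A \<tau>\<^esub> = H1_rel A \<tau> `` {pone A}"
  by (simp add: H1_def pone_def)

lemma comm_monoid_H1:
  assumes A: "cubical_set A" shows "comm_monoid (H1 A \<tau>)"
proof (rule comm_monoidI)
  fix X Y Z assume "X \<in> carrier (H1 A \<tau>)" "Y \<in> carrier (H1 A \<tau>)"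
  then obtain \<alpha> \<beta> where x: "\<alpha> \<in> cub_hom A (ner \<tau>)" "X = H1_rel A \<tau> `` {\<alpha>}" and y: "\<beta> \<in> cub_hom A (ner \<tau>)" "Y = H1_rel A \<tau> `` {\<beta>}"
    by (auto simp: carrier_H1 elim!: quotientE)
  show "X \<otimes>\<^bsub>H1 A \<tau>\<^esub> Y \<in> carrier (H1 A \<tau>)"
    using x y by (simp add: H1_mult[OF A] carrier_H1 quotientI pm_hom[OF A])
  show "X \<otimes>\<^bsub>H1 A \<tau>\<^esub> Y = Y \<otimes>\<^bsub>H1 A \<tau>\<^esub> X"
    using x y by (simp add: H1_mult[OF A] pm_comm[OF A])
  show "\<one>\<^bsub>H1 A \<tau>\<^esub> \<otimes>\<^bsub>H1 A \<tau>\<^esub> X = X"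
    using x by (simp add: one_H1 H1_mult[OF A] pone_hom[OF A] pm_one[OF A])
  assume "Z \<in> carrier (H1 A \<tau>)"
  then obtain \<gamma> where z: "\<gamma> \<in> cub_hom A (ner \<tau>)" "Z = H1_rel A \<tau> `` {\<gamma>}" by (auto simp: carrier_H1 elim!: quotientE)
  show "X \<otimes>\<^bsub>H1 A \<tau>\<^esub> Y \<otimes>\<^bsub>H1 A \<tau>\<^esub> Z = X \<otimes>\<^bsub>H1 A \<tau>\<^esub> (Y \<otimes>\<^bsub>H1 A \<tau>\<^esub> Z)"
    using x y z by (simp add: H1_mult[OF A] pm_assoc[OF A] pm_hom[OF A])
qed (simp add: one_H1 carrier_H1 quotientI pone_hom[OF A])

lemma cub_hom_vx:
  "cubical_set A \<Longrightarrow> f \<in> cub_hom A B \<Longrightarrow> a \<in> cells A n \<Longrightarrow> v \<in> bcube n \<Longrightarrow> f 0 (vx A n a v) = vx B n (f n a) v"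
  by (simp add: vx_def cub_hom_act box_pt)

lemma H1_rel_pull:
  assumes A: "cubical_set A" and B: "cubical_set B" and f: "f \<in> cub_hom A B" and ab: "(\<alpha>, \<beta>) \<in> H1_rel B \<tau>"
  shows "(cub_comp A \<alpha> f, cub_comp A \<beta> f) \<in> H1_rel A \<tau>"
proof (rule equiv_gen_map[OF hrel_sub H1_rel_equiv[OF A] cub_comp_hom[OF A f] _ ab[unfolded H1_rel_eq[OF B]]])
  fix \<alpha> \<beta> assume "(\<alpha>, \<beta>) \<in> hrel B"
  then have hom: "\<alpha> \<in> cub_hom B (ner \<tau>)" "\<beta> \<in> cub_hom B (ner \<tau>)" and "homotopic B \<alpha> \<beta>" by (auto simp: hrel_def)
  then obtain g where g: "g \<in> cells B 0 \<rightarrow> carrier \<tau>"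
    and eq: "\<And>n a v w. a \<in> cells B n \<Longrightarrow> (v, w) \<in> Ar (cube_cat n) \<Longrightarrow>
      snd (\<alpha> n a) (v, w) \<otimes> g (vx B n a w) = g (vx B n a v) \<otimes> snd (\<beta> n a) (v, w)"
    unfolding homotopic_def by blast
  have "homotopic A (cub_comp A \<alpha> f) (cub_comp A \<beta> f)"
    unfolding homotopic_def
  proof (intro bexI[of _ "\<lambda>x. g (f 0 x)"] allI ballI impI)
    show "(\<lambda>x. g (f 0 x)) \<in> cells A 0 \<rightarrow> carrier \<tau>" using g cub_hom_in[OF f] by auto
    fix n a v w assume a: "a \<in> cells A n" and vw: "(v, w) \<in> Ar (cube_cat n)"
    show "snd (cub_comp A \<alpha> f n a) (v, w) \<otimes> g (f 0 (vx A n a w)) = g (f 0 (vx A n a v)) \<otimes> snd (cub_comp A \<beta> f n a) (v, w)"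
      using eq[OF cub_hom_in[OF f a] vw] cube_arr_ob[OF vw] by (simp add: cub_comp_apply[OF a] cub_hom_vx[OF A f a])
  qed
  then show "(cub_comp A \<alpha> f, cub_comp A \<beta> f) \<in> H1_rel A \<tau>"
    by (rule H1_relI[OF A cub_comp_hom[OF A f hom(1)] cub_comp_hom[OF A f hom(2)]])
qed

lemma H1_pull_class:
  assumes A: "cubical_set A" and B: "cubical_set B" and f: "f \<in> cub_hom A B" and \<alpha>: "\<alpha> \<in> cub_hom B (ner \<tau>)"
  shows "H1_pull A \<tau> f (H1_rel B \<tau> `` {\<alpha>}) = H1_rel A \<tau> `` {cub_comp A \<alpha> f}"
  unfolding H1_pull_def
  by (rule class_image[OF H1_rel_equiv[OF B] H1_rel_equiv[OF A] \<alpha> H1_rel_pull[OF A B f]])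

end

section \<open>Change of coefficients\<close>

lemma monoid_functorD:
  assumes "k \<in> functors (monoid_cat \<tau>) (monoid_cat \<tau>')"
  shows "x \<in> carrier \<tau> \<Longrightarrow> snd k x \<in> carrier \<tau>'" "snd k \<one>\<^bsub>\<tau>\<^esub> = \<one>\<^bsub>\<tau>'\<^esub>"
    "x \<in> carrier \<tau> \<Longrightarrow> y \<in> carrier \<tau> \<Longrightarrow> snd k (x \<otimes>\<^bsub>\<tau>\<^esub> y) = snd k x \<otimes>\<^bsub>\<tau>'\<^esub> snd k y"
  using assms by (auto simp: functors_monoid_cat)

lemma snd_func_comp: "f \<in> Ar A \<Longrightarrow> snd (func_comp A G F) f = snd G (snd F f)"
  by (simp add: func_comp_def compose_def)

lemma func_comp_functor:
  assumes A: "closed_cat A" and F: "F \<in> functors A B" and G: "G \<in> functors B D"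
  shows "func_comp A G F \<in> functors A D"
proof -
  obtain F0 F1 G0 G1 where FG: "F = (F0, F1)" "G = (G0, G1)" by (cases F, cases G)
  have f: "F0 \<in> Ob A \<rightarrow>\<^sub>E Ob B" "F1 \<in> Ar A \<rightarrow>\<^sub>E Ar B"
    "\<And>f. f \<in> Ar A \<Longrightarrow> Dom B (F1 f) = F0 (Dom A f)" "\<And>f. f \<in> Ar A \<Longrightarrow> Cod B (F1 f) = F0 (Cod A f)"
    "\<And>x. x \<in> Ob A \<Longrightarrow> F1 (Ident A x) = Ident B (F0 x)"
    "\<And>f g. f \<in> Ar A \<Longrightarrow> g \<in> Ar A \<Longrightarrow> Cod A f = Dom A g \<Longrightarrow> F1 (Comp A g f) = Comp B (F1 g) (F1 f)"
    using F unfolding functors_def FG by auto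
  have g: "G0 \<in> Ob B \<rightarrow>\<^sub>E Ob D" "G1 \<in> Ar B \<rightarrow>\<^sub>E Ar D"
    "\<And>f. f \<in> Ar B \<Longrightarrow> Dom D (G1 f) = G0 (Dom B f)" "\<And>f. f \<in> Ar B \<Longrightarrow> Cod D (G1 f) = G0 (Cod B f)"
    "\<And>x. x \<in> Ob B \<Longrightarrow> G1 (Ident B x) = Ident D (G0 x)"
    "\<And>f g. f \<in> Ar B \<Longrightarrow> g \<in> Ar B \<Longrightarrow> Cod B f = Dom B g \<Longrightarrow> G1 (Comp B g f) = Comp D (G1 g) (G1 f)"
    using G unfolding functors_def FG by auto
  have a: "\<And>f. f \<in> Ar A \<Longrightarrow> Dom A f \<in> Ob A" "\<And>f. f \<in> Ar A \<Longrightarrow> Cod A f \<in> Ob A" "\<And>x. x \<in> Ob A \<Longrightarrow> Ident A x \<in> Ar A"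
    "\<And>f g. f \<in> Ar A \<Longrightarrow> g \<in> Ar A \<Longrightarrow> Cod A f = Dom A g \<Longrightarrow> Comp A g f \<in> Ar A"
    using A unfolding closed_cat_def by auto
  note fi = PiE_mem[OF f(1)] PiE_mem[OF f(2)] PiE_mem[OF g(1)] PiE_mem[OF g(2)]
  show ?thesis
    unfolding functors_def func_comp_def FG fst_conv snd_conv
    by (auto simp: compose_def fi f(3-6) g(3-6) a)
qed

lemma nerve_map_apply: "F \<in> functors (cube_cat n) A \<Longrightarrow> nerve_map A H n F = func_comp (cube_cat n) H F"
  by (simp add: nerve_map_def)

lemma nerve_map_hom:
  assumes H: "H \<in> functors A (monoid_cat \<tau>)"
    and act: "\<And>m n \<psi> F. box m n \<psi> \<Longrightarrow> F \<in> functors (cube_cat n) A \<Longrightarrow> act (nerve A) m n \<psi> F \<in> functors (cube_cat m) A"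
  shows "nerve_map A H \<in> cub_hom (nerve A) (ner \<tau>)"
  unfolding cub_hom_def cells_ner
proof (intro CollectI conjI allI impI ballI)
  have c: "func_comp (cube_cat n) H F \<in> functors (cube_cat n) (monoid_cat \<tau>)" if "F \<in> functors (cube_cat n) A" for n F
    by (rule func_comp_functor[OF closed_cube_cat that H])
  show "nerve_map A H n \<in> functors (cube_cat n) A \<rightarrow>\<^sub>E functors (cube_cat n) (monoid_cat \<tau>)" for n
    using c by (simp add: nerve_map_def)
  fix m n \<phi> F assume b: "box m n \<phi>" and F: "F \<in> functors (cube_cat n) A"
  show "nerve_map A H m (act (nerve A) m n \<phi> F) = act (ner \<tau>) m n \<phi> (nerve_map A H n F)"
    unfolding nerve_map_apply[OF F] nerve_map_apply[OF act[OF b F]]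
    by (rule cube_functor_eqI[OF c[OF act[OF b F]] ner_act_in[OF c[OF F] b]])
      (simp add: snd_func_comp ner_act box_mono[OF b])
qed

text \<open>Applying \<open>k\<close> to the cochain of a homotopy gives the cochain of a homotopy
  between the images, because \<open>k\<close> is multiplicative.\<close>

lemma H1_push_class:
  assumes t: "canc_monoid \<tau>" and t': "canc_monoid \<tau>'" and A: "cubical_set A"
    and k: "k \<in> functors (monoid_cat \<tau>) (monoid_cat \<tau>')" and \<alpha>: "\<alpha> \<in> cub_hom A (ner \<tau>)"
  shows "H1_push A \<tau> \<tau>' k (H1_rel A \<tau> `` {\<alpha>}) = H1_rel A \<tau>' `` {cub_comp A (nerve_map (monoid_cat \<tau>) k) \<alpha>}"
  unfolding H1_push_def
proof (rule class_image[OF canc_monoid.H1_rel_equiv[OF t A] canc_monoid.H1_rel_equiv[OF t' A] \<alpha>])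
  interpret T: canc_monoid \<tau> by fact
  interpret T': canc_monoid \<tau>' by fact
  let ?k = "nerve_map (monoid_cat \<tau>) k"
  have k': "?k \<in> cub_hom (ner \<tau>) (ner \<tau>')" by (rule nerve_map_hom[OF k ner_act_in])
  fix \<beta> assume ab: "(\<alpha>, \<beta>) \<in> H1_rel A \<tau>"
  show "(cub_comp A ?k \<alpha>, cub_comp A ?k \<beta>) \<in> H1_rel A \<tau>'"
  proof (rule equiv_gen_map[OF T.hrel_sub T'.H1_rel_equiv[OF A] cub_comp_hom[OF A _ k'] _ ab[unfolded T.H1_rel_eq[OF A]]])
    fix \<alpha> \<beta> assume "(\<alpha>, \<beta>) \<in> T.hrel A"
    then have hom: "\<alpha> \<in> cub_hom A (ner \<tau>)" "\<beta> \<in> cub_hom A (ner \<tau>)" and "T.homotopic A \<alpha> \<beta>" by (auto simp: T.hrel_def)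
    then obtain g where g: "g \<in> cells A 0 \<rightarrow> carrier \<tau>"
      and eq: "\<And>n a v w. a \<in> cells A n \<Longrightarrow> (v, w) \<in> Ar (cube_cat n) \<Longrightarrow>
        snd (\<alpha> n a) (v, w) \<otimes>\<^bsub>\<tau>\<^esub> g (vx A n a w) = g (vx A n a v) \<otimes>\<^bsub>\<tau>\<^esub> snd (\<beta> n a) (v, w)"
      unfolding T.homotopic_def by blast
    have e: "snd (cub_comp A ?k \<gamma> n a) (v, w) = snd k (snd (\<gamma> n a) (v, w))"
      if "\<gamma> \<in> cub_hom A (ner \<tau>)" "a \<in> cells A n" "(v, w) \<in> Ar (cube_cat n)" for \<gamma> n a v w
      using that by (simp add: cub_comp_apply nerve_map_apply[OF cub_hom_ner_in] snd_func_comp)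
    have "T'.homotopic A (cub_comp A ?k \<alpha>) (cub_comp A ?k \<beta>)"
      unfolding T'.homotopic_def
    proof (intro bexI[of _ "\<lambda>x. snd k (g x)"] allI ballI impI)
      show "(\<lambda>x. snd k (g x)) \<in> cells A 0 \<rightarrow> carrier \<tau>'" using g monoid_functorD(1)[OF k] by auto
      fix n a v w assume a: "a \<in> cells A n" and vw: "(v, w) \<in> Ar (cube_cat n)"
      have gc: "g (vx A n a v) \<in> carrier \<tau>" "g (vx A n a w) \<in> carrier \<tau>"
        using g vx_in[OF A a] cube_arr_ob[OF vw] by auto
      show "snd (cub_comp A ?k \<alpha> n a) (v, w) \<otimes>\<^bsub>\<tau>'\<^esub> snd k (g (vx A n a w)) =
          snd k (g (vx A n a v)) \<otimes>\<^bsub>\<tau>'\<^esub> snd (cub_comp A ?k \<beta> n a) (v, w)"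
        unfolding e[OF hom(1) a vw] e[OF hom(2) a vw]
        using arg_cong[OF eq[OF a vw], of "snd k"] gc T.ner_closed[OF hom(1) a vw] T.ner_closed[OF hom(2) a vw]
        by (simp add: monoid_functorD(3)[OF k])
    qed
    then show "(cub_comp A ?k \<alpha>, cub_comp A ?k \<beta>) \<in> H1_rel A \<tau>'"
      by (rule T'.H1_relI[OF A cub_comp_hom[OF A hom(1) k'] cub_comp_hom[OF A hom(2) k']])
  qed
qed

section \<open>Singular cubical sets\<close>

lemma cells_sing: "\<gamma> \<in> cells (sing X) n \<longleftrightarrow> stream_map (dicube n) X \<gamma> \<and> \<gamma> \<in> extensional (icube n)"
  by (simp add: sing_def)

lemma act_sing: "act (sing X) m n \<psi> \<gamma> = compose (icube m) \<gamma> (geom m n \<psi>)"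
  by (simp add: sing_def)

lemma sing_compose:
  assumes "stream_map (dicube m) (dicube n) \<theta>" "\<gamma> \<in> cells (sing X) n"
  shows "compose (icube m) \<gamma> \<theta> \<in> cells (sing X) m"
  unfolding cells_sing
proof
  show "stream_map (dicube m) X (compose (icube m) \<gamma> \<theta>)"
    by (rule stream_map_dicube_cong[OF stream_map_compose[OF assms(1)]]) (use assms(2) in \<open>auto simp: cells_sing compose_def\<close>)
qed simp

lemma cubical_set_sing: "cubical_set (sing X)"
  unfolding cubical_set_def
proof (intro conjI allI impI ballI Pi_I)
  show "act (sing X) m n \<phi> c \<in> cells (sing X) m" if "box m n \<phi>" "c \<in> cells (sing X) n" for m n \<phi> c
    unfolding act_sing by (rule sing_compose[OF geom_stream_map[OF that(1)] that(2)])
  show "act (sing X) n n (\<lambda>x\<in>bcube n. x) c = c" if "c \<in> cells (sing X) n" for n c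
    using that by (auto simp: act_sing geom_id cells_sing compose_def extensional_def fun_eq_iff)
  show "act (sing X) l n (compose (bcube l) \<psi> \<phi>) c = act (sing X) l m \<phi> (act (sing X) m n \<psi> c)"
    if "box l m \<phi>" "box m n \<psi>" "c \<in> cells (sing X) n" for l m n \<phi> \<psi> c
    unfolding act_sing geom_compose[OF that(1,2)] using geom_in[OF that(1)] by (auto simp: compose_def fun_eq_iff)
qed

lemma sing_map_hom:
  assumes g: "stream_map X Y g" shows "sing_map X g \<in> cub_hom (sing X) (sing Y)"
  unfolding cub_hom_def
proof (intro CollectI conjI allI impI ballI PiE_I)
  show "sing_map X g n \<gamma> \<in> cells (sing Y) n" if "\<gamma> \<in> cells (sing X) n" for n \<gamma>
  proof -
    have "stream_map (dicube n) Y (compose (icube n) g \<gamma>)"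
      by (rule stream_map_dicube_cong[OF stream_map_compose[OF _ g], of _ \<gamma>]) (use that in \<open>auto simp: cells_sing compose_def\<close>)
    then show ?thesis using that by (simp add: sing_map_def cells_sing)
  qed
  show "sing_map X g n \<gamma> = undefined" if "\<gamma> \<notin> cells (sing X) n" for n \<gamma> using that by (simp add: sing_map_def)
  fix m n \<phi> \<gamma> assume b: "box m n \<phi>" and c: "\<gamma> \<in> cells (sing X) n"
  show "sing_map X g m (act (sing X) m n \<phi> \<gamma>) = act (sing Y) m n \<phi> (sing_map X g n \<gamma>)"
    using c act_in[OF cubical_set_sing b c] geom_in[OF b]
    by (auto simp: sing_map_def act_sing compose_def fun_eq_iff)
qed

lemma sing_unit_apply: "c \<in> cells C n \<Longrightarrow> sing_unit C n c = (\<lambda>t\<in>icube n. cell_pt C n c t)"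
  by (simp add: sing_unit_def cell_pt_def)

lemma sing_unit_hom:
  assumes C: "cubical_set C" shows "sing_unit C \<in> cub_hom C (sing (realization C))"
  unfolding cub_hom_def
proof (intro CollectI conjI allI impI ballI PiE_I)
  show "sing_unit C n c \<in> cells (sing (realization C)) n" if "c \<in> cells C n" for n c
    using stream_map_dicube_cong[OF stream_map_cell_pt[OF C that]] by (simp add: sing_unit_apply[OF that] cells_sing)
  show "sing_unit C n c = undefined" if "c \<notin> cells C n" for n c using that by (simp add: sing_unit_def)
  fix m n \<phi> c assume b: "box m n \<phi>" and c: "c \<in> cells C n"
  show "sing_unit C m (act C m n \<phi> c) = act (sing (realization C)) m n \<phi> (sing_unit C n c)"
    using cell_pt_act[OF C b c] geom_in[OF b]
    by (auto simp: sing_unit_apply[OF c] sing_unit_apply[OF act_in[OF C b c]] act_sing compose_def fun_eq_iff)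
qed

lemma realization_map_cell_pt:
  assumes C: "cubical_set C" and D: "cubical_set D" and f: "f \<in> cub_hom C D" and c: "c \<in> cells C n" "t \<in> icube n"
  shows "realization_map D f (cell_pt C n c t) = cell_pt D n (f n c) t"
proof -
  define h where "h = (\<lambda>((n, c), t :: nat \<Rightarrow> real). ((n, f n c), t))"
  have r: "(h x, h y) \<in> real_rel D" if xy: "(x, y) \<in> real_rel C" for x y
  proof (rule equiv_gen_map[OF real_gen_sub[OF C] real_equiv[OF D] _ _ xy[unfolded real_rel_naive[OF C] naive_rel_def]])
    show "h x \<in> pts D" if "x \<in> pts C" for x using that cub_hom_in[OF f] by (auto simp: h_def pts_def)
    fix x y assume "(x, y) \<in> real_gen C"
    then have "(h x, h y) \<in> real_gen D"
      unfolding real_gen_def h_def using cub_hom_act[OF f] cub_hom_in[OF f] by fastforce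
    then show "(h x, h y) \<in> real_rel D" unfolding real_rel_naive[OF D] naive_rel_def by (rule subsetD[OF equiv_gen_incl])
  qed
  have "realization_map D f (cell_pt C n c t) = real_rel D `` {h x | x. x \<in> real_rel C `` {((n, c), t)}}"
    unfolding realization_map_def cell_pt_def h_def by (rule arg_cong[where f = "\<lambda>S. real_rel D `` S"]) auto
  also have "\<dots> = real_rel D `` {h ((n, c), t)}"
    by (rule class_image[OF real_equiv[OF C] real_equiv[OF D] _ r]) (use c in \<open>auto simp: pts_def\<close>)
  finally show ?thesis by (simp add: h_def cell_pt_def)
qed

lemma realization_map_stream_map:
  assumes C: "cubical_set C" and D: "cubical_set D" and f: "f \<in> cub_hom C D"
  shows "stream_map (realization C) (realization D) (realization_map D f)"
proof (rule stream_map_realization[OF C circ_preorder_realization[OF D]])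
  fix n c assume c: "c \<in> cells C n"
  show "stream_map (dicube n) (realization D) (\<lambda>t. realization_map D f (cell_pt C n c t))"
    by (rule stream_map_dicube_cong[OF stream_map_cell_pt[OF D cub_hom_in[OF f c]]])
      (simp add: realization_map_cell_pt[OF C D f c])
qed

lemma sing_map_unit:
  assumes C: "cubical_set C" and D: "cubical_set D" and f: "f \<in> cub_hom C D"
  shows "cub_comp C (sing_map (realization C) (realization_map D f)) (sing_unit C) = cub_comp C (sing_unit D) f"
proof (rule cub_hom_eqI)
  show "cub_comp C (sing_map (realization C) (realization_map D f)) (sing_unit C) \<in> cub_hom C (sing (realization D))"
    by (rule cub_comp_hom[OF C sing_unit_hom[OF C] sing_map_hom[OF realization_map_stream_map[OF C D f]]])
  show "cub_comp C (sing_unit D) f \<in> cub_hom C (sing (realization D))"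
    by (rule cub_comp_hom[OF C f sing_unit_hom[OF D]])
  fix n c assume c: "c \<in> cells C n"
  show "cub_comp C (sing_map (realization C) (realization_map D f)) (sing_unit C) n c = cub_comp C (sing_unit D) f n c"
    using cub_hom_in[OF sing_unit_hom[OF C] c] realization_map_cell_pt[OF C D f c]
    by (auto simp: cub_comp_apply[OF c] sing_map_def sing_unit_apply[OF c] sing_unit_apply[OF cub_hom_in[OF f c]] compose_def fun_eq_iff)
qed

section \<open>The fundamental category\<close>

definition t1_pt :: "'c cubical \<Rightarrow> nat \<Rightarrow> 'c \<Rightarrow> (nat \<Rightarrow> bool) \<Rightarrow> 'c t1_ob" where
  "t1_pt C n c v = t1_ob_rel C `` {((n, c), v)}"

lemma t1_ob_gen_sub:
  assumes C: "cubical_set C"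
  shows "{(((m, act C m n \<phi> c), v), ((n, c), \<phi> v)) | m n \<phi> c v.
        box m n \<phi> \<and> c \<in> cells C n \<and> v \<in> bcube m} \<subseteq> t1_vertices C \<times> t1_vertices C"
  using C by (auto simp: t1_vertices_def act_in box_in)

lemma t1_ob_equiv: "cubical_set C \<Longrightarrow> equiv (t1_vertices C) (t1_ob_rel C)"
  unfolding t1_ob_rel_def by (rule equiv_gen_equiv[OF t1_ob_gen_sub])

lemma t1_pt_in: "c \<in> cells C n \<Longrightarrow> v \<in> bcube n \<Longrightarrow> t1_pt C n c v \<in> t1_vertices C // t1_ob_rel C"
  by (simp add: t1_pt_def quotientI t1_vertices_def)

lemma t1_pt_act:
  assumes C: "cubical_set C" and "box m n \<psi>" "c \<in> cells C n" "v \<in> bcube m"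
  shows "t1_pt C m (act C m n \<psi> c) v = t1_pt C n c (\<psi> v)"
  unfolding t1_pt_def
proof (rule equiv_class_eq[OF t1_ob_equiv[OF C]])
  show "(((m, act C m n \<psi> c), v), ((n, c), \<psi> v)) \<in> t1_ob_rel C"
    unfolding t1_ob_rel_def by (rule subsetD[OF equiv_gen_incl]) (use assms in blast)
qed

lemma t1_path_Cons:
  "t1_path C x (((n, c), (v, w)) # ls) y \<longleftrightarrow> c \<in> cells C n \<and> (v, w) \<in> Ar (cube_cat n) \<and>
     x = t1_pt C n c v \<and> t1_path C (t1_pt C n c w) ls y"
  by (simp add: t1_letters_def t1_pt_def)

lemma t1_path_start: "t1_path C x ls y \<Longrightarrow> x \<in> t1_vertices C // t1_ob_rel C"
proof (cases ls)
  case (Cons l ls')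
  assume p: "t1_path C x ls y"
  obtain n c v w where l: "l = ((n, c), (v, w))" by (metis prod.exhaust)
  show ?thesis using p t1_pt_in[of c C n v] cube_arr_ob(1)[of v w n] unfolding Cons l t1_path_Cons by metis
qed auto

lemma t1_path_append: "t1_path C x (as @ bs) z \<longleftrightarrow> (\<exists>y. t1_path C x as y \<and> t1_path C y bs z)"
proof (induction as arbitrary: x)
  case Nil
  then show ?case using t1_path_start by auto
next
  case (Cons l as)
  obtain n c v w where l: "l = ((n, c), (v, w))" by (metis prod.exhaust)
  show ?case unfolding l append_Cons t1_path_Cons using Cons.IH by blast
qed

lemma t1_path_end: "t1_path C x ls y \<Longrightarrow> y \<in> t1_vertices C // t1_ob_rel C"
  using t1_path_append[of C x ls "[]" y] t1_path_start[of C y "[]" y] by auto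

lemma t1_path_letters: "t1_path C x ls y \<Longrightarrow> set ls \<subseteq> t1_letters C"
proof (induction ls arbitrary: x)
  case (Cons l ls)
  obtain s v w where l: "l = (s, (v, w))" by (metis prod.exhaust)
  show ?case using Cons unfolding l by auto
qed simp

abbreviation t1_gen :: "'c cubical \<Rightarrow> 'c t1_ob \<Rightarrow> 'c t1_ob \<Rightarrow> ('c t1_letter list) rel" where
  "t1_gen C x y \<equiv> {(as @ l @ bs, as @ r @ bs) | as bs l r. (l, r) \<in> t1_basic C \<and>
        as @ l @ bs \<in> t1_words C x y \<and> as @ r @ bs \<in> t1_words C x y}"

lemma t1_gen_sub: "t1_gen C x y \<subseteq> t1_words C x y \<times> t1_words C x y" by blast

lemma t1_equiv: "equiv (t1_words C x y) (t1_rel C x y)"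
  unfolding t1_rel_def by (rule equiv_gen_equiv[OF t1_gen_sub])

lemma t1_relI:
  assumes "(l, r) \<in> t1_basic C" "as @ l @ bs \<in> t1_words C x y" "as @ r @ bs \<in> t1_words C x y"
  shows "(as @ l @ bs, as @ r @ bs) \<in> t1_rel C x y"
  unfolding t1_rel_def by (rule subsetD[OF equiv_gen_incl]) (use assms in blast)

lemma t1_words_append: "p \<in> t1_words C x y \<Longrightarrow> q \<in> t1_words C y z \<Longrightarrow> p @ q \<in> t1_words C x z"
  by (auto simp: t1_words_def t1_path_append)

text \<open>The generators allow arbitrary words on both sides of a basic relation, so the two
  factors can be replaced one after the other.\<close>

lemma t1_rel_append:
  assumes p: "(p, p') \<in> t1_rel C x y" and q: "(q, q') \<in> t1_rel C y z"
  shows "(p @ q, p' @ q') \<in> t1_rel C x z"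
proof -
  have w: "p' \<in> t1_words C x y" "q \<in> t1_words C y z"
    using p q t1_equiv by (meson equiv_class_eq_iff)+
  have "(p @ q, p' @ q) \<in> t1_rel C x z"
  proof (rule equiv_gen_map[OF t1_gen_sub t1_equiv _ _ p[unfolded t1_rel_def], of "\<lambda>p. p @ q"])
    show "a @ q \<in> t1_words C x z" if "a \<in> t1_words C x y" for a using t1_words_append[OF that w(2)] .
    fix a b assume "(a, b) \<in> t1_gen C x y"
    then obtain as bs l r where g: "a = as @ l @ bs" "b = as @ r @ bs" "(l, r) \<in> t1_basic C" "a \<in> t1_words C x y" "b \<in> t1_words C x y" by blast
    show "(a @ q, b @ q) \<in> t1_rel C x z"
      using t1_relI[OF g(3), of as "bs @ q" x z] t1_words_append[OF g(4) w(2)] t1_words_append[OF g(5) w(2)]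
      unfolding g(1,2) by simp
  qed
  moreover have "(p' @ q, p' @ q') \<in> t1_rel C x z"
  proof (rule equiv_gen_map[OF t1_gen_sub t1_equiv _ _ q[unfolded t1_rel_def], of "\<lambda>q. p' @ q"])
    show "p' @ a \<in> t1_words C x z" if "a \<in> t1_words C y z" for a using t1_words_append[OF w(1) that] .
    fix a b assume "(a, b) \<in> t1_gen C y z"
    then obtain as bs l r where g: "a = as @ l @ bs" "b = as @ r @ bs" "(l, r) \<in> t1_basic C" "a \<in> t1_words C y z" "b \<in> t1_words C y z" by blast
    show "(p' @ a, p' @ b) \<in> t1_rel C x z"
      using t1_relI[OF g(3), of "p' @ as" bs x z] t1_words_append[OF w(1) g(4)] t1_words_append[OF w(1) g(5)]
      unfolding g(1,2) by simp
  qed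
  ultimately show ?thesis using t1_equiv[of C x z] unfolding equiv_def by (meson transD)
qed

abbreviation t1_class :: "'c cubical \<Rightarrow> 'c t1_ob \<Rightarrow> 'c t1_letter list \<Rightarrow> 'c t1_ob \<Rightarrow> 'c t1_ar" where
  "t1_class C x p y \<equiv> (x, t1_rel C x y `` {p}, y)"

lemma T1_simps [simp]:
  "Ob (T1 C) = t1_vertices C // t1_ob_rel C" "Dom (T1 C) (x, P, y) = x" "Cod (T1 C) (x, P, y) = y"
  "Ident (T1 C) x = t1_class C x [] x"
  by (simp_all add: T1_def)

lemma T1_arrow: "p \<in> t1_words C x y \<Longrightarrow> t1_class C x p y \<in> Ar (T1 C)"
  by (simp add: T1_def quotientI) (auto simp: t1_words_def dest: t1_path_start t1_path_end)

lemma T1_arrow_cases: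
  assumes "f \<in> Ar (T1 C)" obtains x p y where "p \<in> t1_words C x y" "f = t1_class C x p y"
  using assms by (auto simp: T1_def elim!: quotientE)

lemma T1_Comp:
  assumes p: "p \<in> t1_words C x y" and q: "q \<in> t1_words C y z"
  shows "Comp (T1 C) (t1_class C y q z) (t1_class C x p y) = t1_class C x (p @ q) z"
proof -
  have "t1_rel C x z `` {p' @ q' | p' q'. p' \<in> t1_rel C x y `` {p} \<and> q' \<in> t1_rel C y z `` {q}} = t1_rel C x z `` {p @ q}"
  proof (intro subset_antisym subsetI)
    fix r assume "r \<in> t1_rel C x z `` {p' @ q' | p' q'. p' \<in> t1_rel C x y `` {p} \<and> q' \<in> t1_rel C y z `` {q}}"
    then obtain p' q' where r: "(p, p') \<in> t1_rel C x y" "(q, q') \<in> t1_rel C y z" "(p' @ q', r) \<in> t1_rel C x z" by auto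
    then show "r \<in> t1_rel C x z `` {p @ q}"
      using t1_rel_append[OF r(1,2)] t1_equiv[of C x z] by (auto elim!: equivE dest: transD)
  next
    fix r assume "r \<in> t1_rel C x z `` {p @ q}"
    moreover have "p \<in> t1_rel C x y `` {p}" "q \<in> t1_rel C y z `` {q}"
      using equiv_class_self[OF t1_equiv p] equiv_class_self[OF t1_equiv q] by auto
    ultimately show "r \<in> t1_rel C x z `` {p' @ q' | p' q'. p' \<in> t1_rel C x y `` {p} \<and> q' \<in> t1_rel C y z `` {q}}" by blast
  qed
  then show ?thesis by (simp add: T1_def)
qed

lemma closed_T1: "closed_cat (T1 C)"
  unfolding closed_cat_def
proof (intro conjI ballI impI)
  show "Ident (T1 C) x \<in> Ar (T1 C)" if "x \<in> Ob (T1 C)" for x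
    using T1_arrow[of "[]" C x x] that by (simp add: t1_words_def)
  show "Dom (T1 C) f \<in> Ob (T1 C)" "Cod (T1 C) f \<in> Ob (T1 C)" if "f \<in> Ar (T1 C)" for f
    using that by (auto simp: T1_def)
  fix f g assume f: "f \<in> Ar (T1 C)" and g: "g \<in> Ar (T1 C)" and c: "Cod (T1 C) f = Dom (T1 C) g"
  obtain x p y where p: "p \<in> t1_words C x y" "f = t1_class C x p y" using T1_arrow_cases[OF f] .
  obtain y' q z where q: "q \<in> t1_words C y' z" "g = t1_class C y' q z" using T1_arrow_cases[OF g] .
  have "y' = y" using c p q by simp
  then show "Comp (T1 C) g f \<in> Ar (T1 C)"
    using T1_Comp[OF p(1)] T1_arrow[OF t1_words_append[OF p(1)]] p q by simp
qed

text \<open>The image of the arrow \<open>(v, w)\<close> of the cube \<open>c\<close> in the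
  colimit; these arrows and the identities generate \<open>T1 C\<close> under composition.\<close>

definition t1_edge :: "'c cubical \<Rightarrow> nat \<Rightarrow> 'c \<Rightarrow> (nat \<Rightarrow> bool) \<Rightarrow> (nat \<Rightarrow> bool) \<Rightarrow> 'c t1_ar" where
  "t1_edge C n c v w = t1_class C (t1_pt C n c v) [((n, c), (v, w))] (t1_pt C n c w)"

lemma t1_edge_word:
  "c \<in> cells C n \<Longrightarrow> (v, w) \<in> Ar (cube_cat n) \<Longrightarrow> [((n, c), (v, w))] \<in> t1_words C (t1_pt C n c v) (t1_pt C n c w)"
  using t1_pt_in[of c C n w] cube_arr_ob[of v w n] unfolding t1_words_def by (simp only: mem_Collect_eq t1_path_Cons) simp

lemma t1_edge_in: "c \<in> cells C n \<Longrightarrow> (v, w) \<in> Ar (cube_cat n) \<Longrightarrow> t1_edge C n c v w \<in> Ar (T1 C)"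
  unfolding t1_edge_def by (rule T1_arrow[OF t1_edge_word])

lemma T1_unit_apply:
  "c \<in> cells C n \<Longrightarrow> fst (T1_unit C n c) = (\<lambda>v\<in>bcube n. t1_pt C n c v)"
  "c \<in> cells C n \<Longrightarrow> (v, w) \<in> Ar (cube_cat n) \<Longrightarrow> snd (T1_unit C n c) (v, w) = t1_edge C n c v w"
  by (simp_all add: T1_unit_def t1_pt_def t1_edge_def)

lemma t1_edge_ident:
  assumes "c \<in> cells C n" "v \<in> bcube n" shows "t1_edge C n c v v = Ident (T1 C) (t1_pt C n c v)"
proof -
  let ?x = "t1_pt C n c v"
  have w: "[((n, c), (v, v))] \<in> t1_words C ?x ?x"
    by (rule t1_edge_word[OF assms(1) cube_arr_refl[OF assms(2)]])
  have w': "[] \<in> t1_words C ?x ?x" using t1_pt_in[OF assms] by (simp add: t1_words_def)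
  have "([] @ [((n, c), (v, v))] @ [], [] @ [] @ []) \<in> t1_rel C ?x ?x"
    by (rule t1_relI[OF t1_basic.ident]) (use w w' in simp_all)
  then have "t1_rel C ?x ?x `` {[((n, c), (v, v))]} = t1_rel C ?x ?x `` {[]}"
    by (intro equiv_class_eq[OF t1_equiv]) simp
  then show ?thesis by (simp add: t1_edge_def)
qed

lemma t1_edge_comp:
  assumes "c \<in> cells C n" "(u, v) \<in> Ar (cube_cat n)" "(v, w) \<in> Ar (cube_cat n)"
  shows "t1_edge C n c u w = Comp (T1 C) (t1_edge C n c v w) (t1_edge C n c u v)"
proof -
  let ?x = "t1_pt C n c"
  have "([] @ [((n, c), (u, v)), ((n, c), (v, w))] @ [], [] @ [((n, c), (u, w))] @ []) \<in> t1_rel C (?x u) (?x w)"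
    by (rule t1_relI[OF t1_basic.comp])
      (use t1_words_append[OF t1_edge_word[OF assms(1,2)] t1_edge_word[OF assms(1,3)]]
        t1_edge_word[OF assms(1) cube_arr_trans[OF assms(2,3)]] in simp_all)
  then have "t1_rel C (?x u) (?x w) `` {[((n, c), (u, v)), ((n, c), (v, w))]} = t1_rel C (?x u) (?x w) `` {[((n, c), (u, w))]}"
    by (intro equiv_class_eq[OF t1_equiv]) simp
  then show ?thesis
    unfolding t1_edge_def T1_Comp[OF t1_edge_word[OF assms(1,2)] t1_edge_word[OF assms(1,3)]] by simp
qed

lemma t1_edge_act:
  assumes C: "cubical_set C" and b: "box m n \<psi>" and c: "c \<in> cells C n" and vw: "(v, w) \<in> Ar (cube_cat m)"
  shows "t1_edge C m (act C m n \<psi> c) v w = t1_edge C n c (\<psi> v) (\<psi> w)"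
proof -
  let ?c = "act C m n \<psi> c"
  have x: "t1_pt C m ?c v = t1_pt C n c (\<psi> v)" "t1_pt C m ?c w = t1_pt C n c (\<psi> w)"
    using t1_pt_act[OF C b c] cube_arr_ob[OF vw] by auto
  have "([] @ [((m, ?c), (v, w))] @ [], [] @ [((n, c), (\<psi> v, \<psi> w))] @ []) \<in> t1_rel C (t1_pt C n c (\<psi> v)) (t1_pt C n c (\<psi> w))"
    by (rule t1_relI[OF t1_basic.elem[OF b c vw]])
      (use t1_edge_word[OF act_in[OF C b c] vw, unfolded x] t1_edge_word[OF c box_mono[OF b vw]] in simp_all)
  then have "t1_rel C (t1_pt C n c (\<psi> v)) (t1_pt C n c (\<psi> w)) `` {[((m, ?c), (v, w))]} =
     t1_rel C (t1_pt C n c (\<psi> v)) (t1_pt C n c (\<psi> w)) `` {[((n, c), (\<psi> v, \<psi> w))]}"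
    by (intro equiv_class_eq[OF t1_equiv]) simp
  then show ?thesis unfolding t1_edge_def x by simp
qed

lemma T1_unit_functor:
  assumes c: "c \<in> cells C n" shows "T1_unit C n c \<in> functors (cube_cat n) (T1 C)"
proof -
  have e: "(fst (T1_unit C n c), snd (T1_unit C n c)) \<in> functors (cube_cat n) (T1 C)"
    unfolding functors_def mem_Collect_eq prod.case
  proof (intro conjI ballI impI)
    show "fst (T1_unit C n c) \<in> Ob (cube_cat n) \<rightarrow>\<^sub>E Ob (T1 C)" using t1_pt_in[OF c] by (simp add: T1_unit_apply[OF c])
    have "snd (T1_unit C n c) \<in> extensional (Ar (cube_cat n))" using c by (simp add: T1_unit_def)
    moreover have "snd (T1_unit C n c) f \<in> Ar (T1 C)" if "f \<in> Ar (cube_cat n)" for f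
      using that T1_unit_apply(2)[OF c] t1_edge_in[OF c] by (cases f) simp
    ultimately show "snd (T1_unit C n c) \<in> Ar (cube_cat n) \<rightarrow>\<^sub>E Ar (T1 C)" by (simp add: PiE_iff)
    fix f assume f: "f \<in> Ar (cube_cat n)"
    obtain u v where fu: "f = (u, v)" by (cases f)
    note ob = cube_arr_ob[OF f[unfolded fu]]
    show "Dom (T1 C) (snd (T1_unit C n c) f) = fst (T1_unit C n c) (Dom (cube_cat n) f)"
      "Cod (T1 C) (snd (T1_unit C n c) f) = fst (T1_unit C n c) (Cod (cube_cat n) f)"
      using f ob by (simp_all add: fu T1_unit_apply[OF c] t1_edge_def)
    fix g assume g: "g \<in> Ar (cube_cat n)" and fg: "Cod (cube_cat n) f = Dom (cube_cat n) g"
    obtain w where gv: "g = (v, w)" using fg fu by (cases g) simp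
    show "snd (T1_unit C n c) (Comp (cube_cat n) g f) = Comp (T1 C) (snd (T1_unit C n c) g) (snd (T1_unit C n c) f)"
      using t1_edge_comp[OF c f[unfolded fu] g[unfolded gv]] T1_unit_apply(2)[OF c] f g cube_arr_trans[OF f[unfolded fu] g[unfolded gv]]
      by (simp add: fu gv)
  next
    show "snd (T1_unit C n c) (Ident (cube_cat n) x) = Ident (T1 C) (fst (T1_unit C n c) x)" if "x \<in> Ob (cube_cat n)" for x
      using that t1_edge_ident[OF c, of x] cube_arr_refl[of x n] T1_unit_apply[OF c] by simp
  qed
  then show ?thesis by simp
qed

text \<open>Transposition along the adjunction between \<open>T1\<close> and the nerve.\<close>

definition adjunct where
  "adjunct C F = cub_comp C (nerve_map (T1 C) F) (T1_unit C)"

lemma adjunct_apply: "c \<in> cells C n \<Longrightarrow> adjunct C F n c = func_comp (cube_cat n) F (T1_unit C n c)"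
  by (simp add: adjunct_def cub_comp_apply nerve_map_apply T1_unit_functor)

lemma snd_adjunct:
  "c \<in> cells C n \<Longrightarrow> (v, w) \<in> Ar (cube_cat n) \<Longrightarrow> snd (adjunct C F n c) (v, w) = snd F (t1_edge C n c v w)"
  by (simp add: adjunct_apply snd_func_comp T1_unit_apply)

context canc_monoid
begin

lemma adjunct_hom:
  assumes C: "cubical_set C" and F: "F \<in> functors (T1 C) (monoid_cat \<tau>)"
  shows "adjunct C F \<in> cub_hom C (ner \<tau>)"
proof (rule ner_homI[OF C])
  show "adjunct C F n \<in> extensional (cells C n)" for n by (simp add: adjunct_def cub_comp_def)
  show "adjunct C F n c \<in> functors (cube_cat n) (monoid_cat \<tau>)" if "c \<in> cells C n" for n c
    unfolding adjunct_apply[OF that] by (rule func_comp_functor[OF closed_cube_cat T1_unit_functor[OF that] F])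
  show "snd (adjunct C F m (act C m n \<psi> a)) (v, w) = snd (adjunct C F n a) (\<psi> v, \<psi> w)"
    if "box m n \<psi>" "a \<in> cells C n" "(v, w) \<in> Ar (cube_cat m)" for m n \<psi> a v w
    using that by (simp add: snd_adjunct act_in[OF C] box_mono t1_edge_act[OF C])
qed

lemma adjunct_mult:
  assumes "F \<in> functors (T1 C) (monoid_cat \<tau>)" "G \<in> functors (T1 C) (monoid_cat \<tau>)" "cubical_set C"
  shows "adjunct C (F \<otimes>\<^bsub>functor_monoid (T1 C) \<tau>\<^esub> G) = pm C (adjunct C F) (adjunct C G)"
  by (rule cub_hom_ner_eqI[OF adjunct_hom[OF assms(3) functor_mult_closed[OF closed_T1 assms(1,2)]]
      pm_hom[OF assms(3) adjunct_hom[OF assms(3,1)] adjunct_hom[OF assms(3,2)]]])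
    (simp add: snd_adjunct snd_pm snd_functor_mult t1_edge_in)

text \<open>Every arrow is a composite of edges, on which a functor is read off from its transpose;
  hence induction on a representing word.\<close>

lemma adjunct_inj:
  assumes F: "F \<in> functors (T1 C) (monoid_cat \<tau>)" and G: "G \<in> functors (T1 C) (monoid_cat \<tau>)"
    and eq: "adjunct C F = adjunct C G"
  shows "F = G"
proof (rule functors_monoid_cat_eqI[OF F G])
  fix f assume "f \<in> Ar (T1 C)"
  then obtain x p y where p: "p \<in> t1_words C x y" "f = t1_class C x p y" using T1_arrow_cases by metis
  have Id: "snd H (Ident (T1 C) x) = \<one>" if "H \<in> functors (T1 C) (monoid_cat \<tau>)" "x \<in> Ob (T1 C)" for H x
    using that unfolding functors_monoid_cat by blast
  have Co: "snd H (Comp (T1 C) g f) = snd H g \<otimes> snd H f"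
    if "H \<in> functors (T1 C) (monoid_cat \<tau>)" "f \<in> Ar (T1 C)" "g \<in> Ar (T1 C)" "Cod (T1 C) f = Dom (T1 C) g" for H f g
    using that unfolding functors_monoid_cat by blast
  show "snd F f = snd G f"
    unfolding p(2) using p(1)
  proof (induction p arbitrary: x)
    case Nil
    then have "x \<in> Ob (T1 C)" "x = y" by (auto simp: t1_words_def)
    then show ?case using Id[OF F, of x] Id[OF G, of x] by simp
  next
    case (Cons l ls)
    obtain n c v w where l: "l = ((n, c), (v, w))" by (metis prod.exhaust)
    have h: "c \<in> cells C n" "(v, w) \<in> Ar (cube_cat n)" "x = t1_pt C n c v" "ls \<in> t1_words C (t1_pt C n c w) y"
      using Cons.prems unfolding l t1_words_def mem_Collect_eq t1_path_Cons by auto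
    have "t1_class C x (l # ls) y = Comp (T1 C) (t1_class C (t1_pt C n c w) ls y) (t1_edge C n c v w)"
      unfolding t1_edge_def T1_Comp[OF t1_edge_word[OF h(1,2)] h(4)] by (simp add: l h(3))
    moreover have "snd H (Comp (T1 C) (t1_class C (t1_pt C n c w) ls y) (t1_edge C n c v w)) =
       snd H (t1_class C (t1_pt C n c w) ls y) \<otimes> snd H (t1_edge C n c v w)" if "H \<in> functors (T1 C) (monoid_cat \<tau>)" for H
      by (rule Co[OF that t1_edge_in[OF h(1,2)] T1_arrow[OF h(4)]]) (simp add: t1_edge_def)
    moreover have "snd F (t1_edge C n c v w) = snd G (t1_edge C n c v w)"
      using snd_adjunct[OF h(1,2), of F] snd_adjunct[OF h(1,2), of G] eq by simp
    ultimately show ?case using Cons.IH[OF h(4)] F G by metis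
  qed
qed

text \<open>A word is sent to the product of the values of its letters. The three kinds of basic
  relations are respected because each \<open>f n c\<close> preserves identities and composites and
  because \<open>f\<close> is natural.\<close>

lemma adjunct_surj:
  assumes C: "cubical_set C" and f: "f \<in> cub_hom C (ner \<tau>)"
  shows "\<exists>F\<in>functors (T1 C) (monoid_cat \<tau>). adjunct C F = f"
proof -
  define wt where "wt = (\<lambda>((n, c), e). snd (f n c) e)"
  define wv where "wv = (\<lambda>ls. foldr (\<lambda>l r. wt l \<otimes> r) ls \<one>)"
  have wt: "wt l \<in> carrier \<tau>" if "l \<in> t1_letters C" for l
    using that ner_closed[OF f] by (auto simp: t1_letters_def wt_def)
  have wv: "wv ls \<in> carrier \<tau>" if "set ls \<subseteq> t1_letters C" for ls
    using that by (induction ls) (auto simp: wv_def wt)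
  have wv_app: "wv (as @ bs) = wv as \<otimes> wv bs" if "set as \<subseteq> t1_letters C" "set bs \<subseteq> t1_letters C" for as bs
    using that
  proof (induction as)
    case (Cons l as)
    then show ?case using wv[of as] wv[of bs] wt[of l] by (simp add: wv_def m_assoc)
  qed (use wv in \<open>simp add: wv_def\<close>)
  have basic: "wv l = wv r" if "(l, r) \<in> t1_basic C" "set l \<subseteq> t1_letters C" "set r \<subseteq> t1_letters C" for l r
    using that
  proof cases
    case (ident s v)
    obtain n c where s: "s = (n, c)" by (cases s)
    have "c \<in> cells C n" "v \<in> bcube n" using that(2) ident cube_arr_ob by (auto simp: t1_letters_def s)
    then have "snd (f n c) (v, v) = \<one>" using functor_refl[OF cub_hom_ner_in[OF f]] by blast
    then show ?thesis using ident by (simp add: wv_def wt_def s)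
  next
    case (comp s u v w)
    obtain n c where s: "s = (n, c)" by (cases s)
    have h: "c \<in> cells C n" "(u, v) \<in> Ar (cube_cat n)" "(v, w) \<in> Ar (cube_cat n)" using that(2) comp by (auto simp: t1_letters_def s)
    show ?thesis using functor_trans[OF cub_hom_ner_in[OF f h(1)] h(2,3)] ner_closed[OF f h(1,2)] ner_closed[OF f h(1,3)]
      by (simp add: comp wv_def wt_def s)
  next
    case (elem m n \<phi> c v w)
    then show ?thesis using cub_hom_ner_arr[OF f] by (simp add: wv_def wt_def)
  qed
  have rel: "wv p = wv q" if "(p, q) \<in> t1_rel C x y" for p q x y
  proof (rule equiv_gen_invariant[OF t1_gen_sub _ that[unfolded t1_rel_def]])
    fix a b assume "(a, b) \<in> t1_gen C x y"
    then obtain as bs l r where g: "a = as @ l @ bs" "b = as @ r @ bs" "(l, r) \<in> t1_basic C" "a \<in> t1_words C x y" "b \<in> t1_words C x y" by blast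
    have "set a \<subseteq> t1_letters C" "set b \<subseteq> t1_letters C"
      using t1_path_letters[of C x _ y] g(4,5) unfolding t1_words_def by blast+
    then show "wv a = wv b" using g(1,2) basic[OF g(3)] by (simp add: wv_app)
  qed
  define F where "F = (\<lambda>_ :: 'a t1_ob. (), \<lambda>e\<in>Ar (T1 C). wv (SOME p. p \<in> fst (snd e)))"
  have Fcl: "snd F (t1_class C x p y) = wv p" if "p \<in> t1_words C x y" for x p y
  proof -
    have "p \<in> t1_rel C x y `` {p}" by (rule equiv_class_self[OF t1_equiv that])
    then have "(SOME q. q \<in> t1_rel C x y `` {p}) \<in> t1_rel C x y `` {p}" by (rule someI)
    then have "wv p = wv (SOME q. q \<in> t1_rel C x y `` {p})" using rel by blast
    then show ?thesis using T1_arrow[OF that] by (simp add: F_def)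
  qed
  have letters: "set p \<subseteq> t1_letters C" if "p \<in> t1_words C x y" for p x y
    using that unfolding t1_words_def mem_Collect_eq by (rule t1_path_letters)
  have F: "F \<in> functors (T1 C) (monoid_cat \<tau>)"
    unfolding functors_monoid_cat
  proof (intro conjI ballI impI PiE_I)
    show "snd F e \<in> carrier \<tau>" if "e \<in> Ar (T1 C)" for e
      using T1_arrow_cases[OF that] Fcl wv letters by metis
    show "snd F e = undefined" if "e \<notin> Ar (T1 C)" for e using that by (simp add: F_def)
    show "snd F (Ident (T1 C) x) = \<one>" if "x \<in> Ob (T1 C)" for x
      using Fcl[of "[]" x x] that by (simp add: t1_words_def wv_def)
    fix e g assume e: "e \<in> Ar (T1 C)" and g: "g \<in> Ar (T1 C)" and c: "Cod (T1 C) e = Dom (T1 C) g"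
    obtain x p y where p: "p \<in> t1_words C x y" "e = t1_class C x p y" using T1_arrow_cases[OF e] .
    obtain y' q z where q: "q \<in> t1_words C y' z" "g = t1_class C y' q z" using T1_arrow_cases[OF g] .
    have y: "y' = y" using c p q by simp
    note q = q[unfolded y]
    have "snd F (Comp (T1 C) g e) = wv (p @ q)"
      unfolding p(2) q(2) T1_Comp[OF p(1) q(1)] by (rule Fcl[OF t1_words_append[OF p(1) q(1)]])
    \<comment> \<open>Words are in diagrammatic order and \<open>Comp\<close> is not; commutativity
      reconciles the two.\<close>
    also have "\<dots> = wv q \<otimes> wv p"
      using wv_app[OF letters[OF p(1)] letters[OF q(1)]] wv[OF letters[OF p(1)]] wv[OF letters[OF q(1)]] by (simp add: m_comm)
    finally show "snd F (Comp (T1 C) g e) = snd F g \<otimes> snd F e" by (simp add: p(2) q(2) Fcl[OF p(1)] Fcl[OF q(1)])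
  qed
  have "adjunct C F = f"
  proof (rule cub_hom_ner_eqI[OF adjunct_hom[OF C F] f])
    fix n c v w assume c: "c \<in> cells C n" and vw: "(v, w) \<in> Ar (cube_cat n)"
    show "snd (adjunct C F n c) (v, w) = snd (f n c) (v, w)"
      using ner_closed[OF f c vw] by (simp add: snd_adjunct[OF c vw] t1_edge_def Fcl[OF t1_edge_word[OF c vw]] wv_def wt_def)
  qed
  then show ?thesis using F by blast
qed

end

section \<open>Functoriality of the fundamental category\<close>

context
  fixes C :: "'c cubical" and D :: "'d cubical" and f :: "nat \<Rightarrow> 'c \<Rightarrow> 'd"
  assumes C: "cubical_set C" and D: "cubical_set D" and f: "f \<in> cub_hom C D"
begin

definition t1_ob_map :: "'c t1_ob \<Rightarrow> 'd t1_ob" where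
  "t1_ob_map x = t1_ob_rel D `` {((n, f n c), v) | n c v. ((n, c), v) \<in> x}"

definition t1_word_map :: "'c t1_letter list \<Rightarrow> 'd t1_letter list" where
  "t1_word_map = map (\<lambda>((n, c), e). ((n, f n c), e))"

lemma t1_ob_map_pt:
  assumes c: "c \<in> cells C n" "v \<in> bcube n"
  shows "t1_ob_map (t1_pt C n c v) = t1_pt D n (f n c) v"
proof -
  define h where "h = (\<lambda>((n, c), v :: nat \<Rightarrow> bool). ((n, f n c), v))"
  have r: "(h x, h y) \<in> t1_ob_rel D" if xy: "(x, y) \<in> t1_ob_rel C" for x y
  proof (rule equiv_gen_map[OF t1_ob_gen_sub[OF C] t1_ob_equiv[OF D] _ _ xy[unfolded t1_ob_rel_def]])
    show "h x \<in> t1_vertices D" if "x \<in> t1_vertices C" for x using that cub_hom_in[OF f] by (auto simp: h_def t1_vertices_def)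
    fix x y assume "(x, y) \<in> {(((m, act C m n \<phi> c), v), ((n, c), \<phi> v)) | m n \<phi> c v.
        box m n \<phi> \<and> c \<in> cells C n \<and> v \<in> bcube m}"
    then obtain m n \<phi> c v where g: "x = ((m, act C m n \<phi> c), v)" "y = ((n, c), \<phi> v)" "box m n \<phi>" "c \<in> cells C n" "v \<in> bcube m" by blast
    have "h x = ((m, act D m n \<phi> (f n c)), v)" "h y = ((n, f n c), \<phi> v)" using g cub_hom_act[OF f] by (auto simp: h_def)
    then show "(h x, h y) \<in> t1_ob_rel D"
      unfolding t1_ob_rel_def using g(3,5) cub_hom_in[OF f g(4)] by (intro subsetD[OF equiv_gen_incl]) blast
  qed
  have "t1_ob_map (t1_pt C n c v) = t1_ob_rel D `` {h x | x. x \<in> t1_ob_rel C `` {((n, c), v)}}"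
    unfolding t1_ob_map_def t1_pt_def h_def by (rule arg_cong[where f = "\<lambda>S. t1_ob_rel D `` S"]) auto
  also have "\<dots> = t1_ob_rel D `` {h ((n, c), v)}"
    by (rule class_image[OF t1_ob_equiv[OF C] t1_ob_equiv[OF D] _ r]) (use c in \<open>auto simp: t1_vertices_def\<close>)
  finally show ?thesis by (simp add: h_def t1_pt_def)
qed

lemma t1_ob_map_in: "x \<in> t1_vertices C // t1_ob_rel C \<Longrightarrow> t1_ob_map x \<in> t1_vertices D // t1_ob_rel D"
proof -
  assume "x \<in> t1_vertices C // t1_ob_rel C"
  then obtain n c v where "c \<in> cells C n" "v \<in> bcube n" "x = t1_pt C n c v"
    by (auto simp: t1_vertices_def t1_pt_def elim!: quotientE)
  then show ?thesis using t1_ob_map_pt t1_pt_in cub_hom_in[OF f] by metis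
qed

lemma t1_path_map: "t1_path C x ls y \<Longrightarrow> t1_path D (t1_ob_map x) (t1_word_map ls) (t1_ob_map y)"
proof (induction ls arbitrary: x)
  case Nil
  then show ?case using t1_ob_map_in by (auto simp: t1_word_map_def)
next
  case (Cons l ls)
  obtain n c v w where l: "l = ((n, c), (v, w))" by (metis prod.exhaust)
  have h: "c \<in> cells C n" "(v, w) \<in> Ar (cube_cat n)" "x = t1_pt C n c v" "t1_path C (t1_pt C n c w) ls y"
    using Cons.prems unfolding l t1_path_Cons by auto
  have m: "t1_word_map (l # ls) = ((n, f n c), (v, w)) # t1_word_map ls" by (simp add: t1_word_map_def l)
  show ?case
    using Cons.IH[OF h(4)] h cub_hom_in[OF f h(1)] cube_arr_ob[OF h(2)] unfolding m t1_path_Cons by (simp add: t1_ob_map_pt)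
qed

lemma t1_words_map: "p \<in> t1_words C x y \<Longrightarrow> t1_word_map p \<in> t1_words D (t1_ob_map x) (t1_ob_map y)"
  by (simp add: t1_words_def t1_path_map)

lemma t1_rel_map:
  assumes "(p, q) \<in> t1_rel C x y"
  shows "(t1_word_map p, t1_word_map q) \<in> t1_rel D (t1_ob_map x) (t1_ob_map y)"
proof (rule equiv_gen_map[OF t1_gen_sub t1_equiv t1_words_map _ assms[unfolded t1_rel_def]])
  fix a b assume "(a, b) \<in> t1_gen C x y"
  then obtain as bs l r where g: "a = as @ l @ bs" "b = as @ r @ bs" "(l, r) \<in> t1_basic C" "a \<in> t1_words C x y" "b \<in> t1_words C x y" by blast
  have "(t1_word_map l, t1_word_map r) \<in> t1_basic D"
    using g(3)
  proof cases
    case (ident s v)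
    then show ?thesis by (cases s) (simp add: t1_word_map_def t1_basic.ident)
  next
    case (comp s u v w)
    then show ?thesis by (cases s) (simp add: t1_word_map_def t1_basic.comp)
  next
    case (elem m n \<phi> c v w)
    then show ?thesis using t1_basic.elem[OF elem(3) cub_hom_in[OF f elem(4)] elem(5)] cub_hom_act[OF f elem(3,4)]
      by (simp add: t1_word_map_def)
  qed
  from t1_relI[OF this, of "t1_word_map as" "t1_word_map bs"] t1_words_map[OF g(4)] t1_words_map[OF g(5)]
  show "(t1_word_map a, t1_word_map b) \<in> t1_rel D (t1_ob_map x) (t1_ob_map y)"
    unfolding g(1,2) by (simp add: t1_word_map_def)
qed

lemma T1_map_class:
  assumes p: "p \<in> t1_words C x y"
  shows "snd (T1_map C D f) (t1_class C x p y) = t1_class D (t1_ob_map x) (t1_word_map p) (t1_ob_map y)"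
proof -
  have "t1_rel D (t1_ob_map x) (t1_ob_map y) `` (t1_word_map ` (t1_rel C x y `` {p})) =
      t1_rel D (t1_ob_map x) (t1_ob_map y) `` {t1_word_map q | q. q \<in> t1_rel C x y `` {p}}"
    by (rule arg_cong[where f = "\<lambda>S. t1_rel D (t1_ob_map x) (t1_ob_map y) `` S"]) auto
  also have "\<dots> = t1_rel D (t1_ob_map x) (t1_ob_map y) `` {t1_word_map p}"
    by (rule class_image[OF t1_equiv t1_equiv p t1_rel_map])
  finally show ?thesis
    using T1_arrow[OF p] by (simp add: T1_map_def Let_def t1_ob_map_def[abs_def] t1_word_map_def)
qed

lemma fst_T1_map: "fst (T1_map C D f) = (\<lambda>x\<in>Ob (T1 C). t1_ob_map x)"
  by (simp add: T1_map_def Let_def t1_ob_map_def[abs_def])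

lemma T1_map_functor: "T1_map C D f \<in> functors (T1 C) (T1 D)"
proof -
  have "(fst (T1_map C D f), snd (T1_map C D f)) \<in> functors (T1 C) (T1 D)"
    unfolding functors_def mem_Collect_eq prod.case
  proof (intro conjI ballI impI PiE_I)
    show "fst (T1_map C D f) x \<in> Ob (T1 D)" if "x \<in> Ob (T1 C)" for x
      using that t1_ob_map_in by (simp add: fst_T1_map)
    show "fst (T1_map C D f) x = undefined" if "x \<notin> Ob (T1 C)" for x using that by (simp add: fst_T1_map)
    show "snd (T1_map C D f) e = undefined" if "e \<notin> Ar (T1 C)" for e
      using that by (simp add: T1_map_def Let_def)
    show "snd (T1_map C D f) (Ident (T1 C) x) = Ident (T1 D) (fst (T1_map C D f) x)" if "x \<in> Ob (T1 C)" for x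
      using T1_map_class[of "[]" x x] that by (simp add: t1_words_def fst_T1_map t1_word_map_def)
    fix e assume e: "e \<in> Ar (T1 C)"
    obtain x p y where p: "p \<in> t1_words C x y" "e = t1_class C x p y" using T1_arrow_cases[OF e] .
    have ob: "x \<in> Ob (T1 C)" "y \<in> Ob (T1 C)" using e p(2) closed_T1[of C] unfolding closed_cat_def by force+
    show "snd (T1_map C D f) e \<in> Ar (T1 D)" using T1_arrow[OF t1_words_map[OF p(1)]] by (simp add: p T1_map_class)
    show "Dom (T1 D) (snd (T1_map C D f) e) = fst (T1_map C D f) (Dom (T1 C) e)"
      "Cod (T1 D) (snd (T1_map C D f) e) = fst (T1_map C D f) (Cod (T1 C) e)"
      using ob by (simp_all add: p T1_map_class fst_T1_map)
    fix g assume g: "g \<in> Ar (T1 C)" and eg: "Cod (T1 C) e = Dom (T1 C) g"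
    obtain y' q z where q: "q \<in> t1_words C y' z" "g = t1_class C y' q z" using T1_arrow_cases[OF g] .
    have y: "y' = y" using eg p q by simp
    note q = q[unfolded y]
    show "snd (T1_map C D f) (Comp (T1 C) g e) = Comp (T1 D) (snd (T1_map C D f) g) (snd (T1_map C D f) e)"
      unfolding p(2) q(2) T1_Comp[OF p(1) q(1)] T1_map_class[OF p(1)] T1_map_class[OF q(1)]
        T1_map_class[OF t1_words_append[OF p(1) q(1)]] T1_Comp[OF t1_words_map[OF p(1)] t1_words_map[OF q(1)]]
      by (simp add: t1_word_map_def)
  qed
  then show ?thesis by simp
qed

lemma T1_map_edge:
  assumes "c \<in> cells C n" "(v, w) \<in> Ar (cube_cat n)"
  shows "snd (T1_map C D f) (t1_edge C n c v w) = t1_edge D n (f n c) v w"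
  unfolding t1_edge_def T1_map_class[OF t1_edge_word[OF assms]]
  using assms cube_arr_ob[OF assms(2)] by (simp add: t1_ob_map_pt t1_word_map_def)

end

text \<open>Naturality of transposition in the cubical set; both sides are compared on
  edges.\<close>

lemma (in canc_monoid) adjunct_T1_map:
  assumes C: "cubical_set C" and D: "cubical_set D" and f: "f \<in> cub_hom C D" and F: "F \<in> functors (T1 D) (monoid_cat \<tau>)"
  shows "func_comp (T1 C) F (T1_map C D f) \<in> functors (T1 C) (monoid_cat \<tau>)"
    "adjunct C (func_comp (T1 C) F (T1_map C D f)) = cub_comp C (adjunct D F) f"
proof -
  show 1: "func_comp (T1 C) F (T1_map C D f) \<in> functors (T1 C) (monoid_cat \<tau>)"
    by (rule func_comp_functor[OF closed_T1 T1_map_functor[OF C D f] F])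
  show "adjunct C (func_comp (T1 C) F (T1_map C D f)) = cub_comp C (adjunct D F) f"
    by (rule cub_hom_ner_eqI[OF adjunct_hom[OF C 1] cub_comp_hom[OF C f adjunct_hom[OF D F]]])
      (simp add: snd_adjunct snd_func_comp t1_edge_in T1_map_edge[OF C D f] cub_comp_apply cub_hom_in[OF f])
qed

text \<open>Naturality of transposition in the coefficients.\<close>

lemma adjunct_push:
  assumes t: "canc_monoid \<tau>" and t': "canc_monoid \<tau>'" and C: "cubical_set C"
    and k: "k \<in> functors (monoid_cat \<tau>) (monoid_cat \<tau>')" and F: "F \<in> functors (T1 C) (monoid_cat \<tau>)"
  shows "func_comp (T1 C) k F \<in> functors (T1 C) (monoid_cat \<tau>')"
    "adjunct C (func_comp (T1 C) k F) = cub_comp C (nerve_map (monoid_cat \<tau>) k) (adjunct C F)"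
proof -
  interpret T: canc_monoid \<tau> by fact
  interpret T': canc_monoid \<tau>' by fact
  have k': "nerve_map (monoid_cat \<tau>) k \<in> cub_hom (ner \<tau>) (ner \<tau>')" by (rule nerve_map_hom[OF k ner_act_in])
  show 1: "func_comp (T1 C) k F \<in> functors (T1 C) (monoid_cat \<tau>')" by (rule func_comp_functor[OF closed_T1 F k])
  show "adjunct C (func_comp (T1 C) k F) = cub_comp C (nerve_map (monoid_cat \<tau>) k) (adjunct C F)"
    by (rule cub_hom_ner_eqI[OF T'.adjunct_hom[OF C 1] cub_comp_hom[OF C T.adjunct_hom[OF C F] k']])
      (simp add: snd_adjunct snd_func_comp t1_edge_in cub_comp_apply nerve_map_apply cub_hom_ner_in[OF T.adjunct_hom[OF C F]])
qed

section \<open>Compactness of the cube\<close>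

lemma icube_box_nbhd:
  assumes V: "openin (icube_top n) V" and t: "t \<in> V"
  obtains e where "0 < e" "\<And>q. q \<in> icube n \<Longrightarrow> (\<And>i. i < n \<Longrightarrow> \<bar>q i - t i\<bar> < e) \<Longrightarrow> q \<in> V"
proof -
  have tn: "t \<in> icube n" using assms openin_subset by fastforce
  obtain W where W: "\<And>i. i < n \<Longrightarrow> openin (top_of_set {0..1}) (W i)" "t \<in> Pi\<^sub>E {..<n} W" "Pi\<^sub>E {..<n} W \<subseteq> V"
    using assms unfolding icube_top_def openin_product_topology_alt by (auto; meson lessThan_iff)
  have "\<exists>e>0. ball (t i) e \<inter> {0..1} \<subseteq> W i" if "i < n" for i
    using openin_contains_ball[THEN iffD1, OF W(1)[OF that], THEN conjunct2, rule_format, of "t i"] W(2) that by auto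
  then obtain e where e: "\<And>i. i < n \<Longrightarrow> e i > 0 \<and> ball (t i) (e i) \<inter> {0..1} \<subseteq> W i" by metis
  define d where "d = Min (insert 1 (e ` {..<n}))"
  have d: "0 < d" "\<And>i. i < n \<Longrightarrow> d \<le> e i" using e by (auto simp: d_def)
  show thesis
  proof (rule that[OF d(1)])
    fix q assume q: "q \<in> icube n" "\<And>i. i < n \<Longrightarrow> \<bar>q i - t i\<bar> < d"
    have "q i \<in> W i" if "i < n" for i
    proof -
      have "q i \<in> ball (t i) (e i) \<inter> {0..1}"
        using q(1) q(2)[OF that] d(2)[OF that] that by (auto simp: icube_iff dist_real_def)
      then show ?thesis using e[OF that] by blast
    qed
    then have "q \<in> Pi\<^sub>E {..<n} W" using q(1) by (auto simp: icube_iff PiE_iff)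
    then show "q \<in> V" using W(3) by blast
  qed
qed

text \<open>A convex neighbourhood does it: order intervals between its points stay in
  \<open>V\<close>, so ordered points are related in the circulation on \<open>V\<close> and not
  only in the order of the whole cube.\<close>

lemma icube_circ_nbhd:
  assumes V: "openin (icube_top n) V" and t: "t \<in> V"
  obtains B where "openin (icube_top n) B" "t \<in> B" "B \<subseteq> V"
    "\<And>s s'. s \<in> B \<Longrightarrow> s' \<in> B \<Longrightarrow> icube_seg s s' n \<subseteq> V"
    "\<And>s s'. s \<in> B \<Longrightarrow> s' \<in> B \<Longrightarrow> (s, s') \<in> icube_order n \<Longrightarrow> (s, s') \<in> icube_circ n V"
proof -
  obtain B where B: "openin (icube_top n) B" "t \<in> B" "B \<subseteq> V" "\<And>a b. a \<in> B \<Longrightarrow> b \<in> B \<Longrightarrow> icube_seg a b n \<subseteq> B"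
    using icube_convex_nbhd[OF V t] by blast
  have s: "icube_seg s s' n \<subseteq> V" if "s \<in> B" "s' \<in> B" for s s' using B(3) B(4)[OF that] by blast
  show thesis by (rule that[OF B(1-3) s icube_circ_seg[OF V _ s]])
qed

lemma openin_icube_ball:
  "openin (icube_top n) {q \<in> icube n. \<forall>i<n. \<bar>q i - t i\<bar> < e}"
proof -
  have "{q \<in> icube n. \<forall>i<n. \<bar>q i - t i\<bar> < e} = {q \<in> icube n. \<forall>i<n. q i \<in> ball (t i) e}"
    by (auto simp: dist_real_def abs_minus_commute)
  then show ?thesis using openin_icube_coords[of n "\<lambda>i. ball (t i) e"] by simp
qed

text \<open>The usual argument in the maximum metric: the cover is refined to boxes whose doubles
  still fit, finitely many of them suffice by compactness, and \<open>\<delta>\<close> is below all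
  their radii.\<close>

lemma icube_Lebesgue:
  assumes cov: "\<And>t. t \<in> icube n \<Longrightarrow> \<exists>V\<in>\<V>. openin (icube_top n) V \<and> t \<in> V"
  obtains \<delta> where "0 < \<delta>"
    "\<And>p. p \<in> icube n \<Longrightarrow> \<exists>V\<in>\<V>. openin (icube_top n) V \<and> (\<forall>q\<in>icube n. (\<forall>i<n. \<bar>q i - p i\<bar> < \<delta>) \<longrightarrow> q \<in> V)"
proof -
  have "\<exists>V e. V \<in> \<V> \<and> openin (icube_top n) V \<and> 0 < e \<and> (\<forall>q\<in>icube n. (\<forall>i<n. \<bar>q i - t i\<bar> < 2 * e) \<longrightarrow> q \<in> V)"
    if t: "t \<in> icube n" for t
  proof -
    obtain V where V: "V \<in> \<V>" "openin (icube_top n) V" "t \<in> V" using cov[OF t] by blast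
    obtain e where "0 < e" "\<And>q. q \<in> icube n \<Longrightarrow> (\<And>i. i < n \<Longrightarrow> \<bar>q i - t i\<bar> < e) \<Longrightarrow> q \<in> V"
      using icube_box_nbhd[OF V(2,3)] by blast
    then show ?thesis using V by (intro exI[of _ V] exI[of _ "e / 2"]) auto
  qed
  then obtain V e where Ve: "\<And>t. t \<in> icube n \<Longrightarrow> V t \<in> \<V> \<and> openin (icube_top n) (V t) \<and> 0 < e t \<and>
     (\<forall>q\<in>icube n. (\<forall>i<n. \<bar>q i - t i\<bar> < 2 * e t) \<longrightarrow> q \<in> V t)" by metis
  define B where "B = (\<lambda>t. {q \<in> icube n. \<forall>i<n. \<bar>q i - t i\<bar> < e t})"
  have "compact_space (icube_top n)"
    unfolding icube_top_def compact_space_product_topology by (simp add: compact_space_subtopology)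
  then have "compactin (icube_top n) (icube n)" by (simp add: compact_space_def)
  moreover have "\<forall>U\<in>B ` icube n. openin (icube_top n) U" unfolding B_def using openin_icube_ball by blast
  moreover have "icube n \<subseteq> \<Union>(B ` icube n)" using Ve by (force simp: B_def)
  ultimately obtain \<F> where \<F>: "finite \<F>" "\<F> \<subseteq> B ` icube n" "icube n \<subseteq> \<Union>\<F>"
    unfolding compactin_def by meson
  obtain T where T: "finite T" "T \<subseteq> icube n" "\<F> = B ` T" using finite_subset_image[OF \<F>(1,2)] by blast
  define \<delta> where "\<delta> = Min (insert 1 (e ` T))"
  have \<delta>: "0 < \<delta>" "\<And>t. t \<in> T \<Longrightarrow> \<delta> \<le> e t" using T Ve by (auto simp: \<delta>_def)
  show thesis
  proof (rule that[OF \<delta>(1)])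
    fix p assume p: "p \<in> icube n"
    then obtain t where t: "t \<in> T" "p \<in> B t" using \<F>(3) T(3) by blast
    then have tc: "t \<in> icube n" using T by blast
    have "q \<in> V t" if q: "q \<in> icube n" "\<forall>i<n. \<bar>q i - p i\<bar> < \<delta>" for q
    proof -
      have "\<bar>q i - t i\<bar> < 2 * e t" if i: "i < n" for i
      proof -
        have "\<bar>q i - p i\<bar> < \<delta>" "\<bar>p i - t i\<bar> < e t" using q i t(2) by (auto simp: B_def)
        then show ?thesis using \<delta>(2)[OF t(1)] by linarith
      qed
      then show ?thesis using Ve[OF tc] q by blast
    qed
    then show "\<exists>V\<in>\<V>. openin (icube_top n) V \<and> (\<forall>q\<in>icube n. (\<forall>i<n. \<bar>q i - p i\<bar> < \<delta>) \<longrightarrow> q \<in> V)"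
      using Ve[OF tc] by blast
  qed
qed

section \<open>Extending a cocycle to singular cubes\<close>

locale cocycle = canc_monoid \<tau> for \<tau> :: "'m monoid" (structure) +
  fixes C :: "'c cubical" and f :: "nat \<Rightarrow> 'c \<Rightarrow> (nat \<Rightarrow> bool, (nat \<Rightarrow> bool) \<times> (nat \<Rightarrow> bool), unit, 'm) func"
  assumes C: "cubical_set C" and f: "f \<in> cub_hom C (ner \<tau>)"
begin

text \<open>The increment that the extension is to have along a directed move from \<open>s\<close>
  to \<open>t\<close> inside the cell \<open>c\<close>; \<open>extension_line\<close> confirms
  it.\<close>

definition step :: "nat \<Rightarrow> 'c \<Rightarrow> (nat \<Rightarrow> real) \<Rightarrow> (nat \<Rightarrow> real) \<Rightarrow> 'm" where
  "step n c s t = snd (f n c) (level 1 n s, level 1 n t)"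

lemma fcl: "c \<in> cells C n \<Longrightarrow> (v, w) \<in> Ar (cube_cat n) \<Longrightarrow> snd (f n c) (v, w) \<in> carrier \<tau>"
  by (rule ner_closed[OF f])

lemma ftrans: "c \<in> cells C n \<Longrightarrow> (u, v) \<in> Ar (cube_cat n) \<Longrightarrow> (v, w) \<in> Ar (cube_cat n) \<Longrightarrow>
    snd (f n c) (u, w) = snd (f n c) (u, v) \<otimes> snd (f n c) (v, w)"
  by (rule functor_trans[OF cub_hom_ner_in[OF f]])

lemma step_closed: "c \<in> cells C n \<Longrightarrow> (s, t) \<in> icube_order n \<Longrightarrow> step n c s t \<in> carrier \<tau>"
  unfolding step_def by (rule fcl[OF _ level_arr])

text \<open>A potential is a local primitive of the cocycle, with the sign chosen so that its values lie
  in \<open>\<tau>\<close> and not only in the group generated by \<open>\<tau>\<close>.\<close>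

definition potential :: "'c real_pt set set \<Rightarrow> ('c real_pt set \<Rightarrow> 'm) \<Rightarrow> bool" where
  "potential U \<psi> \<longleftrightarrow> openin (rtop C) U \<and> (\<forall>x\<in>U. \<psi> x \<in> carrier \<tau>) \<and>
     (\<forall>n c t. c \<in> cells C n \<longrightarrow> t \<in> icube n \<longrightarrow> cell_pt C n c t \<in> U \<longrightarrow>
       (\<exists>B. openin (icube_top n) B \<and> t \<in> B \<and> (\<forall>s\<in>B \<inter> icube n. \<forall>s'\<in>B \<inter> icube n.
          cell_pt C n c s \<in> U \<longrightarrow> cell_pt C n c s' \<in> U \<longrightarrow> (s, s') \<in> icube_order n \<longrightarrow>
          step n c s s' \<otimes> \<psi> (cell_pt C n c s') = \<psi> (cell_pt C n c s))))"

lemma level_le: "u \<le> u' \<Longrightarrow> (level u' n t, level u n t) \<in> Ar (cube_cat n)"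
  by (auto simp: cube_arr_iff) (auto simp: level_def)

text \<open>Transport from \<open>t\<close> to its image under the collapse gives a potential.  It does not wind around
  loops: where the collapse is constant, the labels between the level sets \<open>1\<close> and \<open>u\<close> do not change,
  and for suitable \<open>u < 1\<close> the level set \<open>u\<close> does not change either.\<close>

lemma potential_exists:
  assumes P: "P \<in> topspace (rtop C)"
  shows "\<exists>U \<psi>. potential U \<psi> \<and> P \<in> U"
proof -
  obtain U \<phi> where U: "openin (rtop C) U" "P \<in> U" and \<phi>: "natural \<phi>"
    and col: "\<And>n c t. c \<in> cells C n \<Longrightarrow> t \<in> icube n \<Longrightarrow> cell_pt C n c t \<in> U \<Longrightarrow> cell_pt C n c (coord \<phi> n t) = P"
    using realization_collapse[OF C P] by metis
  define J where "J = (\<lambda>n c t. snd (f n c) (level 1 n t, level 1 n (coord \<phi> n t)))"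
  define \<psi> where "\<psi> = desc J"
  \<comment> \<open>Along the collapse the vertex below a point can only grow, since a coordinate
    equal to \<open>1\<close> is fixed by \<open>\<phi>\<close>.\<close>
  have up: "(level 1 n t, level 1 n (coord \<phi> n t)) \<in> Ar (cube_cat n)" if "t \<in> icube n" for n t
  proof -
    have "\<phi> (t i) = 1" if "i < n" "1 \<le> t i" for i
    proof -
      have "t i = 1" using \<open>t \<in> icube n\<close> that by (auto simp: icube_iff intro: antisym)
      then show ?thesis using \<phi> by (simp add: natural_def)
    qed
    then show ?thesis by (auto simp: cube_arr_iff) (auto simp: level_def coord_def)
  qed
  have J: "\<psi> (cell_pt C n c t) = J n c t" if "c \<in> cells C n" "t \<in> icube n" for n c t
    unfolding \<psi>_def
  proof (rule desc_cell_pt[OF C that])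
    fix m n \<theta> c t assume b: "box m n \<theta>" "c \<in> cells C n" "t \<in> icube m"
    show "J m (act C m n \<theta> c) t = J n c (geom m n \<theta> t)"
      unfolding J_def natural_geom_coord[OF \<phi> b(1,3)] geom_level[OF b(1,3) zero_less_one order_refl]
        geom_level[OF b(1) natural_coord_in[OF \<phi> b(3)] zero_less_one order_refl]
      by (rule cub_hom_ner_arr[OF f b(1,2) up[OF b(3)]])
  qed
  have "potential U \<psi>"
    unfolding potential_def
  proof (intro conjI allI ballI impI)
    show "\<psi> x \<in> carrier \<tau>" if x: "x \<in> U" for x
    proof -
      have "x \<in> topspace (rtop C)" using x openin_subset[OF U(1)] by blast
      then obtain n c t where "c \<in> cells C n" "t \<in> icube n" "x = cell_pt C n c t"
        by (rule cell_pt_cases[OF C])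
      then show ?thesis using J fcl up by (simp add: J_def)
    qed
    fix n c t assume c: "c \<in> cells C n" and t: "t \<in> icube n" "cell_pt C n c t \<in> U"
    \<comment> \<open>The finitely many values \<open>\<phi> (t j)\<close> miss some
      \<open>u\<close> in the open unit interval; for points near \<open>t\<close>, no coordinate of
      the collapsed point crosses this \<open>u\<close>.\<close>
    have "infinite ({0<..<1::real} - (\<lambda>j. \<phi> (t j)) ` {..<n})" by (rule Diff_infinite_finite) auto
    then have "{0<..<1::real} - (\<lambda>j. \<phi> (t j)) ` {..<n} \<noteq> {}" by (metis finite.emptyI)
    then obtain u where u: "0 < u" "u < 1" "\<And>j. j < n \<Longrightarrow> \<phi> (t j) \<noteq> u" by force
    define A where "A = (\<lambda>j. if u < \<phi> (t j) then {u<..} else {..<u})"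
    define B where "B = {s \<in> icube n. coord \<phi> n s \<in> {q \<in> icube n. \<forall>j<n. q j \<in> A j}}"
    have "continuous_map (icube_top n) (icube_top n) (coord \<phi> n)"
      using stream_map_dicubeD(1)[OF natural_coord_stream_map[OF \<phi>]] by (simp add: dicube_def)
    then have B: "openin (icube_top n) B"
      unfolding B_def by (rule openin_preimage_cube, intro openin_icube_coords) (simp add: A_def)
    have tB: "t \<in> B" using t(1) u(3) natural_coord_in[OF \<phi>] by (force simp: B_def A_def coord_def)
    have lev: "level u n (coord \<phi> n s) = level u n (coord \<phi> n t)" if "s \<in> B" for s
    proof (rule bcube_eqI[OF level_in level_in])
      fix j assume j: "j < n"
      have "\<phi> (s j) \<in> A j" using that j by (auto simp: B_def coord_def)
      then show "level u n (coord \<phi> n s) j = level u n (coord \<phi> n t) j"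
        using j u(3)[OF j] by (auto simp: level_def coord_def A_def split: if_splits)
    qed
    \<comment> \<open>By naturality of the levels \<open>K\<close> descends to the realization. It
      can therefore be compared at two collapsed points that coincide there, although they may
      differ in the cube.\<close>
    define K where "K = (\<lambda>n c q. snd (f n c) (level 1 n q, level u n q))"
    have K: "desc K (cell_pt C n c q) = K n c q" if "q \<in> icube n" for q
    proof (rule desc_cell_pt[OF C c that])
      fix m n \<theta> c t assume b: "box m n \<theta>" "c \<in> cells C n" "t \<in> icube m"
      have "level u n (geom m n \<theta> t) = \<theta> (level u m t)" by (rule geom_level[OF b(1,3)]) (use u in auto)
      then show "K m (act C m n \<theta> c) t = K n c (geom m n \<theta> t)"
        unfolding K_def geom_level[OF b(1,3) zero_less_one order_refl]
        using cub_hom_ner_arr[OF f b(1,2) level_le[of u 1 m t]] u by simp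
    qed
    show "\<exists>B. openin (icube_top n) B \<and> t \<in> B \<and> (\<forall>s\<in>B \<inter> icube n. \<forall>s'\<in>B \<inter> icube n.
          cell_pt C n c s \<in> U \<longrightarrow> cell_pt C n c s' \<in> U \<longrightarrow> (s, s') \<in> icube_order n \<longrightarrow>
          step n c s s' \<otimes> \<psi> (cell_pt C n c s') = \<psi> (cell_pt C n c s))"
    proof (intro exI[of _ B] conjI B tB ballI impI)
      fix s s' assume s: "s \<in> B \<inter> icube n" "s' \<in> B \<inter> icube n" "cell_pt C n c s \<in> U" "cell_pt C n c s' \<in> U"
        and ss': "(s, s') \<in> icube_order n"
      let ?q = "coord \<phi> n s" and ?q' = "coord \<phi> n s'"
      have q: "?q \<in> icube n" "?q' \<in> icube n" using s natural_coord_in[OF \<phi>] by auto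
      have qq': "(level 1 n ?q, level 1 n ?q') \<in> Ar (cube_cat n)"
        by (rule level_arr[OF natural_coord_order[OF \<phi> ss']])
      have q'u: "(level 1 n ?q', level u n ?q') \<in> Ar (cube_cat n)" using u by (intro level_le) simp
      have lu: "level u n ?q = level u n ?q'" using lev s by simp
      have "cell_pt C n c ?q = cell_pt C n c ?q'" using col[OF c] s by simp
      then have "K n c ?q = K n c ?q'" using K q by metis
      then have "snd (f n c) (level 1 n ?q, level 1 n ?q') \<otimes> snd (f n c) (level 1 n ?q', level u n ?q') =
          \<one> \<otimes> snd (f n c) (level 1 n ?q', level u n ?q')"
        using ftrans[OF c qq' q'u] fcl[OF c q'u] by (simp add: K_def lu)
      then have one: "snd (f n c) (level 1 n ?q, level 1 n ?q') = \<one>"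
        by (rule rcancel) (use fcl[OF c qq'] fcl[OF c q'u] in auto)
      have "step n c s s' \<otimes> \<psi> (cell_pt C n c s') = snd (f n c) (level 1 n s, level 1 n ?q')"
        using ftrans[OF c level_arr[OF ss'] up] s by (simp add: J[OF c] J_def step_def)
      also have "\<dots> = \<psi> (cell_pt C n c s)"
        using ftrans[OF c up qq'] s fcl[OF c up[of s n]] by (simp add: J[OF c] J_def one)
      finally show "step n c s s' \<otimes> \<psi> (cell_pt C n c s') = \<psi> (cell_pt C n c s)" .
    qed
  qed (rule U(1))
  then show ?thesis using U(2) by blast
qed

lemma potentialD:
  assumes "potential U \<psi>"
  shows "openin (rtop C) U" "x \<in> U \<Longrightarrow> \<psi> x \<in> carrier \<tau>"
    "c \<in> cells C n \<Longrightarrow> t \<in> icube n \<Longrightarrow> cell_pt C n c t \<in> U \<Longrightarrow>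
       \<exists>B. openin (icube_top n) B \<and> t \<in> B \<and> (\<forall>s\<in>B \<inter> icube n. \<forall>s'\<in>B \<inter> icube n.
          cell_pt C n c s \<in> U \<longrightarrow> cell_pt C n c s' \<in> U \<longrightarrow> (s, s') \<in> icube_order n \<longrightarrow>
          step n c s s' \<otimes> \<psi> (cell_pt C n c s') = \<psi> (cell_pt C n c s))"
  using assms unfolding potential_def by blast+

text \<open>On a cell a potential changes by the factor \<open>step\<close>, which lies in
  \<open>\<tau>\<close>, and having such a factor is reflexive and transitive.\<close>

lemma potential_divides:
  assumes pot: "potential U \<psi>" and xy: "(x, y) \<in> circ (realization C) U"
  shows "\<exists>d\<in>carrier \<tau>. d \<otimes> \<psi> y = \<psi> x"
proof -
  note D = potentialD[OF pot]
  let ?P = "{(x, y). x \<in> U \<and> y \<in> U \<and> (\<exists>d\<in>carrier \<tau>. d \<otimes> \<psi> y = \<psi> x)}"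
  have "circ (realization C) U \<subseteq> ?P"
  proof (rule circ_realization_local[OF C D(1)])
    have "(x, x) \<in> ?P" if "x \<in> U" for x using that D(2) by (auto intro!: bexI[of _ \<one>])
    moreover have "(x, z) \<in> ?P" if xy: "(x, y) \<in> ?P" and yz: "(y, z) \<in> ?P" for x y z
    proof -
      obtain d e where de: "d \<in> carrier \<tau>" "e \<in> carrier \<tau>" "d \<otimes> \<psi> y = \<psi> x" "e \<otimes> \<psi> z = \<psi> y" "x \<in> U" "z \<in> U" using xy yz by auto
      then have "(d \<otimes> e) \<otimes> \<psi> z = \<psi> x" using D(2) by (simp add: m_assoc)
      then show ?thesis using de by (auto intro!: bexI[of _ "d \<otimes> e"])
    qed
    ultimately show "preorder_on U ?P" unfolding preorder_on_def refl_on_def trans_def by blast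
    fix n c t assume c: "c \<in> cells C n" and t: "t \<in> icube n" "cell_pt C n c t \<in> U"
    obtain B where B: "openin (icube_top n) B" "t \<in> B" "\<And>s s'. s \<in> B \<inter> icube n \<Longrightarrow> s' \<in> B \<inter> icube n \<Longrightarrow>
          cell_pt C n c s \<in> U \<Longrightarrow> cell_pt C n c s' \<in> U \<Longrightarrow> (s, s') \<in> icube_order n \<Longrightarrow>
          step n c s s' \<otimes> \<psi> (cell_pt C n c s') = \<psi> (cell_pt C n c s)" using D(3)[OF c t] by blast
    show "\<exists>B. openin (icube_top n) B \<and> t \<in> B \<and> (\<forall>s\<in>B \<inter> icube n. \<forall>s'\<in>B \<inter> icube n.
        cell_pt C n c s \<in> U \<longrightarrow> cell_pt C n c s' \<in> U \<longrightarrow> (s, s') \<in> icube_order n \<longrightarrow>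
        (cell_pt C n c s, cell_pt C n c s') \<in> ?P)"
    proof (intro exI[of _ B] conjI B(1,2) ballI impI)
      fix s s' assume s: "s \<in> B \<inter> icube n" "s' \<in> B \<inter> icube n" "cell_pt C n c s \<in> U" "cell_pt C n c s' \<in> U" "(s, s') \<in> icube_order n"
      show "(cell_pt C n c s, cell_pt C n c s') \<in> ?P"
        using B(3)[OF s] step_closed[OF c s(5)] s(3,4) by blast
    qed
  qed
  then show ?thesis using xy by blast
qed

text \<open>Two primitives of one cocycle have constant ratio along related points, stated by
  cross-multiplication. For transitivity both equations are multiplied together and the values at
  the middle point are cancelled.\<close>

lemma potential_compat:
  assumes pot: "potential U \<psi>" and pot': "potential U' \<psi>'" and xy: "(x, y) \<in> circ (realization C) (U \<inter> U')"
  shows "\<psi> x \<otimes> \<psi>' y = \<psi> y \<otimes> \<psi>' x"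
proof -
  note D = potentialD[OF pot] and D' = potentialD[OF pot']
  let ?P = "{(x, y). x \<in> U \<inter> U' \<and> y \<in> U \<inter> U' \<and> \<psi> x \<otimes> \<psi>' y = \<psi> y \<otimes> \<psi>' x}"
  have "circ (realization C) (U \<inter> U') \<subseteq> ?P"
  proof (rule circ_realization_local[OF C openin_Int[OF D(1) D'(1)]])
    have "(x, z) \<in> ?P" if xy: "(x, y) \<in> ?P" and yz: "(y, z) \<in> ?P" for x y z
    proof -
      have cl: "\<psi> x \<in> carrier \<tau>" "\<psi> y \<in> carrier \<tau>" "\<psi> z \<in> carrier \<tau>" "\<psi>' x \<in> carrier \<tau>" "\<psi>' y \<in> carrier \<tau>" "\<psi>' z \<in> carrier \<tau>"
        using xy yz D(2) D'(2) by auto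
      have "(\<psi> y \<otimes> \<psi>' y) \<otimes> (\<psi> x \<otimes> \<psi>' z) = (\<psi> x \<otimes> \<psi>' y) \<otimes> (\<psi> y \<otimes> \<psi>' z)" using cl by (simp add: m_ac)
      also have "\<dots> = (\<psi> y \<otimes> \<psi>' x) \<otimes> (\<psi> z \<otimes> \<psi>' y)" using xy yz by simp
      also have "\<dots> = (\<psi> y \<otimes> \<psi>' y) \<otimes> (\<psi> z \<otimes> \<psi>' x)" using cl by (simp add: m_ac)
      finally have "\<psi> x \<otimes> \<psi>' z = \<psi> z \<otimes> \<psi>' x" by (rule lcancel) (use cl in auto)
      then show ?thesis using xy yz by blast
    qed
    then show "preorder_on (U \<inter> U') ?P" unfolding preorder_on_def refl_on_def trans_def by blast
    fix n c t assume c: "c \<in> cells C n" and t: "t \<in> icube n" "cell_pt C n c t \<in> U \<inter> U'"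
    obtain B where B: "openin (icube_top n) B" "t \<in> B" "\<And>s s'. s \<in> B \<inter> icube n \<Longrightarrow> s' \<in> B \<inter> icube n \<Longrightarrow>
          cell_pt C n c s \<in> U \<Longrightarrow> cell_pt C n c s' \<in> U \<Longrightarrow> (s, s') \<in> icube_order n \<Longrightarrow>
          step n c s s' \<otimes> \<psi> (cell_pt C n c s') = \<psi> (cell_pt C n c s)" using D(3)[OF c t(1)] t(2) by blast
    obtain B' where B': "openin (icube_top n) B'" "t \<in> B'" "\<And>s s'. s \<in> B' \<inter> icube n \<Longrightarrow> s' \<in> B' \<inter> icube n \<Longrightarrow>
          cell_pt C n c s \<in> U' \<Longrightarrow> cell_pt C n c s' \<in> U' \<Longrightarrow> (s, s') \<in> icube_order n \<Longrightarrow>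
          step n c s s' \<otimes> \<psi>' (cell_pt C n c s') = \<psi>' (cell_pt C n c s)" using D'(3)[OF c t(1)] t(2) by blast
    show "\<exists>B. openin (icube_top n) B \<and> t \<in> B \<and> (\<forall>s\<in>B \<inter> icube n. \<forall>s'\<in>B \<inter> icube n.
        cell_pt C n c s \<in> U \<inter> U' \<longrightarrow> cell_pt C n c s' \<in> U \<inter> U' \<longrightarrow> (s, s') \<in> icube_order n \<longrightarrow>
        (cell_pt C n c s, cell_pt C n c s') \<in> ?P)"
    proof (intro exI[of _ "B \<inter> B'"] conjI openin_Int B(1) B'(1) ballI impI)
      fix s s' assume s: "s \<in> B \<inter> B' \<inter> icube n" "s' \<in> B \<inter> B' \<inter> icube n" "cell_pt C n c s \<in> U \<inter> U'"
        "cell_pt C n c s' \<in> U \<inter> U'" and ss': "(s, s') \<in> icube_order n"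
      let ?x = "cell_pt C n c s" and ?y = "cell_pt C n c s'"
      have e: "step n c s s' \<otimes> \<psi> ?y = \<psi> ?x" "step n c s s' \<otimes> \<psi>' ?y = \<psi>' ?x"
        using B(3)[of s s'] B'(3)[of s s'] s ss' by auto
      have cl: "\<psi> ?y \<in> carrier \<tau>" "\<psi>' ?y \<in> carrier \<tau>" using s D(2) D'(2) by auto
      have "\<psi> ?x \<otimes> \<psi>' ?y = \<psi> ?y \<otimes> \<psi>' ?x"
        unfolding e[symmetric] using cl step_closed[OF c ss'] by (simp add: m_ac)
      then show "(?x, ?y) \<in> ?P" using s by blast
    qed (use B(2) B'(2) in blast)
  qed
  then show ?thesis using xy by blast
qed

subsection \<open>Lifts\<close>

text \<open>A primitive of the pulled-back cocycle on the whole cube. It grows in the direction in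
  which potentials shrink, so the local condition is constancy of a product and involves no
  division.\<close>

definition lift :: "nat \<Rightarrow> ((nat \<Rightarrow> real) \<Rightarrow> 'c real_pt set) \<Rightarrow> ((nat \<Rightarrow> real) \<Rightarrow> 'm) \<Rightarrow> bool" where
  "lift n \<sigma> \<Phi> \<longleftrightarrow> (\<forall>t\<in>icube n. \<Phi> t \<in> carrier \<tau>) \<and>
     (\<forall>U \<psi> p q. potential U \<psi> \<longrightarrow> (p, q) \<in> icube_circ n {s \<in> icube n. \<sigma> s \<in> U} \<longrightarrow>
        \<Phi> p \<otimes> \<psi> (\<sigma> p) = \<Phi> q \<otimes> \<psi> (\<sigma> q))"

lemma lift_localI:
  assumes \<sigma>: "stream_map (dicube n) (realization C) \<sigma>" and cl: "\<And>t. t \<in> icube n \<Longrightarrow> \<Phi> t \<in> carrier \<tau>"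
    and loc: "\<And>U \<psi> t. potential U \<psi> \<Longrightarrow> t \<in> icube n \<Longrightarrow> \<sigma> t \<in> U \<Longrightarrow> \<exists>B. openin (icube_top n) B \<and> t \<in> B \<and>
       (\<forall>s\<in>B \<inter> icube n. \<forall>s'\<in>B \<inter> icube n. \<sigma> s \<in> U \<longrightarrow> \<sigma> s' \<in> U \<longrightarrow> (s, s') \<in> icube_order n \<longrightarrow>
          \<Phi> s \<otimes> \<psi> (\<sigma> s) = \<Phi> s' \<otimes> \<psi> (\<sigma> s'))"
  shows "lift n \<sigma> \<Phi>"
  unfolding lift_def
proof (intro conjI allI impI ballI cl)
  fix U \<psi> p q assume pot: "potential U \<psi>" and pq: "(p, q) \<in> icube_circ n {s \<in> icube n. \<sigma> s \<in> U}"
  let ?V = "{s \<in> icube n. \<sigma> s \<in> U}"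
  have "icube_circ n ?V \<subseteq> {(s, s'). s \<in> ?V \<and> s' \<in> ?V \<and> \<Phi> s \<otimes> \<psi> (\<sigma> s) = \<Phi> s' \<otimes> \<psi> (\<sigma> s')}"
  proof (rule icube_circ_local)
    show "openin (icube_top n) ?V" by (rule openin_preimage_cube[OF stream_map_dicubeD(1)[OF \<sigma>] potentialD(1)[OF pot]])
    show "preorder_on ?V {(s, s'). s \<in> ?V \<and> s' \<in> ?V \<and> \<Phi> s \<otimes> \<psi> (\<sigma> s) = \<Phi> s' \<otimes> \<psi> (\<sigma> s')}"
      unfolding preorder_on_def refl_on_def trans_def by auto
    fix t assume "t \<in> ?V"
    then obtain B where "openin (icube_top n) B" "t \<in> B" "\<forall>s\<in>B \<inter> icube n. \<forall>s'\<in>B \<inter> icube n. \<sigma> s \<in> U \<longrightarrow> \<sigma> s' \<in> U \<longrightarrow>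
       (s, s') \<in> icube_order n \<longrightarrow> \<Phi> s \<otimes> \<psi> (\<sigma> s) = \<Phi> s' \<otimes> \<psi> (\<sigma> s')" using loc[OF pot, of t] by auto
    then show "\<exists>B. openin (icube_top n) B \<and> t \<in> B \<and> (\<forall>s\<in>B \<inter> ?V. \<forall>s'\<in>B \<inter> ?V. (s, s') \<in> icube_order n \<longrightarrow>
       (s, s') \<in> {(s, s'). s \<in> ?V \<and> s' \<in> ?V \<and> \<Phi> s \<otimes> \<psi> (\<sigma> s) = \<Phi> s' \<otimes> \<psi> (\<sigma> s')})"
      by (intro exI[of _ B]) auto
  qed
  then show "\<Phi> p \<otimes> \<psi> (\<sigma> p) = \<Phi> q \<otimes> \<psi> (\<sigma> q)" using pq by blast
qed

text \<open>This yields naturality of the extension for morphisms of \<open>\<box>\<close>, and its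
  values on straight paths inside a cell.\<close>

lemma lift_compose:
  assumes \<sigma>: "stream_map (dicube n) (realization C) \<sigma>" and l: "lift n \<sigma> \<Phi>" and \<theta>: "stream_map (dicube m) (dicube n) \<theta>"
  shows "lift m (compose (icube m) \<sigma> \<theta>) (\<lambda>t. \<Phi> (\<theta> t))"
proof -
  have in_n: "\<theta> t \<in> icube n" if "t \<in> icube m" for t
    using stream_map_dicubeD(1)[OF \<theta>] that by (auto simp: dicube_def continuous_map_def)
  show ?thesis
    unfolding lift_def
  proof (intro conjI allI impI ballI)
    show "\<Phi> (\<theta> t) \<in> carrier \<tau>" if "t \<in> icube m" for t using l in_n[OF that] by (simp add: lift_def)
    fix U \<psi> p q assume pot: "potential U \<psi>" and pq: "(p, q) \<in> icube_circ m {s \<in> icube m. compose (icube m) \<sigma> \<theta> s \<in> U}"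
    have V: "openin (top_of (dicube n)) {s \<in> icube n. \<sigma> s \<in> U}"
      using openin_preimage_cube[OF stream_map_dicubeD(1)[OF \<sigma>] potentialD(1)[OF pot]] by (simp add: dicube_def)
    have eq: "{s \<in> icube m. compose (icube m) \<sigma> \<theta> s \<in> U} = {s \<in> icube m. \<theta> s \<in> {s \<in> icube n. \<sigma> s \<in> U}}"
      using in_n by (auto simp: compose_def)
    have "(\<theta> p, \<theta> q) \<in> circ (dicube n) {s \<in> icube n. \<sigma> s \<in> U}"
      by (rule stream_map_dicubeD(2)[OF \<theta> V]) (use pq eq in simp)
    then have "\<Phi> (\<theta> p) \<otimes> \<psi> (\<sigma> (\<theta> p)) = \<Phi> (\<theta> q) \<otimes> \<psi> (\<sigma> (\<theta> q))"
      using l pot by (simp add: lift_def dicube_def)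
    moreover have "openin (icube_top m) {s \<in> icube m. \<theta> s \<in> {s \<in> icube n. \<sigma> s \<in> U}}"
      by (rule openin_preimage_cube[OF stream_map_dicubeD(1)[OF \<theta>] V])
    from preorder_onD(1)[OF icube_circ_preorder[OF this]] have "p \<in> icube m" "q \<in> icube m"
      using pq unfolding eq by auto
    ultimately show "\<Phi> (\<theta> p) \<otimes> \<psi> (compose (icube m) \<sigma> \<theta> p) = \<Phi> (\<theta> q) \<otimes> \<psi> (compose (icube m) \<sigma> \<theta> q)"
      by (simp add: compose_def)
  qed
qed

lemma lift_nbhd:
  assumes \<sigma>: "stream_map (dicube n) (realization C) \<sigma>" and t: "t \<in> icube n"
  shows "\<exists>U \<psi> B. potential U \<psi> \<and> openin (icube_top n) B \<and> t \<in> B \<and> B \<subseteq> {s \<in> icube n. \<sigma> s \<in> U} \<and>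
    (\<forall>s\<in>B. \<forall>s'\<in>B. (s, s') \<in> icube_order n \<longrightarrow> icube_seg s s' n \<subseteq> {s \<in> icube n. \<sigma> s \<in> U} \<and>
      (s, s') \<in> icube_circ n {s \<in> icube n. \<sigma> s \<in> U})"
proof -
  have "\<sigma> t \<in> topspace (rtop C)" using stream_map_dicubeD(1)[OF \<sigma>] t by (auto simp: continuous_map_def)
  then obtain U \<psi> where pot: "potential U \<psi>" "\<sigma> t \<in> U" using potential_exists by blast
  let ?V = "{s \<in> icube n. \<sigma> s \<in> U}"
  have V: "openin (icube_top n) ?V"
    by (rule openin_preimage_cube[OF stream_map_dicubeD(1)[OF \<sigma>] potentialD(1)[OF pot(1)]])
  have tV: "t \<in> ?V" using t pot(2) by simp
  show ?thesis
  proof (rule icube_circ_nbhd[OF V tV])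
    fix B assume "openin (icube_top n) B" "t \<in> B" "B \<subseteq> ?V" "\<And>s s'. s \<in> B \<Longrightarrow> s' \<in> B \<Longrightarrow> icube_seg s s' n \<subseteq> ?V"
      "\<And>s s'. s \<in> B \<Longrightarrow> s' \<in> B \<Longrightarrow> (s, s') \<in> icube_order n \<Longrightarrow> (s, s') \<in> icube_circ n ?V"
    then show ?thesis using pot(1) by (intro exI[of _ U] exI[of _ \<psi>] exI[of _ B] conjI ballI impI) simp_all
  qed
qed

text \<open>Locally the increment is the factor by which a potential decreases, supplied by
  \<open>potential_divides\<close>; small steps are then multiplied together.\<close>

lemma lift_divides:
  assumes \<sigma>: "stream_map (dicube n) (realization C) \<sigma>" and l: "lift n \<sigma> \<Phi>" and pq: "(p, q) \<in> icube_order n"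
  shows "\<exists>d\<in>carrier \<tau>. \<Phi> p \<otimes> d = \<Phi> q"
proof -
  have cl: "\<Phi> t \<in> carrier \<tau>" if "t \<in> icube n" for t using l that by (simp add: lift_def)
  let ?P = "{(p, q). p \<in> icube n \<and> q \<in> icube n \<and> (\<exists>d\<in>carrier \<tau>. \<Phi> p \<otimes> d = \<Phi> q)}"
  have "icube_order n \<subseteq> ?P"
  proof (rule icube_order_local)
    have "(x, x) \<in> ?P" if "x \<in> icube n" for x using that cl by (auto intro!: bexI[of _ \<one>])
    moreover have "(x, z) \<in> ?P" if xy: "(x, y) \<in> ?P" and yz: "(y, z) \<in> ?P" for x y z
    proof -
      obtain d e where de: "d \<in> carrier \<tau>" "e \<in> carrier \<tau>" "\<Phi> x \<otimes> d = \<Phi> y" "\<Phi> y \<otimes> e = \<Phi> z" "x \<in> icube n" "z \<in> icube n" using xy yz by auto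
      then have "\<Phi> x \<otimes> (d \<otimes> e) = \<Phi> z" using cl by (simp flip: m_assoc)
      then show ?thesis using de by (auto intro!: bexI[of _ "d \<otimes> e"])
    qed
    ultimately show "preorder_on (icube n) ?P" unfolding preorder_on_def refl_on_def trans_def by blast
    fix t assume t: "t \<in> icube n"
    obtain U \<psi> B where B: "potential U \<psi>" "openin (icube_top n) B" "t \<in> B" "B \<subseteq> {s \<in> icube n. \<sigma> s \<in> U}"
      "\<forall>s\<in>B. \<forall>s'\<in>B. (s, s') \<in> icube_order n \<longrightarrow> icube_seg s s' n \<subseteq> {s \<in> icube n. \<sigma> s \<in> U} \<and>
        (s, s') \<in> icube_circ n {s \<in> icube n. \<sigma> s \<in> U}"
      using lift_nbhd[OF \<sigma> t] by (elim exE conjE) (rule that)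
    show "\<exists>B. openin (icube_top n) B \<and> t \<in> B \<and> (\<forall>s\<in>B \<inter> icube n. \<forall>s'\<in>B \<inter> icube n. (s, s') \<in> icube_order n \<longrightarrow> (s, s') \<in> ?P)"
    proof (intro exI[of _ B] conjI B(2,3) ballI impI)
      fix s s' assume s: "s \<in> B \<inter> icube n" "s' \<in> B \<inter> icube n" "(s, s') \<in> icube_order n"
      then have c: "(s, s') \<in> icube_circ n {s \<in> icube n. \<sigma> s \<in> U}" using B(5) by blast
      obtain d where d: "d \<in> carrier \<tau>" "d \<otimes> \<psi> (\<sigma> s') = \<psi> (\<sigma> s)"
        using potential_divides[OF B(1) stream_map_dicubeD(2)[OF \<sigma> potentialD(1)[OF B(1)] c]] by blast
      have u: "\<psi> (\<sigma> s') \<in> carrier \<tau>" using potentialD(2)[OF B(1)] B(4) s by blast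
      have "\<Phi> s \<otimes> \<psi> (\<sigma> s) = \<Phi> s' \<otimes> \<psi> (\<sigma> s')" using l B(1) c by (simp add: lift_def)
      then have "(\<Phi> s \<otimes> d) \<otimes> \<psi> (\<sigma> s') = \<Phi> s' \<otimes> \<psi> (\<sigma> s')" using d u cl s by (simp add: m_assoc)
      then have "\<Phi> s \<otimes> d = \<Phi> s'" by (rule rcancel) (use d u cl s in auto)
      then show "(s, s') \<in> ?P" using d(1) s by blast
    qed
  qed
  then show ?thesis using pq by blast
qed

text \<open>The ratio of two lifts is constant along ordered pairs, again by cross-multiplication.
  The increment of a lift from \<open>p\<close> to \<open>q\<close> is therefore independent of the
  lift.\<close>

lemma lift_unique:
  assumes \<sigma>: "stream_map (dicube n) (realization C) \<sigma>" and l: "lift n \<sigma> \<Phi>" and l': "lift n \<sigma> \<Phi>'" and pq: "(p, q) \<in> icube_order n"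
  shows "\<Phi> p \<otimes> \<Phi>' q = \<Phi> q \<otimes> \<Phi>' p"
proof -
  have cl: "\<Phi> t \<in> carrier \<tau>" "\<Phi>' t \<in> carrier \<tau>" if "t \<in> icube n" for t using l l' that by (auto simp: lift_def)
  let ?P = "{(p, q). p \<in> icube n \<and> q \<in> icube n \<and> \<Phi> p \<otimes> \<Phi>' q = \<Phi> q \<otimes> \<Phi>' p}"
  have "icube_order n \<subseteq> ?P"
  proof (rule icube_order_local)
    have "(x, z) \<in> ?P" if xy: "(x, y) \<in> ?P" and yz: "(y, z) \<in> ?P" for x y z
    proof -
      have c: "\<Phi> x \<in> carrier \<tau>" "\<Phi> y \<in> carrier \<tau>" "\<Phi> z \<in> carrier \<tau>" "\<Phi>' x \<in> carrier \<tau>" "\<Phi>' y \<in> carrier \<tau>" "\<Phi>' z \<in> carrier \<tau>"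
        using xy yz cl by auto
      have "(\<Phi> y \<otimes> \<Phi>' y) \<otimes> (\<Phi> x \<otimes> \<Phi>' z) = (\<Phi> x \<otimes> \<Phi>' y) \<otimes> (\<Phi> y \<otimes> \<Phi>' z)" using c by (simp add: m_ac)
      also have "\<dots> = (\<Phi> y \<otimes> \<Phi>' x) \<otimes> (\<Phi> z \<otimes> \<Phi>' y)" using xy yz by simp
      also have "\<dots> = (\<Phi> y \<otimes> \<Phi>' y) \<otimes> (\<Phi> z \<otimes> \<Phi>' x)" using c by (simp add: m_ac)
      finally have "\<Phi> x \<otimes> \<Phi>' z = \<Phi> z \<otimes> \<Phi>' x" by (rule lcancel) (use c in auto)
      then show ?thesis using xy yz by blast
    qed
    then show "preorder_on (icube n) ?P" unfolding preorder_on_def refl_on_def trans_def by blast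
    fix t assume t: "t \<in> icube n"
    obtain U \<psi> B where B: "potential U \<psi>" "openin (icube_top n) B" "t \<in> B" "B \<subseteq> {s \<in> icube n. \<sigma> s \<in> U}"
      "\<forall>s\<in>B. \<forall>s'\<in>B. (s, s') \<in> icube_order n \<longrightarrow> icube_seg s s' n \<subseteq> {s \<in> icube n. \<sigma> s \<in> U} \<and>
        (s, s') \<in> icube_circ n {s \<in> icube n. \<sigma> s \<in> U}"
      using lift_nbhd[OF \<sigma> t] by (elim exE conjE) (rule that)
    show "\<exists>B. openin (icube_top n) B \<and> t \<in> B \<and> (\<forall>s\<in>B \<inter> icube n. \<forall>s'\<in>B \<inter> icube n. (s, s') \<in> icube_order n \<longrightarrow> (s, s') \<in> ?P)"
    proof (intro exI[of _ B] conjI B(2,3) ballI impI)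
      fix s s' assume s: "s \<in> B \<inter> icube n" "s' \<in> B \<inter> icube n" "(s, s') \<in> icube_order n"
      then have c: "(s, s') \<in> icube_circ n {s \<in> icube n. \<sigma> s \<in> U}" using B(5) by blast
      have u: "\<psi> (\<sigma> s) \<in> carrier \<tau>" "\<psi> (\<sigma> s') \<in> carrier \<tau>" using potentialD(2)[OF B(1)] B(4) s by blast+
      have k: "\<Phi> s \<in> carrier \<tau>" "\<Phi> s' \<in> carrier \<tau>" "\<Phi>' s \<in> carrier \<tau>" "\<Phi>' s' \<in> carrier \<tau>" using cl s by auto
      have e: "\<Phi> s \<otimes> \<psi> (\<sigma> s) = \<Phi> s' \<otimes> \<psi> (\<sigma> s')" "\<Phi>' s \<otimes> \<psi> (\<sigma> s) = \<Phi>' s' \<otimes> \<psi> (\<sigma> s')"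
        using l l' B(1) c by (simp_all add: lift_def)
      have "(\<psi> (\<sigma> s) \<otimes> \<psi> (\<sigma> s')) \<otimes> (\<Phi> s \<otimes> \<Phi>' s') = (\<Phi> s \<otimes> \<psi> (\<sigma> s)) \<otimes> (\<Phi>' s' \<otimes> \<psi> (\<sigma> s'))" using u k by (simp add: m_ac)
      also have "\<dots> = (\<Phi> s' \<otimes> \<psi> (\<sigma> s')) \<otimes> (\<Phi>' s \<otimes> \<psi> (\<sigma> s))" by (simp add: e)
      also have "\<dots> = (\<psi> (\<sigma> s) \<otimes> \<psi> (\<sigma> s')) \<otimes> (\<Phi> s' \<otimes> \<Phi>' s)" using u k by (simp add: m_ac)
      finally have "\<Phi> s \<otimes> \<Phi>' s' = \<Phi> s' \<otimes> \<Phi>' s" by (rule lcancel) (use u k in auto)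
      then show "(s, s') \<in> ?P" using s by blast
    qed
  qed
  then show ?thesis using pq by blast
qed

end

lemma vert_order: "(v, w) \<in> Ar (cube_cat n) \<Longrightarrow> (vert n v, vert n w) \<in> icube_order n"
  using vert_in[of n v] vert_in[of n w] by (auto simp: cube_arr_iff icube_order_def) (auto simp: vert_def)

section \<open>Transport over short order intervals and existence of lifts\<close>

context cocycle
begin

definition short :: "nat \<Rightarrow> ((nat \<Rightarrow> real) \<Rightarrow> 'c real_pt set) \<Rightarrow> (nat \<Rightarrow> real) \<Rightarrow> (nat \<Rightarrow> real) \<Rightarrow> bool" where
  "short n \<sigma> p q \<longleftrightarrow> (p, q) \<in> icube_order n \<and> (\<exists>U \<psi>. potential U \<psi> \<and> icube_seg p q n \<subseteq> {s \<in> icube n. \<sigma> s \<in> U})"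

text \<open>The factor lost by a potential from \<open>p\<close> to \<open>q\<close>. It is chosen
  for some potential defined over the whole interval; the lemma \<open>transport\<close> shows that
  it serves all of them.\<close>

definition transport :: "nat \<Rightarrow> ((nat \<Rightarrow> real) \<Rightarrow> 'c real_pt set) \<Rightarrow> (nat \<Rightarrow> real) \<Rightarrow> (nat \<Rightarrow> real) \<Rightarrow> 'm" where
  "transport n \<sigma> p q = (SOME d. d \<in> carrier \<tau> \<and> (\<exists>U \<psi>. potential U \<psi> \<and>
     icube_seg p q n \<subseteq> {s \<in> icube n. \<sigma> s \<in> U} \<and> d \<otimes> \<psi> (\<sigma> q) = \<psi> (\<sigma> p)))"

lemma seg_ends: "(p, q) \<in> icube_order n \<Longrightarrow> p \<in> icube_seg p q n" "(p, q) \<in> icube_order n \<Longrightarrow> q \<in> icube_seg p q n"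
  by (auto simp: icube_seg_def icube_order_def)

lemma seg_mono:
  "(p, p') \<in> icube_order n \<Longrightarrow> (q', q) \<in> icube_order n \<Longrightarrow> icube_seg p' q' n \<subseteq> icube_seg p q n"
  using preorder_onD(3)[OF icube_order_preorder] unfolding icube_seg_def by blast

text \<open>\<open>potential_divides\<close> produces the factor for one potential. For another one,
  \<open>potential_compat\<close> on the intersection of the two domains and cancellation carry it
  over.\<close>

lemma transport:
  assumes \<sigma>: "stream_map (dicube n) (realization C) \<sigma>" and s: "short n \<sigma> p q"
  shows "transport n \<sigma> p q \<in> carrier \<tau>"
    "potential U \<psi> \<Longrightarrow> icube_seg p q n \<subseteq> {s \<in> icube n. \<sigma> s \<in> U} \<Longrightarrow> transport n \<sigma> p q \<otimes> \<psi> (\<sigma> q) = \<psi> (\<sigma> p)"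
proof -
  have pq: "(p, q) \<in> icube_order n" using s by (simp add: short_def)
  have V: "openin (icube_top n) {s \<in> icube n. \<sigma> s \<in> U}" if "openin (rtop C) U" for U
    by (rule openin_preimage_cube[OF stream_map_dicubeD(1)[OF \<sigma>] that])
  have circ: "(\<sigma> p, \<sigma> q) \<in> circ (realization C) U" if "openin (rtop C) U" "icube_seg p q n \<subseteq> {s \<in> icube n. \<sigma> s \<in> U}" for U
    by (rule stream_map_dicubeD(2)[OF \<sigma> that(1) icube_circ_seg[OF V[OF that(1)] pq that(2)]])
  obtain U0 \<psi>0 where pot0: "potential U0 \<psi>0" "icube_seg p q n \<subseteq> {s \<in> icube n. \<sigma> s \<in> U0}" using s by (auto simp: short_def)
  then have "\<exists>d. d \<in> carrier \<tau> \<and> (\<exists>U \<psi>. potential U \<psi> \<and>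
     icube_seg p q n \<subseteq> {s \<in> icube n. \<sigma> s \<in> U} \<and> d \<otimes> \<psi> (\<sigma> q) = \<psi> (\<sigma> p))"
    using potential_divides[OF pot0(1) circ[OF potentialD(1)[OF pot0(1)] pot0(2)]] by blast
  then have T: "transport n \<sigma> p q \<in> carrier \<tau> \<and> (\<exists>U \<psi>. potential U \<psi> \<and>
     icube_seg p q n \<subseteq> {s \<in> icube n. \<sigma> s \<in> U} \<and> transport n \<sigma> p q \<otimes> \<psi> (\<sigma> q) = \<psi> (\<sigma> p))"
    unfolding transport_def by (rule someI_ex)
  then show cl: "transport n \<sigma> p q \<in> carrier \<tau>" by simp
  obtain U1 \<psi>1 where pot1: "potential U1 \<psi>1" "icube_seg p q n \<subseteq> {s \<in> icube n. \<sigma> s \<in> U1}"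
    "transport n \<sigma> p q \<otimes> \<psi>1 (\<sigma> q) = \<psi>1 (\<sigma> p)" using T by blast
  assume pot: "potential U \<psi>" and sub: "icube_seg p q n \<subseteq> {s \<in> icube n. \<sigma> s \<in> U}"
  let ?d = "transport n \<sigma> p q"
  have "(\<sigma> p, \<sigma> q) \<in> circ (realization C) (U1 \<inter> U)"
    by (rule circ[OF openin_Int[OF potentialD(1)[OF pot1(1)] potentialD(1)[OF pot]]]) (use pot1(2) sub in blast)
  then have "\<psi>1 (\<sigma> p) \<otimes> \<psi> (\<sigma> q) = \<psi>1 (\<sigma> q) \<otimes> \<psi> (\<sigma> p)" by (rule potential_compat[OF pot1(1) pot])
  moreover have k: "\<psi>1 (\<sigma> q) \<in> carrier \<tau>" "\<psi> (\<sigma> q) \<in> carrier \<tau>" "\<psi> (\<sigma> p) \<in> carrier \<tau>"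
    using potentialD(2)[OF pot1(1)] potentialD(2)[OF pot] pot1(2) sub seg_ends[OF pq] by blast+
  ultimately have "\<psi>1 (\<sigma> q) \<otimes> (?d \<otimes> \<psi> (\<sigma> q)) = \<psi>1 (\<sigma> q) \<otimes> \<psi> (\<sigma> p)"
    unfolding pot1(3)[symmetric] using cl by (simp add: m_ac)
  then show "?d \<otimes> \<psi> (\<sigma> q) = \<psi> (\<sigma> p)" by (rule lcancel) (use k cl in auto)
qed

lemma short_sub:
  assumes "short n \<sigma> p q" "(p, p') \<in> icube_order n" "(p', q') \<in> icube_order n" "(q', q) \<in> icube_order n"
  shows "short n \<sigma> p' q'"
  using assms(1,3) seg_mono[OF assms(2,4)] unfolding short_def by blast

text \<open>A potential over the large interval evaluates all three transports.\<close>

lemma transport_trans: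
  assumes \<sigma>: "stream_map (dicube n) (realization C) \<sigma>" and s: "short n \<sigma> p r"
    and pq: "(p, q) \<in> icube_order n" and qr: "(q, r) \<in> icube_order n"
  shows "transport n \<sigma> p r = transport n \<sigma> p q \<otimes> transport n \<sigma> q r"
proof -
  have refl: "(p, p) \<in> icube_order n" "(r, r) \<in> icube_order n" using pq qr by (auto simp: icube_order_def)
  have s1: "short n \<sigma> p q" by (rule short_sub[OF s refl(1) pq qr])
  have s2: "short n \<sigma> q r" by (rule short_sub[OF s pq qr refl(2)])
  obtain U \<psi> where pot: "potential U \<psi>" "icube_seg p r n \<subseteq> {s \<in> icube n. \<sigma> s \<in> U}" using s by (auto simp: short_def)
  have i: "icube_seg p q n \<subseteq> {s \<in> icube n. \<sigma> s \<in> U}" "icube_seg q r n \<subseteq> {s \<in> icube n. \<sigma> s \<in> U}"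
    using pot(2) seg_mono[OF refl(1) qr] seg_mono[OF pq refl(2)] by blast+
  have k: "\<psi> (\<sigma> r) \<in> carrier \<tau>" using potentialD(2)[OF pot(1)] i(2) seg_ends[OF qr] by blast
  note c = transport(1)[OF \<sigma> s] transport(1)[OF \<sigma> s1] transport(1)[OF \<sigma> s2]
  have "transport n \<sigma> p r \<otimes> \<psi> (\<sigma> r) = transport n \<sigma> p q \<otimes> (transport n \<sigma> q r \<otimes> \<psi> (\<sigma> r))"
    unfolding transport(2)[OF \<sigma> s2 pot(1) i(2)] transport(2)[OF \<sigma> s1 pot(1) i(1)] by (rule transport(2)[OF \<sigma> s pot])
  then have "transport n \<sigma> p r \<otimes> \<psi> (\<sigma> r) = (transport n \<sigma> p q \<otimes> transport n \<sigma> q r) \<otimes> \<psi> (\<sigma> r)"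
    using c k by (simp add: m_assoc)
  then show ?thesis by (rule rcancel) (use k c in auto)
qed

text \<open>By \<open>transport_trans\<close> it is idempotent, and cancellation leaves only the
  unit.\<close>

lemma transport_refl:
  assumes \<sigma>: "stream_map (dicube n) (realization C) \<sigma>" and s: "short n \<sigma> p p"
  shows "transport n \<sigma> p p = \<one>"
proof -
  have "(p, p) \<in> icube_order n" using s by (simp add: short_def)
  from transport_trans[OF \<sigma> s this this]
  have "transport n \<sigma> p p \<otimes> transport n \<sigma> p p = transport n \<sigma> p p \<otimes> \<one>" using transport(1)[OF \<sigma> s] by simp
  then show ?thesis by (rule lcancel) (use transport(1)[OF \<sigma> s] in auto)
qed

text \<open>A Lebesgue number for the preimages of the domains of potentials; an order interval with
  sides below \<open>\<delta>\<close> lies in the box of that radius around its lower end.\<close>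

lemma short_uniform:
  assumes \<sigma>: "stream_map (dicube n) (realization C) \<sigma>"
  obtains \<delta> where "0 < \<delta>" "\<And>p q. (p, q) \<in> icube_order n \<Longrightarrow> (\<And>i. i < n \<Longrightarrow> q i - p i < \<delta>) \<Longrightarrow> short n \<sigma> p q"
proof -
  define \<V> where "\<V> = {{s \<in> icube n. \<sigma> s \<in> U} | U. \<exists>\<psi>. potential U \<psi>}"
  have "\<exists>V\<in>\<V>. openin (icube_top n) V \<and> t \<in> V" if t: "t \<in> icube n" for t
  proof -
    have "\<sigma> t \<in> topspace (rtop C)" using stream_map_dicubeD(1)[OF \<sigma>] t by (auto simp: continuous_map_def)
    then obtain U \<psi> where pot: "potential U \<psi>" "\<sigma> t \<in> U" using potential_exists by blast
    then have "openin (icube_top n) {s \<in> icube n. \<sigma> s \<in> U}"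
      by (intro openin_preimage_cube[OF stream_map_dicubeD(1)[OF \<sigma>] potentialD(1)])
    then show ?thesis using t pot unfolding \<V>_def by blast
  qed
  then obtain \<delta> where \<delta>: "0 < \<delta>"
    "\<And>p. p \<in> icube n \<Longrightarrow> \<exists>V\<in>\<V>. openin (icube_top n) V \<and> (\<forall>q\<in>icube n. (\<forall>i<n. \<bar>q i - p i\<bar> < \<delta>) \<longrightarrow> q \<in> V)"
    using icube_Lebesgue[of n \<V>] by blast
  show thesis
  proof (rule that[OF \<delta>(1)])
    fix p q assume pq: "(p, q) \<in> icube_order n" and d: "\<And>i. i < n \<Longrightarrow> q i - p i < \<delta>"
    have "p \<in> icube n" using pq by (simp add: icube_order_def)
    then obtain V where V: "V \<in> \<V>" "\<forall>q\<in>icube n. (\<forall>i<n. \<bar>q i - p i\<bar> < \<delta>) \<longrightarrow> q \<in> V" using \<delta>(2) by blast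
    have "icube_seg p q n \<subseteq> V"
    proof
      fix x assume "x \<in> icube_seg p q n"
      then have x: "x \<in> icube n" "\<And>i. i < n \<Longrightarrow> p i \<le> x i \<and> x i \<le> q i" by (auto simp: icube_seg_def icube_order_def)
      have "\<bar>x i - p i\<bar> < \<delta>" if "i < n" for i using x(2)[OF that] d[OF that] by linarith
      then show "x \<in> V" using V(2) x(1) by blast
    qed
    then show "short n \<sigma> p q" using pq V(1) unfolding short_def \<V>_def by blast
  qed
qed

text \<open>The lift is the transport along the ray from the vertex \<open>0\<close>, computed on a fine subdivision.\<close>

lemma lift_exists:
  assumes \<sigma>: "stream_map (dicube n) (realization C) \<sigma>"
  shows "\<exists>\<Phi>. lift n \<sigma> \<Phi>"
proof -
  obtain \<delta> where \<delta>: "0 < \<delta>" "\<And>p q. (p, q) \<in> icube_order n \<Longrightarrow> (\<And>i. i < n \<Longrightarrow> q i - p i < \<delta>) \<Longrightarrow> short n \<sigma> p q"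
    using short_uniform[OF \<sigma>] by blast
  \<comment> \<open>The mesh \<open>1 / N\<close> is below \<open>\<delta> / 2\<close>, and the end
    points of neighbouring rays will differ by less than \<open>\<delta> / 2\<close>; together these
    keep the diagonals between consecutive points of two rays short.\<close>
  obtain N :: nat where N: "2 / \<delta> < real N" using reals_Archimedean2 by blast
  have N0: "0 < real N" using N \<delta>(1) by (meson divide_pos_pos less_trans zero_less_numeral)
  have N1: "1 / real N < \<delta> / 2" using N \<delta>(1) N0 by (simp add: field_simps)
  define r where "r = (\<lambda>k s. \<lambda>j\<in>{..<n}. real k / real N * s j)"
  have r: "r k s \<in> icube n" if "s \<in> icube n" "k \<le> N" for k s
  proof -
    have "0 \<le> real k / real N * s i \<and> real k / real N * s i \<le> 1" if "i < n" for i
    proof -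
      have "0 \<le> s i" "s i \<le> 1" using \<open>s \<in> icube n\<close> that by (auto simp: icube_iff)
      moreover have "0 \<le> real k / real N" "real k / real N \<le> 1" using \<open>k \<le> N\<close> N0 by auto
      ultimately show ?thesis by (intro conjI mult_le_one mult_nonneg_nonneg)
    qed
    then show ?thesis by (auto simp: r_def icube_iff)
  qed
  have rle: "(r k s, r l t) \<in> icube_order n" if st: "(s, t) \<in> icube_order n" and kl: "k \<le> l" "l \<le> N" for k l s t
  proof -
    have s: "s \<in> icube n" "t \<in> icube n" "\<And>i. i < n \<Longrightarrow> s i \<le> t i" using st by (auto simp: icube_order_def)
    have "real k / real N * s i \<le> real l / real N * t i" if "i < n" for i
      using s(3)[OF that] s(1) that kl by (intro mult_mono divide_right_mono) (auto simp: icube_iff)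
    then show ?thesis using r s kl by (auto simp: icube_order_def r_def)
  qed
  have sh: "short n \<sigma> (r k s) (r (Suc k) t)"
    if st: "(s, t) \<in> icube_order n" and d: "\<And>i. i < n \<Longrightarrow> t i - s i < \<delta> / 2" and k: "Suc k \<le> N" for k s t
  proof (rule \<delta>(2)[OF rle[OF st _ k]])
    fix i assume i: "i < n"
    have s: "s i \<le> t i" "t i \<le> 1" "0 \<le> t i" using st i by (auto simp: icube_order_def icube_iff)
    have "r (Suc k) t i - r k s i = real k / real N * (t i - s i) + 1 / real N * t i"
      using i by (simp add: r_def add_divide_distrib diff_divide_distrib algebra_simps)
    also have "real k / real N * (t i - s i) \<le> 1 * (t i - s i)"
      using s k N0 by (intro mult_right_mono) auto
    also have "1 / real N * t i \<le> 1 / real N * 1" using s N0 by (intro mult_left_mono) auto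
    finally show "r (Suc k) t i - r k s i < \<delta>" using d[OF i] N1 by simp
  qed simp
  define \<Phi> where "\<Phi> = (\<lambda>k s. rec_nat \<one> (\<lambda>i a. a \<otimes> transport n \<sigma> (r i s) (r (Suc i) s)) k)"
  have \<Phi>0: "\<Phi> 0 s = \<one>" and \<Phi>S: "\<Phi> (Suc k) s = \<Phi> k s \<otimes> transport n \<sigma> (r k s) (r (Suc k) s)" for k s
    by (simp_all add: \<Phi>_def)
  have ss: "(s, s) \<in> icube_order n" if "s \<in> icube n" for s using that by (simp add: icube_order_def)
  have d0: "s i - s i < \<delta> / 2" for s :: "nat \<Rightarrow> real" and i using \<delta>(1) by simp
  have \<Phi>cl: "\<Phi> k s \<in> carrier \<tau>" if "s \<in> icube n" "k \<le> N" for k s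
    using that(2)
  proof (induction k)
    case (Suc k)
    have "transport n \<sigma> (r k s) (r (Suc k) s) \<in> carrier \<tau>"
      by (rule transport(1)[OF \<sigma> sh]) (use ss[OF that(1)] d0[of s] Suc.prems in auto)
    then show ?case using Suc by (simp add: \<Phi>S)
  qed (simp add: \<Phi>0)
  \<comment> \<open>A ladder between the rays to \<open>s\<close> and to \<open>t\<close>: each of
    its squares commutes, since both ways round equal the transport along its diagonal.\<close>
  have key: "\<Phi> k s \<otimes> transport n \<sigma> (r k s) (r k t) = \<Phi> k t"
    if st: "(s, t) \<in> icube_order n" and d: "\<And>i. i < n \<Longrightarrow> t i - s i < \<delta> / 2" and k: "k \<le> N" for k s t
    using k
  proof (induction k)
    case 0
    have e: "r 0 s = r 0 t" by (auto simp: r_def)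
    have "short n \<sigma> (r 0 t) (r 0 t)"
      by (rule \<delta>(2)) (use rle[of t t 0 0] st \<delta>(1) in \<open>auto simp: icube_order_def\<close>)
    then show ?case using transport_refl[OF \<sigma>] by (simp add: \<Phi>0 e)
  next
    case (Suc k)
    have sc: "s \<in> icube n" "t \<in> icube n" using st by (auto simp: icube_order_def)
    note S = sh[OF st d Suc.prems]
    have o: "(r k s, r k t) \<in> icube_order n" "(r k t, r (Suc k) t) \<in> icube_order n"
      "(r k s, r (Suc k) s) \<in> icube_order n" "(r (Suc k) s, r (Suc k) t) \<in> icube_order n"
      using rle[OF st] rle[OF ss[OF sc(1)]] rle[OF ss[OF sc(2)]] Suc.prems by auto
    have rf: "(r k s, r k s) \<in> icube_order n" "(r (Suc k) t, r (Suc k) t) \<in> icube_order n" using o by (auto simp: icube_order_def)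
    have c: "transport n \<sigma> (r k s) (r k t) \<in> carrier \<tau>" "transport n \<sigma> (r k t) (r (Suc k) t) \<in> carrier \<tau>"
      "transport n \<sigma> (r k s) (r (Suc k) s) \<in> carrier \<tau>" "transport n \<sigma> (r (Suc k) s) (r (Suc k) t) \<in> carrier \<tau>"
      using transport(1)[OF \<sigma> short_sub[OF S rf(1) o(1,2)]] transport(1)[OF \<sigma> short_sub[OF S o(1,2) rf(2)]]
        transport(1)[OF \<sigma> short_sub[OF S rf(1) o(3,4)]] transport(1)[OF \<sigma> short_sub[OF S o(3,4) rf(2)]] by auto
    have e: "transport n \<sigma> (r k s) (r (Suc k) s) \<otimes> transport n \<sigma> (r (Suc k) s) (r (Suc k) t) =
        transport n \<sigma> (r k s) (r k t) \<otimes> transport n \<sigma> (r k t) (r (Suc k) t)"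
      using transport_trans[OF \<sigma> S o(3,4)] transport_trans[OF \<sigma> S o(1,2)] by simp
    have pk: "\<Phi> k s \<in> carrier \<tau>" using \<Phi>cl[OF sc(1)] Suc.prems by simp
    have "\<Phi> (Suc k) s \<otimes> transport n \<sigma> (r (Suc k) s) (r (Suc k) t) =
        \<Phi> k s \<otimes> (transport n \<sigma> (r k s) (r (Suc k) s) \<otimes> transport n \<sigma> (r (Suc k) s) (r (Suc k) t))"
      using pk c by (simp add: \<Phi>S m_assoc)
    also have "\<dots> = (\<Phi> k s \<otimes> transport n \<sigma> (r k s) (r k t)) \<otimes> transport n \<sigma> (r k t) (r (Suc k) t)"
      unfolding e using pk c by (simp add: m_assoc)
    also have "\<dots> = \<Phi> (Suc k) t" using Suc by (simp add: \<Phi>S)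
    finally show ?case .
  qed
  have rN: "r N s = s" if "s \<in> icube n" for s
    using that N0 by (auto simp: r_def icube_iff extensional_def fun_eq_iff)
  have "lift n \<sigma> (\<Phi> N)"
  proof (rule lift_localI[OF \<sigma> \<Phi>cl[OF _ order_refl]])
    fix U \<psi> t assume pot: "potential U \<psi>" and t: "t \<in> icube n" "\<sigma> t \<in> U"
    let ?V = "{s \<in> icube n. \<sigma> s \<in> U}"
    have V: "openin (icube_top n) ?V" by (rule openin_preimage_cube[OF stream_map_dicubeD(1)[OF \<sigma>] potentialD(1)[OF pot]])
    have tV: "t \<in> ?V" using t by simp
    obtain B where B: "openin (icube_top n) B" "t \<in> B" "\<And>s s'. s \<in> B \<Longrightarrow> s' \<in> B \<Longrightarrow> icube_seg s s' n \<subseteq> ?V"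
      using icube_circ_nbhd[OF V tV] by (metis (no_types, lifting))
    \<comment> \<open>Radius \<open>\<delta> / 4\<close> around \<open>t\<close> keeps any two
      points of \<open>B'\<close> within \<open>\<delta> / 2\<close> of each other, as
      \<open>key\<close> requires.\<close>
    define B' where "B' = B \<inter> {q \<in> icube n. \<forall>i<n. \<bar>q i - t i\<bar> < \<delta> / 4}"
    show "\<exists>B. openin (icube_top n) B \<and> t \<in> B \<and> (\<forall>s\<in>B \<inter> icube n. \<forall>s'\<in>B \<inter> icube n. \<sigma> s \<in> U \<longrightarrow> \<sigma> s' \<in> U \<longrightarrow>
       (s, s') \<in> icube_order n \<longrightarrow> \<Phi> N s \<otimes> \<psi> (\<sigma> s) = \<Phi> N s' \<otimes> \<psi> (\<sigma> s'))"
    proof (intro exI[of _ B'] conjI ballI impI)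
      show "openin (icube_top n) B'" unfolding B'_def by (rule openin_Int[OF B(1) openin_icube_ball])
      show "t \<in> B'" using B(2) t \<delta>(1) by (simp add: B'_def)
      fix s s' assume s: "s \<in> B' \<inter> icube n" "s' \<in> B' \<inter> icube n" and u: "\<sigma> s \<in> U" "\<sigma> s' \<in> U" and o: "(s, s') \<in> icube_order n"
      have d: "s' i - s i < \<delta> / 2" if "i < n" for i
      proof -
        have "\<bar>s i - t i\<bar> < \<delta> / 4" "\<bar>s' i - t i\<bar> < \<delta> / 4" using s that by (auto simp: B'_def)
        then show ?thesis by linarith
      qed
      have S: "short n \<sigma> s s'"
        by (rule \<delta>(2)[OF o]) (use d \<delta>(1) in fastforce)
      have "icube_seg s s' n \<subseteq> ?V" using B(3) s by (simp add: B'_def)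
      then have w: "transport n \<sigma> s s' \<otimes> \<psi> (\<sigma> s') = \<psi> (\<sigma> s)" by (rule transport(2)[OF \<sigma> S pot])
      have k: "\<Phi> N s \<otimes> transport n \<sigma> s s' = \<Phi> N s'" using key[OF o d order_refl] rN s by simp
      show "\<Phi> N s \<otimes> \<psi> (\<sigma> s) = \<Phi> N s' \<otimes> \<psi> (\<sigma> s')"
        unfolding w[symmetric] k[symmetric]
        using \<Phi>cl[of s N] transport(1)[OF \<sigma> S] potentialD(2)[OF pot u(2)] s by (simp add: m_assoc)
    qed
  qed
  then show ?thesis by blast
qed

text \<open>\<open>THE\<close> denotes the increment of a lift between two vertices. It exists by
  \<open>lift_divides\<close>, is unique by cancellation, and by \<open>lift_unique\<close> does not
  depend on the lift picked by \<open>SOME\<close>; \<open>extension_eval\<close> therefore computes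
  it from any lift.\<close>

definition extension :: "nat \<Rightarrow> ((nat \<Rightarrow> real) \<Rightarrow> 'c real_pt set) \<Rightarrow>
    (nat \<Rightarrow> bool, (nat \<Rightarrow> bool) \<times> (nat \<Rightarrow> bool), unit, 'm) func" where
  "extension n = (\<lambda>\<sigma>\<in>cells (sing (realization C)) n. cube_fun n (\<lambda>v w. THE d. d \<in> carrier \<tau> \<and>
     (SOME \<Phi>. lift n \<sigma> \<Phi>) (vert n v) \<otimes> d = (SOME \<Phi>. lift n \<sigma> \<Phi>) (vert n w)))"

lemma extension_eval:
  assumes \<sigma>: "\<sigma> \<in> cells (sing (realization C)) n" and l: "lift n \<sigma> \<Phi>" and vw: "(v, w) \<in> Ar (cube_cat n)"
    and d: "d \<in> carrier \<tau>" "\<Phi> (vert n v) \<otimes> d = \<Phi> (vert n w)"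
  shows "snd (extension n \<sigma>) (v, w) = d"
proof -
  have s: "stream_map (dicube n) (realization C) \<sigma>" using \<sigma> by (simp add: cells_sing)
  define \<Phi>' where "\<Phi>' = (SOME \<Phi>. lift n \<sigma> \<Phi>)"
  have l': "lift n \<sigma> \<Phi>'" unfolding \<Phi>'_def by (rule someI[of "lift n \<sigma>", OF l])
  have k: "\<Phi> (vert n v) \<in> carrier \<tau>" "\<Phi> (vert n w) \<in> carrier \<tau>" "\<Phi>' (vert n v) \<in> carrier \<tau>" "\<Phi>' (vert n w) \<in> carrier \<tau>"
    using l l' by (auto simp: lift_def)
  have u: "\<Phi> (vert n v) \<otimes> \<Phi>' (vert n w) = \<Phi> (vert n w) \<otimes> \<Phi>' (vert n v)"
    by (rule lift_unique[OF s l l' vert_order[OF vw]])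
  have "\<Phi> (vert n v) \<otimes> (\<Phi>' (vert n v) \<otimes> d) = \<Phi> (vert n v) \<otimes> \<Phi>' (vert n w)"
    unfolding u d(2)[symmetric] using k d(1) by (simp add: m_ac)
  then have d': "\<Phi>' (vert n v) \<otimes> d = \<Phi>' (vert n w)" by (rule lcancel) (use k d in auto)
  have "(THE d. d \<in> carrier \<tau> \<and> \<Phi>' (vert n v) \<otimes> d = \<Phi>' (vert n w)) = d"
  proof (rule the_equality)
    fix e assume "e \<in> carrier \<tau> \<and> \<Phi>' (vert n v) \<otimes> e = \<Phi>' (vert n w)"
    then show "e = d" using lcancel[of "\<Phi>' (vert n v)" e d] d' d(1) k by simp
  qed (use d d' in simp)
  then show ?thesis using \<sigma> vw by (simp add: extension_def \<Phi>'_def)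
qed

lemma extension_lift:
  assumes \<sigma>: "\<sigma> \<in> cells (sing (realization C)) n" and l: "lift n \<sigma> \<Phi>" and vw: "(v, w) \<in> Ar (cube_cat n)"
  shows "snd (extension n \<sigma>) (v, w) \<in> carrier \<tau>" "\<Phi> (vert n v) \<otimes> snd (extension n \<sigma>) (v, w) = \<Phi> (vert n w)"
proof -
  have s: "stream_map (dicube n) (realization C) \<sigma>" using \<sigma> by (simp add: cells_sing)
  obtain d where d: "d \<in> carrier \<tau>" "\<Phi> (vert n v) \<otimes> d = \<Phi> (vert n w)"
    using lift_divides[OF s l vert_order[OF vw]] by blast
  then show "snd (extension n \<sigma>) (v, w) \<in> carrier \<tau>" "\<Phi> (vert n v) \<otimes> snd (extension n \<sigma>) (v, w) = \<Phi> (vert n w)"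
    using extension_eval[OF \<sigma> l vw d] by auto
qed

lemma extension_hom: "extension \<in> cub_hom (sing (realization C)) (ner \<tau>)"
proof (rule ner_homI[OF cubical_set_sing])
  show "extension n \<in> extensional (cells (sing (realization C)) n)" for n by (simp add: extension_def)
next
  fix n \<sigma> assume \<sigma>: "\<sigma> \<in> cells (sing (realization C)) n"
  obtain \<Phi> where l: "lift n \<sigma> \<Phi>" using lift_exists \<sigma> by (auto simp: cells_sing)
  note E = extension_lift[OF \<sigma> l]
  have k: "\<Phi> (vert n v) \<in> carrier \<tau>" for v using l by (auto simp: lift_def)
  have "cube_fun n (\<lambda>v w. snd (extension n \<sigma>) (v, w)) \<in> functors (cube_cat n) (monoid_cat \<tau>)"
  proof (rule cube_functorI)
    show "snd (extension n \<sigma>) (v, w) \<in> carrier \<tau>" if "(v, w) \<in> Ar (cube_cat n)" for v w by (rule E(1)[OF that])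
    show "snd (extension n \<sigma>) (v, v) = \<one>" if "v \<in> bcube n" for v
      by (rule extension_eval[OF \<sigma> l cube_arr_refl[OF that]]) (use k in auto)
    show "snd (extension n \<sigma>) (u, w) = snd (extension n \<sigma>) (u, v) \<otimes> snd (extension n \<sigma>) (v, w)"
      if "(u, v) \<in> Ar (cube_cat n)" "(v, w) \<in> Ar (cube_cat n)" for u v w
      by (rule extension_eval[OF \<sigma> l cube_arr_trans[OF that]])
        (use E(1)[OF that(1)] E(1)[OF that(2)] E(2)[OF that(1)] E(2)[OF that(2)] k in \<open>simp_all flip: m_assoc\<close>)
  qed
  moreover have "cube_fun n (\<lambda>v w. snd (extension n \<sigma>) (v, w)) = extension n \<sigma>"
    using \<sigma> by (auto simp: extension_def cube_fun_def fun_eq_iff)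
  ultimately show "extension n \<sigma> \<in> functors (cube_cat n) (monoid_cat \<tau>)" by simp
next
  fix m n \<psi> \<sigma> v w assume b: "box m n \<psi>" and \<sigma>: "\<sigma> \<in> cells (sing (realization C)) n" and vw: "(v, w) \<in> Ar (cube_cat m)"
  obtain \<Phi> where l: "lift n \<sigma> \<Phi>" using lift_exists \<sigma> by (auto simp: cells_sing)
  have "lift m (act (sing (realization C)) m n \<psi> \<sigma>) (\<lambda>t. \<Phi> (geom m n \<psi> t))"
    unfolding act_sing by (rule lift_compose[OF _ l geom_stream_map[OF b]]) (use \<sigma> in \<open>simp add: cells_sing\<close>)
  then show "snd (extension m (act (sing (realization C)) m n \<psi> \<sigma>)) (v, w) = snd (extension n \<sigma>) (\<psi> v, \<psi> w)"
    by (rule extension_eval[OF act_in[OF cubical_set_sing b \<sigma>] _ vw])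
      (use extension_lift[OF \<sigma> l box_mono[OF b vw]] geom_vert[OF b] cube_arr_ob[OF vw] in simp_all)
qed

text \<open>On a cube of \<open>C\<close> a lift is explicit: the cocycle measured from the least
  vertex to the vertex below the point. By functoriality its increments are the values of
  \<open>step\<close>.\<close>

lemma lift_cell:
  assumes c: "c \<in> cells C n"
  shows "lift n (\<lambda>t\<in>icube n. cell_pt C n c t) (\<lambda>t. snd (f n c) (\<lambda>j\<in>{..<n}. False, level 1 n t))"
proof (rule lift_localI)
  have z: "(\<lambda>j\<in>{..<n}. False, level 1 n t) \<in> Ar (cube_cat n)" for t
    by (auto simp: cube_arr_iff) (simp add: bcube_iff)
  show "stream_map (dicube n) (realization C) (\<lambda>t\<in>icube n. cell_pt C n c t)"
    by (rule stream_map_dicube_cong[OF stream_map_cell_pt[OF C c]]) simp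
  show "snd (f n c) (\<lambda>j\<in>{..<n}. False, level 1 n t) \<in> carrier \<tau>" for t by (rule fcl[OF c z])
  fix U \<psi> t assume pot: "potential U \<psi>" and t: "t \<in> icube n" "(\<lambda>t\<in>icube n. cell_pt C n c t) t \<in> U"
  obtain B where B: "openin (icube_top n) B" "t \<in> B" "\<And>s s'. s \<in> B \<inter> icube n \<Longrightarrow> s' \<in> B \<inter> icube n \<Longrightarrow>
          cell_pt C n c s \<in> U \<Longrightarrow> cell_pt C n c s' \<in> U \<Longrightarrow> (s, s') \<in> icube_order n \<Longrightarrow>
          step n c s s' \<otimes> \<psi> (cell_pt C n c s') = \<psi> (cell_pt C n c s)"
    using potentialD(3)[OF pot c t(1)] t by auto
  show "\<exists>B. openin (icube_top n) B \<and> t \<in> B \<and> (\<forall>s\<in>B \<inter> icube n. \<forall>s'\<in>B \<inter> icube n.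
     (\<lambda>t\<in>icube n. cell_pt C n c t) s \<in> U \<longrightarrow> (\<lambda>t\<in>icube n. cell_pt C n c t) s' \<in> U \<longrightarrow> (s, s') \<in> icube_order n \<longrightarrow>
     snd (f n c) (\<lambda>j\<in>{..<n}. False, level 1 n s) \<otimes> \<psi> ((\<lambda>t\<in>icube n. cell_pt C n c t) s) =
     snd (f n c) (\<lambda>j\<in>{..<n}. False, level 1 n s') \<otimes> \<psi> ((\<lambda>t\<in>icube n. cell_pt C n c t) s'))"
  proof (intro exI[of _ B] conjI B(1,2) ballI impI)
    fix s s' assume s: "s \<in> B \<inter> icube n" "s' \<in> B \<inter> icube n"
      and "(\<lambda>t\<in>icube n. cell_pt C n c t) s \<in> U" "(\<lambda>t\<in>icube n. cell_pt C n c t) s' \<in> U" and o: "(s, s') \<in> icube_order n"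
    then have u: "cell_pt C n c s \<in> U" "cell_pt C n c s' \<in> U" by auto
    have "snd (f n c) (\<lambda>j\<in>{..<n}. False, level 1 n s) \<otimes> \<psi> (cell_pt C n c s) =
        snd (f n c) (\<lambda>j\<in>{..<n}. False, level 1 n s) \<otimes> step n c s s' \<otimes> \<psi> (cell_pt C n c s')"
      unfolding B(3)[OF s u o, symmetric]
      using fcl[OF c z[of s]] step_closed[OF c o] potentialD(2)[OF pot u(2)] by (simp add: m_assoc)
    also have "\<dots> = snd (f n c) (\<lambda>j\<in>{..<n}. False, level 1 n s') \<otimes> \<psi> (cell_pt C n c s')"
      using ftrans[OF c z[of s] level_arr[OF o]] by (simp add: step_def)
    finally show "snd (f n c) (\<lambda>j\<in>{..<n}. False, level 1 n s) \<otimes> \<psi> ((\<lambda>t\<in>icube n. cell_pt C n c t) s) =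
     snd (f n c) (\<lambda>j\<in>{..<n}. False, level 1 n s') \<otimes> \<psi> ((\<lambda>t\<in>icube n. cell_pt C n c t) s')" using s by simp
  qed
qed

text \<open>The level \<open>1\<close> of a vertex of the cube is that vertex, so the increments of
  \<open>lift_cell\<close> between vertices are those of \<open>f\<close>.\<close>

lemma extension_unit: "cub_comp C extension (sing_unit C) = f"
proof (rule cub_hom_ner_eqI[OF cub_comp_hom[OF C sing_unit_hom[OF C] extension_hom] f])
  fix n c v w assume c: "c \<in> cells C n" and vw: "(v, w) \<in> Ar (cube_cat n)"
  have z: "(\<lambda>j\<in>{..<n}. False, v) \<in> Ar (cube_cat n)" using cube_arr_ob[OF vw] by (auto simp: cube_arr_iff bcube_iff)
  have "snd (extension n (sing_unit C n c)) (v, w) = snd (f n c) (v, w)"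
    by (rule extension_eval[OF cub_hom_in[OF sing_unit_hom[OF C] c] lift_cell[OF c, folded sing_unit_apply[OF c]] vw fcl[OF c vw]])
      (use ftrans[OF c z vw] level_vert[of 1] cube_arr_ob[OF vw] in simp)
  then show "snd (cub_comp C extension (sing_unit C) n c) (v, w) = snd (f n c) (v, w)" by (simp add: cub_comp_apply[OF c])
qed

text \<open>The lift of \<open>lift_cell\<close> restricts along the line to a lift of the path, and
  only its end points enter.\<close>

lemma extension_line:
  assumes c: "c \<in> cells C n" and pq: "(p, q) \<in> icube_order n"
  shows "snd (extension 1 (\<lambda>x\<in>icube 1. cell_pt C n c (line n p q (x 0)))) (b1 False, b1 True) = step n c p q"
proof -
  let ?\<sigma> = "\<lambda>t\<in>icube n. cell_pt C n c t"
  let ?l = "\<lambda>x. line n p q (x 0)"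
  have pqc: "p \<in> icube n" "q \<in> icube n" using pq by (auto simp: icube_order_def)
  have l: "?l x \<in> icube n" if "x \<in> icube 1" for x
    by (rule line_in[OF pqc]) (use that in \<open>auto simp: icube_iff\<close>)
  have e: "compose (icube 1) ?\<sigma> ?l = (\<lambda>x\<in>icube 1. cell_pt C n c (?l x))" using l by (intro ext) (auto simp: compose_def)
  have sm: "?\<sigma> \<in> cells (sing (realization C)) n" using cub_hom_in[OF sing_unit_hom[OF C] c] by (simp add: sing_unit_apply[OF c])
  have z: "(\<lambda>j\<in>{..<n}. False, level 1 n p) \<in> Ar (cube_cat n)"
    by (auto simp: cube_arr_iff) (simp add: bcube_iff)
  have ends: "?l (vert 1 (b1 False)) = p" "?l (vert 1 (b1 True)) = q"
    using pqc by (auto intro!: icube_eqI[of _ n] line_in simp: vert_def) (auto simp: line_def)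
  show ?thesis
  proof (rule extension_eval[where \<Phi> = "\<lambda>x. snd (f n c) (\<lambda>j\<in>{..<n}. False, level 1 n (?l x))", OF _ _ b1_arr step_closed[OF c pq]])
    show "(\<lambda>x\<in>icube 1. cell_pt C n c (?l x)) \<in> cells (sing (realization C)) 1"
      unfolding e[symmetric] by (rule sing_compose[OF line_stream_map[OF pq] sm])
    show "lift 1 (\<lambda>x\<in>icube 1. cell_pt C n c (?l x)) (\<lambda>x. snd (f n c) (\<lambda>j\<in>{..<n}. False, level 1 n (?l x)))"
      unfolding e[symmetric] by (rule lift_compose[OF _ lift_cell[OF c] line_stream_map[OF pq]]) (use sm in \<open>simp add: cells_sing\<close>)
    show "snd (f n c) (\<lambda>j\<in>{..<n}. False, level 1 n (?l (vert 1 (b1 False)))) \<otimes> step n c p q =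
        snd (f n c) (\<lambda>j\<in>{..<n}. False, level 1 n (?l (vert 1 (b1 True))))"
      unfolding ends using ftrans[OF c z level_arr[OF pq]] by (simp add: step_def)
  qed
qed

end

section \<open>Values of cocycles along paths\<close>

text \<open>Paths are given by functions of one real variable, so that lines and homotopies can be
  substituted without mentioning the coordinate of the 1-cube.\<close>

definition path1 :: "(real \<Rightarrow> 'x) \<Rightarrow> (nat \<Rightarrow> real) \<Rightarrow> 'x" where
  "path1 k = (\<lambda>x\<in>icube 1. k (x 0))"

lemma path1_cong: "(\<And>u. 0 \<le> u \<Longrightarrow> u \<le> 1 \<Longrightarrow> k u = l u) \<Longrightarrow> path1 k = path1 l"
  by (auto simp: path1_def icube_iff fun_eq_iff)

lemma path1_sing:
  assumes "stream_map (dicube n) X \<sigma>" "stream_map (dicube 1) (dicube n) (\<lambda>x. \<theta> (x 0))"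
  shows "path1 (\<lambda>u. \<sigma> (\<theta> u)) \<in> cells (sing X) 1"
  unfolding cells_sing path1_def
  using stream_map_dicube_cong[OF stream_map_compose[OF assms(2,1)]] by simp

lemma line_0: "p \<in> icube n \<Longrightarrow> line n p q 0 = p"
  by (rule extensionalityI[of _ "{..<n}"]) (auto simp: line_def icube_iff)

lemma line_1: "q \<in> icube n \<Longrightarrow> line n p q 1 = q"
  by (rule extensionalityI[of _ "{..<n}"]) (auto simp: line_def icube_iff)

lemma line_same: "p \<in> icube n \<Longrightarrow> line n p p u = p"
  by (rule extensionalityI[of _ "{..<n}"]) (auto simp: line_def icube_iff)

lemma icube_order_in: "(p, q) \<in> icube_order n \<Longrightarrow> p \<in> icube n" "(p, q) \<in> icube_order n \<Longrightarrow> q \<in> icube n"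
  by (auto simp: icube_order_def)

lemma icube_order_refl: "p \<in> icube n \<Longrightarrow> (p, p) \<in> icube_order n"
  by (simp add: icube_order_def)

lemma icube_order_trans: "(p, q) \<in> icube_order n \<Longrightarrow> (q, r) \<in> icube_order n \<Longrightarrow> (p, r) \<in> icube_order n"
  by (rule preorder_onD(3)[OF icube_order_preorder])

lemma line_mono:
  assumes pq: "(p, q) \<in> icube_order n" and q: "(q, q') \<in> icube_order n" and u: "0 \<le> u" "u \<le> u'" "u' \<le> 1"
  shows "(line n p q u, line n p q' u') \<in> icube_order n"
proof -
  have c: "p \<in> icube n" "q \<in> icube n" "q' \<in> icube n" using pq q by (auto simp: icube_order_def)
  have "p i + u * (q i - p i) \<le> p i + u' * (q' i - p i)" if "i < n" for i
    using pq q u that by (auto simp: icube_order_def intro!: mult_mono)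
  then show ?thesis using c u line_in[of p n q u] line_in[of p n q' u'] by (auto simp: icube_order_def line_def)
qed

lemma line_seg:
  assumes "(p, q) \<in> icube_order n" "0 \<le> u" "u \<le> 1"
  shows "line n p q u \<in> icube_seg p q n"
  using line_order[OF assms(1), of 0 u] line_order[OF assms(1), of u 1] assms icube_order_in[OF assms(1)]
  by (simp add: icube_seg_def line_0 line_1)

context canc_monoid
begin

definition val where
  "val \<beta> \<gamma> = snd (\<beta> (1 :: nat) \<gamma>) (b1 False, b1 True)"

definition along where
  "along \<beta> n \<sigma> p q = val \<beta> (path1 (\<lambda>u. \<sigma> (line n p q u)))"

lemma geom_coface:
  assumes "i \<le> n" shows "geom n (Suc n) (coface UNIV n i e) = coface {0..1} n i (of_bool e)"
  using box_real_unique[OF box_real_geom[OF box.coface[OF assms]] box_real.coface[OF assms]] .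

text \<open>Functoriality of \<open>\<beta>\<close> on a singular square, applied to the two ways
  from the least to the greatest vertex along its boundary.\<close>

lemma val_square:
  assumes \<beta>: "\<beta> \<in> cub_hom (sing X) (ner \<tau>)" and K: "stream_map (dicube 2) X (\<lambda>x. K (x 0) (x 1))"
  shows "val \<beta> (path1 (\<lambda>s. K s 0)) \<otimes> val \<beta> (path1 (K 1)) = val \<beta> (path1 (K 0)) \<otimes> val \<beta> (path1 (\<lambda>s. K s 1))"
proof -
  define \<kappa> where "\<kappa> = (\<lambda>x\<in>icube 2. K (x 0) (x 1))"
  have \<kappa>: "\<kappa> \<in> cells (sing X) 2"
    using stream_map_dicube_cong[OF K, of \<kappa>] by (simp add: \<kappa>_def cells_sing)
  have F: "\<beta> 2 \<kappa> \<in> functors (cube_cat 2) (monoid_cat \<tau>)" by (rule cub_hom_ner_in[OF \<beta> \<kappa>])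
  define v where "v = (\<lambda>d e. \<lambda>j\<in>{..<2::nat}. if j = 0 then d else e :: bool)"
  have b: "box 1 2 (coface UNIV 1 i e)" if "i \<le> 1" for i e
    using box.coface[OF that, of e] by (simp add: numeral_2_eq_2)
  have edge: "val \<beta> (act (sing X) 1 2 (coface UNIV 1 i e) \<kappa>) = snd (\<beta> 2 \<kappa>) (coface UNIV 1 i e (b1 False), coface UNIV 1 i e (b1 True))"
    if "i \<le> 1" for i e
    unfolding val_def by (rule cub_hom_ner_arr[OF \<beta> b[OF that] \<kappa> b1_arr])
  have cf: "coface UNIV 1 0 e (b1 d) = v e d" "coface UNIV 1 1 e (b1 d) = v d e" for d e
    using b1_in[of d] by (auto simp: coface_def v_def fun_eq_iff numeral_2_eq_2 less_Suc_eq)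
  have gin: "geom 1 2 (coface UNIV 1 i e) x \<in> icube 2" if "i \<le> 1" "x \<in> icube 1" for i e x
    by (rule geom_in[OF b[OF that(1)] that(2)])
  have ge: "geom 1 2 (coface UNIV 1 i e) x j = (if j < i then x j else if j = i then of_bool e else x (j - 1))"
    if "i \<le> 1" "x \<in> icube 1" "j < 2" for i e x j
    using geom_coface[OF that(1), of e] that by (simp add: numeral_2_eq_2 coface_def)
  have act: "act (sing X) 1 2 (coface UNIV 1 0 e) \<kappa> = path1 (K (of_bool e))"
    "act (sing X) 1 2 (coface UNIV 1 1 e) \<kappa> = path1 (\<lambda>s. K s (of_bool e))" for e
  proof -
    show "act (sing X) 1 2 (coface UNIV 1 0 e) \<kappa> = path1 (K (of_bool e))"
      unfolding act_sing path1_def compose_def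
      by (rule restrict_ext) (simp add: \<kappa>_def gin[of 0, simplified] ge[of 0, simplified])
    show "act (sing X) 1 2 (coface UNIV 1 1 e) \<kappa> = path1 (\<lambda>s. K s (of_bool e))"
      unfolding act_sing path1_def compose_def
      by (rule restrict_ext) (simp add: \<kappa>_def gin[of 1, simplified] ge[of 1, simplified])
  qed
  have ar: "(v d e, v d' e') \<in> Ar (cube_cat 2)" if "d \<le> d'" "e \<le> e'" for d e d' e'
    using that by (auto simp: cube_arr_iff v_def bcube_iff)
  have "snd (\<beta> 2 \<kappa>) (v False False, v True False) \<otimes> snd (\<beta> 2 \<kappa>) (v True False, v True True) =
      snd (\<beta> 2 \<kappa>) (v False False, v False True) \<otimes> snd (\<beta> 2 \<kappa>) (v False True, v True True)"
    using functor_trans[OF F ar ar, of False True False False True True] functor_trans[OF F ar ar, of False False False True True True]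
    by simp
  then show ?thesis
    using edge[of 0 False] edge[of 0 True] edge[of 1 False] edge[of 1 True] unfolding act cf by simp
qed

lemma val_closed: "\<beta> \<in> cub_hom (sing X) (ner \<tau>) \<Longrightarrow> \<gamma> \<in> cells (sing X) 1 \<Longrightarrow> val \<beta> \<gamma> \<in> carrier \<tau>"
  unfolding val_def by (rule ner_closed[of \<beta> "sing X" \<gamma> 1, OF _ _ b1_arr])

lemma along_sing:
  "stream_map (dicube n) X \<sigma> \<Longrightarrow> (p, q) \<in> icube_order n \<Longrightarrow> path1 (\<lambda>u. \<sigma> (line n p q u)) \<in> cells (sing X) 1"
  by (rule path1_sing[OF _ line_stream_map])

lemma along_closed:
  "\<beta> \<in> cub_hom (sing X) (ner \<tau>) \<Longrightarrow> stream_map (dicube n) X \<sigma> \<Longrightarrow> (p, q) \<in> icube_order n \<Longrightarrow> along \<beta> n \<sigma> p q \<in> carrier \<tau>"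
  unfolding along_def by (rule val_closed[OF _ along_sing])

lemma along_cong:
  assumes "(p, q) \<in> icube_order n" "\<And>t. t \<in> icube n \<Longrightarrow> \<sigma> t = \<sigma>' t"
  shows "along \<beta> n \<sigma> p q = along \<beta> n \<sigma>' p q"
proof -
  have "path1 (\<lambda>u. \<sigma> (line n p q u)) = path1 (\<lambda>u. \<sigma>' (line n p q u))"
    by (rule path1_cong) (use assms line_in icube_order_in[OF assms(1)] in auto)
  then show ?thesis by (simp add: along_def)
qed

text \<open>A constant path is the degeneracy of a 0-cube, so it is sent to the value at an identity
  arrow.\<close>

lemma val_const:
  assumes \<beta>: "\<beta> \<in> cub_hom (sing X) (ner \<tau>)" and \<sigma>: "stream_map (dicube n) X \<sigma>" and p: "p \<in> icube n"
  shows "val \<beta> (path1 (\<lambda>_. \<sigma> p)) = \<one>"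
proof -
  have "stream_map (dicube 0) (dicube n) (\<lambda>_. p)"
    by (rule stream_map_monotone) (use p in \<open>auto simp: continuous_map_const icube_order_refl\<close>)
  from stream_map_compose[OF this \<sigma>] have "stream_map (dicube 0) X (\<lambda>_. \<sigma> p)" .
  then have c: "(\<lambda>_\<in>icube 0. \<sigma> p) \<in> cells (sing X) 0"
    using stream_map_dicube_cong[of 0 X "\<lambda>_. \<sigma> p" "\<lambda>_\<in>icube 0. \<sigma> p"] by (simp add: cells_sing)
  let ?s = "codegen UNIV 0 0 :: boxmap"
  have b: "box 1 0 ?s" using box.codegen[of 0 0] by simp
  have "act (sing X) 1 0 ?s (\<lambda>_\<in>icube 0. \<sigma> p) = path1 (\<lambda>_. \<sigma> p)"
    unfolding act_sing path1_def compose_def by (rule restrict_ext) (simp add: geom_in[OF b, simplified])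
  then have "val \<beta> (path1 (\<lambda>_. \<sigma> p)) = snd (\<beta> 0 (\<lambda>_\<in>icube 0. \<sigma> p)) (?s (b1 False), ?s (b1 True))"
    unfolding val_def using cub_hom_ner_arr[OF \<beta> b c b1_arr] by simp
  moreover have "?s (b1 False) = ?s (b1 True)"
    by (rule bcube_eqI[OF box_in[OF b b1_in] box_in[OF b b1_in]]) simp
  ultimately show ?thesis using functor_refl[OF cub_hom_ner_in[OF \<beta> c] box_in[OF b b1_in]] by simp
qed

lemma along_refl:
  "\<beta> \<in> cub_hom (sing X) (ner \<tau>) \<Longrightarrow> stream_map (dicube n) X \<sigma> \<Longrightarrow> p \<in> icube n \<Longrightarrow> along \<beta> n \<sigma> p p = \<one>"
  by (simp add: along_def line_same val_const)

text \<open>The square \<open>\<theta>\<close> runs at time \<open>s\<close> from \<open>p\<close>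
  towards the point at time \<open>t\<close> on the segment from \<open>q\<close> to
  \<open>r\<close>. Its side at \<open>s = 0\<close> is constant and the other three are the
  segments in question, so it is a degenerate triangle.\<close>

lemma along_trans:
  assumes \<beta>: "\<beta> \<in> cub_hom (sing X) (ner \<tau>)" and \<sigma>: "stream_map (dicube n) X \<sigma>"
    and pq: "(p, q) \<in> icube_order n" and qr: "(q, r) \<in> icube_order n"
  shows "along \<beta> n \<sigma> p r = along \<beta> n \<sigma> p q \<otimes> along \<beta> n \<sigma> q r"
proof -
  define \<theta> where "\<theta> = (\<lambda>s t. line n p (line n q r t) s)"
  have c: "p \<in> icube n" "q \<in> icube n" "r \<in> icube n" using pq qr by (auto simp: icube_order_def)
  have q_le: "(q, line n q r t) \<in> icube_order n" if "0 \<le> t" "t \<le> 1" for t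
    using line_order[OF qr, of 0 t] that c by (simp add: line_0)
  have "stream_map (dicube 2) (dicube n) (\<lambda>x. \<theta> (x 0) (x 1))"
  proof (rule stream_map_monotone)
    show "continuous_map (icube_top 2) (icube_top n) (\<lambda>x. \<theta> (x 0) (x 1))"
      unfolding continuous_map_into_icube
    proof (intro conjI allI impI)
      have "\<theta> (x 0) (x 1) \<in> icube n" if "x \<in> icube 2" for x
        unfolding \<theta>_def using that c by (intro line_in) (auto simp: icube_iff[of _ 2])
      then show "(\<lambda>x. \<theta> (x 0) (x 1)) ` topspace (icube_top 2) \<subseteq> icube n" by auto
      show "continuous_map (icube_top 2) euclideanreal (\<lambda>x. \<theta> (x 0) (x 1) i)" if "i < n" for i
        using that by (simp add: \<theta>_def line_def) (intro continuous_intros continuous_map_icube_proj; simp)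
    qed
    fix x y assume xy: "(x, y) \<in> icube_order 2"
    then have h: "0 \<le> x 0" "x 0 \<le> y 0" "y 0 \<le> 1" "0 \<le> x 1" "x 1 \<le> y 1" "y 1 \<le> 1"
      by (auto simp: icube_order_def icube_iff)
    show "(\<theta> (x 0) (x 1), \<theta> (y 0) (y 1)) \<in> icube_order n"
      unfolding \<theta>_def using h
      by (intro line_mono icube_order_trans[OF pq q_le] line_order[OF qr]) auto
  qed
  from val_square[OF \<beta> stream_map_compose[OF this \<sigma>]]
  have "val \<beta> (path1 (\<lambda>s. \<sigma> (\<theta> s 0))) \<otimes> val \<beta> (path1 (\<lambda>t. \<sigma> (\<theta> 1 t))) = val \<beta> (path1 (\<lambda>t. \<sigma> (\<theta> 0 t))) \<otimes> val \<beta> (path1 (\<lambda>s. \<sigma> (\<theta> s 1)))"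
    by simp
  moreover have "path1 (\<lambda>t. \<sigma> (\<theta> 1 t)) = path1 (\<lambda>t. \<sigma> (line n q r t))"
    by (rule path1_cong) (use c line_in in \<open>simp add: \<theta>_def line_1\<close>)
  ultimately show ?thesis
    using val_const[OF \<beta> \<sigma> c(1)] along_closed[OF \<beta> \<sigma> icube_order_trans[OF pq qr]] c
    by (simp add: \<theta>_def line_0 line_1 along_def)
qed

text \<open>An arrow changing the single coordinate \<open>k\<close> is the image of the edge of
  \<open>[1]\<close> under a morphism of \<open>\<box>\<close> with constants in all other
  coordinates; its geometric realization is the straight line between the two vertices.\<close>

lemma val_edge:
  assumes \<beta>: "\<beta> \<in> cub_hom (sing X) (ner \<tau>)" and \<sigma>: "\<sigma> \<in> cells (sing X) n"
    and uw: "u \<in> bcube n" "w \<in> bcube n" "k < n" "\<not> u k" "w k" "\<And>j. j < n \<Longrightarrow> j \<noteq> k \<Longrightarrow> w j = u j"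
  shows "snd (\<beta> n \<sigma>) (u, w) = along \<beta> n \<sigma> (vert n u) (vert n w)"
proof -
  define s where "s = (\<lambda>j. if j = k then Inr 0 else Inl (u j) :: bool + nat)"
  have lin: "linear_template 1 n s" by (auto simp: linear_template_def box_template_def s_def)
  let ?\<psi> = "template_map UNIV id 1 n s"
  have b: "box 1 n ?\<psi>" by (rule linear_template_box[OF lin])
  have g: "geom 1 n ?\<psi> = template_map {0..1} of_bool 1 n s" by (rule geom_template[OF lin])
  have "?\<psi> (b1 False) = u"
    by (rule bcube_eqI[OF box_in[OF b b1_in] uw(1)]) (use uw in \<open>simp add: template_map_def s_def bcube_iff\<close>)
  moreover have "?\<psi> (b1 True) = w"
    by (rule bcube_eqI[OF box_in[OF b b1_in] uw(2)]) (use uw in \<open>simp add: template_map_def s_def bcube_iff\<close>)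
  moreover have "geom 1 n ?\<psi> x = line n (vert n u) (vert n w) (x 0)" if x: "x \<in> icube 1" for x
    unfolding g using x uw by (auto simp: template_map_def s_def line_def vert_def restrict_def fun_eq_iff)
  then have "act (sing X) 1 n ?\<psi> \<sigma> = path1 (\<lambda>t. \<sigma> (line n (vert n u) (vert n w) t))"
    unfolding act_sing path1_def compose_def by (intro restrict_ext) simp
  ultimately show ?thesis
    using cub_hom_ner_arr[OF \<beta> b \<sigma> b1_arr] by (simp add: along_def val_def)
qed

text \<open>Without diagonals in \<open>\<box>\<close>, only arrows that change one coordinate come
  from edges. A general arrow is factored through the vertices \<open>u k\<close>, in which the
  first \<open>k\<close> coordinates have been switched, and \<open>along_trans\<close> recombines
  the broken line into the straight one.\<close>

lemma val_vert:
  assumes \<beta>: "\<beta> \<in> cub_hom (sing X) (ner \<tau>)" and \<sigma>: "\<sigma> \<in> cells (sing X) n" and vw: "(v, w) \<in> Ar (cube_cat n)"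
  shows "snd (\<beta> n \<sigma>) (v, w) = along \<beta> n \<sigma> (vert n v) (vert n w)"
proof -
  have sm: "stream_map (dicube n) X \<sigma>" using \<sigma> by (simp add: cells_sing)
  have F: "\<beta> n \<sigma> \<in> functors (cube_cat n) (monoid_cat \<tau>)" by (rule cub_hom_ner_in[OF \<beta> \<sigma>])
  note ob = cube_arr_ob[OF vw]
  define u where "u = (\<lambda>k. \<lambda>j\<in>{..<n}. if j < k then w j else v j)"
  have ub: "u k \<in> bcube n" for k by (simp add: u_def bcube_iff)
  have ar: "(u k, u l) \<in> Ar (cube_cat n)" if "k \<le> l" for k l
    using vw that ub by (auto simp: cube_arr_iff) (auto simp: u_def split: if_splits)
  have "snd (\<beta> n \<sigma>) (u 0, u k) = along \<beta> n \<sigma> (vert n (u 0)) (vert n (u k))" if "k \<le> n" for k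
    using that
  proof (induction k)
    case 0
    show ?case using functor_refl[OF F ub] along_refl[OF \<beta> sm vert_in] by simp
  next
    case (Suc k)
    have "snd (\<beta> n \<sigma>) (u k, u (Suc k)) = along \<beta> n \<sigma> (vert n (u k)) (vert n (u (Suc k)))"
    proof (cases "v k = w k")
      case True
      have "u (Suc k) = u k" using True by (auto simp: u_def fun_eq_iff less_Suc_eq)
      then show ?thesis using functor_refl[OF F ub] along_refl[OF \<beta> sm vert_in] by simp
    next
      case False
      then have "\<not> v k" "w k" using vw Suc.prems by (auto simp: cube_arr_iff)
      then show ?thesis using Suc.prems by (intro val_edge[OF \<beta> \<sigma> ub ub, of k]) (auto simp: u_def)
    qed
    then show ?case
      using functor_trans[OF F ar[of 0 k] ar[of k "Suc k"]] Suc
        along_trans[OF \<beta> sm vert_order[OF ar[of 0 k]] vert_order[OF ar[of k "Suc k"]]] by simp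
  qed
  moreover have "u 0 = v" "u n = w" using ob by (auto simp: u_def bcube_iff extensional_def fun_eq_iff)
  ultimately show ?thesis by (metis order_refl)
qed

end

section \<open>Natural homotopies of the realization\<close>

lemma stream_map_dicube_in: "stream_map (dicube n) X \<sigma> \<Longrightarrow> t \<in> icube n \<Longrightarrow> \<sigma> t \<in> topspace (top_of X)"
  using stream_map_dicubeD(1)[of n X \<sigma>] by (auto simp: continuous_map_def)

definition interp :: "(real \<Rightarrow> real) \<Rightarrow> (real \<Rightarrow> real) \<Rightarrow> real \<Rightarrow> real \<Rightarrow> real" where
  "interp \<phi> \<phi>' s = (\<lambda>x. \<phi> x + s * (\<phi>' x - \<phi> x))"

text \<open>Natural functions form a convex set, so every stage of an affine homotopy between two of
  them acts on the realization again.\<close>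

lemma natural_interp:
  assumes \<phi>: "natural \<phi>" and \<phi>': "natural \<phi>'" and s: "0 \<le> s" "s \<le> 1"
  shows "natural (interp \<phi> \<phi>' s)"
proof -
  have "continuous_on {0..1} (interp \<phi> \<phi>' s)"
    using \<phi> \<phi>' unfolding natural_def interp_def by (intro continuous_intros) auto
  moreover have "interp \<phi> \<phi>' s x \<le> interp \<phi> \<phi>' s y" if "x \<in> {0..1}" "y \<in> {0..1}" "x \<le> y" for x y
  proof -
    have "\<phi> x \<le> \<phi> y" "\<phi>' x \<le> \<phi>' y" using \<phi> \<phi>' that unfolding natural_def by (blast dest: mono_onD)+
    then have "(1 - s) * \<phi> x + s * \<phi>' x \<le> (1 - s) * \<phi> y + s * \<phi>' y"
      using s by (intro add_mono mult_left_mono) auto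
    then show ?thesis by (simp add: interp_def algebra_simps)
  qed
  ultimately show ?thesis using \<phi> \<phi>' by (auto simp: natural_def interp_def intro: mono_onI)
qed

lemma coord_interp: "coord (interp \<phi> \<phi>' s) n t = line n (coord \<phi> n t) (coord \<phi>' n t) s"
  by (auto simp: coord_def interp_def line_def fun_eq_iff)

lemma natural_le_order:
  assumes "natural \<phi>" "natural \<phi>'" "\<And>x. 0 \<le> x \<Longrightarrow> x \<le> 1 \<Longrightarrow> \<phi> x \<le> \<phi>' x" "t \<in> icube n"
  shows "(coord \<phi> n t, coord \<phi>' n t) \<in> icube_order n"
  using assms natural_coord_in[OF assms(1,4)] natural_coord_in[OF assms(2,4)]
  by (auto simp: icube_order_def coord_def icube_iff[of t])

lemma natural_max: assumes "natural \<phi>" "natural \<phi>'" shows "natural (\<lambda>x. max (\<phi> x) (\<phi>' x))"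
proof -
  have "continuous_on {0..1} (\<lambda>x. max (\<phi> x) (\<phi>' x))"
    using assms unfolding natural_def by (intro continuous_intros) auto
  moreover have "max (\<phi> x) (\<phi>' x) \<le> max (\<phi> y) (\<phi>' y)" if "x \<in> {0..1}" "y \<in> {0..1}" "x \<le> y" for x y
    using assms that unfolding natural_def by (intro max.mono) (blast dest: mono_onD)+
  ultimately show ?thesis using assms by (auto simp: natural_def intro: mono_onI)
qed

definition homotopy_map :: "'c cubical \<Rightarrow> (real \<Rightarrow> real) \<Rightarrow> (real \<Rightarrow> real) \<Rightarrow> 'c real_pt set \<Rightarrow> real \<Rightarrow> 'c real_pt set" where
  "homotopy_map C \<phi> \<phi>' P s = natural_map C (interp \<phi> \<phi>' s) P"

context
  fixes C :: "'c cubical" and \<phi> \<phi>' :: "real \<Rightarrow> real"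
  assumes C: "cubical_set C" and \<phi>: "natural \<phi>" and \<phi>': "natural \<phi>'"
    and le: "\<And>x. 0 \<le> x \<Longrightarrow> x \<le> 1 \<Longrightarrow> \<phi> x \<le> \<phi>' x"
begin

lemma homotopy_map_cell:
  assumes "c \<in> cells C n" "t \<in> icube n" "0 \<le> s" "s \<le> 1"
  shows "homotopy_map C \<phi> \<phi>' (cell_pt C n c t) s = cell_pt C n c (line n (coord \<phi> n t) (coord \<phi>' n t) s)"
  unfolding homotopy_map_def natural_map_cell_pt[OF C natural_interp[OF \<phi> \<phi>' assms(3,4)] assms(1,2)] coord_interp ..

text \<open>The track of a point is a straight path in any cell containing it, directed because
  \<open>\<phi>\<close> lies below \<open>\<phi>'\<close>.\<close>

lemma homotopy_track:
  assumes P: "P \<in> topspace (rtop C)"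
  shows "stream_map (dicube 1) (realization C) (\<lambda>x. homotopy_map C \<phi> \<phi>' P (x 0))"
proof -
  obtain n c t where c: "c \<in> cells C n" "t \<in> icube n" "P = cell_pt C n c t" using cell_pt_cases[OF C P] by blast
  have "(coord \<phi> n t, coord \<phi>' n t) \<in> icube_order n" by (rule natural_le_order[OF \<phi> \<phi>' le c(2)])
  from stream_map_compose[OF line_stream_map[OF this] stream_map_cell_pt[OF C c(1)]]
  show ?thesis
    by (rule stream_map_dicube_cong) (simp add: c(3) homotopy_map_cell[OF c(1,2)] icube_iff)
qed

text \<open>Continuity in the point and the time jointly is not immediate from a quotient topology
  on points. The set \<open>U\<close> of points that stay in \<open>W\<close> during a compact
  interval of times is shown open cell by cell, with the tube lemma over that interval.\<close>

lemma homotopy_joint_nbhd: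
  assumes W: "openin (rtop C) W" and P: "P \<in> topspace (rtop C)" and s: "0 \<le> s" "s \<le> 1"
    and PW: "homotopy_map C \<phi> \<phi>' P s \<in> W"
  obtains U e where "openin (rtop C) U" "P \<in> U" "0 < e"
    "\<And>Q r. Q \<in> U \<Longrightarrow> 0 \<le> r \<Longrightarrow> r \<le> 1 \<Longrightarrow> \<bar>r - s\<bar> < e \<Longrightarrow> homotopy_map C \<phi> \<phi>' Q r \<in> W"
proof -
  let ?x = "\<lambda>i\<in>{..<1::nat}. s"
  have x: "?x \<in> icube 1" using s by (simp add: icube_iff)
  have op: "openin (icube_top 1) {x \<in> icube 1. homotopy_map C \<phi> \<phi>' P (x 0) \<in> W}"
    by (rule openin_preimage_cube[OF stream_map_dicubeD(1)[OF homotopy_track[OF P]] W])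
  have "?x \<in> {x \<in> icube 1. homotopy_map C \<phi> \<phi>' P (x 0) \<in> W}" using PW x by simp
  then obtain e where e: "0 < e" "\<And>q. q \<in> icube 1 \<Longrightarrow> (\<And>i. i < 1 \<Longrightarrow> \<bar>q i - ?x i\<bar> < e) \<Longrightarrow>
      q \<in> {x \<in> icube 1. homotopy_map C \<phi> \<phi>' P (x 0) \<in> W}"
    using icube_box_nbhd[OF op] by blast
  \<comment> \<open>Halving the radius turns the interval of admissible times into a compact
    one.\<close>
  define J where "J = {0..1} \<inter> {s - e / 2..s + e / 2}"
  have J: "compact J" "J \<subseteq> {0..1}" unfolding J_def by (auto intro: compact_Int)
  have JW: "homotopy_map C \<phi> \<phi>' P r \<in> W" if "r \<in> J" for r
    using e(2)[of "\<lambda>i\<in>{..<1}. r"] that e(1) by (auto simp: J_def icube_iff)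
  define U where "U = {Q \<in> topspace (rtop C). \<forall>r\<in>J. homotopy_map C \<phi> \<phi>' Q r \<in> W}"
  have "openin (rtop C) U"
    unfolding openin_realization[OF C]
  proof (intro conjI allI ballI)
    fix n c assume c: "c \<in> cells C n"
    define G where "G = (\<lambda>(t, r). line n (coord \<phi> n t) (coord \<phi>' n t) r)"
    let ?Y = "prod_topology (icube_top n) (top_of_set J)"
    have cc: "continuous_map (icube_top n) euclideanreal (\<lambda>t. coord \<psi> n t i)" if "natural \<psi>" "i < n" for \<psi> i
      using stream_map_dicubeD(1)[OF natural_coord_stream_map[OF that(1), of n]] that(2)
      by (simp add: dicube_def continuous_map_into_icube)
    have cG: "continuous_map ?Y (icube_top n) G"
      unfolding continuous_map_into_icube
    proof (intro conjI allI impI)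
      show "G ` topspace ?Y \<subseteq> icube n"
        using natural_coord_in[OF \<phi>] natural_coord_in[OF \<phi>'] J(2) by (force simp: G_def intro!: line_in)
      fix i assume i: "i < n"
      have f: "continuous_map ?Y euclideanreal (\<lambda>z. coord \<psi> n (fst z) i)" if "natural \<psi>" for \<psi>
        using continuous_map_compose[OF continuous_map_fst cc[OF that i]] by (simp add: o_def)
      have r: "continuous_map ?Y euclideanreal snd"
        using continuous_map_snd continuous_map_in_subtopology by blast
      have "continuous_map ?Y euclideanreal (\<lambda>z. coord \<phi> n (fst z) i + snd z * (coord \<phi>' n (fst z) i - coord \<phi> n (fst z) i))"
        by (intro continuous_intros f \<phi> \<phi>' r)
      then show "continuous_map ?Y euclideanreal (\<lambda>z. G z i)"
        by (rule continuous_map_eq) (use i in \<open>auto simp: G_def line_def\<close>)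
    qed
    let ?V = "{z \<in> topspace ?Y. G z \<in> {t \<in> icube n. cell_pt C n c t \<in> W}}"
    have V: "openin ?Y ?V" by (rule openin_continuous_map_preimage[OF cG openin_slice[OF C W c]])
    have GH: "cell_pt C n c (G (t, r)) = homotopy_map C \<phi> \<phi>' (cell_pt C n c t) r" if "t \<in> icube n" "r \<in> J" for t r
      using homotopy_map_cell[OF c that(1), of r] J(2) that(2) by (auto simp: G_def)
    have Gin: "G (t, r) \<in> icube n" if "t \<in> icube n" "r \<in> J" for t r
      using natural_coord_in[OF \<phi> that(1)] natural_coord_in[OF \<phi>' that(1)] J(2) that(2) by (auto simp: G_def intro!: line_in)
    have "\<exists>B. openin (icube_top n) B \<and> t \<in> B \<and> B \<subseteq> {t \<in> icube n. cell_pt C n c t \<in> U}"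
      if t: "t \<in> {t \<in> icube n. cell_pt C n c t \<in> U}" for t
    proof -
      have tc: "t \<in> icube n" using t by simp
      have "{t} \<times> J \<subseteq> ?V" using t GH Gin by (auto simp: U_def)
      moreover have "compactin (top_of_set J) J" using J(1) by (simp add: compactin_subtopology)
      ultimately obtain B B' where B: "openin (icube_top n) B" "t \<in> B" "J \<subseteq> B'" "B \<times> B' \<subseteq> ?V"
        using tube_lemma_right[OF V, of J t] tc by auto
      have "cell_pt C n c q \<in> U" if q: "q \<in> B" for q
      proof -
        have qc: "q \<in> icube n" using openin_subset[OF B(1)] q by auto
        have "homotopy_map C \<phi> \<phi>' (cell_pt C n c q) r \<in> W" if "r \<in> J" for r
        proof -
          have "(q, r) \<in> ?V" using B(3,4) q that by blast
          then show ?thesis using GH[OF qc that] by simp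
        qed
        then show ?thesis using cell_pt_in[OF C c qc] by (simp add: U_def)
      qed
      then show ?thesis using B(1,2) openin_subset[OF B(1)] by auto
    qed
    then show "openin (icube_top n) {t \<in> icube n. cell_pt C n c t \<in> U}"
      by (subst openin_subopen) blast
  qed (auto simp: U_def)
  moreover have "P \<in> U" using P JW by (simp add: U_def)
  moreover have "homotopy_map C \<phi> \<phi>' Q r \<in> W" if "Q \<in> U" "0 \<le> r" "r \<le> 1" "\<bar>r - s\<bar> < e / 2" for Q r
  proof -
    have "r \<in> J" using that unfolding J_def abs_less_iff by auto
    then show ?thesis using that(1) by (simp add: U_def)
  qed
  ultimately show thesis using that[of U "e / 2"] e(1) by simp
qed

text \<open>An ordered move in a small part of the square is split in two: first time advances at
  the fixed point \<open>\<gamma> (y 0)\<close>, then the point advances along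
  \<open>\<gamma>\<close> at the fixed time \<open>y' 1\<close>. The neighbourhoods from
  \<open>nb\<close> keep both moves inside \<open>W\<close>.\<close>

lemma homotopy_square:
  assumes \<gamma>: "stream_map (dicube 1) (realization C) (\<lambda>x. \<gamma> (x 0))"
  shows "stream_map (dicube 2) (realization C) (\<lambda>x. homotopy_map C \<phi> \<phi>' (\<gamma> (x 0)) (x 1))"
proof -
  let ?H = "homotopy_map C \<phi> \<phi>'"
  define pr where "pr = (\<lambda>x :: nat \<Rightarrow> real. \<lambda>i\<in>{..<1::nat}. x 0)"
  have pr: "pr x \<in> icube 1" "pr x 0 = x 0" if "x \<in> icube 2" for x
    using that by (auto simp: pr_def icube_iff)
  have prc: "continuous_map (icube_top 2) (icube_top 1) pr"
    unfolding continuous_map_into_icube using pr continuous_map_icube_proj[of 0 2] by (auto simp: pr_def)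
  have \<gamma>P: "\<gamma> (x 0) \<in> topspace (rtop C)" if "x \<in> icube 2" for x
    using stream_map_dicube_in[OF \<gamma> pr(1)[OF that]] pr(2)[OF that] by simp
  have nb: "\<exists>U e B. openin (rtop C) U \<and> 0 < e \<and> openin (icube_top 2) B \<and> x \<in> B \<and>
      (\<forall>Q r. Q \<in> U \<longrightarrow> 0 \<le> r \<longrightarrow> r \<le> 1 \<longrightarrow> \<bar>r - x 1\<bar> < e \<longrightarrow> ?H Q r \<in> W) \<and>
      (\<forall>y\<in>B. y \<in> icube 2 \<and> \<gamma> (y 0) \<in> U \<and> \<bar>y 1 - x 1\<bar> < e) \<and>
      (\<forall>y\<in>B. \<forall>y'\<in>B. icube_seg (pr y) (pr y') 1 \<subseteq> {z \<in> icube 1. \<gamma> (z 0) \<in> U})"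
    if W: "openin (rtop C) W" and x: "x \<in> icube 2" and xW: "?H (\<gamma> (x 0)) (x 1) \<in> W" for W x
  proof -
    have x1: "0 \<le> x 1" "x 1 \<le> 1" using x by (auto simp: icube_iff)
    show ?thesis
    proof (rule homotopy_joint_nbhd[OF W \<gamma>P[OF x] x1 xW])
      fix U e assume U: "openin (rtop C) U" "\<gamma> (x 0) \<in> U" and e: "0 < e"
        and H: "\<And>Q r. Q \<in> U \<Longrightarrow> 0 \<le> r \<Longrightarrow> r \<le> 1 \<Longrightarrow> \<bar>r - x 1\<bar> < e \<Longrightarrow> ?H Q r \<in> W"
      let ?V = "{z \<in> icube 1. \<gamma> (z 0) \<in> U}"
      have V: "openin (icube_top 1) ?V" by (rule openin_preimage_cube[OF stream_map_dicubeD(1)[OF \<gamma>] U(1)])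
      have xV: "pr x \<in> ?V" using pr[OF x] U(2) by simp
      show ?thesis
      proof (rule icube_circ_nbhd[OF V xV])
        fix B1 assume B1: "openin (icube_top 1) B1" "pr x \<in> B1" "B1 \<subseteq> ?V"
          and seg: "\<And>s s'. s \<in> B1 \<Longrightarrow> s' \<in> B1 \<Longrightarrow> icube_seg s s' 1 \<subseteq> ?V"
        define A where "A = (\<lambda>j :: nat. if j = 1 then {x 1 - e<..<x 1 + e} else UNIV)"
        define B where "B = {y \<in> icube 2. pr y \<in> B1} \<inter> {y \<in> icube 2. \<forall>j<2. y j \<in> A j}"
        have "openin (icube_top 2) B"
          unfolding B_def by (intro openin_Int openin_preimage_cube[OF prc B1(1)] openin_icube_coords) (simp add: A_def)
        moreover have "x \<in> B" using x B1(2) e by (simp add: B_def A_def)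
        moreover have "y \<in> icube 2 \<and> \<gamma> (y 0) \<in> U \<and> \<bar>y 1 - x 1\<bar> < e" if "y \<in> B" for y
        proof -
          have "y \<in> icube 2" "pr y \<in> B1" "y 1 \<in> A 1" using that by (auto simp: B_def)
          then show ?thesis using B1(3) pr(2)[of y] by (auto simp: A_def abs_less_iff)
        qed
        moreover have "icube_seg (pr y) (pr y') 1 \<subseteq> ?V" if "y \<in> B" "y' \<in> B" for y y'
          using seg that by (simp add: B_def)
        ultimately show ?thesis using U(1) e H by (intro exI[of _ U] exI[of _ e] exI[of _ B]) blast
      qed
    qed
  qed
  show ?thesis
  proof (rule stream_map_dicube_local[OF _ circ_preorder_realization[OF C]])
    show "continuous_map (icube_top 2) (rtop C) (\<lambda>x. ?H (\<gamma> (x 0)) (x 1))"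
      unfolding continuous_map_def
    proof (intro conjI allI impI Pi_I)
      fix x assume "x \<in> topspace (icube_top 2)"
      then have x: "x \<in> icube 2" by simp
      then have "(\<lambda>i\<in>{..<1::nat}. x 1) \<in> icube 1" by (simp add: icube_iff)
      then show "?H (\<gamma> (x 0)) (x 1) \<in> topspace (rtop C)"
        using stream_map_dicube_in[OF homotopy_track[OF \<gamma>P[OF x]]] by fastforce
    next
      fix W assume W: "openin (rtop C) W"
      show "openin (icube_top 2) {x \<in> topspace (icube_top 2). ?H (\<gamma> (x 0)) (x 1) \<in> W}"
      proof (subst openin_subopen, intro ballI)
        fix x assume "x \<in> {x \<in> topspace (icube_top 2). ?H (\<gamma> (x 0)) (x 1) \<in> W}"
        then have x: "x \<in> icube 2" "?H (\<gamma> (x 0)) (x 1) \<in> W" by auto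
        obtain U e B where B: "openin (icube_top 2) B" "x \<in> B"
          "\<forall>Q r. Q \<in> U \<longrightarrow> 0 \<le> r \<longrightarrow> r \<le> 1 \<longrightarrow> \<bar>r - x 1\<bar> < e \<longrightarrow> ?H Q r \<in> W"
          "\<forall>y\<in>B. y \<in> icube 2 \<and> \<gamma> (y 0) \<in> U \<and> \<bar>y 1 - x 1\<bar> < e" using nb[OF W x] by blast
        have "B \<subseteq> {x \<in> topspace (icube_top 2). ?H (\<gamma> (x 0)) (x 1) \<in> W}"
          using B(3,4) by (auto simp: icube_iff[of _ 2])
        then show "\<exists>T. openin (icube_top 2) T \<and> x \<in> T \<and> T \<subseteq> {x \<in> topspace (icube_top 2). ?H (\<gamma> (x 0)) (x 1) \<in> W}"
          using B(1,2) by blast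
      qed
    qed
    fix W x assume W: "openin (rtop C) W" and x: "x \<in> icube 2" "?H (\<gamma> (x 0)) (x 1) \<in> W"
    from nb[OF W x] obtain U e B where U: "openin (rtop C) U" "0 < e" and B: "openin (icube_top 2) B" "x \<in> B"
      and UW': "\<forall>Q r. Q \<in> U \<longrightarrow> 0 \<le> r \<longrightarrow> r \<le> 1 \<longrightarrow> \<bar>r - x 1\<bar> < e \<longrightarrow> ?H Q r \<in> W"
      and BU: "\<forall>y\<in>B. y \<in> icube 2 \<and> \<gamma> (y 0) \<in> U \<and> \<bar>y 1 - x 1\<bar> < e"
      and seg: "\<forall>y\<in>B. \<forall>y'\<in>B. icube_seg (pr y) (pr y') 1 \<subseteq> {z \<in> icube 1. \<gamma> (z 0) \<in> U}"
      by (elim exE conjE) (rule that)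
    have UW: "?H Q r \<in> W" if "Q \<in> U" "0 \<le> r" "r \<le> 1" "\<bar>r - x 1\<bar> < e" for Q r using UW' that by blast
    have W': "preorder_on W (circ (realization C) W)" using circ_preorder_realization[OF C] W by (simp add: circ_preorder_def)
    show "\<exists>B. openin (icube_top 2) B \<and> x \<in> B \<and> (\<forall>y\<in>B \<inter> icube 2. \<forall>y'\<in>B \<inter> icube 2. ?H (\<gamma> (y 0)) (y 1) \<in> W \<longrightarrow>
       ?H (\<gamma> (y' 0)) (y' 1) \<in> W \<longrightarrow> (y, y') \<in> icube_order 2 \<longrightarrow> (?H (\<gamma> (y 0)) (y 1), ?H (\<gamma> (y' 0)) (y' 1)) \<in> circ (realization C) W)"
    proof (intro exI[of _ B] conjI B ballI impI)
      fix y y' assume y: "y \<in> B \<inter> icube 2" "y' \<in> B \<inter> icube 2" and o: "(y, y') \<in> icube_order 2"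
      have yc: "y \<in> icube 2" "y' \<in> icube 2" using y by auto
      have le1: "y 0 \<le> y' 0" "y 1 \<le> y' 1" "0 \<le> y 1" "y' 1 \<le> 1" using o yc by (auto simp: icube_order_def icube_iff)
      have yu: "\<gamma> (y 0) \<in> U" "\<bar>y 1 - x 1\<bar> < e" "\<bar>y' 1 - x 1\<bar> < e" using BU y by auto
      let ?r = "\<lambda>s. \<lambda>i\<in>{..<1::nat}. s :: real"
      have first: "(?H (\<gamma> (y 0)) (?r (y 1) 0), ?H (\<gamma> (y 0)) (?r (y' 1) 0)) \<in> circ (realization C) W"
      proof (rule stream_map_dicubeD(2)[OF homotopy_track[OF \<gamma>P[OF yc(1)]] W])
        show "(?r (y 1), ?r (y' 1)) \<in> icube_circ 1 {z \<in> icube 1. ?H (\<gamma> (y 0)) (z 0) \<in> W}"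
        proof (rule icube_circ_seg)
          show "openin (icube_top 1) {z \<in> icube 1. ?H (\<gamma> (y 0)) (z 0) \<in> W}"
            by (rule openin_preimage_cube[OF stream_map_dicubeD(1)[OF homotopy_track[OF \<gamma>P[OF yc(1)]]] W])
          show "(?r (y 1), ?r (y' 1)) \<in> icube_order 1" using le1 by (auto simp: icube_order_def icube_iff)
          show "icube_seg (?r (y 1)) (?r (y' 1)) 1 \<subseteq> {z \<in> icube 1. ?H (\<gamma> (y 0)) (z 0) \<in> W}"
          proof
            fix z assume "z \<in> icube_seg (?r (y 1)) (?r (y' 1)) 1"
            then have z: "z \<in> icube 1" "y 1 \<le> z 0" "z 0 \<le> y' 1" by (auto simp: icube_seg_def icube_order_def)
            then have "\<bar>z 0 - x 1\<bar> < e" "0 \<le> z 0" "z 0 \<le> 1" using yu le1 by auto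
            then show "z \<in> {z \<in> icube 1. ?H (\<gamma> (y 0)) (z 0) \<in> W}" using UW[OF yu(1)] z(1) by simp
          qed
        qed
      qed
      have N: "natural (interp \<phi> \<phi>' (y' 1))" by (rule natural_interp[OF \<phi> \<phi>']) (use le1 in auto)
      have sm: "stream_map (dicube 1) (realization C) (\<lambda>z. ?H (\<gamma> (z 0)) (y' 1))"
        using stream_map_compose[OF \<gamma> natural_map_stream_map[OF C N]] by (simp add: homotopy_map_def)
      have second: "(?H (\<gamma> (pr y 0)) (y' 1), ?H (\<gamma> (pr y' 0)) (y' 1)) \<in> circ (realization C) W"
      proof (rule stream_map_dicubeD(2)[OF sm W])
        show "(pr y, pr y') \<in> icube_circ 1 {z \<in> icube 1. ?H (\<gamma> (z 0)) (y' 1) \<in> W}"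
        proof (rule icube_circ_seg)
          show "openin (icube_top 1) {z \<in> icube 1. ?H (\<gamma> (z 0)) (y' 1) \<in> W}"
            by (rule openin_preimage_cube[OF stream_map_dicubeD(1)[OF sm] W])
          show "(pr y, pr y') \<in> icube_order 1" using pr[OF yc(1)] pr[OF yc(2)] le1 by (auto simp: icube_order_def)
          show "icube_seg (pr y) (pr y') 1 \<subseteq> {z \<in> icube 1. ?H (\<gamma> (z 0)) (y' 1) \<in> W}"
          proof
            fix z assume "z \<in> icube_seg (pr y) (pr y') 1"
            then have "z \<in> icube 1" "\<gamma> (z 0) \<in> U" using seg y by blast+
            then show "z \<in> {z \<in> icube 1. ?H (\<gamma> (z 0)) (y' 1) \<in> W}" using UW[of "\<gamma> (z 0)" "y' 1"] le1 yu by simp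
          qed
        qed
      qed
      show "(?H (\<gamma> (y 0)) (y 1), ?H (\<gamma> (y' 0)) (y' 1)) \<in> circ (realization C) W"
        using preorder_onD(3)[OF W'] first second pr(2)[OF yc(1)] pr(2)[OF yc(2)] by simp
    qed
  qed
qed

end

lemma level_order: "t \<in> icube n \<Longrightarrow> (vert n (level 1 n t), t) \<in> icube_order n"
  using vert_in[of n "level 1 n t"] by (auto simp: icube_order_def) (auto simp: vert_def level_def icube_iff)

definition track where
  "track \<phi> \<phi>' C P = path1 (homotopy_map C \<phi> \<phi>' P)"

context canc_monoid
begin

text \<open>This makes values along straight paths in cells compatible with the identifications, so
  that \<open>primitive\<close> below is well defined.\<close>

lemma along_cell_act:
  assumes C: "cubical_set C" and b: "box m n \<psi>" "c \<in> cells C n" and pq: "(p, q) \<in> icube_order m"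
  shows "along \<beta> m (cell_pt C m (act C m n \<psi> c)) p q = along \<beta> n (cell_pt C n c) (geom m n \<psi> p) (geom m n \<psi> q)"
proof -
  note pqc = icube_order_in[OF pq]
  have "path1 (\<lambda>u. cell_pt C m (act C m n \<psi> c) (line m p q u)) = path1 (\<lambda>u. cell_pt C n c (line n (geom m n \<psi> p) (geom m n \<psi> q) u))"
    by (rule path1_cong) (simp add: cell_pt_act[OF C b line_in[OF pqc]] geom_line[OF b(1) pqc])
  then show ?thesis by (simp add: along_def)
qed

text \<open>The boundary of \<open>homotopy_square\<close>: the tracks behave like a natural
  transformation between the two images of the path.\<close>

lemma along_natural_homotopy:
  assumes C: "cubical_set C" and \<beta>: "\<beta> \<in> cub_hom (sing (realization C)) (ner \<tau>)"
    and \<phi>: "natural \<phi>" "natural \<phi>'" "\<And>x. 0 \<le> x \<Longrightarrow> x \<le> 1 \<Longrightarrow> \<phi> x \<le> \<phi>' x"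
    and \<sigma>: "stream_map (dicube n) (realization C) \<sigma>" and pq: "(p, q) \<in> icube_order n"
  shows "along \<beta> n (\<lambda>t. natural_map C \<phi> (\<sigma> t)) p q \<otimes> val \<beta> (track \<phi> \<phi>' C (\<sigma> q)) =
    val \<beta> (track \<phi> \<phi>' C (\<sigma> p)) \<otimes> along \<beta> n (\<lambda>t. natural_map C \<phi>' (\<sigma> t)) p q"
proof -
  have i: "interp \<phi> \<phi>' 0 = \<phi>" "interp \<phi> \<phi>' 1 = \<phi>'" by (auto simp: interp_def)
  have "stream_map (dicube 1) (realization C) (\<lambda>x. \<sigma> (line n p q (x 0)))"
    by (rule stream_map_compose[OF line_stream_map[OF pq] \<sigma>])
  from val_square[OF \<beta> homotopy_square[OF C \<phi> this]]
  show ?thesis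
    using line_0[OF icube_order_in(1)[OF pq]] line_1[OF icube_order_in(2)[OF pq]]
    by (simp add: along_def track_def homotopy_map_def[abs_def] i)
qed

lemma val_track_cell:
  assumes C: "cubical_set C" and \<phi>: "natural \<phi>" "natural \<phi>'" "\<And>x. 0 \<le> x \<Longrightarrow> x \<le> 1 \<Longrightarrow> \<phi> x \<le> \<phi>' x"
    and c: "c \<in> cells C n" "t \<in> icube n"
  shows "val \<beta> (track \<phi> \<phi>' C (cell_pt C n c t)) = along \<beta> n (cell_pt C n c) (coord \<phi> n t) (coord \<phi>' n t)"
proof -
  have "path1 (homotopy_map C \<phi> \<phi>' (cell_pt C n c t)) = path1 (\<lambda>u. cell_pt C n c (line n (coord \<phi> n t) (coord \<phi>' n t) u))"
    by (rule path1_cong) (rule homotopy_map_cell[OF C \<phi> c])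
  then show ?thesis by (simp add: track_def along_def)
qed

end

section \<open>Comparison with the extension of the restriction\<close>

context cocycle
begin

context
  fixes \<alpha> assumes \<alpha>: "\<alpha> \<in> cub_hom (sing (realization C)) (ner \<tau>)" and restr: "cub_comp C \<alpha> (sing_unit C) = f"
begin

text \<open>The value of \<open>\<alpha>\<close> along the straight path from the vertex below a
  point up to the point. Since the extension evaluates on points pushed down, this is the cochain of
  a homotopy from the extension to \<open>\<alpha>\<close>.\<close>

definition primitive :: "'c real_pt set \<Rightarrow> 'm" where
  "primitive = desc (\<lambda>n c t. along \<alpha> n (cell_pt C n c) (vert n (level 1 n t)) t)"

lemma along_cell_closed:
  "c \<in> cells C n \<Longrightarrow> (p, q) \<in> icube_order n \<Longrightarrow> along \<alpha> n (cell_pt C n c) p q \<in> carrier \<tau>"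
  by (rule along_closed[OF \<alpha> stream_map_cell_pt[OF C]])

lemma primitive_cell:
  assumes "c \<in> cells C n" "t \<in> icube n"
  shows "primitive (cell_pt C n c t) = along \<alpha> n (cell_pt C n c) (vert n (level 1 n t)) t"
  unfolding primitive_def
proof (rule desc_cell_pt[OF C assms])
  fix m n \<psi> c t assume b: "box m n \<psi>" "c \<in> cells C n" "t \<in> icube m"
  show "along \<alpha> m (cell_pt C m (act C m n \<psi> c)) (vert m (level 1 m t)) t =
      along \<alpha> n (cell_pt C n c) (vert n (level 1 n (geom m n \<psi> t))) (geom m n \<psi> t)"
    unfolding along_cell_act[OF C b(1,2) level_order[OF b(3)]] geom_vert[OF b(1) level_in]
      geom_level[OF b(1,3) zero_less_one order_refl] ..
qed

lemma primitive_closed: "P \<in> topspace (rtop C) \<Longrightarrow> primitive P \<in> carrier \<tau>"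
  using cell_pt_cases[OF C] primitive_cell along_cell_closed level_order by metis

text \<open>The assumption that \<open>\<alpha>\<close> restricts to \<open>f\<close> on
  \<open>C\<close> enters here, through \<open>val_vert\<close>.\<close>

lemma step_along:
  assumes c: "c \<in> cells C n" and pq: "(p, q) \<in> icube_order n"
  shows "step n c p q = along \<alpha> n (cell_pt C n c) (vert n (level 1 n p)) (vert n (level 1 n q))"
proof -
  have l: "(level 1 n p, level 1 n q) \<in> Ar (cube_cat n)" by (rule level_arr[OF pq])
  have "step n c p q = snd (\<alpha> n (sing_unit C n c)) (level 1 n p, level 1 n q)"
    using cub_comp_apply[OF c, of \<alpha> "sing_unit C"] by (simp add: step_def restr)
  also have "\<dots> = along \<alpha> n (sing_unit C n c) (vert n (level 1 n p)) (vert n (level 1 n q))"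
    by (rule val_vert[OF \<alpha> cub_hom_in[OF sing_unit_hom[OF C] c] l])
  also have "\<dots> = along \<alpha> n (cell_pt C n c) (vert n (level 1 n p)) (vert n (level 1 n q))"
    by (rule along_cong[OF vert_order[OF l]]) (simp add: sing_unit_apply[OF c])
  finally show ?thesis .
qed

text \<open>Both sides are the value of \<open>\<alpha>\<close> from the vertex below
  \<open>p\<close> up to \<open>q\<close>: once through the vertex below \<open>q\<close>, once
  through \<open>p\<close>.\<close>

lemma primitive_step:
  assumes c: "c \<in> cells C n" and pq: "(p, q) \<in> icube_order n"
  shows "step n c p q \<otimes> primitive (cell_pt C n c q) = primitive (cell_pt C n c p) \<otimes> along \<alpha> n (cell_pt C n c) p q"
proof -
  note pqc = icube_order_in[OF pq]
  note tr = along_trans[OF \<alpha> stream_map_cell_pt[OF C c]]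
  show ?thesis
    unfolding step_along[OF c pq] primitive_cell[OF c pqc(1)] primitive_cell[OF c pqc(2)]
      tr[OF vert_order[OF level_arr[OF pq]] level_order[OF pqc(2)], symmetric] tr[OF level_order[OF pqc(1)] pq, symmetric] ..
qed

lemma extension_along_cell:
  "c \<in> cells C n \<Longrightarrow> (p, q) \<in> icube_order n \<Longrightarrow> along extension n (cell_pt C n c) p q = step n c p q"
  using extension_line by (simp add: along_def val_def path1_def)

text \<open>The equation of the homotopy from the extension to \<open>\<alpha>\<close>, for the
  single path from \<open>p\<close> to \<open>q\<close>.\<close>

definition agree :: "nat \<Rightarrow> ((nat \<Rightarrow> real) \<Rightarrow> 'c real_pt set) \<Rightarrow> (nat \<Rightarrow> real) \<Rightarrow> (nat \<Rightarrow> real) \<Rightarrow> bool" where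
  "agree n \<sigma> p q \<longleftrightarrow> along extension n \<sigma> p q \<otimes> primitive (\<sigma> q) = primitive (\<sigma> p) \<otimes> along \<alpha> n \<sigma> p q"

text \<open>A track stays inside one cell of \<open>C\<close>, where \<open>primitive_step\<close>
  and \<open>extension_along_cell\<close> apply.\<close>

lemma track_primitive:
  assumes \<phi>: "natural \<phi>" "natural \<phi>'" "\<And>x. 0 \<le> x \<Longrightarrow> x \<le> 1 \<Longrightarrow> \<phi> x \<le> \<phi>' x" and P: "P \<in> topspace (rtop C)"
  shows "val extension (track \<phi> \<phi>' C P) \<otimes> primitive (natural_map C \<phi>' P) = primitive (natural_map C \<phi> P) \<otimes> val \<alpha> (track \<phi> \<phi>' C P)"
    "val extension (track \<phi> \<phi>' C P) \<in> carrier \<tau>" "val \<alpha> (track \<phi> \<phi>' C P) \<in> carrier \<tau>"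
proof -
  obtain n c t where c: "c \<in> cells C n" "t \<in> icube n" "P = cell_pt C n c t" by (rule cell_pt_cases[OF C P])
  have o: "(coord \<phi> n t, coord \<phi>' n t) \<in> icube_order n" by (rule natural_le_order[OF \<phi> c(2)])
  have v: "val extension (track \<phi> \<phi>' C P) = step n c (coord \<phi> n t) (coord \<phi>' n t)"
    "val \<alpha> (track \<phi> \<phi>' C P) = along \<alpha> n (cell_pt C n c) (coord \<phi> n t) (coord \<phi>' n t)"
    using val_track_cell[OF C \<phi> c(1,2), of extension] val_track_cell[OF C \<phi> c(1,2), of \<alpha>]
    by (simp_all add: extension_along_cell[OF c(1) o] c(3))
  show "val extension (track \<phi> \<phi>' C P) \<otimes> primitive (natural_map C \<phi>' P) = primitive (natural_map C \<phi> P) \<otimes> val \<alpha> (track \<phi> \<phi>' C P)"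
    unfolding v unfolding c(3) natural_map_cell_pt[OF C \<phi>(1) c(1,2)] natural_map_cell_pt[OF C \<phi>(2) c(1,2)]
    by (rule primitive_step[OF c(1) o])
  show "val extension (track \<phi> \<phi>' C P) \<in> carrier \<tau>" "val \<alpha> (track \<phi> \<phi>' C P) \<in> carrier \<tau>"
    unfolding v using step_closed[OF c(1) o] along_cell_closed[OF c(1) o] by auto
qed

text \<open>In the homotopy square the equation holds along the two tracks by
  \<open>track_primitive\<close>. Commutativity of the square for both cocycles, with cancellation
  of the tracks, then makes it hold along one of the remaining sides exactly when it holds along the
  other.\<close>

lemma agree_homotopy:
  assumes \<phi>: "natural \<phi>" "natural \<phi>'" "\<And>x. 0 \<le> x \<Longrightarrow> x \<le> 1 \<Longrightarrow> \<phi> x \<le> \<phi>' x"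
    and \<sigma>: "stream_map (dicube n) (realization C) \<sigma>" and pq: "(p, q) \<in> icube_order n"
  shows "agree n (\<lambda>t. natural_map C \<phi> (\<sigma> t)) p q \<longleftrightarrow> agree n (\<lambda>t. natural_map C \<phi>' (\<sigma> t)) p q"
proof -
  have xy: "\<sigma> p \<in> topspace (rtop C)" "\<sigma> q \<in> topspace (rtop C)"
    using stream_map_dicube_in[OF \<sigma>] icube_order_in[OF pq] by auto
  have sm: "stream_map (dicube n) (realization C) (\<lambda>t. natural_map C \<theta> (\<sigma> t))" if "natural \<theta>" for \<theta>
    by (rule stream_map_compose[OF \<sigma> natural_map_stream_map[OF C that]])
  have nm: "natural_map C \<theta> P \<in> topspace (rtop C)" if "natural \<theta>" "P \<in> topspace (rtop C)" for \<theta> P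
    using natural_map_stream_map[OF C that(1)] that(2) by (auto simp: stream_map_def continuous_map_def)
  define B where "B = along extension n (\<lambda>t. natural_map C \<phi> (\<sigma> t)) p q"
  define B' where "B' = along extension n (\<lambda>t. natural_map C \<phi>' (\<sigma> t)) p q"
  define A where "A = along \<alpha> n (\<lambda>t. natural_map C \<phi> (\<sigma> t)) p q"
  define A' where "A' = along \<alpha> n (\<lambda>t. natural_map C \<phi>' (\<sigma> t)) p q"
  define ax where "ax = val \<alpha> (track \<phi> \<phi>' C (\<sigma> p))"
  define ay where "ay = val \<alpha> (track \<phi> \<phi>' C (\<sigma> q))"
  define bx where "bx = val extension (track \<phi> \<phi>' C (\<sigma> p))"
  define yb where "yb = val extension (track \<phi> \<phi>' C (\<sigma> q))"
  define gx where "gx = primitive (natural_map C \<phi> (\<sigma> p))"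
  define gy where "gy = primitive (natural_map C \<phi> (\<sigma> q))"
  define hx where "hx = primitive (natural_map C \<phi>' (\<sigma> p))"
  define hy where "hy = primitive (natural_map C \<phi>' (\<sigma> q))"
  have cl: "B \<in> carrier \<tau>" "B' \<in> carrier \<tau>" "A \<in> carrier \<tau>" "A' \<in> carrier \<tau>"
    unfolding B_def B'_def A_def A'_def
    using along_closed[OF extension_hom sm[OF \<phi>(1)] pq] along_closed[OF extension_hom sm[OF \<phi>(2)] pq]
      along_closed[OF \<alpha> sm[OF \<phi>(1)] pq] along_closed[OF \<alpha> sm[OF \<phi>(2)] pq] by auto
  have cl2: "ax \<in> carrier \<tau>" "ay \<in> carrier \<tau>" "bx \<in> carrier \<tau>" "yb \<in> carrier \<tau>"
    unfolding ax_def ay_def bx_def yb_def using track_primitive(2,3)[OF \<phi> xy(1)] track_primitive(2,3)[OF \<phi> xy(2)] by auto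
  have cl3: "gx \<in> carrier \<tau>" "gy \<in> carrier \<tau>" "hx \<in> carrier \<tau>" "hy \<in> carrier \<tau>"
    unfolding gx_def gy_def hx_def hy_def using primitive_closed nm xy \<phi>(1,2) by auto
  have e1: "B \<otimes> yb = bx \<otimes> B'" unfolding B_def yb_def bx_def B'_def by (rule along_natural_homotopy[OF C extension_hom \<phi> \<sigma> pq])
  have e2: "A \<otimes> ay = ax \<otimes> A'" unfolding A_def ay_def ax_def A'_def by (rule along_natural_homotopy[OF C \<alpha> \<phi> \<sigma> pq])
  have e3: "bx \<otimes> hx = gx \<otimes> ax" unfolding bx_def hx_def gx_def ax_def by (rule track_primitive(1)[OF \<phi> xy(1)])
  have e4: "yb \<otimes> hy = gy \<otimes> ay" unfolding yb_def hy_def gy_def ay_def by (rule track_primitive(1)[OF \<phi> xy(2)])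
  note cs = cl cl2 cl3
  \<comment> \<open>Each side of the equation for \<open>\<phi>\<close>, multiplied by
    \<open>ay\<close>, becomes \<open>bx\<close> times the corresponding side for
    \<open>\<phi>'\<close>.\<close>
  have "B \<otimes> gy \<otimes> ay = B \<otimes> (yb \<otimes> hy)" using cs by (simp add: e4 m_assoc)
  also have "\<dots> = (B \<otimes> yb) \<otimes> hy" using cs by (simp add: m_assoc)
  also have "\<dots> = bx \<otimes> (B' \<otimes> hy)" using cs by (simp add: e1 m_assoc)
  finally have L: "B \<otimes> gy \<otimes> ay = bx \<otimes> (B' \<otimes> hy)" .
  have "gx \<otimes> A \<otimes> ay = gx \<otimes> (ax \<otimes> A')" using cs by (simp add: e2 m_assoc)
  also have "\<dots> = (bx \<otimes> hx) \<otimes> A'" using cs by (simp add: e3 m_assoc)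
  finally have R: "gx \<otimes> A \<otimes> ay = bx \<otimes> (hx \<otimes> A')" using cs by (simp add: m_assoc)
  have "B \<otimes> gy = gx \<otimes> A \<longleftrightarrow> B' \<otimes> hy = hx \<otimes> A'"
  proof
    assume "B \<otimes> gy = gx \<otimes> A"
    then have "bx \<otimes> (B' \<otimes> hy) = bx \<otimes> (hx \<otimes> A')" using L R by simp
    then show "B' \<otimes> hy = hx \<otimes> A'" by (rule lcancel) (use cs in auto)
  next
    assume "B' \<otimes> hy = hx \<otimes> A'"
    then have "B \<otimes> gy \<otimes> ay = gx \<otimes> A \<otimes> ay" using L R by simp
    then show "B \<otimes> gy = gx \<otimes> A" by (rule rcancel) (use cs in auto)
  qed
  then show ?thesis
    unfolding agree_def B_def B'_def A_def A'_def gx_def gy_def hx_def hy_def .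
qed

lemma agree_cong:
  assumes "(p, q) \<in> icube_order n" "\<And>t. t \<in> icube n \<Longrightarrow> \<sigma> t = \<sigma>' t"
  shows "agree n \<sigma> p q \<longleftrightarrow> agree n \<sigma>' p q"
  using along_cong[OF assms, where \<beta> = extension] along_cong[OF assms, where \<beta> = \<alpha>] assms(2) icube_order_in[OF assms(1)]
  by (simp add: agree_def)

text \<open>After the collapse the path is constant and the equation is trivial. Homotopies have to
  be directed and \<open>\<phi>\<close> need not be comparable with the identity, so the equation is
  carried back to \<open>\<sigma>\<close> through the maximum of the two.\<close>

lemma agree_local:
  assumes \<sigma>: "stream_map (dicube n) (realization C) \<sigma>" and pq: "(p, q) \<in> icube_order n"
    and \<phi>: "natural \<phi>" and col: "\<And>n c t. c \<in> cells C n \<Longrightarrow> t \<in> icube n \<Longrightarrow> cell_pt C n c t \<in> U \<Longrightarrow> cell_pt C n c (coord \<phi> n t) = z"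
    and U: "icube_seg p q n \<subseteq> {t \<in> icube n. \<sigma> t \<in> U}"
  shows "agree n \<sigma> p q"
proof -
  note pqc = icube_order_in[OF pq]
  let ?m = "\<lambda>x. max x (\<phi> x)"
  have m: "natural ?m" by (rule natural_max[OF natural_id \<phi>])
  have top: "\<sigma> t \<in> topspace (rtop C)" if "t \<in> icube n" for t by (rule stream_map_dicube_in[OF \<sigma> that])
  have nid: "natural_map C (\<lambda>x. x) P = P" if P: "P \<in> topspace (rtop C)" for P
  proof -
    obtain k c t where c: "c \<in> cells C k" "t \<in> icube k" "P = cell_pt C k c t" by (rule cell_pt_cases[OF C P])
    have "coord (\<lambda>x. x) k t = t" using c(2) by (auto simp: coord_def icube_iff extensional_def fun_eq_iff)
    then show ?thesis using natural_map_cell_pt[OF C natural_id c(1,2)] c(3) by simp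
  qed
  have z: "natural_map C \<phi> (\<sigma> t) = z" if "t \<in> icube_seg p q n" for t
  proof -
    have t: "t \<in> icube n" "\<sigma> t \<in> U" using U that by auto
    obtain k c s where c: "c \<in> cells C k" "s \<in> icube k" "\<sigma> t = cell_pt C k c s" by (rule cell_pt_cases[OF C top[OF t(1)]])
    then show ?thesis using natural_map_cell_pt[OF C \<phi> c(1,2)] col[OF c(1,2)] t(2) by simp
  qed
  have zp: "natural_map C \<phi> (\<sigma> p) = z" "natural_map C \<phi> (\<sigma> q) = z"
    using z[of p] z[of q] seg_ends[OF pq] by auto
  have sm: "stream_map (dicube n) (realization C) (\<lambda>t. natural_map C \<phi> (\<sigma> t))"
    by (rule stream_map_compose[OF \<sigma> natural_map_stream_map[OF C \<phi>]])
  have one: "along \<beta> n (\<lambda>t. natural_map C \<phi> (\<sigma> t)) p q = \<one>" if "\<beta> \<in> cub_hom (sing (realization C)) (ner \<tau>)" for \<beta>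
  proof -
    have "path1 (\<lambda>u. natural_map C \<phi> (\<sigma> (line n p q u))) = path1 (\<lambda>_. natural_map C \<phi> (\<sigma> p))"
      by (rule path1_cong) (use z[OF line_seg[OF pq]] zp in simp)
    then show ?thesis using val_const[OF that sm pqc(1)] by (simp add: along_def)
  qed
  have "z \<in> topspace (rtop C)" using stream_map_dicube_in[OF sm pqc(1)] zp by simp
  then have "agree n (\<lambda>t. natural_map C \<phi> (\<sigma> t)) p q"
    unfolding agree_def one[OF extension_hom] one[OF \<alpha>] zp using primitive_closed by simp
  moreover have "agree n (\<lambda>t. natural_map C \<phi> (\<sigma> t)) p q \<longleftrightarrow> agree n (\<lambda>t. natural_map C ?m (\<sigma> t)) p q"
    by (rule agree_homotopy[OF \<phi> m _ \<sigma> pq]) simp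
  moreover have "agree n (\<lambda>t. natural_map C (\<lambda>x. x) (\<sigma> t)) p q \<longleftrightarrow> agree n (\<lambda>t. natural_map C ?m (\<sigma> t)) p q"
    by (rule agree_homotopy[OF natural_id m _ \<sigma> pq]) simp
  moreover have "agree n (\<lambda>t. natural_map C (\<lambda>x. x) (\<sigma> t)) p q \<longleftrightarrow> agree n \<sigma> p q"
    by (rule agree_cong[OF pq]) (rule nid[OF top])
  ultimately show ?thesis by simp
qed

text \<open>Both cocycles are multiplicative along consecutive segments, so the pairs satisfying the
  equation form a preorder; near each point it holds by \<open>agree_local\<close>.\<close>

lemma agree_all:
  assumes \<sigma>: "stream_map (dicube n) (realization C) \<sigma>" and pq: "(p, q) \<in> icube_order n"
  shows "agree n \<sigma> p q"
proof -
  have pc: "primitive (\<sigma> t) \<in> carrier \<tau>" if "t \<in> icube n" for t using primitive_closed stream_map_dicube_in[OF \<sigma> that] by blast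
  let ?P = "{(p, q). (p, q) \<in> icube_order n \<and> agree n \<sigma> p q}"
  have "icube_order n \<subseteq> ?P"
  proof (rule icube_order_local)
    have "(x, x) \<in> ?P" if "x \<in> icube n" for x
      using along_refl[OF \<alpha> \<sigma> that] along_refl[OF extension_hom \<sigma> that] pc[OF that] icube_order_refl[OF that]
      by (simp add: agree_def)
    moreover have "(x, z) \<in> ?P" if xy: "(x, y) \<in> ?P" and yz: "(y, z) \<in> ?P" for x y z
    proof -
      have o: "(x, y) \<in> icube_order n" "(y, z) \<in> icube_order n" using xy yz by auto
      note c = along_closed[OF \<alpha> \<sigma> o(1)] along_closed[OF \<alpha> \<sigma> o(2)] along_closed[OF extension_hom \<sigma> o(1)]
        along_closed[OF extension_hom \<sigma> o(2)] pc[OF icube_order_in(1)[OF o(1)]] pc[OF icube_order_in(2)[OF o(1)]] pc[OF icube_order_in(2)[OF o(2)]]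
      have e: "along extension n \<sigma> x y \<otimes> primitive (\<sigma> y) = primitive (\<sigma> x) \<otimes> along \<alpha> n \<sigma> x y"
        "along extension n \<sigma> y z \<otimes> primitive (\<sigma> z) = primitive (\<sigma> y) \<otimes> along \<alpha> n \<sigma> y z"
        using xy yz by (auto simp: agree_def)
      have "along extension n \<sigma> x z \<otimes> primitive (\<sigma> z) = along extension n \<sigma> x y \<otimes> (along extension n \<sigma> y z \<otimes> primitive (\<sigma> z))"
        unfolding along_trans[OF extension_hom \<sigma> o] using c by (simp add: m_assoc)
      also have "\<dots> = (along extension n \<sigma> x y \<otimes> primitive (\<sigma> y)) \<otimes> along \<alpha> n \<sigma> y z"
        unfolding e(2) using c by (simp add: m_assoc)
      also have "\<dots> = primitive (\<sigma> x) \<otimes> along \<alpha> n \<sigma> x z"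
        unfolding e(1) along_trans[OF \<alpha> \<sigma> o] using c by (simp add: m_assoc)
      finally show ?thesis using icube_order_trans[OF o] by (simp add: agree_def)
    qed
    moreover have "?P \<subseteq> icube n \<times> icube n" using icube_order_in by fast
    ultimately show "preorder_on (icube n) ?P" unfolding preorder_on_def refl_on_def trans_def by blast
    fix t assume t: "t \<in> icube n"
    show "\<exists>B. openin (icube_top n) B \<and> t \<in> B \<and> (\<forall>s\<in>B \<inter> icube n. \<forall>s'\<in>B \<inter> icube n. (s, s') \<in> icube_order n \<longrightarrow> (s, s') \<in> ?P)"
    proof (rule realization_collapse[OF C stream_map_dicube_in[OF \<sigma> t]])
      fix U \<phi> assume U: "openin (rtop C) U" "\<sigma> t \<in> U" and \<phi>: "natural \<phi>"
        and col: "\<And>n' c t'. c \<in> cells C n' \<Longrightarrow> t' \<in> icube n' \<Longrightarrow> cell_pt C n' c t' \<in> U \<Longrightarrow> cell_pt C n' c (coord \<phi> n' t') = \<sigma> t"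
      have V: "openin (icube_top n) {t \<in> icube n. \<sigma> t \<in> U}" by (rule openin_preimage_cube[OF stream_map_dicubeD(1)[OF \<sigma>] U(1)])
      have tV: "t \<in> {t \<in> icube n. \<sigma> t \<in> U}" using t U(2) by simp
      show ?thesis
      proof (rule icube_circ_nbhd[OF V tV])
        fix B assume B: "openin (icube_top n) B" "t \<in> B" and seg: "\<And>s s'. s \<in> B \<Longrightarrow> s' \<in> B \<Longrightarrow> icube_seg s s' n \<subseteq> {t \<in> icube n. \<sigma> t \<in> U}"
        have "(s, s') \<in> ?P" if "s \<in> B" "s' \<in> B" "(s, s') \<in> icube_order n" for s s'
          using agree_local[OF \<sigma> that(3) \<phi> col seg[OF that(1,2)]] that(3) by simp
        then show ?thesis using B by blast
      qed
    qed
  qed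
  then show ?thesis using pq by blast
qed

lemma extension_homotopic: "homotopic (sing (realization C)) extension \<alpha>"
  unfolding homotopic_def
\<comment> \<open>A singular vertex is a function on \<open>icube 0\<close>, whose only point is
  \<open>\<lambda>_. undefined\<close>; the cochain is \<open>primitive\<close> at its value
  there.\<close>
proof (intro bexI[of _ "\<lambda>\<gamma>. primitive (\<gamma> (\<lambda>_. undefined))"] allI ballI impI)
  have o: "(\<lambda>_. undefined) \<in> icube 0" by (simp add: icube_iff)
  show "(\<lambda>\<gamma>. primitive (\<gamma> (\<lambda>_. undefined))) \<in> cells (sing (realization C)) 0 \<rightarrow> carrier \<tau>"
  proof (rule Pi_I)
    fix \<gamma> assume "\<gamma> \<in> cells (sing (realization C)) 0"
    then have "stream_map (dicube 0) (realization C) \<gamma>" by (simp add: cells_sing)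
    then show "primitive (\<gamma> (\<lambda>_. undefined)) \<in> carrier \<tau>" by (rule primitive_closed[OF stream_map_dicube_in[OF _ o]])
  qed
  fix n \<sigma> v w assume \<sigma>: "\<sigma> \<in> cells (sing (realization C)) n" and vw: "(v, w) \<in> Ar (cube_cat n)"
  have sm: "stream_map (dicube n) (realization C) \<sigma>" using \<sigma> by (simp add: cells_sing)
  have vx: "vx (sing (realization C)) n \<sigma> u (\<lambda>_. undefined) = \<sigma> (vert n u)" if u: "u \<in> bcube n" for u
  proof -
    have e: "vert 0 (\<lambda>_. undefined) = (\<lambda>_. undefined)" by (auto simp: vert_def)
    have b0: "(\<lambda>_. undefined) \<in> bcube 0" by (simp add: bcube_iff)
    have "geom 0 n (pt n u) (\<lambda>_. undefined) = vert n u"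
      using geom_vert[OF box_pt[OF u] b0] b0 by (simp add: e pt_def)
    then show ?thesis using o by (simp add: vx_def act_sing compose_def)
  qed
  show "snd (extension n \<sigma>) (v, w) \<otimes> primitive (vx (sing (realization C)) n \<sigma> w (\<lambda>_. undefined)) =
      primitive (vx (sing (realization C)) n \<sigma> v (\<lambda>_. undefined)) \<otimes> snd (\<alpha> n \<sigma>) (v, w)"
    unfolding vx[OF cube_arr_ob(1)[OF vw]] vx[OF cube_arr_ob(2)[OF vw]] val_vert[OF extension_hom \<sigma> vw] val_vert[OF \<alpha> \<sigma> vw]
    using agree_all[OF sm vert_order[OF vw]] by (simp add: agree_def)
qed

end

end

section \<open>The comparison\<close>

context canc_monoid
begin

lemma H1_rel_restriction:
  assumes C: "cubical_set C" and one: "\<exists>!v. v \<in> cells C 0"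
    and ab: "(\<alpha>, \<beta>) \<in> H1_rel (sing (realization C)) \<tau>"
  shows "cub_comp C \<alpha> (sing_unit C) = cub_comp C \<beta> (sing_unit C)"
proof (rule equiv_gen_invariant[OF hrel_sub _ ab[unfolded H1_rel_eq[OF cubical_set_sing]]])
  let ?S = "sing (realization C)"
  fix \<alpha> \<beta> assume "(\<alpha>, \<beta>) \<in> hrel ?S"
  then have hom: "\<alpha> \<in> cub_hom ?S (ner \<tau>)" "\<beta> \<in> cub_hom ?S (ner \<tau>)" and "homotopic ?S \<alpha> \<beta>" by (auto simp: hrel_def)
  then obtain g where g: "g \<in> cells ?S 0 \<rightarrow> carrier \<tau>"
    and eq: "\<And>n a v w. a \<in> cells ?S n \<Longrightarrow> (v, w) \<in> Ar (cube_cat n) \<Longrightarrow>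
      snd (\<alpha> n a) (v, w) \<otimes> g (vx ?S n a w) = g (vx ?S n a v) \<otimes> snd (\<beta> n a) (v, w)"
    unfolding homotopic_def by blast
  note u = sing_unit_hom[OF C]
  show "cub_comp C \<alpha> (sing_unit C) = cub_comp C \<beta> (sing_unit C)"
  proof (rule cub_hom_ner_eqI[OF cub_comp_hom[OF C u hom(1)] cub_comp_hom[OF C u hom(2)]])
    fix n c v w assume c: "c \<in> cells C n" and vw: "(v, w) \<in> Ar (cube_cat n)"
    note ob = cube_arr_ob[OF vw]
    note uc = cub_hom_in[OF u c]
    have "vx C n c v = vx C n c w" using one vx_in[OF C c] ob by blast
    then have same: "vx ?S n (sing_unit C n c) v = vx ?S n (sing_unit C n c) w"
      using cub_hom_vx[OF C u c ob(1)] cub_hom_vx[OF C u c ob(2)] by simp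
    have gc: "g (vx ?S n (sing_unit C n c) w) \<in> carrier \<tau>" using g vx_in[OF cubical_set_sing uc ob(2)] by blast
    note cl = ner_closed[OF hom(1) uc vw] ner_closed[OF hom(2) uc vw]
    have "snd (\<alpha> n (sing_unit C n c)) (v, w) \<otimes> g (vx ?S n (sing_unit C n c) w) =
        snd (\<beta> n (sing_unit C n c)) (v, w) \<otimes> g (vx ?S n (sing_unit C n c) w)"
      using eq[OF uc vw] gc cl by (simp add: same m_comm)
    then have "snd (\<alpha> n (sing_unit C n c)) (v, w) = snd (\<beta> n (sing_unit C n c)) (v, w)"
      by (rule rcancel) (use gc cl in auto)
    then show "snd (cub_comp C \<alpha> (sing_unit C) n c) (v, w) = snd (cub_comp C \<beta> (sing_unit C) n c) (v, w)"
      by (simp add: cub_comp_apply[OF c])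
  qed
qed

text \<open>Both cocycles are linked to the extension of their common restriction.\<close>

lemma restriction_H1_rel:
  assumes C: "cubical_set C" and ab: "\<alpha> \<in> cub_hom (sing (realization C)) (ner \<tau>)" "\<beta> \<in> cub_hom (sing (realization C)) (ner \<tau>)"
    and eq: "cub_comp C \<alpha> (sing_unit C) = cub_comp C \<beta> (sing_unit C)"
  shows "(\<alpha>, \<beta>) \<in> H1_rel (sing (realization C)) \<tau>"
proof -
  interpret E: cocycle \<tau> C "cub_comp C \<beta> (sing_unit C)"
    by unfold_locales (fact C cub_comp_hom[OF C sing_unit_hom[OF C] ab(2)])+
  have h: "(E.extension, \<gamma>) \<in> H1_rel (sing (realization C)) \<tau>"
    if "\<gamma> \<in> cub_hom (sing (realization C)) (ner \<tau>)" "cub_comp C \<gamma> (sing_unit C) = cub_comp C \<beta> (sing_unit C)" for \<gamma>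
    by (rule H1_relI[OF cubical_set_sing E.extension_hom that(1) E.extension_homotopic[OF that]])
  show ?thesis
    using h[OF ab(1) eq] h[OF ab(2) refl] H1_rel_equiv[OF cubical_set_sing] by (auto elim!: equivE dest: transD symD)
qed

lemma restriction_surj:
  assumes C: "cubical_set C" and f: "f \<in> cub_hom C (ner \<tau>)"
  shows "\<exists>\<alpha>\<in>cub_hom (sing (realization C)) (ner \<tau>). cub_comp C \<alpha> (sing_unit C) = f"
proof -
  interpret E: cocycle \<tau> C f by unfold_locales (fact C f)+
  show ?thesis using E.extension_hom E.extension_unit by blast
qed

text \<open>The description by \<open>THE\<close> is justified: a functor exists by
  \<open>adjunct_surj\<close>, is unique by \<open>adjunct_inj\<close>, and fits all representatives
  of the class by \<open>H1_rel_restriction\<close>.\<close>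

lemma comparison_class:
  assumes C: "cubical_set C" and one: "\<exists>!v. v \<in> cells C 0" and \<alpha>: "\<alpha> \<in> cub_hom (sing (realization C)) (ner \<tau>)"
  shows "comparison C \<tau> (H1_rel (sing (realization C)) \<tau> `` {\<alpha>}) \<in> functors (T1 C) (monoid_cat \<tau>)"
    "adjunct C (comparison C \<tau> (H1_rel (sing (realization C)) \<tau> `` {\<alpha>})) = cub_comp C \<alpha> (sing_unit C)"
proof -
  let ?X = "H1_rel (sing (realization C)) \<tau> `` {\<alpha>}"
  let ?Q = "\<lambda>F. F \<in> functors (T1 C) (monoid_cat \<tau>) \<and> (\<forall>\<beta>\<in>?X. adjunct C F = cub_comp C \<beta> (sing_unit C))"
  obtain F where F: "F \<in> functors (T1 C) (monoid_cat \<tau>)" "adjunct C F = cub_comp C \<alpha> (sing_unit C)"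
    using adjunct_surj[OF C cub_comp_hom[OF C sing_unit_hom[OF C] \<alpha>]] by blast
  have self: "\<alpha> \<in> ?X" by (rule equiv_class_self[OF H1_rel_equiv[OF cubical_set_sing] \<alpha>])
  have "?Q (THE F. ?Q F)"
  proof (rule theI)
    show "?Q F" using F H1_rel_restriction[OF C one] by auto
    show "G = F" if "?Q G" for G using that self F adjunct_inj by metis
  qed
  then have "?Q (comparison C \<tau> ?X)" unfolding comparison_def adjunct_def .
  then show "comparison C \<tau> ?X \<in> functors (T1 C) (monoid_cat \<tau>)" "adjunct C (comparison C \<tau> ?X) = cub_comp C \<alpha> (sing_unit C)"
    using self by auto
qed

lemma comparison_eqI:
  assumes "cubical_set C" "\<exists>!v. v \<in> cells C 0" "\<alpha> \<in> cub_hom (sing (realization C)) (ner \<tau>)"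
    and "F \<in> functors (T1 C) (monoid_cat \<tau>)" "adjunct C F = cub_comp C \<alpha> (sing_unit C)"
  shows "comparison C \<tau> (H1_rel (sing (realization C)) \<tau> `` {\<alpha>}) = F"
  using adjunct_inj comparison_class[OF assms(1-3)] assms(4,5) by metis

lemma pm_cub_comp:
  assumes C: "cubical_set C" and f: "f \<in> cub_hom C A" and A: "cubical_set A"
    and ab: "\<alpha> \<in> cub_hom A (ner \<tau>)" "\<beta> \<in> cub_hom A (ner \<tau>)"
  shows "cub_comp C (pm A \<alpha> \<beta>) f = pm C (cub_comp C \<alpha> f) (cub_comp C \<beta> f)"
  by (rule cub_hom_ner_eqI[OF cub_comp_hom[OF C f pm_hom[OF A ab]] pm_hom[OF C cub_comp_hom[OF C f ab(1)] cub_comp_hom[OF C f ab(2)]]])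
    (simp add: cub_comp_apply snd_pm cub_hom_in[OF f])

text \<open>Everything is checked on restrictions to \<open>C\<close>, which determine both the
  cohomology class and, by transposition, the functor.\<close>

lemma comparison_iso:
  assumes C: "cubical_set C" and one: "\<exists>!v. v \<in> cells C 0"
  shows "comparison C \<tau> \<in> iso (H1_sing (realization C) \<tau>) (functor_monoid (T1 C) \<tau>)"
proof -
  let ?S = "sing (realization C)"
  let ?cl = "\<lambda>\<alpha>. H1_rel ?S \<tau> `` {\<alpha>}"
  note S = cubical_set_sing[of "realization C"]
  note u = sing_unit_hom[OF C]
  have car: "carrier (functor_monoid (T1 C) \<tau>) = functors (T1 C) (monoid_cat \<tau>)" by (simp add: functor_monoid_def)
  have cases: "\<exists>\<alpha>\<in>cub_hom ?S (ner \<tau>). X = ?cl \<alpha>" if "X \<in> carrier (H1_sing (realization C) \<tau>)" for X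
    using that by (auto simp: H1_sing_def carrier_H1 elim!: quotientE)
  show ?thesis
    unfolding iso_def mem_Collect_eq
  proof
    show "comparison C \<tau> \<in> hom (H1_sing (realization C) \<tau>) (functor_monoid (T1 C) \<tau>)"
    proof (rule homI)
      show "comparison C \<tau> X \<in> carrier (functor_monoid (T1 C) \<tau>)" if "X \<in> carrier (H1_sing (realization C) \<tau>)" for X
        using cases[OF that] comparison_class(1)[OF C one] by (auto simp: car)
      fix X Y assume "X \<in> carrier (H1_sing (realization C) \<tau>)" "Y \<in> carrier (H1_sing (realization C) \<tau>)"
      then obtain \<alpha> \<beta> where a: "\<alpha> \<in> cub_hom ?S (ner \<tau>)" "X = ?cl \<alpha>" and b: "\<beta> \<in> cub_hom ?S (ner \<tau>)" "Y = ?cl \<beta>"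
        using cases by metis
      note ca = comparison_class[OF C one a(1)] and cb = comparison_class[OF C one b(1)]
      have "comparison C \<tau> (?cl (pm ?S \<alpha> \<beta>)) = comparison C \<tau> (?cl \<alpha>) \<otimes>\<^bsub>functor_monoid (T1 C) \<tau>\<^esub> comparison C \<tau> (?cl \<beta>)"
        by (rule comparison_eqI[OF C one pm_hom[OF S a(1) b(1)] functor_mult_closed[OF closed_T1 ca(1) cb(1)]])
          (simp add: adjunct_mult[OF ca(1) cb(1) C] ca(2) cb(2) pm_cub_comp[OF C u S a(1) b(1)])
      then show "comparison C \<tau> (X \<otimes>\<^bsub>H1_sing (realization C) \<tau>\<^esub> Y) =
          comparison C \<tau> X \<otimes>\<^bsub>functor_monoid (T1 C) \<tau>\<^esub> comparison C \<tau> Y"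
        unfolding H1_sing_def a(2) b(2) H1_mult[OF S a(1) b(1)] .
    qed
    show "bij_betw (comparison C \<tau>) (carrier (H1_sing (realization C) \<tau>)) (carrier (functor_monoid (T1 C) \<tau>))"
      unfolding bij_betw_def
    proof
      show "inj_on (comparison C \<tau>) (carrier (H1_sing (realization C) \<tau>))"
      proof (rule inj_onI)
        fix X Y assume "X \<in> carrier (H1_sing (realization C) \<tau>)" "Y \<in> carrier (H1_sing (realization C) \<tau>)"
          and eq: "comparison C \<tau> X = comparison C \<tau> Y"
        then obtain \<alpha> \<beta> where a: "\<alpha> \<in> cub_hom ?S (ner \<tau>)" "X = ?cl \<alpha>" and b: "\<beta> \<in> cub_hom ?S (ner \<tau>)" "Y = ?cl \<beta>"
          using cases by metis
        have "cub_comp C \<alpha> (sing_unit C) = cub_comp C \<beta> (sing_unit C)"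
          using comparison_class(2)[OF C one a(1)] comparison_class(2)[OF C one b(1)] eq a(2) b(2) by simp
        then show "X = Y" unfolding a(2) b(2)
          by (intro equiv_class_eq[OF H1_rel_equiv[OF S]] restriction_H1_rel[OF C a(1) b(1)])
      qed
      show "comparison C \<tau> ` carrier (H1_sing (realization C) \<tau>) = carrier (functor_monoid (T1 C) \<tau>)"
      proof (intro subset_antisym subsetI)
        fix F assume "F \<in> comparison C \<tau> ` carrier (H1_sing (realization C) \<tau>)"
        then show "F \<in> carrier (functor_monoid (T1 C) \<tau>)"
          using cases comparison_class(1)[OF C one] by (auto simp: car)
      next
        fix F assume "F \<in> carrier (functor_monoid (T1 C) \<tau>)"
        then have F: "F \<in> functors (T1 C) (monoid_cat \<tau>)" by (simp add: car)
        obtain \<alpha> where a: "\<alpha> \<in> cub_hom ?S (ner \<tau>)" "cub_comp C \<alpha> (sing_unit C) = adjunct C F"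
          using restriction_surj[OF C adjunct_hom[OF C F]] by blast
        have "comparison C \<tau> (?cl \<alpha>) = F" by (rule comparison_eqI[OF C one a(1) F a(2)[symmetric]])
        moreover have "?cl \<alpha> \<in> carrier (H1_sing (realization C) \<tau>)" using a(1) by (simp add: H1_sing_def carrier_H1 quotientI)
        ultimately show "F \<in> comparison C \<tau> ` carrier (H1_sing (realization C) \<tau>)" by blast
      qed
    qed
  qed
qed

text \<open>By \<open>comparison_eqI\<close> it suffices to compare transposes; the essential step
  is naturality of the unit, \<open>sing_map_unit\<close>.\<close>

lemma comparison_natural:
  assumes C: "cubical_set C" and oneC: "\<exists>!v. v \<in> cells C 0" and D: "cubical_set D" and oneD: "\<exists>!v. v \<in> cells D 0"
    and f: "f \<in> cub_hom C D" and X: "X \<in> carrier (H1_sing (realization D) \<tau>)"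
  shows "comparison C \<tau> (H1_pull (sing (realization C)) \<tau> (sing_map (realization C) (realization_map D f)) X)
    = func_comp (T1 C) (comparison D \<tau> X) (T1_map C D f)"
proof -
  let ?g = "sing_map (realization C) (realization_map D f)"
  have g: "?g \<in> cub_hom (sing (realization C)) (sing (realization D))"
    by (rule sing_map_hom[OF realization_map_stream_map[OF C D f]])
  obtain \<alpha> where a: "\<alpha> \<in> cub_hom (sing (realization D)) (ner \<tau>)" "X = H1_rel (sing (realization D)) \<tau> `` {\<alpha>}"
    using X by (auto simp: H1_sing_def carrier_H1 elim!: quotientE)
  note cmp = comparison_class[OF D oneD a(1), folded a(2)]
  have "cub_comp C (cub_comp (sing (realization C)) \<alpha> ?g) (sing_unit C) = cub_comp C \<alpha> (cub_comp C ?g (sing_unit C))"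
    by (rule cub_comp_assoc[OF sing_unit_hom[OF C]])
  also have "\<dots> = cub_comp C (cub_comp D \<alpha> (sing_unit D)) f"
    unfolding sing_map_unit[OF C D f] by (rule cub_comp_assoc[OF f, symmetric])
  also have "\<dots> = adjunct C (func_comp (T1 C) (comparison D \<tau> X) (T1_map C D f))"
    unfolding adjunct_T1_map(2)[OF C D f cmp(1)] cmp(2) ..
  finally show ?thesis
    unfolding a(2) H1_pull_class[OF cubical_set_sing cubical_set_sing g a(1)]
    by (intro comparison_eqI[OF C oneC cub_comp_hom[OF cubical_set_sing g a(1)]])
      (use adjunct_T1_map(1)[OF C D f cmp(1)] a(2) in simp_all)
qed

end

lemma comparison_natural_coefficients:
  assumes t: "canc_monoid \<tau>" and t': "canc_monoid \<tau>'" and C: "cubical_set C" and one: "\<exists>!v. v \<in> cells C 0"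
    and k: "k \<in> functors (monoid_cat \<tau>) (monoid_cat \<tau>')" and X: "X \<in> carrier (H1_sing (realization C) \<tau>)"
  shows "comparison C \<tau>' (H1_push (sing (realization C)) \<tau> \<tau>' k X) = func_comp (T1 C) k (comparison C \<tau> X)"
proof -
  let ?S = "sing (realization C)" and ?k = "nerve_map (monoid_cat \<tau>) k"
  interpret T: canc_monoid \<tau> by fact
  interpret T': canc_monoid \<tau>' by fact
  obtain \<alpha> where a: "\<alpha> \<in> cub_hom ?S (ner \<tau>)" "X = H1_rel ?S \<tau> `` {\<alpha>}"
    using X by (auto simp: H1_sing_def T.carrier_H1 elim!: quotientE)
  note cmp = T.comparison_class[OF C one a(1), folded a(2)]
  have k': "?k \<in> cub_hom (ner \<tau>) (ner \<tau>')" by (rule nerve_map_hom[OF k ner_act_in])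
  have "cub_comp C (cub_comp ?S ?k \<alpha>) (sing_unit C) = cub_comp C ?k (cub_comp C \<alpha> (sing_unit C))"
    by (rule cub_comp_assoc[OF sing_unit_hom[OF C]])
  also have "\<dots> = adjunct C (func_comp (T1 C) k (comparison C \<tau> X))"
    unfolding adjunct_push(2)[OF t t' C k cmp(1)] cmp(2) ..
  finally show ?thesis
    unfolding a(2) H1_push_class[OF t t' cubical_set_sing k a(1)]
    by (intro T'.comparison_eqI[OF C one cub_comp_hom[OF cubical_set_sing a(1) k']])
      (use adjunct_push(1)[OF t t' C k cmp(1)] a(2) in simp_all)
qed

text \<open>Beyond the isomorphism, the comparison map is pinned down by its transpose and is shown
  natural in the cubical set and in the coefficients; together this makes the equality a natural
  identification.\<close>

theorem proposition4p26:
  fixes C :: "'c cubical" and \<tau> :: "'m monoid"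
  assumes "comm_monoid \<tau>" and "cancellative \<tau>"
    and "cubical_set C" and "\<exists>!v. v \<in> cells C 0"
  shows "comm_monoid (H1_sing (realization C) \<tau>) \<and>
    comm_monoid (functor_monoid (T1 C) \<tau>) \<and>
    comparison C \<tau> \<in> iso (H1_sing (realization C) \<tau>) (functor_monoid (T1 C) \<tau>) \<and>
    (\<forall>\<alpha>\<in>cub_hom (sing (realization C)) (ner \<tau>).
       cub_comp C (nerve_map (T1 C) (comparison C \<tau> (H1_rel (sing (realization C)) \<tau> `` {\<alpha>})))
         (T1_unit C)
       = cub_comp C \<alpha> (sing_unit C)) \<and>
    (\<forall>(D :: 'd cubical) f. cubical_set D \<longrightarrow> (\<exists>!v. v \<in> cells D 0) \<longrightarrow> f \<in> cub_hom C D \<longrightarrow>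
       (\<forall>X\<in>carrier (H1_sing (realization D) \<tau>).
          comparison C \<tau> (H1_pull (sing (realization C)) \<tau>
            (sing_map (realization C) (realization_map D f)) X)
          = func_comp (T1 C) (comparison D \<tau> X) (T1_map C D f))) \<and>
    (\<forall>(\<tau>' :: 'k monoid) k. comm_monoid \<tau>' \<longrightarrow> cancellative \<tau>' \<longrightarrow>
       k \<in> functors (monoid_cat \<tau>) (monoid_cat \<tau>') \<longrightarrow>
       (\<forall>X\<in>carrier (H1_sing (realization C) \<tau>).
          comparison C \<tau>' (H1_push (sing (realization C)) \<tau> \<tau>' k X)
          = func_comp (T1 C) k (comparison C \<tau> X)))"
proof -
  \<comment> \<open>Stated over a type of its own, so that it serves for both coefficient
    monoids.\<close>
  have cm: "canc_monoid \<sigma>" if "comm_monoid \<sigma>" "cancellative \<sigma>" for \<sigma> :: "'n monoid"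
    using that by (simp add: canc_monoid_def canc_monoid_axioms_def)
  interpret canc_monoid \<tau> by (rule cm[OF assms(1,2)])
  show ?thesis
  proof (intro conjI allI impI ballI)
    show "comm_monoid (H1_sing (realization C) \<tau>)"
      unfolding H1_sing_def by (rule comm_monoid_H1[OF cubical_set_sing])
    show "comm_monoid (functor_monoid (T1 C) \<tau>)" by (rule comm_monoid_functor_monoid[OF closed_T1])
    show "comparison C \<tau> \<in> iso (H1_sing (realization C) \<tau>) (functor_monoid (T1 C) \<tau>)"
      by (rule comparison_iso[OF assms(3,4)])
    show "cub_comp C (nerve_map (T1 C) (comparison C \<tau> (H1_rel (sing (realization C)) \<tau> `` {\<alpha>}))) (T1_unit C) = cub_comp C \<alpha> (sing_unit C)"
      if "\<alpha> \<in> cub_hom (sing (realization C)) (ner \<tau>)" for \<alpha>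
      using comparison_class(2)[OF assms(3,4) that] by (simp add: adjunct_def)
  qed (rule comparison_natural[OF assms(3,4)] comparison_natural_coefficients[OF canc_monoid_axioms cm assms(3,4)]; assumption)+
qed

end
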